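(* Let $(f_\varepsilon^0)_{\varepsilon>0}$ be a family of functions on $\mathbb{R}^2\times\mathbb{R}^2$ such that, for each $\varepsilon>0$, $f_\varepsilon^0\in L^1(\mathbb{R}^2\times\mathbb{R}^2)\cap L^\infty(\mathbb{R}^2\times\mathbb{R}^2)$, $f_\varepsilon^0\ge 0$ and $f_\varepsilon^0$ is compactly supported; set $\rho_\varepsilon^0(x)=\int_{\mathbb{R}^2}f_\varepsilon^0(x,v)\,dv$. Assume that $$\sup_{\varepsilon>0}\Big(\|f_\varepsilon^0\|_{L^1}+\int_{\mathbb{R}^2}|x|^2\rho_\varepsilon^0(x)\,dx\Big)<+\infty,\qquad \sup_{\varepsilon>0}\mathcal{H}(f_\varepsilon^0)<+\infty,$$ and $$\varepsilon^2\,\Theta(\|f_\varepsilon^0\|_{L^\infty})\to 0\quad\text{as }\varepsilon\to 0,\qquad \Theta(\tau)=\tau\ln(\tau+2).$$ Let $f_\varepsilon$ be the corresponding global weak solution of the Vlasov-Poisson system $(\mathrm{VP}_\varepsilon)$ with initial datum $f_\varepsilon^0$, and let $\rho_\varepsilon(t,x)=\int_{\mathbb{R}^2}f_\varepsilon(t,x,v)\,dv$. Then there exists a subsequence $\varepsilon_n\to 0$ as $n\to+\infty$ such that $(\rho_{\varepsilon_n})_{n\in\mathbb{N}}$ converges to some $\rho$ in $C(\mathbb{R}_+,\mathcal{M}^+(\mathbb{R}^2)-w^* )$. Moreover, $\rho$ belongs to $L^\infty(\mathbb{R}_+,H^{-1}(\mathbb{R}^2))$ and it is a global weak solution of the 2D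 Euler equation in the sense of the definition of (vortex sheet) weak solution given in the context.
   Context: Notation: for $v=(v_1,v_2)\in\mathbb{R}^2$, $v^\perp=(-v_2,v_1)$; $\mathbb{R}_+=[0,+\infty)$. Energy: for $f\in L^1(\mathbb{R}^2\times\mathbb{R}^2)$ and $\rho=\int f\,dv$, $$\mathcal{H}(f)=\frac12\iint_{\mathbb{R}^2\times\mathbb{R}^2}|v|^2f(x,v)\,dx\,dv-\frac12\iint_{\mathbb{R}^2\times\mathbb{R}^2}\ln|x-y|\,\rho(x)\rho(y)\,dx\,dy.$$ System $(\mathrm{VP}_\varepsilon)$, for $(t,x,v)\in\mathbb{R}_+\times\mathbb{R}^2\times\mathbb{R}^2$: $$\partial_t f_\varepsilon+\frac{v}{\varepsilon}\cdot\nabla_x f_\varepsilon+\Big(\frac{E_\varepsilon}{\varepsilon}+\frac{v^\perp}{\varepsilon^2}\Big)\cdot\nabla_v f_\varepsilon=0,\quad E_\varepsilon(t,x)=\int_{\mathbb{R}^2}\frac{x-y}{|x-y|^2}\rho_\varepsilon(t,y)\,dy,\quad \rho_\varepsilon(t,x)=\int_{\mathbb{R}^2}f_\varepsilon(t,x,v)\,dv,\quad f_\varepsilon(0)=f_\varepsilon^0.$$ By the classical Cauchy theory, for each $\varepsilon>0$ and each nonnegative, compactly supported $f_\varepsilon^0\in L^1\cap L^\infty(\mathbb{R}^2\times\mathbb{R}^2)$ there is a unique global weak solution $f_\varepsilon\in L^\infty(\mathbb{R}_+,L^1\cap L^\infty(\mathbb{R}^2\times\mathbb{R}^2))$, compactly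 supported, with $f_\varepsilon(0)=f_\varepsilon^0$; its density satisfies $\rho_\varepsilon\in L^\infty_{\mathrm{loc}}(\mathbb{R}_+,L^\infty(\mathbb{R}^2))$, and its energy and $L^p$ norms are non-increasing in time. This $f_\varepsilon$ is "the corresponding global weak solution". $\mathcal{M}^+(\mathbb{R}^2)$ is the space of bounded positive Radon measures on $\mathbb{R}^2$. $\rho\in C(\mathbb{R}_+,\mathcal{M}^+(\mathbb{R}^2)-w^* )$ means that $\rho(t)\in\mathcal{M}^+(\mathbb{R}^2)$ for all $t\in\mathbb{R}_+$ and $t\mapsto\int\varphi(x)\,d\rho(t,x)$ is continuous for every $\varphi\in C_c(\mathbb{R}^2)$; convergence in this space means that for every $\varphi\in C_c(\mathbb{R}^2)$ the functions $t\mapsto\int\varphi\,d\rho_{\varepsilon_n}(t)$ converge to $t\mapsto\int\varphi\,d\rho(t)$ locally uniformly on $\mathbb{R}_+$. The 2D Euler equation is $\partial_t\rho+E^\perp\cdot\nabla\rho=0$, $E^\perp=2\pi\nabla^\perp\Delta^{-1}\rho$. Definition of (vortex sheet) weak solution: let $\rho_0\in\mathcal{M}^+(\mathbb{R}^2)\cap H^{-1}(\mathbb{R}^2)$ be compactly supported. Then $\rho\in C(\mathbb{R}_+,\mathcal{M}^+(\mathbb{R}^2)-w^* )\cap L^\infty(\mathbb{R}_+,H^{-1}(\mathbb{R}^2))$ is a global weak solution of the Euler equation with initial datum $\rho_0$ if for all $\Phi\in C_c^\infty(\mathbb{R}_+\times\mathbb{R}^2)$ and all $t\in\mathbb{R}_+$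 $$\int_{\mathbb{R}^2}\Phi(t,x)\,d\rho(t,x)=\int_{\mathbb{R}^2}\Phi(0,x)\,d\rho_0(x)+\int_0^t\!\int_{\mathbb{R}^2}\partial_s\Phi(s,x)\,d\rho(s,x)\,ds+\int_0^t\!\iint_{\mathbb{R}^2\times\mathbb{R}^2}H_{\Phi(s,\cdot)}(x,y)\,d\rho(s,x)\,d\rho(s,y)\,ds,$$ where, for a function $\phi$ on $\mathbb{R}^2$, $$H_\phi(x,y)=\frac12\frac{(x-y)^\perp}{|x-y|^2}\cdot(\nabla\phi(x)-\nabla\phi(y)).$$ $H_\phi$ is bounded and is defined and continuous off the diagonal $\{x=y\}$; the last integral makes sense because a positive measure in $H^{-1}(\mathbb{R}^2)$ has no atoms.
   Formalization: The limit's initial datum ρ(0) is only claimed to lie in M⁺∩H⁻¹, not to be compactly supported as the definition of weak solution asks: truncated Gaussians in x meet all hypotheses, yet their limit datum is not compactly supported. *)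

theory Defs
  imports
    "HOL-Analysis.Analysis"
    "HOL-Probability.Essential_Supremum"
begin

type_synonym plane = "real ^ 2"
type_synonym phase = "plane \<times> plane"

definition perp :: "plane \<Rightarrow> plane" where
  "perp v = vector [- (v $ 2), v $ 1]"

definition grad :: "(plane \<Rightarrow> real) \<Rightarrow> plane \<Rightarrow> plane" where
  "grad \<phi> x = (\<chi> i. frechet_derivative \<phi> (at x) (axis i 1))"

primrec C_k :: "nat \<Rightarrow> ('a::euclidean_space \<Rightarrow> real) \<Rightarrow> bool" where
  "C_k 0 \<phi> \<longleftrightarrow> continuous_on UNIV \<phi>"
| "C_k (Suc k) \<phi> \<longleftrightarrow> (\<forall>x. \<phi> differentiable (at x)) \<and>
     (\<forall>h. C_k k (\<lambda>x. frechet_derivative \<phi> (at x) h))"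

definition compact_support :: "('a::euclidean_space \<Rightarrow> real) \<Rightarrow> bool" where
  "compact_support \<phi> \<longleftrightarrow> compact (closure {x. \<phi> x \<noteq> 0})"

definition C_c :: "('a::euclidean_space \<Rightarrow> real) set" where
  "C_c = {\<phi>. continuous_on UNIV \<phi> \<and> compact_support \<phi>}"

text \<open>
  Test functions in \<open>C\<^sub>c\<^sup>\<infinity>([0,\<infinity>) \<times> X)\<close> are represented by elements of
  \<open>C_c_inf\<close> over \<open>real \<times> X\<close>, which need not vanish at time 0. Every smooth compactly
  supported function on the closed half-space is the restriction of such a function, and only
  values and derivatives at times \<open>t \<ge> 0\<close> are ever used.
\<close>
definition C_c_inf :: "('a::euclidean_space \<Rightarrow> real) set" where
  "C_c_inf = {\<phi>. (\<forall>k. C_k k \<phi>) \<and> compact_support \<phi>}"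

definition Lp_norm :: "real \<Rightarrow> ('a::euclidean_space \<Rightarrow> real) \<Rightarrow> real" where
  "Lp_norm p g = (\<integral>z. \<bar>g z\<bar> powr p \<partial>lborel) powr (1 / p)"

definition ess_bounded :: "('a::euclidean_space \<Rightarrow> real) \<Rightarrow> bool" where
  "ess_bounded g \<longleftrightarrow> esssup lborel (\<lambda>z. ereal \<bar>g z\<bar>) < \<infinity>"

definition Linf_norm :: "('a::euclidean_space \<Rightarrow> real) \<Rightarrow> real" where
  "Linf_norm g = real_of_ereal (esssup lborel (\<lambda>z. ereal \<bar>g z\<bar>))"

definition L1_Linf :: "('a::euclidean_space \<Rightarrow> real) set" where
  "L1_Linf = {g. integrable lborel g \<and> ess_bounded g}"

definition ess_supported_in :: "real \<Rightarrow> ('a::euclidean_space \<Rightarrow> real) \<Rightarrow> bool" where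
  "ess_supported_in R g \<longleftrightarrow> (AE z in lborel. norm z > R \<longrightarrow> g z = 0)"

definition rho :: "(phase \<Rightarrow> real) \<Rightarrow> plane \<Rightarrow> real" where
  "rho g x = (\<integral>v. g (x, v) \<partial>lborel)"

definition energy :: "(phase \<Rightarrow> real) \<Rightarrow> real" where
  "energy g =
     1/2 * (\<integral>z. (norm (snd z))\<^sup>2 * g z \<partial>lborel)
   - 1/2 * (\<integral>p. ln (norm (fst p - snd p)) * rho g (fst p) * rho g (snd p) \<partial>(lborel :: phase measure))"

definition Theta :: "real \<Rightarrow> real" where
  "Theta \<tau> = \<tau> * ln (\<tau> + 2)"

definition E_field :: "(plane \<Rightarrow> real) \<Rightarrow> plane \<Rightarrow> plane" where
  "E_field r x = (\<integral>y. (r y / (norm (x - y))\<^sup>2) *\<^sub>R (x - y) \<partial>lborel)"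

definition VP_operator ::
  "real \<Rightarrow> (plane \<Rightarrow> real) \<Rightarrow> (real \<times> phase \<Rightarrow> real) \<Rightarrow> real \<Rightarrow> plane \<Rightarrow> plane \<Rightarrow> real" where
  "VP_operator \<epsilon> r \<Phi> s x v =
     deriv (\<lambda>\<tau>. \<Phi> (\<tau>, x, v)) s
   + ((1 / \<epsilon>) *\<^sub>R v) \<bullet> grad (\<lambda>y. \<Phi> (s, y, v)) x
   + ((1 / \<epsilon>) *\<^sub>R E_field r x + (1 / \<epsilon>\<^sup>2) *\<^sub>R perp v) \<bullet> grad (\<lambda>w. \<Phi> (s, x, w)) v"

text \<open>
  The weak formulation is imposed at every time, which selects the weakly continuous
  representative of \<open>f\<close> (the field \<open>(v/\<epsilon>, E/\<epsilon> + v\<^sup>\<bottom>/\<epsilon>\<^sup>2)\<close> is divergence free in phase space).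
  Only times \<open>t \<ge> 0\<close> are relevant.
\<close>
definition VP_weak_solution ::
  "real \<Rightarrow> (phase \<Rightarrow> real) \<Rightarrow> (real \<Rightarrow> phase \<Rightarrow> real) \<Rightarrow> bool" where
  "VP_weak_solution \<epsilon> f0 f \<longleftrightarrow>
     (\<lambda>p. f (fst p) (snd p)) \<in> borel_measurable (restrict_space borel ({0..} \<times> UNIV)) \<and>
     (\<forall>t\<ge>0. f t \<in> L1_Linf) \<and>
     (\<exists>C. \<forall>t\<ge>0. Lp_norm 1 (f t) \<le> C \<and> Linf_norm (f t) \<le> C) \<and>
     (\<forall>T\<ge>0. \<exists>R. \<forall>t\<in>{0..T}. ess_supported_in R (f t)) \<and>
     (AE z in lborel. f 0 z = f0 z) \<and>
     (\<forall>\<Phi>\<in>C_c_inf. \<forall>t\<ge>0.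
        (\<integral>z. \<Phi> (t, z) * f t z \<partial>lborel) =
        (\<integral>z. \<Phi> (0, z) * f0 z \<partial>lborel)
      + (LINT s:{0..t}|lborel.
           (\<integral>z. VP_operator \<epsilon> (rho (f s)) \<Phi> s (fst z) (snd z) * f s z \<partial>lborel)))"

text \<open>
  The weak solution provided by the classical Cauchy theory, together with the properties that
  this theory supplies for it: locally bounded density, and non-increasing energy and
  \<open>L\<^sup>p\<close> norms for \<open>1 \<le> p \<le> \<infinity>\<close>.
\<close>
definition VP_global_solution ::
  "real \<Rightarrow> (phase \<Rightarrow> real) \<Rightarrow> (real \<Rightarrow> phase \<Rightarrow> real) \<Rightarrow> bool" where
  "VP_global_solution \<epsilon> f0 f \<longleftrightarrow>
     VP_weak_solution \<epsilon> f0 f \<and>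
     (\<forall>T\<ge>0. \<exists>C. \<forall>t\<in>{0..T}. AE x in lborel. \<bar>rho (f t) x\<bar> \<le> C) \<and>
     (\<forall>s t. 0 \<le> s \<and> s \<le> t \<longrightarrow>
        energy (f t) \<le> energy (f s) \<and>
        (\<forall>p\<ge>1. Lp_norm p (f t) \<le> Lp_norm p (f s)) \<and>
        Linf_norm (f t) \<le> Linf_norm (f s))"

text \<open>Finite Borel measures on the plane are automatically Radon.\<close>
definition Mplus :: "plane measure set" where
  "Mplus = {\<mu>. sets \<mu> = sets borel \<and> finite_measure \<mu>}"

definition C_Mplus :: "(real \<Rightarrow> plane measure) set" where
  "C_Mplus = {\<mu>. (\<forall>t\<ge>0. \<mu> t \<in> Mplus) \<and>
     (\<forall>\<phi>\<in>C_c. continuous_on {0..} (\<lambda>t. \<integral>x. \<phi> x \<partial>\<mu> t))}"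

definition converges_in_C_Mplus ::
  "(nat \<Rightarrow> real \<Rightarrow> plane measure) \<Rightarrow> (real \<Rightarrow> plane measure) \<Rightarrow> bool" where
  "converges_in_C_Mplus \<mu>s \<mu> \<longleftrightarrow>
     (\<forall>n. \<mu>s n \<in> C_Mplus) \<and> \<mu> \<in> C_Mplus \<and>
     (\<forall>\<phi>\<in>C_c. \<forall>T\<ge>0.
        uniform_limit {0..T} (\<lambda>n t. \<integral>x. \<phi> x \<partial>\<mu>s n t) (\<lambda>t. \<integral>x. \<phi> x \<partial>\<mu> t) sequentially)"

text \<open>
  The measure with Lebesgue density \<open>r\<close>. As \<open>ennreal\<close> truncates negative values, it carries this
  meaning only for \<open>r\<close> nonnegative almost everywhere.
\<close>
definition density_measure :: "(plane \<Rightarrow> real) \<Rightarrow> plane measure" where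
  "density_measure r = density lborel (\<lambda>x. ennreal (r x))"

definition H1_norm :: "(plane \<Rightarrow> real) \<Rightarrow> real" where
  "H1_norm \<phi> = sqrt ((\<integral>x. (\<phi> x)\<^sup>2 \<partial>lborel) + (\<integral>x. (norm (grad \<phi> x))\<^sup>2 \<partial>lborel))"

text \<open>
  The norm of the dual space \<open>H\<^sup>-\<^sup>1\<close> of \<open>H\<^sup>1\<close>; the supremum may be taken over the dense subspace
  \<open>C_c_inf\<close> of \<open>H\<^sup>1\<close>.
\<close>
definition Hm1_norm :: "plane measure \<Rightarrow> ereal" where
  "Hm1_norm \<mu> = (SUP \<phi>\<in>{\<phi>\<in>C_c_inf. H1_norm \<phi> \<le> 1}. ereal \<bar>\<integral>x. \<phi> x \<partial>\<mu>\<bar>)"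

definition Hm1 :: "plane measure set" where
  "Hm1 = {\<mu>. Hm1_norm \<mu> < \<infinity>}"

definition Linf_Hm1 :: "(real \<Rightarrow> plane measure) set" where
  "Linf_Hm1 = {\<mu>. \<exists>C::real. AE t in lborel. 0 \<le> t \<longrightarrow> Hm1_norm (\<mu> t) \<le> ereal C}"

text \<open>
  On the diagonal \<open>x = y\<close> this is 0, since \<open>a / 0 = 0\<close>. The value there is irrelevant for the
  measures below: they have no atoms, so the diagonal is a null set of the product measure.
\<close>
definition H_kernel :: "(plane \<Rightarrow> real) \<Rightarrow> plane \<Rightarrow> plane \<Rightarrow> real" where
  "H_kernel \<phi> x y =
     1/2 * (((1 / (norm (x - y))\<^sup>2) *\<^sub>R perp (x - y)) \<bullet> (grad \<phi> x - grad \<phi> y))"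

text \<open>
  The initial measure is not required to have compact support. Compactly supported initial data
  whose second moments are bounded can have weak limits without compact support (truncated
  Gaussians, for example), so for a limit of Vlasov-Poisson densities only finiteness and
  membership in \<open>H\<^sup>-\<^sup>1\<close> can be expected.
\<close>
definition Euler_weak_solution :: "plane measure \<Rightarrow> (real \<Rightarrow> plane measure) \<Rightarrow> bool" where
  "Euler_weak_solution \<mu>0 \<mu> \<longleftrightarrow>
     \<mu>0 \<in> Mplus \<inter> Hm1 \<and>
     \<mu> \<in> C_Mplus \<inter> Linf_Hm1 \<and>
     (\<forall>\<Phi>\<in>C_c_inf. \<forall>t\<ge>0.
        (\<integral>x. \<Phi> (t, x) \<partial>\<mu> t) =
        (\<integral>x. \<Phi> (0, x) \<partial>\<mu>0)
      + (LINT s:{0..t}|lborel. (\<integral>x. deriv (\<lambda>\<tau>. \<Phi> (\<tau>, x)) s \<partial>\<mu> s))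
      + (LINT s:{0..t}|lborel.
           (\<integral>p. H_kernel (\<lambda>x. \<Phi> (s, x)) (fst p) (snd p) \<partial>(\<mu> s \<Otimes>\<^sub>M \<mu> s))))"

end

theory Submission
  imports
    Defs
    "HOL-Probability.Helly_Selection"
    "HOL-Library.Diagonal_Subsequence"
begin

text \<open>
  The gyrocentre \<open>x + \<epsilon> v\<^sup>\<bottom>\<close> is transported by \<open>E\<^sup>\<bottom>\<close> alone: both singular terms of the system cancel
  along it. Testing with functions of the gyrocentre therefore gives the Euler equation up to two
  errors, the shift from \<open>x + \<epsilon> v\<^sup>\<bottom>\<close> to \<open>x\<close>, of order \<open>\<epsilon>\<close>, and the commutator
  \<open>\<epsilon> \<integral>|v| |E| f\<close>. The energy together with the invariant \<open>\<integral>(|x|\<^sup>2 + 2\<epsilon> x \<cdot> v\<^sup>\<bottom>) f\<close> bounds, uniformly in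
  time and in \<open>\<epsilon>\<close>, the second moment, the kinetic energy and the local part
  \<open>J = \<integral>\<integral> max(0, -ln|x-y|) d\<rho> d\<rho>\<close> of the potential energy. Splitting the interaction at distance
  \<open>1 / (S (1 + |v|))\<close> with \<open>S\<^sup>2 = 1 + \<parallel>f\<parallel>\<^sub>\<infinity>\<close> bounds the commutator by \<open>C \<epsilon> S\<close>, which tends to 0.
  The bound on \<open>J\<close> controls the \<open>H\<^sup>-\<^sup>1\<close> norm and prevents concentration of \<open>\<rho> \<otimes> \<rho>\<close> near the diagonal,
  where the kernel of the symmetrised nonlinearity is discontinuous, so that the limit can be taken.
\<close>

subsection \<open>Smooth functions and test functions\<close>

text \<open>The cancellation along the gyrocentre is algebraic: applying \<open>perp\<close> twice
  gives -1, so v/\<epsilon> + \<epsilon> perp (E/\<epsilon> + perp v/\<epsilon>^2) = perp E, and the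
  fast rotation need not be averaged.

  The obstacle is that the energy has no sign. Its logarithm at large distance has to be paid for
  with the second moment, while the second moment is only almost conserved, up to \<epsilon> (mom +
  kin), which the energy has to control in turn. The factor \<epsilon> breaks the circle as soon as
  \<epsilon> (1 + 2 A) \<le> 1/2.

  The commutator has to be bounded without a uniform bound on the spatial density. The pointwise
  bound on f is spent only at small distances, and only on the slower particle of each interacting
  pair, whose velocity fills a disc of controlled area; everything else is charged to mass and
  kinetic energy.

  The solution is given only up to null sets and without a sign at positive times. On each interval
  [0, T] it is therefore replaced by a bounded, nonnegative, compactly supported representative
  before any estimate is made; the spatial measures do not change.\<close>

definition smooth :: "('a::euclidean_space \<Rightarrow> real) \<Rightarrow> bool" where
  "smooth \<phi> \<longleftrightarrow> (\<forall>k. C_k k \<phi>)"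

abbreviation dirderiv :: "('a::euclidean_space \<Rightarrow> real) \<Rightarrow> 'a \<Rightarrow> 'a \<Rightarrow> real" where
  "dirderiv \<phi> x h \<equiv> frechet_derivative \<phi> (at x) h"

lemma C_k_imp_continuous: "C_k k \<phi> \<Longrightarrow> continuous_on UNIV \<phi>"
  by (cases k) (auto intro!: differentiable_imp_continuous_on simp: differentiable_on_def)

lemma C_k_Suc_imp_C_k: "C_k (Suc k) \<phi> \<Longrightarrow> C_k k \<phi>"
proof (induction k arbitrary: \<phi>)
  case 0 then show ?case using C_k_imp_continuous[of "Suc 0" \<phi>] by (simp only: C_k.simps(1))
next
  case (Suc k) then show ?case by (metis C_k.simps(2))
qed

lemma C_k_const: "C_k k (\<lambda>x::'a::euclidean_space. c)"
  by (induction k arbitrary: c) (auto simp: frechet_derivative_const)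

lemma dirderiv_eq: "(\<phi> has_derivative D) (at x) \<Longrightarrow> dirderiv \<phi> x h = D h"
  using frechet_derivative_at by metis

lemma C_k_bounded_linear: "bounded_linear (l :: 'a::euclidean_space \<Rightarrow> real) \<Longrightarrow> C_k k l"
proof (cases k)
  case 0
  assume "bounded_linear l" then show ?thesis using 0
    by (auto intro: linear_continuous_on)
next
  case (Suc k)
  assume l: "bounded_linear l"
  have "(l has_derivative l) (at x)" for x by (rule bounded_linear_imp_has_derivative[OF l])
  then have "dirderiv l x h = l h" and "l differentiable (at x)" for x h
    by (auto simp: dirderiv_eq differentiable_def)
  then show ?thesis by (simp add: Suc C_k_const)
qed

lemma C_k_add: "C_k k \<phi> \<Longrightarrow> C_k k \<psi> \<Longrightarrow> C_k k (\<lambda>x. \<phi> x + \<psi> x)"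
proof (induction k arbitrary: \<phi> \<psi>)
  case 0 then show ?case by (auto intro: continuous_intros)
next
  case (Suc k)
  have "dirderiv (\<lambda>x. \<phi> x + \<psi> x) x h = dirderiv \<phi> x h + dirderiv \<psi> x h" for x h
    using Suc.prems by (intro dirderiv_eq has_derivative_add) (auto simp: frechet_derivative_works)
  then show ?case using Suc by auto
qed

lemma C_k_mult: "C_k k \<phi> \<Longrightarrow> C_k k \<psi> \<Longrightarrow> C_k k (\<lambda>x. \<phi> x * \<psi> x)"
proof (induction k arbitrary: \<phi> \<psi>)
  case 0 then show ?case by (auto intro: continuous_intros)
next
  case (Suc k)
  have "dirderiv (\<lambda>x. \<phi> x * \<psi> x) x h = \<phi> x * dirderiv \<psi> x h + dirderiv \<phi> x h * \<psi> x" for x h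
    using Suc.prems by (intro dirderiv_eq has_derivative_mult) (auto simp: frechet_derivative_works)
  moreover have "C_k k \<phi>" "C_k k \<psi>" using Suc.prems by (blast intro: C_k_Suc_imp_C_k)+
  ultimately show ?case using Suc by (auto intro!: C_k_add)
qed

lemma C_k_compose_linear:
  fixes L :: "'a::euclidean_space \<Rightarrow> 'b::euclidean_space"
  shows "bounded_linear L \<Longrightarrow> C_k k \<phi> \<Longrightarrow> C_k k (\<lambda>x. \<phi> (L x))"
proof (induction k arbitrary: \<phi>)
  case 0 then show ?case
    using continuous_on_compose2[of UNIV \<phi> UNIV L] linear_continuous_on[of L UNIV] by simp
next
  case (Suc k)
  have *: "((\<lambda>x. \<phi> (L x)) has_derivative (\<lambda>h. dirderiv \<phi> (L x) (L h))) (at x)" for x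
    by (rule has_derivative_compose[OF bounded_linear_imp_has_derivative])
      (use Suc.prems in \<open>auto simp: frechet_derivative_works[symmetric]\<close>)
  then have "dirderiv (\<lambda>x. \<phi> (L x)) x h = dirderiv \<phi> (L x) (L h)" "(\<lambda>x. \<phi> (L x)) differentiable (at x)" for x h
    using dirderiv_eq[OF *] * by (auto simp: differentiable_def)
  moreover have "C_k k (\<lambda>x. dirderiv \<phi> (L x) (L h))" for h
    using Suc.prems by (intro Suc.IH) auto
  ultimately show ?case by simp
qed

lemma C_k_compose_real:
  fixes h :: "real \<Rightarrow> real"
  shows "C_k k h \<Longrightarrow> C_k k \<phi> \<Longrightarrow> C_k k (\<lambda>x. h (\<phi> x))"
proof (induction k arbitrary: h)
  case 0 then show ?case
    by (auto intro!: continuous_on_compose2[of UNIV h])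
next
  case (Suc k)
  have *: "((\<lambda>x. h (\<phi> x)) has_derivative (\<lambda>e. dirderiv h (\<phi> x) (dirderiv \<phi> x e))) (at x)" for x
    by (rule has_derivative_compose) (use Suc.prems in \<open>auto simp: frechet_derivative_works[symmetric]\<close>)
  \<comment> \<open>On the line a derivative is multiplication by h'(y). This turns the chain rule
    into a product of two functions that \<open>C_k_mult\<close> and the induction hypothesis
    cover.\<close>
  have hom: "dirderiv h y u = u * dirderiv h y 1" for y u
    using Suc.prems linear_frechet_derivative[of h "at y"] linear_cmul[of "dirderiv h y" u 1] by auto
  have "dirderiv (\<lambda>x. h (\<phi> x)) x e = dirderiv \<phi> x e * dirderiv h (\<phi> x) 1" for x e
    unfolding dirderiv_eq[OF *] by (rule hom)
  moreover have "(\<lambda>x. h (\<phi> x)) differentiable (at x)" for x using * by (auto simp: differentiable_def)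
  moreover have "C_k k (\<lambda>x. dirderiv \<phi> x e * dirderiv h (\<phi> x) 1)" for e
  proof (rule C_k_mult)
    have "C_k k \<phi>" using Suc.prems(2) by (rule C_k_Suc_imp_C_k)
    moreover have "C_k k (\<lambda>y. dirderiv h y 1)" using Suc.prems(1) by simp
    ultimately show "C_k k (\<lambda>x. dirderiv h (\<phi> x) 1)" by (rule Suc.IH[rotated])
    show "C_k k (\<lambda>x. dirderiv \<phi> x e)" using Suc.prems(2) by simp
  qed
  ultimately show ?case by simp
qed

lemma smooth_const: "smooth (\<lambda>x. c)" by (simp add: smooth_def C_k_const)
lemma smooth_bounded_linear: "bounded_linear l \<Longrightarrow> smooth l" by (simp add: smooth_def C_k_bounded_linear)
lemma smooth_add: "smooth \<phi> \<Longrightarrow> smooth \<psi> \<Longrightarrow> smooth (\<lambda>x. \<phi> x + \<psi> x)" by (simp add: smooth_def C_k_add)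
lemma smooth_mult: "smooth \<phi> \<Longrightarrow> smooth \<psi> \<Longrightarrow> smooth (\<lambda>x. \<phi> x * \<psi> x)" by (simp add: smooth_def C_k_mult)
lemma smooth_compose_linear: "smooth \<phi> \<Longrightarrow> bounded_linear L \<Longrightarrow> smooth (\<lambda>x. \<phi> (L x))"
  by (simp add: smooth_def C_k_compose_linear)
lemma smooth_compose_real: "smooth h \<Longrightarrow> smooth \<phi> \<Longrightarrow> smooth (\<lambda>x. h (\<phi> x))" for h :: "real \<Rightarrow> real"
  by (simp add: smooth_def C_k_compose_real)

lemma smooth_real_polynomial_function: "real_polynomial_function p \<Longrightarrow> smooth p"
  by (induction rule: real_polynomial_function.induct)
     (auto intro: smooth_const smooth_bounded_linear smooth_add smooth_mult)

lemma smooth_dirderiv: "smooth \<phi> \<Longrightarrow> smooth (\<lambda>x. dirderiv \<phi> x h)"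
  unfolding smooth_def using C_k.simps(2) by blast

lemma smooth_differentiable: "smooth \<phi> \<Longrightarrow> \<phi> differentiable (at x)"
  unfolding smooth_def using C_k.simps(2) by blast

lemma smooth_has_derivative: "smooth \<phi> \<Longrightarrow> (\<phi> has_derivative dirderiv \<phi> x) (at x)"
  using frechet_derivative_works smooth_differentiable by blast

lemma smooth_continuous_on: "smooth \<phi> \<Longrightarrow> continuous_on S \<phi>"
  by (meson C_k_imp_continuous continuous_on_subset smooth_def subset_UNIV)

text \<open>The functions \<open>P(1/x) exp(-1/x)\<close>, extended by 0, are closed under differentiation.\<close>

definition flat :: "real poly \<Rightarrow> real \<Rightarrow> real" where
  "flat P x = (if x > 0 then poly P (1 / x) * exp (- (1 / x)) else 0)"

lemma flat_tendsto_0: "(flat P \<longlongrightarrow> 0) (at_right 0)"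
proof -
  have "((\<lambda>y. poly P y * exp (- y)) \<longlongrightarrow> 0) at_top"
  proof -
    have "((\<lambda>y. (\<Sum>i\<le>degree P. coeff P i * (y ^ i / exp y))) \<longlongrightarrow> (\<Sum>i\<le>degree P. coeff P i * 0)) at_top"
      by (intro tendsto_intros tendsto_power_div_exp_0)
    then show ?thesis by (simp add: poly_altdef sum_distrib_right exp_minus divide_inverse mult.assoc)
  qed
  then have "((\<lambda>x. poly P (1/x) * exp (- (1/x))) \<longlongrightarrow> 0) (at_right 0)"
    by (rule filterlim_compose)
       (use filterlim_inverse_at_top_right in \<open>simp add: inverse_eq_divide\<close>)
  then show ?thesis
    by (rule Lim_transform_eventually) (auto simp: flat_def eventually_at_filter)
qed

text \<open>With y = 1/x one has d/dx = - y^2 d/dy, and d/dy (P(y) exp(-y)) = (P' - P) exp(-y);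
  \<open>[:0,0,1:]\<close> is the polynomial y^2.\<close>

lemma flat_has_derivative:
  "(flat P has_real_derivative flat ([:0,0,1:] * (P - pderiv P)) x) (at x)"
proof -
  consider "x > 0" | "x < 0" | "x = 0" by linarith
  then show ?thesis
  proof cases
    case 1
    have "((\<lambda>x. poly P (1/x) * exp (- (1/x))) has_real_derivative flat ([:0,0,1:] * (P - pderiv P)) x) (at x)"
      using 1 by (auto intro!: derivative_eq_intros DERIV_chain'[OF _ poly_DERIV] simp: flat_def field_simps power2_eq_square)
    then show ?thesis
      by (rule has_field_derivative_transform_within_open[where S="{0<..}"]) (use 1 in \<open>auto simp: flat_def\<close>)
  next
    case 2
    have "((\<lambda>x. 0) has_real_derivative 0) (at x)" by simp
    then have "(flat P has_real_derivative 0) (at x)"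
      by (rule has_field_derivative_transform_within_open[where S="{..<0}"]) (use 2 in \<open>auto simp: flat_def\<close>)
    then show ?thesis using 2 by (simp add: flat_def)
  next
    case 3
    \<comment> \<open>Dividing by h adds one power of 1/h, so the right difference quotient at 0 is
      itself a flat function, for the polynomial \<open>[:0,1:] * P\<close>.\<close>
    have r: "((\<lambda>h. (flat P (0 + h) - flat P 0) / h) \<longlongrightarrow> 0) (at_right 0)"
      by (rule Lim_transform_eventually[OF flat_tendsto_0[of "[:0,1:] * P"]])
         (auto simp: flat_def eventually_at_filter)
    have l: "((\<lambda>h. (flat P (0 + h) - flat P 0) / h) \<longlongrightarrow> 0) (at_left 0)"
      by (rule tendsto_eventually) (auto simp: flat_def eventually_at_filter)
    have "((\<lambda>h. (flat P (0 + h) - flat P 0) / h) \<longlongrightarrow> 0) (at 0)"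
      by (rule filterlim_split_at_real[OF l r, unfolded]) 
    then show ?thesis using 3 by (simp add: DERIV_def flat_def)
  qed
qed

lemma smooth_flat: "smooth (flat P)"
proof -
  have "C_k k (flat P)" for k
  proof (induction k arbitrary: P)
    case 0
    show ?case using flat_has_derivative
      by (auto intro!: DERIV_continuous_on[where s=UNIV])
  next
    case (Suc k)
    have "dirderiv (flat P) x h = h * flat ([:0,0,1:] * (P - pderiv P)) x" for x h
      using flat_has_derivative[of P x] by (intro dirderiv_eq) (simp add: has_field_derivative_def mult.commute[of _ "flat _ _"])
    moreover have "flat P differentiable (at x)" for x
      using flat_has_derivative real_differentiable_def by blast
    moreover have "C_k k (\<lambda>x. h * flat ([:0,0,1:] * (P - pderiv P)) x)" for h
      by (rule C_k_mult[OF C_k_const Suc])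
    ultimately show ?case by simp
  qed
  then show ?thesis by (simp add: smooth_def)
qed

text \<open>Nesting \<open>flat 1\<close> in itself, instead of dividing one flat function by
  another, leaves only a division by a constant, so smoothness follows from composition alone. Since
  \<open>flat 1 1 = exp (- 1)\<close>, the inner argument is nonpositive exactly for x \<le> 1, and
  it is \<open>exp (- 1)\<close> for x \<ge> 2.\<close>

definition real_bump :: "real \<Rightarrow> real" where
  "real_bump x = 1 - flat 1 (exp (- 1) - flat 1 (2 - x)) / flat 1 (exp (- 1))"

lemma flat_1_mono: "x \<le> y \<Longrightarrow> flat 1 x \<le> flat 1 y"
  by (auto simp: flat_def field_simps)

lemma flat_1_nonneg: "0 \<le> flat 1 x"
  by (auto simp: flat_def)

lemma real_bump_props:
  "smooth real_bump" "x \<le> 1 \<Longrightarrow> real_bump x = 1" "2 \<le> x \<Longrightarrow> real_bump x = 0"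
  "0 \<le> real_bump x" "real_bump x \<le> 1"
proof -
  have aff: "smooth (\<lambda>x::real. c + d * x)" for c d
    by (intro smooth_add smooth_const smooth_bounded_linear) (rule bounded_linear_mult_right)
  have "smooth (\<lambda>x. flat 1 (2 - x))"
    using smooth_compose_real[OF smooth_flat aff[of 2 "-1"]] by simp
  from smooth_compose_real[OF aff[of "exp(-1)" "-1"] this]
  have "smooth (\<lambda>x. flat 1 (exp (- 1) - flat 1 (2 - x)))"
    using smooth_compose_real[OF smooth_flat] by simp
  from smooth_compose_real[OF aff[of 1 "- 1 / flat 1 (exp (- 1))"] this]
  show "smooth real_bump" by (simp add: real_bump_def[abs_def])
  have pos: "flat 1 (exp (- 1)) > 0" by (simp add: flat_def)
  show "real_bump x = 1" if "x \<le> 1"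
  proof -
    have "flat 1 1 \<le> flat 1 (2 - x)" using that by (intro flat_1_mono) auto
    then have "exp (- 1) - flat 1 (2 - x) \<le> 0" by (simp add: flat_def)
    then show ?thesis by (simp add: real_bump_def flat_def)
  qed
  show "real_bump x = 0" if "2 \<le> x"
    using that pos by (simp add: real_bump_def) (simp add: flat_def)
  have "flat 1 (exp (- 1) - flat 1 (2 - x)) \<le> flat 1 (exp (- 1))"
    using flat_1_nonneg by (intro flat_1_mono) auto
  then show "0 \<le> real_bump x" using pos by (simp add: real_bump_def field_simps)
  show "real_bump x \<le> 1" using pos flat_1_nonneg by (simp add: real_bump_def)
qed

section \<open>Cutoffs, test functions and uniform bounds for their derivatives\<close>

definition bump :: "real \<Rightarrow> 'a::euclidean_space \<Rightarrow> real" where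
  "bump R x = real_bump ((norm x)\<^sup>2 / R\<^sup>2)"

lemma compact_supportI: "(\<And>x. norm x > R \<Longrightarrow> \<phi> x = 0) \<Longrightarrow> compact_support \<phi>"
  unfolding compact_support_def compact_closure
  by (rule boundedI[of _ R]) (use not_le in auto)

lemma compact_supportD:
  assumes "compact_support \<phi>" shows "\<exists>R>0. \<forall>x. norm x > R \<longrightarrow> \<phi> x = 0"
proof -
  from assms obtain R where "R > 0" "\<And>x. x \<in> {x. \<phi> x \<noteq> 0} \<Longrightarrow> norm x \<le> R"
    unfolding compact_support_def compact_closure by (auto simp: bounded_pos)
  then show ?thesis by (metis mem_Collect_eq not_le)
qed

lemma smooth_norm_square: "smooth (\<lambda>x::'a::euclidean_space. (norm x)\<^sup>2)"
proof -
  have "real_polynomial_function (\<lambda>x::'a. \<Sum>b\<in>Basis. (x \<bullet> b) * (x \<bullet> b))"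
    by (intro real_polynomial_function_sum real_polynomial_function.intros(4) real_polynomial_function.intros(1))
       (auto intro: bounded_linear_inner_left)
  moreover have "(\<lambda>x::'a. (norm x)\<^sup>2) = (\<lambda>x. \<Sum>b\<in>Basis. (x \<bullet> b) * (x \<bullet> b))"
    unfolding power2_norm_eq_inner by (subst euclidean_inner) (rule refl)
  ultimately show ?thesis by (simp only: smooth_real_polynomial_function)
qed

lemma bump_props:
  fixes x :: "'a::euclidean_space"
  assumes "R > 0"
  shows "smooth (bump R :: 'a \<Rightarrow> real)" "norm x \<le> R \<Longrightarrow> bump R x = 1" "2 * R \<le> norm x \<Longrightarrow> bump R x = 0"
    "0 \<le> bump R x" "bump R x \<le> 1" "(bump R :: 'a \<Rightarrow> real) \<in> C_c_inf" "(bump R :: 'a \<Rightarrow> real) \<in> C_c"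
proof -
  have "smooth (\<lambda>x::'a. (1 / R\<^sup>2) * (norm x)\<^sup>2)"
    by (intro smooth_mult smooth_const smooth_norm_square)
  from smooth_compose_real[OF real_bump_props(1) this]
  show s: "smooth (bump R :: 'a \<Rightarrow> real)" by (simp add: bump_def[abs_def])
  show "norm x \<le> R \<Longrightarrow> bump R x = 1"
    unfolding bump_def using assms by (intro real_bump_props(2)) (simp add: power_mono)
  have z: "2 * R \<le> norm x \<Longrightarrow> bump R x = 0" for x :: 'a
  proof -
    assume "2 * R \<le> norm x"
    then have "(2 * R)\<^sup>2 \<le> (norm x)\<^sup>2" using assms by (intro power_mono) auto
    then have "2 * R\<^sup>2 \<le> (norm x)\<^sup>2" by (simp add: power_mult_distrib)
      (smt (verit) zero_le_power2)
    then show ?thesis unfolding bump_def using assms by (intro real_bump_props(3)) (simp add: pos_le_divide_eq)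
  qed
  then show "2 * R \<le> norm x \<Longrightarrow> bump R x = 0" .
  show "0 \<le> bump R x" "bump R x \<le> 1" by (simp_all add: bump_def real_bump_props)
  have c: "compact_support (bump R :: 'a \<Rightarrow> real)"
    by (rule compact_supportI[of "2*R"]) (simp add: z)
  then show "(bump R :: 'a \<Rightarrow> real) \<in> C_c_inf" using s by (simp add: C_c_inf_def smooth_def)
  show "(bump R :: 'a \<Rightarrow> real) \<in> C_c" using s c by (simp add: C_c_def smooth_continuous_on)
qed

lemma C_c_inf_smooth: "\<phi> \<in> C_c_inf \<longleftrightarrow> smooth \<phi> \<and> compact_support \<phi>"
  by (simp add: C_c_inf_def smooth_def)

lemma C_c_inf_subset_C_c: "\<phi> \<in> C_c_inf \<Longrightarrow> \<phi> \<in> C_c"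
  by (simp add: C_c_inf_smooth C_c_def smooth_continuous_on)

lemma compact_support_mult: "compact_support \<phi> \<Longrightarrow> compact_support (\<lambda>x. \<phi> x * \<psi> x)"
  using compact_supportD[of \<phi>] compact_supportI[of _ "\<lambda>x. \<phi> x * \<psi> x"] by fastforce

lemma C_c_inf_mult: "\<phi> \<in> C_c_inf \<Longrightarrow> smooth \<psi> \<Longrightarrow> (\<lambda>x. \<phi> x * \<psi> x) \<in> C_c_inf"
  by (simp add: C_c_inf_smooth smooth_mult compact_support_mult)

lemma C_c_bounded:
  assumes "\<phi> \<in> C_c" obtains B where "B > 0" "\<And>x. \<bar>\<phi> x\<bar> \<le> B"
proof -
  from assms obtain R where R: "\<And>x. norm x > R \<Longrightarrow> \<phi> x = 0"
    using compact_supportD[of \<phi>] by (auto simp: C_c_def)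
  have "compact (\<phi> ` cball 0 R)"
    using assms by (intro compact_continuous_image compact_cball) (auto simp: C_c_def intro: continuous_on_subset)
  then obtain B where "B > 0" "\<And>y. y \<in> \<phi> ` cball 0 R \<Longrightarrow> norm y \<le> B"
    using compact_imp_bounded bounded_pos by metis
  then have "\<bar>\<phi> x\<bar> \<le> B" for x using R[of x] by (cases "norm x \<le> R") auto
  then show ?thesis using that \<open>B > 0\<close> by blast
qed

lemma dirderiv_C_c_inf:
  assumes "\<phi> \<in> C_c_inf" shows "(\<lambda>x. dirderiv \<phi> x h) \<in> C_c_inf"
proof -
  obtain R where R: "\<And>x. norm x > R \<Longrightarrow> \<phi> x = 0"
    using assms compact_supportD[of \<phi>] by (auto simp: C_c_inf_smooth)
  have "dirderiv \<phi> x h = 0" if "norm x > R" for x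
  proof -
    have "open {x::'a. norm x > R}" by (intro open_Collect_less continuous_intros)
    then have "(\<phi> has_derivative (\<lambda>h. 0)) (at x)"
      by (rule has_derivative_transform_within_open[OF has_derivative_const]) (use that R in auto)
    then show ?thesis by (simp add: dirderiv_eq)
  qed
  then have "compact_support (\<lambda>x. dirderiv \<phi> x h)" by (rule compact_supportI)
  then show ?thesis using assms by (simp add: C_c_inf_smooth smooth_dirderiv)
qed

lemma dirderiv_linear: "smooth \<phi> \<Longrightarrow> linear (dirderiv \<phi> x)"
  by (simp add: linear_frechet_derivative smooth_differentiable)

lemma dirderiv_basis:
  assumes "smooth \<phi>" shows "dirderiv \<phi> x h = (\<Sum>b\<in>Basis. (h \<bullet> b) * dirderiv \<phi> x b)"
proof -
  have "dirderiv \<phi> x h = dirderiv \<phi> x (\<Sum>b\<in>Basis. (h \<bullet> b) *\<^sub>R b)"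
    by (simp add: euclidean_representation)
  also have "\<dots> = (\<Sum>b\<in>Basis. (h \<bullet> b) * dirderiv \<phi> x b)"
    by (subst linear_sum[OF dirderiv_linear[OF assms]])
       (simp add: linear_cmul[OF dirderiv_linear[OF assms]])
  finally show ?thesis .
qed

lemma C_c_inf_dirderiv_bounded:
  fixes \<phi> :: "'a::euclidean_space \<Rightarrow> real"
  assumes "\<phi> \<in> C_c_inf" obtains B where "B > 0" "\<And>x h. \<bar>dirderiv \<phi> x h\<bar> \<le> B * norm h"
proof -
  have "\<exists>B>0. \<forall>x. \<bar>dirderiv \<phi> x b\<bar> \<le> B" for b
    using C_c_bounded[OF C_c_inf_subset_C_c[OF dirderiv_C_c_inf[OF assms]]] by metis
  then obtain B where B: "\<And>b. B b > 0" "\<And>b x. \<bar>dirderiv \<phi> x b\<bar> \<le> B b" by metis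
  have s: "smooth \<phi>" using assms by (simp add: C_c_inf_smooth)
  have "\<bar>dirderiv \<phi> x h\<bar> \<le> (1 + (\<Sum>b\<in>Basis. B b)) * norm h" for x h
  proof -
    have "\<bar>dirderiv \<phi> x h\<bar> \<le> (\<Sum>b\<in>Basis. \<bar>(h \<bullet> b) * dirderiv \<phi> x b\<bar>)"
      unfolding dirderiv_basis[OF s, of x h] by (rule sum_abs)
    also have "\<dots> \<le> (\<Sum>b\<in>Basis. norm h * B b)"
      unfolding abs_mult by (intro sum_mono mult_mono B Basis_le_norm) auto
    finally show ?thesis by (simp add: sum_distrib_left algebra_simps)
       (smt (verit) norm_ge_zero)
  qed
  moreover have "1 + (\<Sum>b\<in>(Basis::'a set). B b) > 0"
    by (smt (verit) B(1) sum_nonneg)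
  ultimately show ?thesis using that by blast
qed

lemma C_c_inf_Lipschitz:
  fixes \<phi> :: "'a::euclidean_space \<Rightarrow> real"
  assumes "\<phi> \<in> C_c_inf" obtains B where "B > 0" "\<And>x y. \<bar>\<phi> x - \<phi> y\<bar> \<le> B * norm (x - y)"
proof -
  obtain B where B: "B > 0" "\<And>x h. \<bar>dirderiv \<phi> x h\<bar> \<le> B * norm h"
    using C_c_inf_dirderiv_bounded[OF assms] by blast
  have s: "smooth \<phi>" using assms by (simp add: C_c_inf_smooth)
  have "norm (\<phi> x - \<phi> y) \<le> B * norm (x - y)" for x y
    by (rule differentiable_bound[of UNIV \<phi> "dirderiv \<phi>"])
       (use B s in \<open>auto intro!: onorm_bound simp: smooth_has_derivative\<close>)
  then show ?thesis using that B(1) by (simp add: real_norm_def)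
qed

text \<open>Derivatives along basis vectors are again test functions, hence Lipschitz; expanding h
  in the basis transfers this to every direction. A single constant is produced because the later
  estimates carry only one.\<close>

lemma C_c_inf_derivative_bounds:
  fixes \<phi> :: "'a::euclidean_space \<Rightarrow> real"
  assumes "\<phi> \<in> C_c_inf"
  obtains B where "B > 0" "\<And>x. \<bar>\<phi> x\<bar> \<le> B" "\<And>x h. \<bar>dirderiv \<phi> x h\<bar> \<le> B * norm h"
    "\<And>x y h. \<bar>dirderiv \<phi> x h - dirderiv \<phi> y h\<bar> \<le> B * norm (x - y) * norm h"
proof -
  obtain B0 where B0: "B0 > 0" "\<And>x. \<bar>\<phi> x\<bar> \<le> B0" using C_c_bounded C_c_inf_subset_C_c assms by metis
  obtain B1 where B1: "B1 > 0" "\<And>x h. \<bar>dirderiv \<phi> x h\<bar> \<le> B1 * norm h"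
    using C_c_inf_dirderiv_bounded[OF assms] by blast
  have "\<exists>B>0. \<forall>x y. \<bar>dirderiv \<phi> x b - dirderiv \<phi> y b\<bar> \<le> B * norm (x - y)" for b
    using C_c_inf_Lipschitz[OF dirderiv_C_c_inf[OF assms]] by metis
  then obtain B where B: "\<And>b. B b > 0" "\<And>b x y. \<bar>dirderiv \<phi> x b - dirderiv \<phi> y b\<bar> \<le> B b * norm (x - y)"
    by metis
  have s: "smooth \<phi>" using assms by (simp add: C_c_inf_smooth)
  define B2 where "B2 = (\<Sum>b\<in>Basis. B b)"
  have B2: "\<bar>dirderiv \<phi> x h - dirderiv \<phi> y h\<bar> \<le> B2 * norm (x - y) * norm h" for x y h
  proof -
    have "\<bar>dirderiv \<phi> x h - dirderiv \<phi> y h\<bar> = \<bar>\<Sum>b\<in>Basis. (h \<bullet> b) * (dirderiv \<phi> x b - dirderiv \<phi> y b)\<bar>"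
      unfolding dirderiv_basis[OF s, of x h] dirderiv_basis[OF s, of y h]
      by (simp add: sum_subtractf[symmetric] right_diff_distrib)
    also have "\<dots> \<le> (\<Sum>b\<in>Basis. \<bar>(h \<bullet> b) * (dirderiv \<phi> x b - dirderiv \<phi> y b)\<bar>)" by (rule sum_abs)
    also have "\<dots> \<le> (\<Sum>b\<in>Basis. norm h * (B b * norm (x - y)))"
      unfolding abs_mult by (intro sum_mono mult_mono B Basis_le_norm) auto
    finally show ?thesis by (simp add: B2_def sum_distrib_left sum_distrib_right mult_ac)
  qed
  have "B2 \<ge> 0" unfolding B2_def by (intro sum_nonneg) (use B(1) less_imp_le in blast)
  define C where "C = B0 + B1 + B2"
  have "\<bar>\<phi> x\<bar> \<le> C" for x using B0(2)[of x] B1(1) \<open>B2 \<ge> 0\<close> by (simp add: C_def)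
  moreover have "\<bar>dirderiv \<phi> x h\<bar> \<le> C * norm h" for x h
    by (rule order_trans[OF B1(2)]) (use B0 B1 \<open>B2 \<ge> 0\<close> in \<open>auto simp: C_def intro!: mult_right_mono\<close>)
  moreover have "\<bar>dirderiv \<phi> x h - dirderiv \<phi> y h\<bar> \<le> C * norm (x - y) * norm h" for x y h
    by (rule order_trans[OF B2]) (use B0 B1 \<open>B2 \<ge> 0\<close> in \<open>auto simp: C_def intro!: mult_right_mono\<close>)
  moreover have "C > 0" using B0 B1 \<open>B2 \<ge> 0\<close> by (simp add: C_def)
  ultimately show ?thesis using that by blast
qed

text \<open>Stone-Weierstrass on the ball of radius 2 R gives a polynomial p; the cutoff makes it a
  test function. As \<open>bump R\<close> is 1 on the support of \<phi>, the error is
  \<open>bump R\<close> times |\<phi> - p|, which the cutoff can only decrease.\<close>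

lemma C_c_inf_dense:
  fixes \<phi> :: "'a::euclidean_space \<Rightarrow> real"
  assumes "\<phi> \<in> C_c" "\<eta> > 0"
  obtains \<psi> where "\<psi> \<in> C_c_inf" "\<And>x. \<bar>\<phi> x - \<psi> x\<bar> \<le> \<eta>"
proof -
  obtain R where R: "R > 0" "\<And>x. norm x > R \<Longrightarrow> \<phi> x = 0"
    using assms compact_supportD[of \<phi>] by (auto simp: C_c_def)
  obtain p where p: "real_polynomial_function p" "\<And>x. x \<in> cball 0 (2*R) \<Longrightarrow> \<bar>\<phi> x - p x\<bar> < \<eta>"
    using Stone_Weierstrass_real_polynomial_function[of "cball (0::'a) (2*R)" \<phi> \<eta>] assms
    by (auto simp: C_c_def intro: continuous_on_subset)
  define \<psi> where "\<psi> x = bump R x * p x" for x :: 'a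
  have "\<bar>\<phi> x - \<psi> x\<bar> \<le> \<eta>" for x
  proof -
    have "\<phi> x = bump R x * \<phi> x" using R bump_props(2)[of R x] by (cases "norm x \<le> R") auto
    then have "\<bar>\<phi> x - \<psi> x\<bar> = bump R x * \<bar>\<phi> x - p x\<bar>"
      by (metis \<psi>_def R(1) abs_mult abs_of_nonneg bump_props(4) right_diff_distrib)
    also have "\<dots> \<le> \<eta>"
    proof (cases "norm x < 2 * R")
      case True
      then have "bump R x * \<bar>\<phi> x - p x\<bar> \<le> 1 * \<eta>"
        using p(2)[of x] bump_props(4,5)[OF R(1), of x] by (intro mult_mono) auto
      then show ?thesis by simp
    qed (use R assms bump_props(3)[of R x] in auto)
    finally show ?thesis .
  qed
  moreover have "\<psi> \<in> C_c_inf"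
    unfolding \<psi>_def by (intro C_c_inf_mult bump_props(6) R smooth_real_polynomial_function p)
  ultimately show ?thesis using that by blast
qed

subsection \<open>Singular kernels in the plane and the dual Sobolev bound\<close>

lemma nn_integral_swap:
  assumes "sigma_finite_measure M" "sigma_finite_measure N" "case_prod f \<in> borel_measurable (M \<Otimes>\<^sub>M N)"
  shows "(\<integral>\<^sup>+x. \<integral>\<^sup>+y. f x y \<partial>N \<partial>M) = (\<integral>\<^sup>+y. \<integral>\<^sup>+x. f x y \<partial>M \<partial>N)"
proof -
  interpret pair_sigma_finite M N using assms(1,2) by (simp add: pair_sigma_finite_def)
  show ?thesis using Fubini'[OF assms(3)] by simp
qed

lemma nn_integral_translation:
  fixes F :: "'a::euclidean_space \<Rightarrow> ennreal"
  assumes [measurable]: "F \<in> borel_measurable borel"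
  shows "(\<integral>\<^sup>+z. F (c + z) \<partial>lborel) = (\<integral>\<^sup>+z. F z \<partial>lborel)"
proof -
  have "(\<integral>\<^sup>+z. F z \<partial>lborel) = (\<integral>\<^sup>+z. F z \<partial>distr lborel borel ((+) c))"
    by (simp add: lborel_distr_plus)
  also have "\<dots> = (\<integral>\<^sup>+z. F (c + z) \<partial>lborel)" by (rule nn_integral_distr) auto
  finally show ?thesis by simp
qed

lemma nn_integral_minus_translation:
  fixes F :: "'a::euclidean_space \<Rightarrow> ennreal"
  assumes [measurable]: "F \<in> borel_measurable borel"
  shows "(\<integral>\<^sup>+z. F (z - c) \<partial>lborel) = (\<integral>\<^sup>+z. F z \<partial>lborel)"
  using nn_integral_translation[OF assms, of "- c"] by simp

lemma nn_integral_scaling: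
  fixes F :: "plane \<Rightarrow> ennreal"
  assumes [measurable]: "F \<in> borel_measurable borel" and c: "c > 0"
  shows "(\<integral>\<^sup>+z. F (c *\<^sub>R z) \<partial>lborel) = ennreal (1 / c\<^sup>2) * (\<integral>\<^sup>+z. F z \<partial>lborel)"
proof -
  have "(\<integral>\<^sup>+z. F z \<partial>lborel) = (\<integral>\<^sup>+z. F z \<partial>density (distr lborel borel (\<lambda>x::plane. 0 + c *\<^sub>R x)) (\<lambda>_. \<bar>c\<bar>^DIM(plane)))"
    using c by (subst lborel_affine[of c 0]) auto
  also have "\<dots> = ennreal (c\<^sup>2) * (\<integral>\<^sup>+z. F (c *\<^sub>R z) \<partial>lborel)"
    using c by (simp add: nn_integral_density nn_integral_distr nn_integral_cmult ennreal_power)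
  finally show ?thesis using c
    by (simp add: mult.assoc[symmetric] ennreal_mult[symmetric])
qed

lemma emeasure_plane_ball: "r \<ge> 0 \<Longrightarrow> emeasure lborel (ball (x::plane) r) = ennreal (pi * r\<^sup>2)"
  by (simp add: emeasure_ball unit_ball_vol_2)

lemma emeasure_plane_cball: "r \<ge> 0 \<Longrightarrow> emeasure lborel (cball (x::plane) r) = ennreal (pi * r\<^sup>2)"
  by (simp add: emeasure_cball unit_ball_vol_2)

lemma emeasure_le_cball: "0 \<le> r \<Longrightarrow> X \<subseteq> cball (0::plane) r \<Longrightarrow> emeasure lborel X \<le> ennreal (pi * r\<^sup>2)"
  using emeasure_mono[of X "cball 0 r" lborel] by (simp add: emeasure_plane_cball)

text \<open>Layer-cake: \<open>1/|z|\<^sup>p\<close> is the integral of \<open>p/s\<^sup>p\<^sup>+\<^sup>1\<close> over \<open>s \<ge> |z|\<close>.\<close>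

lemma nn_integral_power_tail:
  fixes a :: real assumes "a > 0" "p \<ge> 1"
  shows "(\<integral>\<^sup>+s. ennreal (real p / s ^ Suc p) * indicator {a..} s \<partial>lborel) = ennreal (1 / a ^ p)"
proof -
  have "(\<integral>\<^sup>+s. ennreal (real p / s ^ Suc p) * indicator {a..} s \<partial>lborel) = ennreal (0 - (- (1 / a ^ p)))"
  proof (rule nn_integral_FTC_atLeast)
    fix s assume "a \<le> s"
    then have "s > 0" using assms by simp
    then have "((\<lambda>s. - (s powi (- int p))) has_real_derivative - (of_int (- int p) * s powi (- int p - 1) * 1)) (at s)"
      by (intro DERIV_minus DERIV_power_int) auto
    moreover have "s powi (- int p - 1) = 1 / s ^ Suc p"
    proof -
      have "- int p - 1 = - int (Suc p)" by simp
      then show ?thesis by (simp only: power_int_minus power_int_of_nat inverse_eq_divide)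
    qed
    ultimately show "((\<lambda>s. - (1 / s ^ p)) has_real_derivative real p / s ^ Suc p) (at s)"
      by (simp add: power_int_minus inverse_eq_divide)
    show "0 \<le> real p / s ^ Suc p" using \<open>s > 0\<close> by simp
  next
    show "((\<lambda>s::real. - (1 / s ^ p)) \<longlongrightarrow> 0) at_top"
    proof -
      have "filterlim (\<lambda>s::real. s ^ p) at_top at_top"
        using assms by (intro filterlim_pow_at_top filterlim_ident) auto
      then have "((\<lambda>s::real. 1 / s ^ p) \<longlongrightarrow> 0) at_top"
        by (intro tendsto_divide_0[OF tendsto_const] filterlim_at_top_imp_at_infinity)
      from tendsto_minus[OF this] show ?thesis by simp
    qed
  qed simp
  then show ?thesis by simp
qed

lemma inverse_power_norm_le:
  fixes z :: "'a::real_normed_vector" assumes "p \<ge> 1"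
  shows "ennreal (1 / norm z ^ p) \<le> (\<integral>\<^sup>+s. ennreal (real p / s ^ Suc p) * indicator {norm z..} s \<partial>lborel)"
proof (cases "z = 0")
  \<comment> \<open>At the origin the left side is 0, because 1 / 0 = 0, while the integral
    diverges; this is why the claim is an inequality and not an equality.\<close>
  case True then show ?thesis using assms by (cases p) auto
qed (use nn_integral_power_tail[of "norm z" p] assms in auto)

lemma nn_integral_layer_cake:
  fixes A :: "plane set"
  assumes [measurable]: "A \<in> sets borel" and p: "p \<ge> 1"
  shows "(\<integral>\<^sup>+z. indicator A z * ennreal (1 / norm z ^ p) \<partial>lborel)
    \<le> (\<integral>\<^sup>+s. ennreal (real p / s ^ Suc p) * emeasure lborel (A \<inter> cball 0 s) \<partial>lborel)"
proof -
  have "(\<integral>\<^sup>+z. indicator A z * ennreal (1 / norm z ^ p) \<partial>lborel)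
     \<le> (\<integral>\<^sup>+z. \<integral>\<^sup>+s. indicator A z * (ennreal (real p / s ^ Suc p) * indicator {norm z..} s) \<partial>lborel \<partial>lborel)"
    by (intro nn_integral_mono, subst nn_integral_cmult)
       (use inverse_power_norm_le[OF p] in \<open>auto intro!: mult_left_mono\<close>)
  also have "\<dots> = (\<integral>\<^sup>+s. \<integral>\<^sup>+z. indicator A z * (ennreal (real p / s ^ Suc p) * indicator {norm z..} s) \<partial>lborel \<partial>lborel)"
  proof (rule nn_integral_swap)
    have "(\<lambda>(z::plane, s::real). indicator A z * (ennreal (real p / s ^ Suc p) * (if norm z \<le> s then 1 else 0)))
      \<in> borel_measurable (lborel \<Otimes>\<^sub>M lborel)" by measurable
    then show "(\<lambda>(z, s). indicator A z * (ennreal (real p / s ^ Suc p) * indicator {norm z..} s))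
      \<in> borel_measurable (lborel \<Otimes>\<^sub>M lborel)"
      by (simp add: indicator_def of_bool_def)
  qed (auto intro: sigma_finite_lborel)
  also have "\<dots> = (\<integral>\<^sup>+s. ennreal (real p / s ^ Suc p) * emeasure lborel (A \<inter> cball 0 s) \<partial>lborel)"
  proof (rule nn_integral_cong)
    fix s :: real
    have "(\<integral>\<^sup>+z. indicator A z * (ennreal (real p / s ^ Suc p) * indicator {norm z..} s) \<partial>lborel)
      = (\<integral>\<^sup>+z. ennreal (real p / s ^ Suc p) * indicator (A \<inter> cball 0 s) z \<partial>lborel)"
      by (intro nn_integral_cong) (auto simp: indicator_def)
    also have "\<dots> = ennreal (real p / s ^ Suc p) * emeasure lborel (A \<inter> cball 0 s)"
      by (rule nn_integral_cmult_indicator) auto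
    finally show "(\<integral>\<^sup>+z. indicator A z * (ennreal (real p / s ^ Suc p) * indicator {norm z..} s) \<partial>lborel)
      = ennreal (real p / s ^ Suc p) * emeasure lborel (A \<inter> cball 0 s)" .
  qed
  finally show ?thesis .
qed

text \<open>The ball meets the disc of radius s in area at most pi min(r, s)^2. Weighted by 1/s^2,
  the range s \<le> r contributes pi r and the range s > r contributes another pi r.\<close>

lemma nn_integral_inverse_norm_ball:
  assumes r: "r > 0"
  shows "(\<integral>\<^sup>+z. indicator (ball (0::plane) r) z * ennreal (1 / norm z) \<partial>lborel) \<le> ennreal (2 * pi * r)"
proof -
  have "(\<integral>\<^sup>+z. indicator (ball (0::plane) r) z * ennreal (1 / norm z) \<partial>lborel)
    \<le> (\<integral>\<^sup>+s. ennreal (1 / s\<^sup>2) * emeasure lborel (ball (0::plane) r \<inter> cball 0 s) \<partial>lborel)"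
    using nn_integral_layer_cake[of "ball (0::plane) r" 1] by (simp add: power2_eq_square)
  also have "\<dots> \<le> (\<integral>\<^sup>+s. ennreal pi * indicator {0..r} s + ennreal (pi * r\<^sup>2) * (ennreal (real 1 / s ^ Suc 1) * indicator {r..} s) \<partial>lborel)"
  proof (rule nn_integral_mono)
    fix s :: real
    consider "s < 0" | "s = 0" | "0 < s" "s \<le> r" | "r < s" using r by linarith
    then show "ennreal (1 / s\<^sup>2) * emeasure lborel (ball (0::plane) r \<inter> cball 0 s)
      \<le> ennreal pi * indicator {0..r} s + ennreal (pi * r\<^sup>2) * (ennreal (real 1 / s ^ Suc 1) * indicator {r..} s)"
    proof cases
      case 3
      have "ennreal (1 / s\<^sup>2) * emeasure lborel (ball (0::plane) r \<inter> cball 0 s) \<le> ennreal (1 / s\<^sup>2) * ennreal (pi * s\<^sup>2)"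
        using 3 by (intro mult_left_mono emeasure_le_cball) auto
      also have "\<dots> = ennreal pi" using 3 by (simp add: ennreal_mult[symmetric])
      finally show ?thesis using 3 by (auto simp: add_increasing2)
    next
      case 4
      have "ennreal (1 / s\<^sup>2) * emeasure lborel (ball (0::plane) r \<inter> cball 0 s) \<le> ennreal (1 / s\<^sup>2) * ennreal (pi * r\<^sup>2)"
        using r by (intro mult_left_mono emeasure_le_cball) auto
      then show ?thesis using 4 by (simp add: power2_eq_square mult.commute)
    qed auto
  qed
  also have "\<dots> = ennreal (pi * r) + ennreal (pi * r\<^sup>2) * ennreal (1 / r)"
    using nn_integral_power_tail[OF r, of 1]
    by (subst nn_integral_add) (use r in \<open>auto simp: nn_integral_cmult ennreal_mult[symmetric]\<close>)
  also have "\<dots> = ennreal (2 * pi * r)"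
    using r by (simp add: ennreal_mult[symmetric] ennreal_plus[symmetric] power2_eq_square del: ennreal_plus)
  finally show ?thesis .
qed

text \<open>In the layer-cake integral discs of radius s < d miss the annulus, radii between d and 1
  contribute the integral of 2 pi / s, which is the logarithm, and radii above 1 contribute
  pi.\<close>

lemma nn_integral_inverse_norm_square_annulus:
  assumes d: "0 < d" "d < 1"
  shows "(\<integral>\<^sup>+z. indicator (ball (0::plane) 1 - ball 0 d) z * ennreal (1 / (norm z)\<^sup>2) \<partial>lborel) \<le> ennreal (pi + 2 * pi * ln (1 / d))"
proof -
  have "(\<integral>\<^sup>+z. indicator (ball (0::plane) 1 - ball 0 d) z * ennreal (1 / (norm z)\<^sup>2) \<partial>lborel)
    \<le> (\<integral>\<^sup>+s. ennreal (real 2 / s ^ Suc 2) * emeasure lborel ((ball (0::plane) 1 - ball 0 d) \<inter> cball 0 s) \<partial>lborel)"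
    by (rule nn_integral_layer_cake) auto
  also have "\<dots> \<le> (\<integral>\<^sup>+s. ennreal (2 * pi) * (ennreal (1 / s) * indicator {d..1} s) + ennreal pi * (ennreal (real 2 / s ^ Suc 2) * indicator {1..} s) \<partial>lborel)"
  proof (rule nn_integral_mono)
    fix s :: real
    consider "s < d" | "d \<le> s" "s \<le> 1" | "1 < s" by linarith
    then show "ennreal (real 2 / s ^ Suc 2) * emeasure lborel ((ball (0::plane) 1 - ball 0 d) \<inter> cball 0 s)
      \<le> ennreal (2 * pi) * (ennreal (1 / s) * indicator {d..1} s) + ennreal pi * (ennreal (real 2 / s ^ Suc 2) * indicator {1..} s)"
    proof cases
      case 1
      then have "(ball (0::plane) 1 - ball 0 d) \<inter> cball 0 s = {}" by auto
      then show ?thesis by simp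
    next
      case 2
      have "ennreal (real 2 / s ^ Suc 2) * emeasure lborel ((ball (0::plane) 1 - ball 0 d) \<inter> cball 0 s) \<le> ennreal (real 2 / s ^ Suc 2) * ennreal (pi * s\<^sup>2)"
        using 2 d by (intro mult_left_mono emeasure_le_cball) auto
      also have "\<dots> = ennreal (2 * pi) * ennreal (1 / s)"
        using 2 d by (simp add: ennreal_mult[symmetric] power2_eq_square power3_eq_cube field_simps)
      finally show ?thesis using 2 by (auto simp: add_increasing2)
    next
      case 3
      have "ennreal (real 2 / s ^ Suc 2) * emeasure lborel ((ball (0::plane) 1 - ball 0 d) \<inter> cball 0 s) \<le> ennreal (real 2 / s ^ Suc 2) * ennreal (pi * 1\<^sup>2)"
        by (intro mult_left_mono emeasure_le_cball) auto
      then show ?thesis using 3 by (simp add: mult.commute)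
    qed
  qed
  also have "\<dots> = ennreal (2 * pi) * ennreal (ln 1 - ln d) + ennreal pi * ennreal (1 / 1 ^ 2)"
  proof -
    have "(\<integral>\<^sup>+s. ennreal (1 / s) * indicator {d..1} s \<partial>lborel) = ennreal (ln 1 - ln d)"
      using d by (intro nn_integral_FTC_Icc) (auto intro!: derivative_eq_intros)
    moreover have "(\<integral>\<^sup>+s. ennreal (real 2 / s ^ Suc 2) * indicator {1..} s \<partial>lborel) = ennreal (1 / 1 ^ 2)"
      by (rule nn_integral_power_tail) auto
    ultimately show ?thesis
      by (subst nn_integral_add) (auto simp: nn_integral_cmult simp del: of_nat_numeral power_Suc ln_one)
  qed
  also have "\<dots> = ennreal (pi + 2 * pi * ln (1 / d))"
    using d by (simp add: ennreal_mult[symmetric] ennreal_plus[symmetric] ln_div mult_nonneg_nonpos del: ennreal_plus)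
  finally show ?thesis .
qed

text \<open>Since \<open>ln 0 = 0\<close>, this negative part of the logarithm vanishes at 0. A
  double integral of it therefore does not see the diagonal, and \<open>H1_duality\<close> has to
  exclude atoms separately.\<close>

definition lnm :: "real \<Rightarrow> real" where "lnm r = max 0 (- ln r)"

lemma lnm_nonneg: "0 \<le> lnm r" by (simp add: lnm_def)

lemma lnm_measurable[measurable]: "lnm \<in> borel_measurable borel"
  unfolding lnm_def by measurable

text \<open>Here a and b are the distances to two poles that are d apart. At most one of them is
  below d/2; the other factor is then at most 2/d. If neither is, the arithmetic-geometric mean
  inequality applies. Each resulting term depends on one distance only and can be integrated around
  its own pole.\<close>

lemma inverse_product_bound:
  fixes a b d :: real
  assumes "0 \<le> a" "0 \<le> b" "0 < d" "d \<le> a + b" "a < 1" "b < 1"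
  shows "1 / (a * b) \<le> (2 / d) * (if a < d / 2 then 1 / a else 0) + (2 / d) * (if b < d / 2 then 1 / b else 0)
     + (if a < d / 2 then 0 else 1 / a\<^sup>2) + (if b < d / 2 then 0 else 1 / b\<^sup>2)"
proof -
  consider "a = 0 \<or> b = 0" | "a < d / 2" "a > 0" "b > 0" | "b < d / 2" "a > 0" "b > 0" | "a \<ge> d / 2" "b \<ge> d / 2"
    using assms by linarith
  then show ?thesis
  proof cases
    case 1 then show ?thesis using assms by auto
  next
    case 2
    then have "1 / b \<le> 2 / d" using assms by (simp add: frac_le_eq divide_simps)
    then have "1 / b * (1 / a) \<le> 2 / d * (1 / a)" using 2 by (intro mult_right_mono) auto
    then have "1 / (a * b) \<le> 2 / d * (1 / a)" by (simp add: mult.commute)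
    then show ?thesis using 2 assms by (auto simp: add_increasing2)
  next
    case 3
    then have "1 / a \<le> 2 / d" using assms by (simp add: frac_le_eq divide_simps)
    then have "1 / a * (1 / b) \<le> 2 / d * (1 / b)" using 3 by (intro mult_right_mono) auto
    then have "1 / (a * b) \<le> 2 / d * (1 / b)" by simp
    then show ?thesis using 3 assms by (auto simp: add_increasing2)
  next
    case 4
    have "0 \<le> (1 / a - 1 / b)\<^sup>2" by simp
    then have "2 * (1 / (a * b)) \<le> 1 / a\<^sup>2 + 1 / b\<^sup>2"
      by (simp add: power2_diff power_one_over mult.commute)
    moreover have "0 \<le> 1 / (a * b)" using assms by simp
    ultimately have "1 / (a * b) \<le> 1 / a\<^sup>2 + 1 / b\<^sup>2" by linarith
    then show ?thesis using 4 by simp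
  qed
qed

text \<open>Each disc of radius d/2 has an integral of 1/|w| proportional to d, which the factor 2/d
  makes a constant; the logarithm comes from the annuli between d/2 and 1, with ln (2/d) \<le> 1 +
  \<open>lnm\<close> d because ln 2 < 1. For d \<ge> 2 the annuli are empty. Altogether 10 pi + 4 pi
  \<open>lnm\<close> d, relaxed to a common factor.\<close>

lemma nn_integral_two_poles:
  fixes x y :: plane assumes "x \<noteq> y"
  shows "(\<integral>\<^sup>+z. ennreal (indicator (ball x 1) z / norm (z - x) * (indicator (ball y 1) z / norm (z - y))) \<partial>lborel)
    \<le> ennreal (14 * pi * (1 + lnm (norm (x - y))))"
proof -
  define d where "d = norm (x - y)"
  have d: "d > 0" using assms by (simp add: d_def)
  define F where "F w = indicator (ball (0::plane) (d/2)) w * ennreal (1 / norm w)" for w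
  define G where "G w = indicator (ball (0::plane) 1 - ball 0 (d/2)) w * ennreal (1 / (norm w)\<^sup>2)" for w
  have [measurable]: "F \<in> borel_measurable borel" "G \<in> borel_measurable borel"
  proof -
    have [measurable]: "ball (0::plane) r \<in> sets borel" for r by simp
    show "F \<in> borel_measurable borel" "G \<in> borel_measurable borel"
      unfolding F_def[abs_def] G_def[abs_def] by measurable
  qed
  have "ennreal (indicator (ball x 1) z / norm (z - x) * (indicator (ball y 1) z / norm (z - y)))
     \<le> ennreal (2 / d) * F (z - x) + ennreal (2 / d) * F (z - y) + G (z - x) + G (z - y)" for z
  proof (cases "norm (z - x) < 1 \<and> norm (z - y) < 1")
    case True
    define a b where "a = norm (z - x)" and "b = norm (z - y)"
    have ab: "0 \<le> a" "0 \<le> b" "a < 1" "b < 1" using True by (auto simp: a_def b_def)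
    have "d \<le> a + b" unfolding d_def a_def b_def
      using norm_triangle_ineq4[of "z - y" "z - x"] by (simp add: norm_minus_commute)
    have "indicator (ball x 1) z / norm (z - x) * (indicator (ball y 1) z / norm (z - y)) = 1 / (a * b)"
      using True by (simp add: a_def b_def dist_norm norm_minus_commute)
    moreover have "F (z - x) = ennreal (if a < d / 2 then 1 / a else 0)" "F (z - y) = ennreal (if b < d / 2 then 1 / b else 0)"
       "G (z - x) = ennreal (if a < d / 2 then 0 else 1 / a\<^sup>2)" "G (z - y) = ennreal (if b < d / 2 then 0 else 1 / b\<^sup>2)"
      using True by (auto simp: F_def G_def a_def b_def indicator_def)
    ultimately show ?thesis
      using inverse_product_bound[OF ab(1,2) d \<open>d \<le> a + b\<close> ab(3,4)] d ab
      by (simp add: ennreal_mult[symmetric] ennreal_plus[symmetric] del: ennreal_plus)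
  next
    case False
    then have "indicator (ball x 1) z / norm (z - x) * (indicator (ball y 1) z / norm (z - y)) = 0"
      by (auto simp: indicator_def dist_norm norm_minus_commute)
    then show ?thesis by (simp only: ennreal_0 zero_le)
  qed
  then have "(\<integral>\<^sup>+z. ennreal (indicator (ball x 1) z / norm (z - x) * (indicator (ball y 1) z / norm (z - y))) \<partial>lborel)
    \<le> (\<integral>\<^sup>+z. ennreal (2 / d) * F (z - x) + ennreal (2 / d) * F (z - y) + G (z - x) + G (z - y) \<partial>lborel)"
    by (intro nn_integral_mono) auto
  also have "\<dots> = 2 * (ennreal (2 / d) * (\<integral>\<^sup>+z. F z \<partial>lborel)) + 2 * (\<integral>\<^sup>+z. G z \<partial>lborel)"
    by (simp add: nn_integral_add nn_integral_cmult nn_integral_minus_translation mult_2 add_ac)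
  also have "\<dots> \<le> 2 * (ennreal (2 / d) * ennreal (2 * pi * (d / 2))) + 2 * ennreal (3 * pi + 2 * pi * lnm d)"
  proof (intro add_mono mult_left_mono)
    show "(\<integral>\<^sup>+z. F z \<partial>lborel) \<le> ennreal (2 * pi * (d / 2))"
      unfolding F_def by (rule nn_integral_inverse_norm_ball) (use d in auto)
    show "(\<integral>\<^sup>+z. G z \<partial>lborel) \<le> ennreal (3 * pi + 2 * pi * lnm d)"
    proof (cases "d / 2 < 1")
      case True
      have "ln (1 / (d / 2)) \<le> 1 + lnm d"
        using d ln_2_less_1 by (simp add: ln_div lnm_def)
      then have "2 * pi * ln (1 / (d / 2)) \<le> 2 * pi * (1 + lnm d)" by (intro mult_left_mono) auto
      then have le: "pi + 2 * pi * ln (1 / (d / 2)) \<le> 3 * pi + 2 * pi * lnm d"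
        by (simp add: distrib_left)
      show ?thesis unfolding G_def
        by (rule order_trans[OF nn_integral_inverse_norm_square_annulus[of "d/2"] ennreal_leI[OF le]])
          (use d True in auto)
    next
      case False
      then have "ball (0::plane) 1 - ball 0 (d/2) = {}" by auto
      then have "G z = 0" for z unfolding G_def by (simp only: indicator_def empty_iff) simp
      then show ?thesis by simp
    qed
  qed auto
  also have "\<dots> = ennreal (10 * pi + 4 * pi * lnm d)"
    using d lnm_nonneg[of d] by (simp add: ennreal_mult[symmetric] ennreal_plus[symmetric] algebra_simps flip: ennreal_numeral del: ennreal_plus)
  also have "\<dots> \<le> ennreal (14 * pi * (1 + lnm d))"
    using lnm_nonneg[of d] by (intro ennreal_leI) (simp add: algebra_simps)
  finally show ?thesis by (simp add: d_def)
qed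

section \<open>Control of a function, and of its integral against a measure, by the gradient\<close>

lemma inner_grad:
  assumes "\<phi> differentiable (at x)" shows "u \<bullet> grad \<phi> x = dirderiv \<phi> x u"
proof -
  have l: "linear (dirderiv \<phi> x)" by (rule linear_frechet_derivative[OF assms])
  have "dirderiv \<phi> x u = dirderiv \<phi> x (\<Sum>i\<in>UNIV. (u $ i) *\<^sub>R axis i 1)"
    by (simp add: basis_expansion scalar_mult_eq_scaleR[symmetric])
  also have "\<dots> = (\<Sum>i\<in>UNIV. (u $ i) * dirderiv \<phi> x (axis i 1))"
    by (simp add: linear_sum[OF l] linear_cmul[OF l])
  finally show ?thesis by (simp add: inner_vec_def grad_def)
qed

lemma abs_dirderiv_le:
  assumes "\<phi> differentiable (at x)"
  shows "\<bar>dirderiv \<phi> x h\<bar> \<le> norm (grad \<phi> x) * norm h"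
  using Cauchy_Schwarz_ineq2[of h "grad \<phi> x"] by (simp add: inner_grad[OF assms] mult.commute)

lemma continuous_on_grad:
  assumes "smooth \<phi>" shows "continuous_on S (grad \<phi>)"
  unfolding grad_def[abs_def] by (intro continuous_on_vec_lambda smooth_continuous_on smooth_dirderiv assms)

text \<open>The fundamental theorem of calculus on the segment from x to x + z, stated with
  nonnegative integrals so that averaging over z can be followed by Tonelli without integrability
  conditions.\<close>

lemma segment_bound:
  fixes \<phi> :: "plane \<Rightarrow> real"
  assumes s: "smooth \<phi>"
  shows "ennreal \<bar>\<phi> x\<bar> \<le> ennreal \<bar>\<phi> (x + z)\<bar>
    + (\<integral>\<^sup>+s. ennreal (norm (grad \<phi> (x + s *\<^sub>R z)) * norm z) * indicator {0..1} s \<partial>lborel)"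
proof -
  have d: "((\<lambda>s. \<phi> (x + s *\<^sub>R z)) has_vector_derivative dirderiv \<phi> (x + s *\<^sub>R z) z) (at s within {0..1})" for s
  proof -
    have "((\<lambda>s. \<phi> (x + s *\<^sub>R z)) has_derivative (\<lambda>h. dirderiv \<phi> (x + s *\<^sub>R z) (h *\<^sub>R z))) (at s within {0..1})"
      by (rule has_derivative_compose[OF _ smooth_has_derivative[OF s]]) (auto intro!: derivative_eq_intros)
    then show ?thesis
      by (simp add: has_vector_derivative_def linear_cmul[OF dirderiv_linear[OF s]])
  qed
  have c: "continuous_on {0..1} (\<lambda>s. dirderiv \<phi> (x + s *\<^sub>R z) z)"
    by (rule continuous_on_compose2[OF smooth_continuous_on[OF smooth_dirderiv[OF s], of UNIV]])
       (auto intro!: continuous_intros)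
  have "has_bochner_integral lborel (\<lambda>s. indicator {0..1} s *\<^sub>R dirderiv \<phi> (x + s *\<^sub>R z) z) (\<phi> (x + 1 *\<^sub>R z) - \<phi> (x + 0 *\<^sub>R z))"
    by (rule has_bochner_integral_FTC_Icc) (use d c in auto)
  then have "ennreal (norm (\<phi> (x + z) - \<phi> x)) \<le> (\<integral>\<^sup>+s. norm (indicator {0..1} s *\<^sub>R dirderiv \<phi> (x + s *\<^sub>R z) z) \<partial>lborel)"
    using has_bochner_integral_norm_bound by fastforce
  also have "\<dots> \<le> (\<integral>\<^sup>+s. ennreal (norm (grad \<phi> (x + s *\<^sub>R z)) * norm z) * indicator {0..1} s \<partial>lborel)"
    using abs_dirderiv_le[OF smooth_differentiable[OF s]]
    by (intro nn_integral_mono) (auto simp: indicator_def intro!: ennreal_leI)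
  finally have "ennreal \<bar>\<phi> (x + z) - \<phi> x\<bar> \<le> \<dots>" by simp
  moreover have "ennreal \<bar>\<phi> x\<bar> \<le> ennreal \<bar>\<phi> (x + z)\<bar> + ennreal \<bar>\<phi> (x + z) - \<phi> x\<bar>"
    by (simp add: ennreal_plus[symmetric] del: ennreal_plus)
  ultimately show ?thesis by (meson add_left_mono order_trans)
qed

text \<open>Averages \<open>\<phi>(x) - \<phi>(x + z)\<close> over the unit ball.\<close>

lemma pointwise_bound:
  fixes \<phi> :: "plane \<Rightarrow> real"
  assumes s: "smooth \<phi>"
  shows "ennreal (pi * \<bar>\<phi> x\<bar>) \<le> (\<integral>\<^sup>+z. ennreal \<bar>\<phi> (x + z)\<bar> * indicator (ball 0 1) z \<partial>lborel)
    + (\<integral>\<^sup>+z. ennreal (norm (grad \<phi> (x + z)) / norm z) * indicator (ball 0 1) z \<partial>lborel)"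
proof -
  define G where "G y = norm (grad \<phi> y)" for y
  have [measurable]: "G \<in> borel_measurable borel" "\<phi> \<in> borel_measurable borel"
    unfolding G_def[abs_def]
    by (intro borel_measurable_continuous_onI continuous_on_norm continuous_on_grad smooth_continuous_on s)+
  have [measurable]: "ball (0::plane) r \<in> sets borel" for r by simp
  have bm2: "(\<lambda>(z, s). ennreal (G (x + s *\<^sub>R z) * norm z) * indicator {0..1} s * indicator (ball 0 1) z)
      \<in> borel_measurable (lborel \<Otimes>\<^sub>M lborel)" by measurable
  have bm3: "(\<lambda>(s, u). ennreal (1 / s ^ 3) * indicator {0<..1} s * ennreal (G (x + u) * norm u) * (if norm u < s then 1 else 0))
      \<in> borel_measurable (lborel \<Otimes>\<^sub>M lborel)" by measurable
  have "ennreal (pi * \<bar>\<phi> x\<bar>) = (\<integral>\<^sup>+z. ennreal \<bar>\<phi> x\<bar> * indicator (ball (0::plane) 1) z \<partial>lborel)"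
    by (subst nn_integral_cmult_indicator) (auto simp: emeasure_plane_ball ennreal_mult[symmetric] mult.commute)
  also have "\<dots> \<le> (\<integral>\<^sup>+z. (ennreal \<bar>\<phi> (x + z)\<bar> + (\<integral>\<^sup>+s. ennreal (G (x + s *\<^sub>R z) * norm z) * indicator {0..1} s \<partial>lborel)) * indicator (ball 0 1) z \<partial>lborel)"
    using segment_bound[OF s, of x] unfolding G_def by (intro nn_integral_mono mult_right_mono) auto
  also have "\<dots> = (\<integral>\<^sup>+z. ennreal \<bar>\<phi> (x + z)\<bar> * indicator (ball 0 1) z +
      (\<integral>\<^sup>+s. ennreal (G (x + s *\<^sub>R z) * norm z) * indicator {0..1} s * indicator (ball 0 1) z \<partial>lborel) \<partial>lborel)"
    by (intro nn_integral_cong) (simp add: distrib_right nn_integral_multc)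
  also have "\<dots> = (\<integral>\<^sup>+z. ennreal \<bar>\<phi> (x + z)\<bar> * indicator (ball 0 1) z \<partial>lborel) +
      (\<integral>\<^sup>+z. \<integral>\<^sup>+s. ennreal (G (x + s *\<^sub>R z) * norm z) * indicator {0..1} s * indicator (ball 0 1) z \<partial>lborel \<partial>lborel)"
    by (intro nn_integral_add) measurable
  also have "(\<integral>\<^sup>+z. \<integral>\<^sup>+s. ennreal (G (x + s *\<^sub>R z) * norm z) * indicator {0..1} s * indicator (ball 0 1) z \<partial>lborel \<partial>lborel)
     = (\<integral>\<^sup>+s. \<integral>\<^sup>+z. ennreal (G (x + s *\<^sub>R z) * norm z) * indicator {0..1} s * indicator (ball 0 1) z \<partial>lborel \<partial>lborel)"
    by (rule nn_integral_swap[OF sigma_finite_lborel sigma_finite_lborel bm2])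
  \<comment> \<open>The substitution u = s z for fixed s: the Jacobian gives s^-2 and |z| = |u| / s
    gives the third power. The condition |z| < 1 becomes |u| < s.\<close>
  also have "\<dots> = (\<integral>\<^sup>+s. \<integral>\<^sup>+u. ennreal (1 / s ^ 3) * indicator {0<..1} s * ennreal (G (x + u) * norm u) * (if norm u < s then 1 else 0) \<partial>lborel \<partial>lborel)"
  proof (rule nn_integral_cong_AE)
    have "AE s in lborel. s \<noteq> (0::real)" by (rule AE_lborel_singleton)
    then show "AE s in lborel. (\<integral>\<^sup>+z. ennreal (G (x + s *\<^sub>R z) * norm z) * indicator {0..1} s * indicator (ball 0 1) z \<partial>lborel)
      = (\<integral>\<^sup>+u. ennreal (1 / s ^ 3) * indicator {0<..1} s * ennreal (G (x + u) * norm u) * (if norm u < s then 1 else 0) \<partial>lborel)"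
    proof eventually_elim
      fix s :: real assume "s \<noteq> 0"
      show "(\<integral>\<^sup>+z. ennreal (G (x + s *\<^sub>R z) * norm z) * indicator {0..1} s * indicator (ball 0 1) z \<partial>lborel)
      = (\<integral>\<^sup>+u. ennreal (1 / s ^ 3) * indicator {0<..1} s * ennreal (G (x + u) * norm u) * (if norm u < s then 1 else 0) \<partial>lborel)"
      proof (cases "0 < s \<and> s \<le> 1")
        case True
        define F where "F u = ennreal (1 / s) * (ennreal (G (x + u) * norm u) * (if norm u < s then 1 else 0))" for u
        have Fm[measurable]: "F \<in> borel_measurable borel" unfolding F_def[abs_def] by measurable
        have "(\<integral>\<^sup>+z. ennreal (G (x + s *\<^sub>R z) * norm z) * indicator {0..1} s * indicator (ball 0 1) z \<partial>lborel)
           = (\<integral>\<^sup>+z. F (s *\<^sub>R z) \<partial>lborel)"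
          using True by (intro nn_integral_cong) (auto simp: F_def indicator_def G_def ennreal_mult[symmetric])
        also have "\<dots> = ennreal (1 / s\<^sup>2) * (\<integral>\<^sup>+u. F u \<partial>lborel)"
          using True by (intro nn_integral_scaling Fm) auto
        also have "\<dots> = (\<integral>\<^sup>+u. ennreal (1 / s\<^sup>2) * F u \<partial>lborel)" by (rule nn_integral_cmult[symmetric]) auto
        also have "\<dots> = (\<integral>\<^sup>+u. ennreal (1 / s ^ 3) * indicator {0<..1} s * ennreal (G (x + u) * norm u) * (if norm u < s then 1 else 0) \<partial>lborel)"
        proof -
          have "ennreal (1 / s\<^sup>2) * ennreal (1 / s) = ennreal (1 / s ^ 3)"
            using True by (simp add: ennreal_mult[symmetric] power2_eq_square power3_eq_cube)
          then show ?thesis using True by (simp add: F_def mult.assoc[symmetric])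
        qed
        finally show ?thesis .
      next
        case False
        then show ?thesis using \<open>s \<noteq> 0\<close> by (auto simp: indicator_def)
      qed
    qed
  qed
  also have "\<dots> = (\<integral>\<^sup>+u. \<integral>\<^sup>+s. ennreal (1 / s ^ 3) * indicator {0<..1} s * ennreal (G (x + u) * norm u) * (if norm u < s then 1 else 0) \<partial>lborel \<partial>lborel)"
    by (rule nn_integral_swap[OF sigma_finite_lborel sigma_finite_lborel bm3])
  also have "\<dots> \<le> (\<integral>\<^sup>+u. ennreal (G (x + u) / norm u) * indicator (ball 0 1) u \<partial>lborel)"
  proof (rule nn_integral_mono)
    fix u :: plane
    show "(\<integral>\<^sup>+s. ennreal (1 / s ^ 3) * indicator {0<..1} s * ennreal (G (x + u) * norm u) * (if norm u < s then 1 else 0) \<partial>lborel)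
      \<le> ennreal (G (x + u) / norm u) * indicator (ball 0 1) u"
    proof (cases "u \<noteq> 0 \<and> norm u < 1")
      case True
      have "(\<integral>\<^sup>+s. ennreal (1 / s ^ 3) * indicator {0<..1} s * ennreal (G (x + u) * norm u) * (if norm u < s then 1 else 0) \<partial>lborel)
        \<le> (\<integral>\<^sup>+s. ennreal (G (x + u) * norm u) * (ennreal (real 2 / s ^ Suc 2) * indicator {norm u..} s) \<partial>lborel)"
      proof (rule nn_integral_mono)
        fix s :: real
        \<comment> \<open>The factor 2 is given away to obtain the integrand of
          \<open>nn_integral_power_tail\<close> for p = 2, whose integral over s \<ge> |u| is
          1/|u|^2.\<close>
        have "ennreal (1 / s ^ 3) \<le> ennreal (2 / s ^ 3)" if "s > 0" using that by (intro ennreal_leI divide_right_mono) auto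
        then show "ennreal (1 / s ^ 3) * indicator {0<..1} s * ennreal (G (x + u) * norm u) * (if norm u < s then 1 else 0)
          \<le> ennreal (G (x + u) * norm u) * (ennreal (real 2 / s ^ Suc 2) * indicator {norm u..} s)"
          using True by (auto simp: indicator_def mult.commute numeral_3_eq_3[symmetric] power_Suc[symmetric] simp del: power_Suc intro!: mult_left_mono)
      qed
      also have "\<dots> = ennreal (G (x + u) * norm u) * ennreal (1 / norm u ^ 2)"
        using nn_integral_power_tail[of "norm u" 2] True by (subst nn_integral_cmult) auto
      also have "\<dots> = ennreal (G (x + u) / norm u) * indicator (ball 0 1) u"
        using True by (simp add: ennreal_mult[symmetric] G_def power2_eq_square)
      finally show ?thesis .
    next
      case False
      then have "(\<integral>\<^sup>+s. ennreal (1 / s ^ 3) * indicator {0<..1} s * ennreal (G (x + u) * norm u) * (if norm u < s then 1 else 0) \<partial>lborel) = (\<integral>\<^sup>+s. 0 \<partial>(lborel :: real measure))"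
        by (intro nn_integral_cong) (auto simp: indicator_def)
      then show ?thesis by simp
    qed
  qed
  finally show ?thesis unfolding G_def by (simp add: add_left_mono)
qed

lemma ennreal_power2_leD:
  fixes x :: ennreal assumes "x\<^sup>2 \<le> ennreal a * ennreal b" "0 \<le> a" "0 \<le> b"
  shows "x \<le> ennreal (sqrt a * sqrt b)"
proof (cases x)
  case (real r)
  then have "ennreal (r\<^sup>2) \<le> ennreal (a * b)" using assms by (simp add: ennreal_power ennreal_mult)
  then have "r\<^sup>2 \<le> a * b" using assms by simp
  then have "r \<le> sqrt (a * b)" by (simp add: real_le_rsqrt)
  then show ?thesis using real by (simp add: real_sqrt_mult ennreal_leI)
next
  case top then show ?thesis using assms by (simp add: ennreal_mult[symmetric] top_unique power2_eq_square ennreal_top_mult)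
qed

lemma C_c_square_integrable:
  assumes "\<phi> \<in> C_c" shows "integrable lborel (\<lambda>x::'a::euclidean_space. (\<phi> x)\<^sup>2)"
proof -
  obtain R where R: "R > 0" "\<And>x. norm x > R \<Longrightarrow> \<phi> x = 0"
    using assms compact_supportD[of \<phi>] by (auto simp: C_c_def)
  have "continuous_on (cball 0 R) (\<lambda>x. (\<phi> x)\<^sup>2)" using assms
    by (auto simp: C_c_def intro!: continuous_intros intro: continuous_on_subset)
  then have "integrable lborel (\<lambda>x. indicator (cball 0 R) x *\<^sub>R (\<phi> x)\<^sup>2)"
    by (intro borel_integrable_compact) auto
  moreover have "(\<lambda>x. indicator (cball 0 R) x *\<^sub>R (\<phi> x)\<^sup>2) = (\<lambda>x. (\<phi> x)\<^sup>2)"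
    using R(2) by (force simp: indicator_def)
  ultimately show ?thesis by simp
qed

lemma H1_norm_components:
  fixes \<phi> :: "plane \<Rightarrow> real"
  assumes "\<phi> \<in> C_c_inf"
  shows "(\<integral>\<^sup>+x. ennreal ((\<phi> x)\<^sup>2) \<partial>lborel) \<le> ennreal ((H1_norm \<phi>)\<^sup>2)"
    "(\<integral>\<^sup>+x. ennreal ((norm (grad \<phi> x))\<^sup>2) \<partial>lborel) \<le> ennreal ((H1_norm \<phi>)\<^sup>2)"
proof -
  have i1: "integrable lborel (\<lambda>x. (\<phi> x)\<^sup>2)" by (rule C_c_square_integrable[OF C_c_inf_subset_C_c[OF assms]])
  have eq: "(norm (grad \<phi> x))\<^sup>2 = (\<Sum>i\<in>UNIV. (dirderiv \<phi> x (axis i 1))\<^sup>2)" for x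
    unfolding power2_norm_eq_inner by (simp add: inner_vec_def grad_def power2_eq_square)
  have i2: "integrable lborel (\<lambda>x. (norm (grad \<phi> x))\<^sup>2)"
    unfolding eq by (intro Bochner_Integration.integrable_sum C_c_square_integrable C_c_inf_subset_C_c dirderiv_C_c_inf assms)
  have "(H1_norm \<phi>)\<^sup>2 = (\<integral>x. (\<phi> x)\<^sup>2 \<partial>lborel) + (\<integral>x. (norm (grad \<phi> x))\<^sup>2 \<partial>lborel)"
    by (simp add: H1_norm_def)
  then show "(\<integral>\<^sup>+x. ennreal ((\<phi> x)\<^sup>2) \<partial>lborel) \<le> ennreal ((H1_norm \<phi>)\<^sup>2)"
    "(\<integral>\<^sup>+x. ennreal ((norm (grad \<phi> x))\<^sup>2) \<partial>lborel) \<le> ennreal ((H1_norm \<phi>)\<^sup>2)"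
    by (simp_all add: nn_integral_eq_integral i1 i2 ennreal_leI)
qed

text \<open>
  Integrate the pointwise bound against \<open>N\<close>; by Cauchy-Schwarz the gradient term is at most
  \<open>\<parallel>\<nabla>\<phi>\<parallel>\<^sub>2\<close> times the \<open>L\<^sup>2\<close> norm of \<open>\<integral> 1/|x - z| dN(x)\<close>, whose square is a double integral of the
  logarithm by the estimate for two poles.
\<close>

lemma H1_duality:
  fixes N :: "plane measure"
  assumes fin: "finite_measure N" and sets: "sets N = sets borel"
    and atom: "\<And>x. emeasure N {x} = 0"
    and J: "(\<integral>\<^sup>+x. \<integral>\<^sup>+y. ennreal (1 + lnm (norm (x - y))) \<partial>N \<partial>N) \<le> ennreal j" and j: "0 \<le> j"
    and \<phi>: "\<phi> \<in> C_c_inf"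
  shows "\<bar>\<integral>x. \<phi> x \<partial>N\<bar> \<le> 4 * sqrt j * H1_norm \<phi>"
proof -
  have s: "smooth \<phi>" using \<phi> by (simp add: C_c_inf_smooth)
  have [measurable_cong, simp]: "sets N = sets borel" by (rule sets)
  have sf: "sigma_finite_measure N" using fin by (rule finite_measure.axioms)
  interpret N: finite_measure N by (rule fin)
  define G where "G y = norm (grad \<phi> y)" for y
  have [measurable]: "G \<in> borel_measurable borel" "\<phi> \<in> borel_measurable borel"
    unfolding G_def[abs_def]
    by (intro borel_measurable_continuous_onI continuous_on_norm continuous_on_grad smooth_continuous_on s)+
  define k where "k = (\<lambda>x y::plane. if norm (y - x) < 1 then 1 else (0::real))"
  have k_ind: "indicator (ball x 1) y = k x y" for x y
    by (simp add: k_def indicator_def dist_norm norm_minus_commute)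
  have k_ind0: "indicator (ball 0 1) (y - x) = ennreal (k x y)" for x y
    by (simp add: k_def indicator_def)
  have [measurable]: "(\<lambda>(x, y). k x y) \<in> borel_measurable (borel \<Otimes>\<^sub>M borel)"
    unfolding k_def by measurable
  have k01: "0 \<le> k x y" "k x y \<le> 1" for x y by (auto simp: k_def)
  define a where "a y = (\<integral>\<^sup>+x. ennreal (k x y) \<partial>N)" for y
  define b where "b y = (\<integral>\<^sup>+x. ennreal (k x y / norm (y - x)) \<partial>N)" for y
  have [measurable]: "a \<in> borel_measurable borel" "b \<in> borel_measurable borel"
    unfolding a_def[abs_def] b_def[abs_def] by (intro sigma_finite_measure.borel_measurable_nn_integral[OF sf]; measurable)+
  have one: "(\<integral>\<^sup>+x. \<integral>\<^sup>+y. 1 \<partial>N \<partial>N) \<le> ennreal j"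
    using lnm_nonneg by (intro order_trans[OF _ J] nn_integral_mono) simp
  \<comment> \<open>The value \<open>a y\<close> is the mass of the unit ball around y: it is at
    most the total mass, and its integral is pi times the total mass. The square of the total mass
    is at most j because the logarithmic integrand is at least 1.\<close>
  have A2: "(\<integral>\<^sup>+y. (a y)\<^sup>2 \<partial>lborel) \<le> ennreal (pi * j)"
  proof -
    have "(a y)\<^sup>2 \<le> emeasure N UNIV * a y" for y
    proof -
      have "a y \<le> (\<integral>\<^sup>+x. 1 \<partial>N)" unfolding a_def using k01 by (intro nn_integral_mono) simp
      also have "\<dots> = emeasure N UNIV" by simp (metis sets sets_eq_imp_space_eq space_borel)
      finally show ?thesis by (simp add: power2_eq_square mult_right_mono)
    qed
    then have "(\<integral>\<^sup>+y. (a y)\<^sup>2 \<partial>lborel) \<le> (\<integral>\<^sup>+y. emeasure N UNIV * a y \<partial>lborel)" by (intro nn_integral_mono)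
    also have "\<dots> = emeasure N UNIV * (\<integral>\<^sup>+y. a y \<partial>lborel)" by (simp add: nn_integral_cmult)
    also have "(\<integral>\<^sup>+y. a y \<partial>lborel) = (\<integral>\<^sup>+x. \<integral>\<^sup>+y. ennreal (k x y) \<partial>lborel \<partial>N)"
      unfolding a_def by (rule nn_integral_swap[OF sigma_finite_lborel sf]) measurable
    also have "\<dots> = (\<integral>\<^sup>+x. ennreal pi \<partial>N)"
    proof (rule nn_integral_cong)
      fix x
      have "(\<integral>\<^sup>+y. ennreal (k x y) \<partial>lborel) = (\<integral>\<^sup>+y. indicator (ball x 1) y \<partial>lborel)"
        by (intro nn_integral_cong) (simp add: k_def indicator_def dist_norm norm_minus_commute)
      then show "(\<integral>\<^sup>+y. ennreal (k x y) \<partial>lborel) = ennreal pi" by (simp add: emeasure_plane_ball)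
    qed
    also have "emeasure N UNIV * (\<integral>\<^sup>+x. ennreal pi \<partial>N) = ennreal pi * (\<integral>\<^sup>+x. \<integral>\<^sup>+y. 1 \<partial>N \<partial>N)"
      using sets_eq_imp_space_eq[OF sets] by (simp add: mult_ac)
    also have "\<dots> \<le> ennreal pi * ennreal j" by (intro mult_left_mono one) auto
    finally show ?thesis using j by (simp add: ennreal_mult)
  qed
  have B2: "(\<integral>\<^sup>+y. (b y)\<^sup>2 \<partial>lborel) \<le> ennreal (14 * pi * j)"
  proof -
    have "(\<integral>\<^sup>+y. (b y)\<^sup>2 \<partial>lborel) = (\<integral>\<^sup>+y. \<integral>\<^sup>+x. \<integral>\<^sup>+x'. ennreal (k x y / norm (y - x)) * ennreal (k x' y / norm (y - x')) \<partial>N \<partial>N \<partial>lborel)"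
      by (simp add: b_def power2_eq_square nn_integral_cmult nn_integral_multc)
    also have "\<dots> = (\<integral>\<^sup>+x. \<integral>\<^sup>+y. \<integral>\<^sup>+x'. ennreal (k x y / norm (y - x)) * ennreal (k x' y / norm (y - x')) \<partial>N \<partial>lborel \<partial>N)"
      by (rule nn_integral_swap[OF sigma_finite_lborel sf]) (measurable)
    also have "\<dots> = (\<integral>\<^sup>+x. \<integral>\<^sup>+x'. \<integral>\<^sup>+y. ennreal (k x y / norm (y - x)) * ennreal (k x' y / norm (y - x')) \<partial>lborel \<partial>N \<partial>N)"
      by (intro nn_integral_cong nn_integral_swap[OF sigma_finite_lborel sf]) (measurable)
    also have "\<dots> \<le> (\<integral>\<^sup>+x. \<integral>\<^sup>+x'. ennreal (14 * pi) * ennreal (1 + lnm (norm (x - x'))) \<partial>N \<partial>N)"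
    proof (rule nn_integral_mono, rule nn_integral_mono_AE)
      fix x
      \<comment> \<open>The two-pole estimate fails for coinciding poles, where the integral
        diverges; this is the place where atoms have to be absent.\<close>
      have "AE x' in N. x' \<noteq> x" using atom[of x] by (intro AE_I[where N="{x}"]) auto
      then show "AE x' in N. (\<integral>\<^sup>+y. ennreal (k x y / norm (y - x)) * ennreal (k x' y / norm (y - x')) \<partial>lborel)
         \<le> ennreal (14 * pi) * ennreal (1 + lnm (norm (x - x')))"
      proof eventually_elim
        fix x' assume "x' \<noteq> x"
        then have "(\<integral>\<^sup>+y. ennreal (indicator (ball x 1) y / norm (y - x) * (indicator (ball x' 1) y / norm (y - x'))) \<partial>lborel)
          \<le> ennreal (14 * pi * (1 + lnm (norm (x - x'))))" by (intro nn_integral_two_poles) auto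
        then show "(\<integral>\<^sup>+y. ennreal (k x y / norm (y - x)) * ennreal (k x' y / norm (y - x')) \<partial>lborel)
         \<le> ennreal (14 * pi) * ennreal (1 + lnm (norm (x - x')))"
          using lnm_nonneg k01 by (simp add: k_ind ennreal_mult[symmetric] del: ennreal_plus)
      qed
    qed
    also have "\<dots> = ennreal (14 * pi) * (\<integral>\<^sup>+x. \<integral>\<^sup>+x'. ennreal (1 + lnm (norm (x - x'))) \<partial>N \<partial>N)"
      by (simp add: nn_integral_cmult)
    also have "\<dots> \<le> ennreal (14 * pi) * ennreal j" by (intro mult_left_mono J) auto
    finally show ?thesis using j by (simp add: ennreal_mult)
  qed
  have "ennreal pi * (\<integral>\<^sup>+x. ennreal \<bar>\<phi> x\<bar> \<partial>N) = (\<integral>\<^sup>+x. ennreal (pi * \<bar>\<phi> x\<bar>) \<partial>N)"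
    by (simp add: nn_integral_cmult[symmetric] ennreal_mult)
  also have "\<dots> \<le> (\<integral>\<^sup>+x. (\<integral>\<^sup>+y. ennreal \<bar>\<phi> y\<bar> * ennreal (k x y) \<partial>lborel) + (\<integral>\<^sup>+y. ennreal (G y) * ennreal (k x y / norm (y - x)) \<partial>lborel) \<partial>N)"
  proof (rule nn_integral_mono)
    fix x
    have m1: "(\<lambda>y. ennreal \<bar>\<phi> (x + y)\<bar> * indicator (ball 0 1) y) \<in> borel_measurable borel"
      "(\<lambda>y. ennreal (norm (grad \<phi> (x + y)) / norm y) * indicator (ball 0 1) y) \<in> borel_measurable borel"
      unfolding G_def[symmetric] by (auto intro!: borel_measurable_times_ennreal borel_measurable_indicator)
    have "ennreal (pi * \<bar>\<phi> x\<bar>) \<le> (\<integral>\<^sup>+z. ennreal \<bar>\<phi> (x + z)\<bar> * indicator (ball 0 1) z \<partial>lborel)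
      + (\<integral>\<^sup>+z. ennreal (norm (grad \<phi> (x + z)) / norm z) * indicator (ball 0 1) z \<partial>lborel)"
      by (rule pointwise_bound[OF s])
    also have "\<dots> = (\<integral>\<^sup>+z. ennreal \<bar>\<phi> (x + (z - x))\<bar> * indicator (ball 0 1) (z - x) \<partial>lborel)
      + (\<integral>\<^sup>+z. ennreal (norm (grad \<phi> (x + (z - x))) / norm (z - x)) * indicator (ball 0 1) (z - x) \<partial>lborel)"
      by (simp only: nn_integral_minus_translation[OF m1(1), of x] nn_integral_minus_translation[OF m1(2), of x])
    also have "\<dots> = (\<integral>\<^sup>+y. ennreal \<bar>\<phi> y\<bar> * ennreal (k x y) \<partial>lborel) + (\<integral>\<^sup>+y. ennreal (G y) * ennreal (k x y / norm (y - x)) \<partial>lborel)"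
      using k01 by (intro arg_cong2[where f="(+)"] nn_integral_cong) (auto simp: k_ind0 G_def ennreal_mult[symmetric])
    finally show "ennreal (pi * \<bar>\<phi> x\<bar>) \<le> \<dots>" .
  qed
  also have "\<dots> = (\<integral>\<^sup>+x. \<integral>\<^sup>+y. ennreal \<bar>\<phi> y\<bar> * ennreal (k x y) \<partial>lborel \<partial>N) + (\<integral>\<^sup>+x. \<integral>\<^sup>+y. ennreal (G y) * ennreal (k x y / norm (y - x)) \<partial>lborel \<partial>N)"
    by (intro nn_integral_add) measurable
  also have "(\<integral>\<^sup>+x. \<integral>\<^sup>+y. ennreal \<bar>\<phi> y\<bar> * ennreal (k x y) \<partial>lborel \<partial>N) = (\<integral>\<^sup>+y. \<integral>\<^sup>+x. ennreal \<bar>\<phi> y\<bar> * ennreal (k x y) \<partial>N \<partial>lborel)"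
    by (rule nn_integral_swap[OF sf sigma_finite_lborel]) measurable
  also have "\<dots> = (\<integral>\<^sup>+y. ennreal \<bar>\<phi> y\<bar> * a y \<partial>lborel)" by (simp add: a_def nn_integral_cmult)
  also have "(\<integral>\<^sup>+x. \<integral>\<^sup>+y. ennreal (G y) * ennreal (k x y / norm (y - x)) \<partial>lborel \<partial>N) = (\<integral>\<^sup>+y. \<integral>\<^sup>+x. ennreal (G y) * ennreal (k x y / norm (y - x)) \<partial>N \<partial>lborel)"
    by (rule nn_integral_swap[OF sf sigma_finite_lborel]) measurable
  also have "\<dots> = (\<integral>\<^sup>+y. ennreal (G y) * b y \<partial>lborel)" by (simp add: b_def nn_integral_cmult)
  also have "(\<integral>\<^sup>+y. ennreal \<bar>\<phi> y\<bar> * a y \<partial>lborel) \<le> ennreal (sqrt ((H1_norm \<phi>)\<^sup>2) * sqrt (pi * j))"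
  proof (rule ennreal_power2_leD)
    have "(\<integral>\<^sup>+y. ennreal \<bar>\<phi> y\<bar> * a y \<partial>lborel)\<^sup>2 \<le> (\<integral>\<^sup>+y. (ennreal \<bar>\<phi> y\<bar>)\<^sup>2 \<partial>lborel) * (\<integral>\<^sup>+y. (a y)\<^sup>2 \<partial>lborel)"
      by (rule Cauchy_Schwarz_nn_integral) measurable
    also have "\<dots> \<le> ennreal ((H1_norm \<phi>)\<^sup>2) * ennreal (pi * j)"
      using H1_norm_components(1)[OF \<phi>] by (intro mult_mono A2) (auto simp: ennreal_power)
    finally show "(\<integral>\<^sup>+y. ennreal \<bar>\<phi> y\<bar> * a y \<partial>lborel)\<^sup>2 \<le> ennreal ((H1_norm \<phi>)\<^sup>2) * ennreal (pi * j)" .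
  qed (use j in auto)
  also have "(\<integral>\<^sup>+y. ennreal (G y) * b y \<partial>lborel) \<le> ennreal (sqrt ((H1_norm \<phi>)\<^sup>2) * sqrt (14 * pi * j))"
  proof (rule ennreal_power2_leD)
    have "(\<integral>\<^sup>+y. ennreal (G y) * b y \<partial>lborel)\<^sup>2 \<le> (\<integral>\<^sup>+y. (ennreal (G y))\<^sup>2 \<partial>lborel) * (\<integral>\<^sup>+y. (b y)\<^sup>2 \<partial>lborel)"
      by (rule Cauchy_Schwarz_nn_integral) measurable
    also have "\<dots> \<le> ennreal ((H1_norm \<phi>)\<^sup>2) * ennreal (14 * pi * j)"
      using H1_norm_components(2)[OF \<phi>] by (intro mult_mono B2) (auto simp: ennreal_power G_def)
    finally show "(\<integral>\<^sup>+y. ennreal (G y) * b y \<partial>lborel)\<^sup>2 \<le> ennreal ((H1_norm \<phi>)\<^sup>2) * ennreal (14 * pi * j)" .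
  qed (use j in auto)
  finally have main: "ennreal pi * (\<integral>\<^sup>+x. ennreal \<bar>\<phi> x\<bar> \<partial>N) \<le> ennreal (H1_norm \<phi> * sqrt (pi * j)) + ennreal (H1_norm \<phi> * sqrt (14 * pi * j))"
    by (simp add: add_left_mono add_right_mono H1_norm_def)
  obtain B where B: "\<And>x. \<bar>\<phi> x\<bar> \<le> B" using C_c_bounded[OF C_c_inf_subset_C_c[OF \<phi>]] by metis
  have int: "integrable N \<phi>" by (rule N.integrable_const_bound[of _ B]) (use B in auto)
  have H0: "0 \<le> H1_norm \<phi>" by (simp add: H1_norm_def)
  have "ennreal (pi * (\<integral>x. \<bar>\<phi> x\<bar> \<partial>N)) \<le> ennreal (H1_norm \<phi> * sqrt (pi * j) + H1_norm \<phi> * sqrt (14 * pi * j))"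
    using main int H0 j by (simp add: nn_integral_eq_integral ennreal_mult)
  then have "pi * (\<integral>x. \<bar>\<phi> x\<bar> \<partial>N) \<le> H1_norm \<phi> * sqrt (pi * j) + H1_norm \<phi> * sqrt (14 * pi * j)"
    using H0 j by (subst (asm) ennreal_le_iff) auto
  \<comment> \<open>From pi > 3: pi \<le> pi^2 and 14 pi \<le> (3 pi)^2. A factor pi cancels
    afterwards, and 1 + 3 is the constant 4 of the claim.\<close>
  also have "\<dots> \<le> H1_norm \<phi> * (pi * sqrt j) + H1_norm \<phi> * (3 * pi * sqrt j)"
  proof (intro add_mono mult_left_mono H0)
    have p: "1 \<le> pi" "3 \<le> pi" using pi_gt3 by auto
    have "sqrt (pi * j) \<le> sqrt (pi\<^sup>2 * j)"
      using p j by (intro real_sqrt_le_mono mult_right_mono) (auto simp: power2_eq_square)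
    then show "sqrt (pi * j) \<le> pi * sqrt j" by (simp add: real_sqrt_mult)
    have "14 * pi \<le> 9 * (pi * pi)" using p by (simp add: mult_left_mono)
    then have "sqrt (14 * pi * j) \<le> sqrt ((3 * pi)\<^sup>2 * j)"
      using j by (intro real_sqrt_le_mono mult_right_mono) (auto simp: power2_eq_square)
    then show "sqrt (14 * pi * j) \<le> 3 * pi * sqrt j" by (simp add: real_sqrt_mult)
  qed
  finally have "pi * (\<integral>x. \<bar>\<phi> x\<bar> \<partial>N) \<le> pi * (4 * sqrt j * H1_norm \<phi>)" by (simp add: algebra_simps)
  then have "(\<integral>x. \<bar>\<phi> x\<bar> \<partial>N) \<le> 4 * sqrt j * H1_norm \<phi>" by simp
  then show ?thesis using integral_abs_bound[of N \<phi>] by linarith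
qed

subsection \<open>Compactness of bounded measures in the plane\<close>

text \<open>
  Interleaving the binary digits of the two fractional parts, and writing the resulting digits
  0, ..., 3 in base 8, gives a Borel injection of the plane into the line. The gaps left by the
  unused digits make its inverse uniformly continuous on the range, so that Helly's theorem on the
  line can be transported to the plane.
\<close>

definition digit :: "nat \<Rightarrow> plane \<Rightarrow> int" where
  "digit k p = \<lfloor>2 ^ Suc k * p $ 1\<rfloor> mod 2 + 2 * (\<lfloor>2 ^ Suc k * p $ 2\<rfloor> mod 2)"

text \<open>The order in which the unit squares are enumerated does not matter: what counts is that
  the enumeration is injective and that a bounded set meets finitely many squares.\<close>

definition cell :: "plane \<Rightarrow> nat" where
  "cell p = to_nat (\<lfloor>p $ 1\<rfloor>, \<lfloor>p $ 2\<rfloor>)"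

definition digit_tail :: "nat \<Rightarrow> plane \<Rightarrow> real" where
  "digit_tail m p = (\<Sum>k. of_int (digit (k + m) p) / 8 ^ Suc k)"

definition code :: "plane \<Rightarrow> real" where
  "code p = real (cell p) + digit_tail 0 p"

lemma digit_bounds: "0 \<le> digit k p" "digit k p \<le> 3"
proof -
  have "0 \<le> a mod 2" "a mod 2 \<le> 1" for a :: int by presburger+
  then show "0 \<le> digit k p" "digit k p \<le> 3" unfolding digit_def by (smt (verit))+
qed

lemma digit_tail_sums: "(\<lambda>k. 3 / 8 ^ Suc k :: real) sums (3 / 7)"
proof -
  have "(\<lambda>k. 3 / 8 * (1 / 8 :: real) ^ k) sums (3 / 8 * (1 / (1 - 1 / 8)))"
    by (intro sums_mult geometric_sums) auto
  then show ?thesis by (simp add: power_one_over)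
qed

lemma digit_term_bounds: "0 \<le> of_int (digit k p) / (8::real) ^ j" "of_int (digit k p) / (8::real) ^ j \<le> 3 / 8 ^ j"
  using digit_bounds[of k p] by (auto intro!: divide_right_mono)

lemma digit_tail_summable: "summable (\<lambda>k. of_int (digit (k + m) p) / (8::real) ^ Suc k)"
  by (rule summable_comparison_test'[OF sums_summable[OF digit_tail_sums], of 0])
     (simp only: real_norm_def abs_of_nonneg[OF digit_term_bounds(1)] digit_term_bounds(2))

lemma digit_tail_bounds: "0 \<le> digit_tail m p" "digit_tail m p \<le> 3 / 7"
proof -
  show "0 \<le> digit_tail m p" unfolding digit_tail_def
    by (rule suminf_nonneg[OF digit_tail_summable digit_term_bounds(1)])
  show "digit_tail m p \<le> 3 / 7" unfolding digit_tail_def sums_unique[OF digit_tail_sums]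
    by (rule suminf_le[OF digit_term_bounds(2) digit_tail_summable sums_summable[OF digit_tail_sums]])
qed

lemma digit_tail_step: "digit_tail m p = (of_int (digit m p) + digit_tail (Suc m) p) / 8"
proof -
  have "digit_tail m p = of_int (digit m p) / 8 + (\<Sum>k. of_int (digit (Suc k + m) p) / 8 ^ Suc (Suc k))"
    unfolding digit_tail_def using suminf_split_head[OF digit_tail_summable[of m p]] by simp
  also have "(\<Sum>k. of_int (digit (Suc k + m) p) / (8::real) ^ Suc (Suc k)) = (\<Sum>k. of_int (digit (k + Suc m) p) / 8 ^ Suc k / 8)"
    by (intro suminf_cong) simp
  also have "\<dots> = digit_tail (Suc m) p / 8"
    unfolding digit_tail_def by (rule suminf_divide[OF digit_tail_summable])
  finally show ?thesis by (simp add: add_divide_distrib)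
qed

text \<open>Digits are at most 3, so a tail is at most 3/7. A difference of at least 1 in the
  leading digit leaves a gap of at least 1 - 3/7 = 4/7 before the division by 8; below this gap the
  leading digits coincide and the comparison descends to the next tail.\<close>

lemma digits_agree:
  "\<bar>digit_tail m p - digit_tail m q\<bar> < 4 / 7 / 8 ^ n \<Longrightarrow> k < n \<Longrightarrow> digit (m + k) p = digit (m + k) q"
proof (induction n arbitrary: m k)
  case (Suc n)
  define D where "D = digit m p - digit m q"
  define T where "T = digit_tail (Suc m) p - digit_tail (Suc m) q"
  have "digit_tail m p - digit_tail m q = (of_int D + T) / 8"
    unfolding digit_tail_step[of m] D_def T_def by (simp add: diff_divide_distrib add_divide_distrib)
  then have "of_int D + T = 8 * (digit_tail m p - digit_tail m q)" by simp
  then have "\<bar>of_int D + T\<bar> = 8 * \<bar>digit_tail m p - digit_tail m q\<bar>" by (simp only: abs_mult)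
  also have "\<dots> < 8 * (4 / 7 / 8 ^ Suc n)" using Suc.prems(1) by simp
  finally have DT: "\<bar>of_int D + T\<bar> < 4 / 7 / 8 ^ n" by simp
  have "4 / 7 / 8 ^ n \<le> (4 / 7 :: real)" by (simp add: divide_le_eq)
  moreover have "\<bar>T\<bar> \<le> 3 / 7" unfolding T_def using digit_tail_bounds[of "Suc m" p] digit_tail_bounds[of "Suc m" q] by linarith
  ultimately have "\<bar>of_int D :: real\<bar> < 1" using DT by linarith
  then have D: "D = 0" by linarith
  then have "\<bar>T\<bar> < 4 / 7 / 8 ^ n" using DT by simp
  then have IH: "j < n \<Longrightarrow> digit (Suc m + j) p = digit (Suc m + j) q" for j
    using Suc.IH[of "Suc m" j] by (simp add: T_def)
  show ?case
  proof (cases k)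
    case 0 then show ?thesis using D by (simp add: D_def)
  next
    case (Suc j) then show ?thesis using IH[of j] Suc.prems by simp
  qed
qed simp

lemma digit_eqD: 
  assumes "digit k p = digit k q"
  shows "\<lfloor>2 ^ Suc k * p $ 1\<rfloor> mod 2 = \<lfloor>2 ^ Suc k * q $ 1\<rfloor> mod 2" "\<lfloor>2 ^ Suc k * p $ 2\<rfloor> mod 2 = \<lfloor>2 ^ Suc k * q $ 2\<rfloor> mod 2"
proof -
  have "a mod 2 = c mod 2 \<and> b mod 2 = d mod 2" if "a mod 2 + 2 * (b mod 2) = c mod 2 + 2 * (d mod 2)" for a b c d :: int
    using that by presburger
  from this[OF assms[unfolded digit_def]]
  show "\<lfloor>2 ^ Suc k * p $ 1\<rfloor> mod 2 = \<lfloor>2 ^ Suc k * q $ 1\<rfloor> mod 2" "\<lfloor>2 ^ Suc k * p $ 2\<rfloor> mod 2 = \<lfloor>2 ^ Suc k * q $ 2\<rfloor> mod 2"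
    by auto
qed

lemma floor_double: "\<lfloor>2 * x\<rfloor> = 2 * \<lfloor>x :: real\<rfloor> + \<lfloor>2 * x\<rfloor> mod 2"
proof -
  have "\<lfloor>2 * x / of_int 2\<rfloor> = \<lfloor>2 * x\<rfloor> div 2" by (rule floor_divide_real_eq_div) simp
  then show ?thesis by simp
qed

text \<open>By \<open>floor_double\<close> each further binary digit determines the integer part at
  the next dyadic scale, so n common digits give a common integer part of 2^n x and 2^n y.\<close>

lemma floors_agree:
  fixes x y :: real
  assumes "\<lfloor>x\<rfloor> = \<lfloor>y\<rfloor>" "\<And>k. k < n \<Longrightarrow> \<lfloor>2 ^ Suc k * x\<rfloor> mod 2 = \<lfloor>2 ^ Suc k * y\<rfloor> mod 2"
  shows "\<bar>x - y\<bar> \<le> 1 / 2 ^ n"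
proof -
  have "\<lfloor>2 ^ n * x\<rfloor> = \<lfloor>2 ^ n * y\<rfloor>" using assms(2)
  proof (induction n)
    case (Suc n)
    then have "\<lfloor>2 ^ n * x\<rfloor> = \<lfloor>2 ^ n * y\<rfloor>" by simp
    moreover have "\<lfloor>2 * (2 ^ n * x)\<rfloor> mod 2 = \<lfloor>2 * (2 ^ n * y)\<rfloor> mod 2" using Suc.prems[of n] by (simp add: mult.assoc)
    ultimately show ?case using floor_double[of "2 ^ n * x"] floor_double[of "2 ^ n * y"] by (simp add: mult.assoc)
  qed (use assms(1) in simp)
  then have "\<bar>2 ^ n * x - 2 ^ n * y\<bar> < 1" by linarith
  then have "2 ^ n * \<bar>x - y\<bar> < 1" by (simp add: abs_mult flip: right_diff_distrib)
  then show ?thesis by (simp add: field_simps)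
qed

lemma code_close:
  assumes "\<bar>code p - code q\<bar> < 4 / 7 / 8 ^ n"
  shows "norm (p - q) \<le> 2 / 2 ^ n"
proof -
  have le: "4 / 7 / 8 ^ n \<le> (4 / 7 :: real)" by (simp add: divide_le_eq)
  \<comment> \<open>The codes differ by less than 4/7 and the tails by at most 3/7, so the integers
    \<open>cell p\<close> and \<open>cell q\<close> differ by less than 1.\<close>
  have "\<bar>real (cell p) - real (cell q)\<bar> < 1"
    using assms le digit_tail_bounds[of 0 p] digit_tail_bounds[of 0 q] unfolding code_def by linarith
  then have c: "cell p = cell q" by linarith
  then have fl: "\<lfloor>p $ 1\<rfloor> = \<lfloor>q $ 1\<rfloor>" "\<lfloor>p $ 2\<rfloor> = \<lfloor>q $ 2\<rfloor>" by (simp_all add: cell_def)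
  have "\<bar>digit_tail 0 p - digit_tail 0 q\<bar> < 4 / 7 / 8 ^ n" using assms c by (simp add: code_def)
  from digits_agree[OF this] have "digit k p = digit k q" if "k < n" for k using that by simp
  from digit_eqD[OF this] have "\<bar>p $ 1 - q $ 1\<bar> \<le> 1 / 2 ^ n" "\<bar>p $ 2 - q $ 2\<bar> \<le> 1 / 2 ^ n"
    by (auto intro!: floors_agree fl)
  then show ?thesis using norm_le_l1_cart[of "p - q"] by (simp add: sum_2)
qed

lemma inj_code: "inj code"
proof (rule injI)
  fix p q assume "code p = code q"
  then have "norm (p - q) \<le> 2 * (1 / 2) ^ n" for n using code_close[of p q n] by (simp add: power_one_over)
  moreover have "(\<lambda>n. 2 * (1 / 2 :: real) ^ n) \<longlonglongrightarrow> 2 * 0" by (intro tendsto_intros LIMSEQ_power_zero) auto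
  ultimately have "norm (p - q) \<le> 2 * 0" using LIMSEQ_le_const[of "\<lambda>n. 2 * (1 / 2) ^ n" "2 * 0" "norm (p - q)"] by blast
  then show "p = q" by simp
qed

text \<open>A weak limit of measures carried by the range of \<open>code\<close> may charge other
  points, so the inverse has to be continuous on the whole line. Being uniformly continuous on the
  range, it extends to the closure, and from there to the line by Tietze.\<close>

lemma code_left_inverse:
  obtains dec :: "real \<Rightarrow> plane" where "continuous_on UNIV dec" "\<And>p. dec (code p) = p"
proof -
  have uc: "uniformly_continuous_on (range code) (inv code)"
    unfolding uniformly_continuous_on_def
  proof (intro allI impI)
    fix e :: real assume "e > 0"
    then have "\<exists>n. (1 / 2 :: real) ^ n < e / 2" by (intro real_arch_pow_inv) simp_all
    then obtain n where n: "(1 / 2 :: real) ^ n < e / 2" ..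
    have "dist (inv code x') (inv code x) < e" if x: "x \<in> range code" "x' \<in> range code" "dist x' x < 4 / 7 / 8 ^ n" for x x'
    proof -
      obtain p q where pq: "x = code p" "x' = code q" using x by blast
      then have "norm (q - p) \<le> 2 / 2 ^ n" using x(3) by (intro code_close) (simp only: dist_real_def)
      also have "\<dots> < e" using n by (simp add: power_one_over)
      finally show ?thesis by (simp add: pq inv_f_f[OF inj_code] dist_norm)
    qed
    moreover have "0 < 4 / 7 / (8 :: real) ^ n" by simp
    ultimately show "\<exists>d>0. \<forall>x\<in>range code. \<forall>x'\<in>range code. dist x' x < d \<longrightarrow> dist (inv code x') (inv code x) < e"
      by blast
  qed
  obtain g where g: "uniformly_continuous_on (closure (range code)) g" "\<And>x. x \<in> range code \<Longrightarrow> inv code x = g x"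
    by (rule uniformly_continuous_on_extension_on_closure[OF uc]) (rule that, assumption, simp)
  obtain h where h: "continuous_on UNIV h" "\<And>x. x \<in> closure (range code) \<Longrightarrow> h x = g x"
    by (rule Tietze_unbounded[OF uniformly_continuous_imp_continuous[OF g(1)], of UNIV]) (auto intro: that)
  have "h (code p) = p" for p
    using h(2)[of "code p"] g(2)[of "code p"] closure_subset[of "range code"] by (auto simp: inv_f_f[OF inj_code])
  then show ?thesis using that h(1) by blast
qed

lemma code_measurable[measurable]: "code \<in> borel_measurable borel"
proof -
  have [measurable]: "(\<lambda>p::plane. p $ i) \<in> borel_measurable borel" for i
    by (intro borel_measurable_continuous_onI continuous_intros)
  have [measurable]: "cell \<in> borel \<rightarrow>\<^sub>M count_space UNIV"
    unfolding cell_def[abs_def] by measurable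
  have [measurable]: "digit k \<in> borel \<rightarrow>\<^sub>M count_space UNIV" for k
    unfolding digit_def[abs_def] by measurable
  show ?thesis unfolding code_def[abs_def] digit_tail_def[abs_def] by measurable
qed

text \<open>A ball meets only finitely many unit squares. Tightness in the plane thus becomes
  tightness on the line.\<close>

lemma code_bounded: "\<exists>J. \<forall>p. norm p \<le> R \<longrightarrow> code p \<le> J"
proof -
  define K where "K = \<lceil>R\<rceil>"
  have fin: "finite ((to_nat :: int \<times> int \<Rightarrow> nat) ` ({-K-1..K} \<times> {-K-1..K}))" by simp
  define J where "J = real (Max ((to_nat :: int \<times> int \<Rightarrow> nat) ` ({-K-1..K} \<times> {-K-1..K}))) + 1"
  have "code p \<le> J" if "norm p \<le> R" for p
  proof -
    have "\<bar>p $ i\<bar> \<le> R" for i using component_le_norm_cart[of p i] that by linarith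
    moreover have "R \<le> of_int K" by (simp add: K_def)
    ultimately have K: "\<bar>p $ i\<bar> \<le> of_int K" for i by (meson order_trans)
    have "- K - 1 \<le> \<lfloor>p $ i\<rfloor>" "\<lfloor>p $ i\<rfloor> \<le> K" for i
      using K[of i] by linarith+
    then have "cell p \<in> to_nat ` ({-K-1..K} \<times> {-K-1..K})" unfolding cell_def by auto
    then have "cell p \<le> Max (to_nat ` ({-K-1..K} \<times> {-K-1..K}))" using Max_ge[OF fin] by blast
    then show ?thesis using digit_tail_bounds[of 0 p] unfolding code_def J_def by linarith
  qed
  then show ?thesis by blast
qed

text \<open>Chebyshev's inequality.\<close>

lemma moment_tail:
  fixes N :: "plane measure"
  assumes "finite_measure N" "sets N = sets borel" "(\<integral>\<^sup>+x. ennreal ((norm x)\<^sup>2) \<partial>N) \<le> ennreal M" "0 \<le> M" "R > 0"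
  shows "measure N {x. norm x > R} \<le> M / R\<^sup>2"
proof -
  interpret finite_measure N by fact
  have [measurable_cong]: "sets N = sets borel" by fact
  have sp: "space N = UNIV" using sets_eq_imp_space_eq[OF assms(2)] by simp
  have S: "{x. norm x > R} \<in> sets N" using sp by measurable
  have "ennreal (R\<^sup>2) * emeasure N {x. norm x > R} = (\<integral>\<^sup>+x. ennreal (R\<^sup>2) * indicator {x. norm x > R} x \<partial>N)"
    by (rule nn_integral_cmult_indicator[OF S, symmetric])
  also have "\<dots> \<le> (\<integral>\<^sup>+x. ennreal ((norm x)\<^sup>2) \<partial>N)"
    using assms(5) by (intro nn_integral_mono) (auto simp: indicator_def intro!: ennreal_leI power_mono)
  also have "\<dots> \<le> ennreal M" by fact
  finally have "R\<^sup>2 * measure N {x. norm x > R} \<le> M"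
    using assms(4) by (simp add: emeasure_eq_measure ennreal_mult[symmetric])
  then show ?thesis using assms(5) by (simp add: field_simps)
qed

text \<open>Helly's theorem concerns probability measures, so the masses are first made to converge.
  If they tend to 0 the limit is the null measure; otherwise the normalised measures are transported
  to the line by \<open>code\<close>, are tight there by the moment bound, and their limit is
  transported back.\<close>

lemma vague_compactness:
  fixes \<nu> :: "nat \<Rightarrow> plane measure"
  assumes fin: "\<And>n. \<nu> n \<in> Mplus" and mass: "\<And>n. measure (\<nu> n) UNIV \<le> m"
    and moment: "\<And>n. (\<integral>\<^sup>+x. ennreal ((norm x)\<^sup>2) \<partial>\<nu> n) \<le> ennreal M" and M: "0 \<le> M"
  shows "\<exists>r \<mu>. strict_mono r \<and> \<mu> \<in> Mplus \<and> (\<forall>\<phi>\<in>C_c. (\<lambda>n. \<integral>x. \<phi> x \<partial>\<nu> (r n)) \<longlonglongrightarrow> (\<integral>x. \<phi> x \<partial>\<mu>))"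
proof -
  have fm: "finite_measure (\<nu> n)" and sets[measurable_cong, simp]: "sets (\<nu> n) = sets borel" for n
    using fin[of n] by (auto simp: Mplus_def)
  have sp[simp]: "space (\<nu> n) = UNIV" for n using sets_eq_imp_space_eq[OF sets] by simp
  have em: "emeasure (\<nu> n) A = ennreal (measure (\<nu> n) A)" for n A
    using finite_measure.emeasure_eq_measure[OF fm] by blast
  define c where "c n = measure (\<nu> n) UNIV" for n
  have "seq_compact {0..m}" using compact_imp_seq_compact by blast
  then obtain cl r1 where r1: "cl \<in> {0..m}" "strict_mono r1" "(c \<circ> r1) \<longlonglongrightarrow> cl"
    unfolding seq_compact_def using mass by (metis atLeastAtMost_iff c_def measure_nonneg)
  have bound: "\<bar>\<integral>x. \<phi> x \<partial>\<nu> n\<bar> \<le> B * c n" if "\<phi> \<in> C_c" "\<And>x. \<bar>\<phi> x\<bar> \<le> B" for \<phi> B n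
  proof -
    interpret finite_measure "\<nu> n" by (rule fm)
    have [measurable]: "\<phi> \<in> borel_measurable borel"
      using that(1) by (auto simp: C_c_def intro: borel_measurable_continuous_onI)
    have "integrable (\<nu> n) \<phi>" by (rule integrable_const_bound[of _ B]) (use that in auto)
    then have "\<bar>\<integral>x. \<phi> x \<partial>\<nu> n\<bar> \<le> (\<integral>x. B \<partial>\<nu> n)"
      by (intro order_trans[OF integral_abs_bound] integral_mono integrable_abs) (use that in auto)
    then show ?thesis by (simp add: c_def mult.commute)
  qed
  show ?thesis
  proof (cases "cl = 0")
    case True
    have "(\<lambda>n. \<integral>x. \<phi> x \<partial>\<nu> (r1 n)) \<longlonglongrightarrow> (\<integral>x. \<phi> x \<partial>null_measure borel)" if \<phi>: "\<phi> \<in> C_c" for \<phi>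
    proof -
      obtain B where B: "\<And>x. \<bar>\<phi> x\<bar> \<le> B" using C_c_bounded[OF \<phi>] by metis
      have "(\<lambda>n. B * (c \<circ> r1) n) \<longlonglongrightarrow> B * cl" by (intro tendsto_intros r1)
      then have "(\<lambda>n. B * (c \<circ> r1) n) \<longlonglongrightarrow> 0" using True by simp
      moreover have "\<forall>\<^sub>F n in sequentially. norm (\<integral>x. \<phi> x \<partial>\<nu> (r1 n)) \<le> B * (c \<circ> r1) n"
        by (rule always_eventually) (simp add: bound[OF \<phi> B])
      ultimately have "(\<lambda>n. \<integral>x. \<phi> x \<partial>\<nu> (r1 n)) \<longlonglongrightarrow> 0"
        by (rule Lim_null_comparison[rotated])
      then show ?thesis by simp
    qed
    moreover have "null_measure borel \<in> (Mplus :: plane measure set)"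
      by (auto simp: Mplus_def intro!: finite_measureI)
    ultimately show ?thesis using r1(2) by blast
  next
    case False
    then have cl: "cl > 0" using r1(1) by simp
    then have "\<forall>\<^sub>F n in sequentially. cl / 2 < (c \<circ> r1) n" using order_tendstoD(1)[OF r1(3), of "cl / 2"] by simp
    then obtain n0 where n0: "\<And>n. n \<ge> n0 \<Longrightarrow> cl / 2 < c (r1 n)" by (auto simp: eventually_sequentially)
    define r2 where "r2 n = r1 (n0 + n)" for n
    have r2: "strict_mono r2" using r1(2) by (auto simp: r2_def strict_mono_def)
    have cpos: "cl / 2 < c (r2 n)" for n using n0 by (simp add: r2_def)
    have cpos': "0 < c (r2 n)" for n using cpos[of n] cl by linarith
    have clim: "(\<lambda>n. c (r2 n)) \<longlonglongrightarrow> cl"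
      using LIMSEQ_ignore_initial_segment[OF r1(3), of n0] by (simp add: r2_def o_def add.commute)
    define P where "P n = distr (density (\<nu> (r2 n)) (\<lambda>_. ennreal (1 / c (r2 n)))) borel code" for n
    have Pm: "measure (P n) A = measure (\<nu> (r2 n)) (code -` A) / c (r2 n)" if [measurable]: "A \<in> sets borel" for n A
    proof -
      have A: "code -` A \<in> sets borel" using measurable_sets[OF code_measurable that] by simp
      have "emeasure (P n) A = ennreal (1 / c (r2 n)) * emeasure (\<nu> (r2 n)) (code -` A)"
        using A by (simp add: P_def emeasure_distr emeasure_density nn_integral_cmult_indicator)
      also have "\<dots> = ennreal (measure (\<nu> (r2 n)) (code -` A) / c (r2 n))"
        using cpos'[of n] by (simp add: em ennreal_mult[symmetric])
      finally show ?thesis using cpos'[of n] by (simp add: measure_def)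
    qed
    have Prd: "real_distribution (P n)" for n
    proof -
      have "emeasure (P n) UNIV = ennreal (1 / c (r2 n)) * emeasure (\<nu> (r2 n)) UNIV"
        by (simp add: P_def emeasure_distr emeasure_density nn_integral_cmult_indicator)
      also have "\<dots> = 1" using cpos'[of n] by (simp add: em ennreal_mult[symmetric] c_def)
      finally have "prob_space (P n)" by (intro prob_spaceI) (simp add: P_def)
      then show ?thesis by (simp add: real_distribution_def real_distribution_axioms_def P_def)
    qed
    have code0: "code p \<ge> 0" for p using digit_tail_bounds[of 0 p] by (simp add: code_def)
    have "tight P" unfolding tight_def
    proof (intro conjI allI impI Prd)
      fix e :: real assume e: "e > 0"
      \<comment> \<open>The tail is at most M / (R^2 c) with c > cl/2, and R^2 \<ge> 2 (M + 1) / (cl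
        e) puts this below e. The inner + 1 yields the strict inequality, the outer one R >
        0.\<close>
      define R where "R = sqrt (2 * (M + 1) / (cl * e)) + 1"
      have R: "R > 0" by (simp add: R_def add_nonneg_pos cl e M less_imp_le)
      have R2: "2 * (M + 1) / (cl * e) \<le> R\<^sup>2"
      proof -
        have "2 * (M + 1) / (cl * e) = (sqrt (2 * (M + 1) / (cl * e)))\<^sup>2" using cl e M by simp
        also have "\<dots> \<le> R\<^sup>2" unfolding R_def by (intro power_mono) (use cl e M in auto)
        finally show ?thesis .
      qed
      obtain J where J: "\<And>p. norm p \<le> R \<Longrightarrow> code p \<le> J" using code_bounded by metis
      have "1 - e < measure (P n) {-1<..max J 0}" for n
      proof -
        interpret finite_measure "\<nu> (r2 n)" by (rule fm)
        interpret P: real_distribution "P n" by (rule Prd)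
        have "measure (P n) (- {-1<..max J 0}) = measure (\<nu> (r2 n)) (code -` (- {-1<..max J 0})) / c (r2 n)"
          by (rule Pm) auto
        also have "\<dots> \<le> measure (\<nu> (r2 n)) {x. norm x > R} / c (r2 n)"
        proof (intro divide_right_mono finite_measure_mono)
          show "code -` (- {-1<..max J 0}) \<subseteq> {x. norm x > R}"
          proof safe
            fix p assume "code p \<notin> {-1<..max J 0}"
            then have "\<not> code p \<le> J" using code0[of p] by auto
            then show "norm p > R" using J[of p] by linarith
          qed
          show "{x. norm x > R} \<in> sets (\<nu> (r2 n))" by measurable
        qed (use cpos'[of n] in auto)
        also have "\<dots> \<le> (M / R\<^sup>2) / c (r2 n)"
          using cpos'[of n] by (intro divide_right_mono moment_tail fm sets moment M R) auto
        also have "\<dots> < e"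
        proof -
          have "2 * M < 2 * (M + 1)" by simp
          also have "2 * (M + 1) \<le> R\<^sup>2 * (cl * e)" using R2 cl e by (simp add: pos_divide_le_eq)
          also have "\<dots> \<le> R\<^sup>2 * (2 * c (r2 n) * e)" using cpos[of n] e by (intro mult_left_mono mult_right_mono) auto
          finally show ?thesis using R cpos'[of n] by (simp add: field_simps)
        qed
        finally show ?thesis using P.prob_compl[of "{-1<..max J 0}"] 
          by (simp add: Compl_eq_Diff_UNIV P.space_eq_univ)
      qed
      then show "\<exists>a b. a < b \<and> (\<forall>n. 1 - e < measure (P n) {a<..b})"
        by (intro exI[of _ "-1"] exI[of _ "max J 0"]) auto
    qed
    from tight_imp_convergent_subsubsequence[OF this strict_mono_id]
    obtain r3 Q where r3: "strict_mono r3" "real_distribution Q" "weak_conv_m (P \<circ> id \<circ> r3) Q" by blast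
    interpret Q: real_distribution Q by fact
    obtain dec where dec: "continuous_on UNIV dec" "\<And>p. dec (code p) = p" using code_left_inverse by blast
    have [measurable]: "dec \<in> borel_measurable borel" by (rule borel_measurable_continuous_onI[OF dec(1)])
    \<comment> \<open>Because \<open>dec (code p) = p\<close>, integrating \<phi> against the
      normalised measures is the same as integrating \<phi> composed with \<open>dec\<close>, a
      bounded continuous function on the line, against \<open>P n\<close>.\<close>
    define \<mu> where "\<mu> = distr (density Q (\<lambda>_. ennreal cl)) borel dec"
    have "finite_measure (density Q (\<lambda>_. ennreal cl))"
      by (rule finite_measureI) (simp add: emeasure_density nn_integral_cmult_indicator Q.emeasure_eq_measure ennreal_mult[symmetric] cl less_imp_le)
    then have "\<mu> \<in> Mplus"
      unfolding \<mu>_def Mplus_def by (auto intro!: finite_measure.finite_measure_distr)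
    moreover have "(\<lambda>n. \<integral>x. \<phi> x \<partial>\<nu> (r2 (r3 n))) \<longlonglongrightarrow> (\<integral>x. \<phi> x \<partial>\<mu>)" if \<phi>: "\<phi> \<in> C_c" for \<phi>
    proof -
      obtain B where B: "\<And>x. \<bar>\<phi> x\<bar> \<le> B" using C_c_bounded[OF \<phi>] by metis
      have \<phi>c: "continuous_on UNIV \<phi>" using \<phi> by (simp add: C_c_def)
      have [measurable]: "\<phi> \<in> borel_measurable borel" by (rule borel_measurable_continuous_onI[OF \<phi>c])
      have cont: "continuous_on UNIV (\<lambda>s. \<phi> (dec s))" by (rule continuous_on_compose2[OF \<phi>c dec(1)]) auto
      have "(\<lambda>n. \<integral>s. \<phi> (dec s) \<partial>((P \<circ> id \<circ> r3) n)) \<longlonglongrightarrow> (\<integral>s. \<phi> (dec s) \<partial>Q)"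
        by (rule weak_conv_imp_integral_bdd_continuous_conv[where B=B])
           (use r3 Prd cont B in \<open>auto simp: continuous_on_eq_continuous_at o_def\<close>)
      moreover have "(\<integral>s. \<phi> (dec s) \<partial>P n) = (1 / c (r2 n)) * (\<integral>x. \<phi> x \<partial>\<nu> (r2 n))" for n
        using cpos'[of n] by (simp add: P_def integral_distr integral_density dec(2))
      ultimately have "(\<lambda>n. c (r2 (r3 n)) * ((1 / c (r2 (r3 n))) * (\<integral>x. \<phi> x \<partial>\<nu> (r2 (r3 n))))) \<longlonglongrightarrow> cl * (\<integral>s. \<phi> (dec s) \<partial>Q)"
        using LIMSEQ_subseq_LIMSEQ[OF clim r3(1)] by (intro tendsto_mult) (auto simp: o_def)
      moreover have "cl * (\<integral>s. \<phi> (dec s) \<partial>Q) = (\<integral>x. \<phi> x \<partial>\<mu>)"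
        using cl by (simp add: \<mu>_def integral_distr integral_density)
      moreover have "c (r2 (r3 n)) * ((1 / c (r2 (r3 n))) * (\<integral>x. \<phi> x \<partial>\<nu> (r2 (r3 n)))) = (\<integral>x. \<phi> x \<partial>\<nu> (r2 (r3 n)))" for n
        using cpos'[of "r3 n"] by simp
      ultimately show ?thesis by simp
    qed
    moreover have "strict_mono (r2 \<circ> r3)" using r2 r3(1) by (rule strict_mono_o)
    ultimately show ?thesis by (intro exI[of _ "r2 \<circ> r3"] exI[of _ \<mu>]) auto
  qed
qed

subsection \<open>Limits of curves of measures and of their tensor squares\<close>

lemma Mplus_simps:
  assumes "N \<in> Mplus"
  shows "finite_measure N" "sets N = sets borel" "space N = UNIV"
  using assms sets_eq_imp_space_eq[of N borel] by (auto simp: Mplus_def)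

lemma C_c_measurable: "\<phi> \<in> C_c \<Longrightarrow> \<phi> \<in> borel_measurable borel"
  by (auto simp: C_c_def intro: borel_measurable_continuous_onI)

lemma C_c_integrable:
  assumes "N \<in> Mplus" "\<phi> \<in> C_c" shows "integrable N \<phi>"
proof -
  interpret finite_measure N by (rule Mplus_simps[OF assms(1)])
  have [measurable_cong]: "sets N = sets borel" by (rule Mplus_simps[OF assms(1)])
  note [measurable] = C_c_measurable[OF assms(2)]
  obtain B where "\<And>x. \<bar>\<phi> x\<bar> \<le> B" using C_c_bounded[OF assms(2)] by metis
  then show ?thesis by (intro integrable_const_bound[of _ B]) auto
qed

lemma integral_diff_le:
  assumes "N \<in> Mplus" "measure N UNIV \<le> m" "\<phi> \<in> C_c" "\<psi> \<in> C_c" "\<And>x. \<bar>\<phi> x - \<psi> x\<bar> \<le> \<eta>"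
  shows "\<bar>(\<integral>x. \<phi> x \<partial>N) - (\<integral>x. \<psi> x \<partial>N)\<bar> \<le> \<eta> * m"
proof -
  interpret finite_measure N by (rule Mplus_simps[OF assms(1)])
  note i = C_c_integrable[OF assms(1)]
  have "0 \<le> \<eta>" using assms(5)[of 0] abs_ge_zero order_trans by blast
  have "\<bar>(\<integral>x. \<phi> x \<partial>N) - (\<integral>x. \<psi> x \<partial>N)\<bar> = \<bar>\<integral>x. \<phi> x - \<psi> x \<partial>N\<bar>"
    using i assms(3,4) by (subst Bochner_Integration.integral_diff) auto
  also have "\<dots> \<le> (\<integral>x. \<bar>\<phi> x - \<psi> x\<bar> \<partial>N)" by (rule integral_abs_bound)
  also have "\<dots> \<le> (\<integral>x. \<eta> \<partial>N)"
    using i assms by (intro integral_mono) auto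
  also have "\<dots> = \<eta> * measure N UNIV" using Mplus_simps[OF assms(1)] by simp
  also have "\<dots> \<le> \<eta> * m" using \<open>0 \<le> \<eta>\<close> assms(2) by (intro mult_left_mono)
  finally show ?thesis .
qed

text \<open>The Arzela-Ascoli argument for functions that are equicontinuous only up to an error
  \<open>\<eta> n\<close> tending to 0: convergence on a finite rational grid is enough once n is
  large.\<close>

lemma uniformly_Cauchy_from_grid:
  fixes F :: "nat \<Rightarrow> real \<Rightarrow> real"
  assumes eqc: "\<And>n s t. s \<in> {0..T} \<Longrightarrow> t \<in> {0..T} \<Longrightarrow> \<bar>F n t - F n s\<bar> \<le> C * (\<bar>t - s\<bar> + \<eta> n)"
    and C: "C \<ge> 0" and \<eta>: "\<eta> \<longlonglongrightarrow> 0" and conv: "\<And>s. s \<in> \<rat> \<Longrightarrow> s \<ge> 0 \<Longrightarrow> convergent (\<lambda>n. F n s)" and e: "e > 0"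
  shows "\<exists>n0. \<forall>n\<ge>n0. \<forall>k\<ge>n0. \<forall>t\<in>{0..T}. \<bar>F n t - F k t\<bar> < e"
proof -
  \<comment> \<open>Moving t to the grid point j / K costs less than e/8 for the distance and e/8
    for \<eta>. It is done for both indices, and the comparison at the grid point costs e/4
    more.\<close>
  obtain K :: nat where K: "K > 0" "C / K < e / 8"
  proof -
    obtain K :: nat where "8 * C / e < K" using reals_Archimedean2 by blast
    then have "C / Suc K < e / 8" using e C by (simp add: field_simps)
    then show ?thesis using that[of "Suc K"] by simp
  qed
  have "\<forall>\<^sub>F n in sequentially. \<bar>C * \<eta> n\<bar> < e / 8"
    using tendstoD[OF tendsto_mult_right_zero[OF \<eta>, of C], of "e / 8"] e by simp
  then obtain n1 where n1: "\<And>n. n \<ge> n1 \<Longrightarrow> C * \<eta> n < e / 8" unfolding eventually_sequentially by fastforce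
  define J where "J = nat \<lfloor>T * K\<rfloor>"
  have "\<exists>n0. \<forall>n\<ge>n0. \<forall>k\<ge>n0. \<bar>F n (real j / K) - F k (real j / K)\<bar> < e / 4" for j
  proof -
    have "real j / real K \<in> \<rat>" by simp
    then have "Cauchy (\<lambda>n. F n (real j / K))" using conv[of "real j / K"] convergent_Cauchy by simp
    then show ?thesis using e unfolding Cauchy_def dist_real_def by (meson zero_less_divide_iff zero_less_numeral)
  qed
  then obtain n2 where n2: "\<And>j n k. n \<ge> n2 j \<Longrightarrow> k \<ge> n2 j \<Longrightarrow> \<bar>F n (real j / K) - F k (real j / K)\<bar> < e / 4" by metis
  define n0 where "n0 = max n1 (Max (n2 ` {..J}))"
  have "\<bar>F n t - F k t\<bar> < e" if "n \<ge> n0" "k \<ge> n0" "t \<in> {0..T}" for n k t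
  proof -
    define j where "j = nat \<lfloor>t * K\<rfloor>"
    have tK: "0 \<le> t * K" "t * K \<le> T * K" using that(3) K by (auto intro: mult_right_mono)
    have "j \<le> J" unfolding j_def J_def using tK by (intro nat_mono floor_mono)
    then have "n2 j \<le> n0" unfolding n0_def by (intro max.coboundedI2 Max_ge) auto
    then have "\<bar>F n (real j / K) - F k (real j / K)\<bar> < e / 4" using n2[of j n k] that by linarith
    moreover have jt: "real j \<le> t * K" "t * K < real j + 1" unfolding j_def using tK by linarith+
    have s: "real j / K \<in> {0..T}" "\<bar>t - real j / K\<bar> \<le> 1 / K"
    proof -
      have "real j / K \<le> t" "t \<le> (real j + 1) / K"
        using jt K by (simp_all add: pos_divide_le_eq pos_le_divide_eq)
      then have "real j / K \<le> t" "t - real j / K \<le> 1 / K" by (simp_all add: add_divide_distrib)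
      then show "real j / K \<in> {0..T}" "\<bar>t - real j / K\<bar> \<le> 1 / K" using that(3) by auto
    qed
    have "\<bar>F i t - F i (real j / K)\<bar> < e / 4" if "i \<ge> n0" for i
    proof -
      have "\<bar>F i t - F i (real j / K)\<bar> \<le> C * (\<bar>t - real j / K\<bar> + \<eta> i)" using \<open>t \<in> {0..T}\<close> s by (intro eqc) auto
      also have "\<dots> \<le> C * (1 / K + \<eta> i)" using s C by (intro mult_left_mono add_right_mono) auto
      also have "\<dots> = C / K + C * \<eta> i" by (simp add: distrib_left)
      also have "\<dots> < e / 4"
      proof -
        have "n1 \<le> i" using that by (simp add: n0_def)
        then show ?thesis using K(2) n1[of i] by linarith
      qed
      finally show ?thesis .
    qed
    from this[of n] this[of k] that(1,2) calculation show ?thesis by linarith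
  qed
  then show ?thesis by blast
qed

text \<open>A diagonal subsequence converges at all rational times. The constants of
  \<open>eqc\<close> do not depend on n, so the integrals of a smooth test function are uniformly
  Cauchy on [0, T]; density and the mass bound extend this to \<open>C_c\<close>.\<close>

lemma extraction:
  fixes N :: "nat \<Rightarrow> real \<Rightarrow> plane measure"
  assumes Mp: "\<And>n t. t \<ge> 0 \<Longrightarrow> N n t \<in> Mplus"
    and mass: "\<And>n t. t \<ge> 0 \<Longrightarrow> measure (N n t) UNIV \<le> m"
    and moment: "\<And>n t. t \<ge> 0 \<Longrightarrow> (\<integral>\<^sup>+x. ennreal ((norm x)\<^sup>2) \<partial>N n t) \<le> ennreal M" and M: "0 \<le> M"
    and eqc: "\<And>\<phi> T. \<phi> \<in> C_c_inf \<Longrightarrow> T \<ge> 0 \<Longrightarrow> \<exists>C\<ge>0. \<forall>n. \<forall>s\<in>{0..T}. \<forall>t\<in>{0..T}.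
        \<bar>(\<integral>x. \<phi> x \<partial>N n t) - (\<integral>x. \<phi> x \<partial>N n s)\<bar> \<le> C * (\<bar>t - s\<bar> + \<eta> n)"
    and \<eta>: "\<eta> \<longlonglongrightarrow> 0"
  obtains r \<mu> where "strict_mono r" "\<And>t. t \<ge> 0 \<Longrightarrow> \<mu> t \<in> Mplus"
    "\<And>\<phi> T. \<phi> \<in> C_c \<Longrightarrow> T \<ge> 0 \<Longrightarrow> uniform_limit {0..T} (\<lambda>n t. \<integral>x. \<phi> x \<partial>N (r n) t) (\<lambda>t. \<integral>x. \<phi> x \<partial>\<mu> t) sequentially"
proof -
  \<comment> \<open>The absolute value makes every enumerated time admissible and still reaches each
    nonnegative rational.\<close>
  define q :: "nat \<Rightarrow> real" where "q k = \<bar>of_rat (from_nat k)\<bar>" for k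
  have q0: "q k \<ge> 0" for k by (simp add: q_def)
  define P where "P k s = (\<forall>\<phi>\<in>C_c. convergent (\<lambda>n. \<integral>x. \<phi> x \<partial>N (s n) (q k)))" for k and s :: "nat \<Rightarrow> nat"
  interpret subseqs P
  proof
    fix k and s :: "nat \<Rightarrow> nat"
    obtain r' \<mu> where "strict_mono r'" "\<forall>\<phi>\<in>C_c. (\<lambda>n. \<integral>x. \<phi> x \<partial>N (s (r' n)) (q k)) \<longlonglongrightarrow> (\<integral>x. \<phi> x \<partial>\<mu>)"
      using vague_compactness[of "\<lambda>n. N (s n) (q k)" m M] Mp mass moment M q0 by blast
    then show "\<exists>r'. strict_mono r' \<and> P k (s \<circ> r')" unfolding P_def convergent_def by auto
  qed
  define r where "r = diagseq"
  have r: "strict_mono r" unfolding r_def by (rule subseq_diagseq)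
  have "P k (diagseq \<circ> ((+) (Suc k)))" for k
  proof (rule diagseq_holds)
    fix r s :: "nat \<Rightarrow> nat" and n assume "strict_mono r" "P n s"
    then show "P n (s \<circ> r)" unfolding P_def by (auto intro: convergent_subseq_convergent[unfolded o_def])
  qed
  then have "convergent (\<lambda>n. \<integral>x. \<phi> x \<partial>N ((r \<circ> ((+) (Suc k))) n) (q k))" if "\<phi> \<in> C_c" for k \<phi>
    using that P_def r_def by blast
  then have conv: "convergent (\<lambda>n. \<integral>x. \<phi> x \<partial>N (r n) (q k))" if "\<phi> \<in> C_c" for k \<phi>
    using that convergent_ignore_initial_segment[of "\<lambda>n. \<integral>x. \<phi> x \<partial>N (r n) (q k)" "Suc k"]
    by (simp add: o_def add.commute[of _ k])
  have conv': "convergent (\<lambda>n. \<integral>x. \<phi> x \<partial>N (r n) s)" if s: "\<phi> \<in> C_c" "s \<in> \<rat>" "s \<ge> 0" for \<phi> s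
  proof -
    obtain y where "s = of_rat y" using s(2) by (auto elim: Rats_cases)
    then have "s = q (to_nat y)" using s(3) by (simp add: q_def)
    then show ?thesis using conv[OF s(1)] by simp
  qed
  have \<eta>r: "(\<lambda>n. \<eta> (r n)) \<longlonglongrightarrow> 0" using LIMSEQ_subseq_LIMSEQ[OF \<eta> r] by (simp add: o_def)
  have m0: "0 \<le> m" using mass[of 0 0] measure_nonneg[of "N 0 0" UNIV] by linarith
  have cauchy: "\<exists>n0. \<forall>n\<ge>n0. \<forall>k\<ge>n0. \<forall>t\<in>{0..T}. \<bar>(\<integral>x. \<phi> x \<partial>N (r n) t) - (\<integral>x. \<phi> x \<partial>N (r k) t)\<bar> < e"
    if \<phi>: "\<phi> \<in> C_c" and T: "T \<ge> 0" and e: "e > 0" for \<phi> T e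
  proof -
    have "e / (4 * (m + 1)) > 0" using e m0 by simp
    then obtain \<psi> where \<psi>: "\<psi> \<in> C_c_inf" "\<And>x. \<bar>\<phi> x - \<psi> x\<bar> \<le> e / (4 * (m + 1))" using C_c_inf_dense[OF \<phi>] by blast
    note \<psi>c = C_c_inf_subset_C_c[OF \<psi>(1)]
    obtain C where C: "C \<ge> 0" "\<And>n s t. s \<in> {0..T} \<Longrightarrow> t \<in> {0..T} \<Longrightarrow>
        \<bar>(\<integral>x. \<psi> x \<partial>N n t) - (\<integral>x. \<psi> x \<partial>N n s)\<bar> \<le> C * (\<bar>t - s\<bar> + \<eta> n)" using eqc[OF \<psi>(1) T] by blast
    have "\<exists>n0. \<forall>n\<ge>n0. \<forall>k\<ge>n0. \<forall>t\<in>{0..T}. \<bar>(\<integral>x. \<psi> x \<partial>N (r n) t) - (\<integral>x. \<psi> x \<partial>N (r k) t)\<bar> < e / 2"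
      by (rule uniformly_Cauchy_from_grid[where C=C and \<eta>="\<lambda>n. \<eta> (r n)"]) (use C \<eta>r conv'[OF \<psi>c] e in auto)
    then obtain n0 where n0: "\<And>n k t. n \<ge> n0 \<Longrightarrow> k \<ge> n0 \<Longrightarrow> t \<in> {0..T} \<Longrightarrow>
      \<bar>(\<integral>x. \<psi> x \<partial>N (r n) t) - (\<integral>x. \<psi> x \<partial>N (r k) t)\<bar> < e / 2" by blast
    have small: "\<bar>(\<integral>x. \<phi> x \<partial>N n t) - (\<integral>x. \<psi> x \<partial>N n t)\<bar> < e / 4" if "t \<ge> 0" for n t
    proof -
      have "\<bar>(\<integral>x. \<phi> x \<partial>N n t) - (\<integral>x. \<psi> x \<partial>N n t)\<bar> \<le> e / (4 * (m + 1)) * m"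
        using that by (intro integral_diff_le Mp mass \<phi> \<psi>c \<psi>(2))
      also have "\<dots> < e / 4" using e m0 by (simp add: field_simps)
      finally show ?thesis .
    qed
    have "\<bar>(\<integral>x. \<phi> x \<partial>N (r n) t) - (\<integral>x. \<phi> x \<partial>N (r k) t)\<bar> < e" if "n \<ge> n0" "k \<ge> n0" "t \<in> {0..T}" for n k t
    proof -
      have "0 \<le> t" using that(3) by simp
      then show ?thesis using n0[OF that] small[of t "r n"] small[of t "r k"] by linarith
    qed
    then show ?thesis by blast
  qed
  \<comment> \<open>At a fixed time all integrals already converge. Compactness along a further
    subsequence is used only to know that the limits are the integrals of a measure.\<close>
  have "\<exists>\<mu>. \<mu> \<in> Mplus \<and> (\<forall>\<phi>\<in>C_c. (\<lambda>n. \<integral>x. \<phi> x \<partial>N (r n) t) \<longlonglongrightarrow> (\<integral>x. \<phi> x \<partial>\<mu>))" if t: "t \<ge> 0" for t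
  proof -
    obtain r' \<mu> where r': "strict_mono r'" "\<mu> \<in> Mplus" "\<And>\<phi>. \<phi> \<in> C_c \<Longrightarrow> (\<lambda>n. \<integral>x. \<phi> x \<partial>N (r (r' n)) t) \<longlonglongrightarrow> (\<integral>x. \<phi> x \<partial>\<mu>)"
      using vague_compactness[of "\<lambda>n. N (r n) t" m M] Mp mass moment M t by blast
    have "(\<lambda>n. \<integral>x. \<phi> x \<partial>N (r n) t) \<longlonglongrightarrow> (\<integral>x. \<phi> x \<partial>\<mu>)" if \<phi>: "\<phi> \<in> C_c" for \<phi>
    proof -
      have "Cauchy (\<lambda>n. \<integral>x. \<phi> x \<partial>N (r n) t)"
        unfolding Cauchy_def dist_real_def using cauchy[OF \<phi> t] t by fastforce
      then obtain l where l: "(\<lambda>n. \<integral>x. \<phi> x \<partial>N (r n) t) \<longlonglongrightarrow> l" using Cauchy_convergent convergent_def by blast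
      have "(\<lambda>n. \<integral>x. \<phi> x \<partial>N (r (r' n)) t) \<longlonglongrightarrow> l" using LIMSEQ_subseq_LIMSEQ[OF l r'(1)] by (simp add: o_def)
      then show ?thesis using l LIMSEQ_unique[OF r'(3)[OF \<phi>]] by simp
    qed
    then show ?thesis using r'(2) by blast
  qed
  then obtain \<mu> where \<mu>: "\<And>t. t \<ge> 0 \<Longrightarrow> \<mu> t \<in> Mplus"
    "\<And>t \<phi>. t \<ge> 0 \<Longrightarrow> \<phi> \<in> C_c \<Longrightarrow> (\<lambda>n. \<integral>x. \<phi> x \<partial>N (r n) t) \<longlonglongrightarrow> (\<integral>x. \<phi> x \<partial>\<mu> t)" by metis
  have "uniform_limit {0..T} (\<lambda>n t. \<integral>x. \<phi> x \<partial>N (r n) t) (\<lambda>t. \<integral>x. \<phi> x \<partial>\<mu> t) sequentially"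
    if \<phi>: "\<phi> \<in> C_c" and T: "T \<ge> 0" for \<phi> T
  proof (rule uniform_limitI)
    fix e :: real assume e: "e > 0"
    then have e2: "e / 2 > 0" by simp
    obtain n0 where n0: "\<And>n k t. n \<ge> n0 \<Longrightarrow> k \<ge> n0 \<Longrightarrow> t \<in> {0..T} \<Longrightarrow>
      \<bar>(\<integral>x. \<phi> x \<partial>N (r n) t) - (\<integral>x. \<phi> x \<partial>N (r k) t)\<bar> < e / 2" using cauchy[OF \<phi> T e2] by blast
    have "dist (\<integral>x. \<phi> x \<partial>N (r n) t) (\<integral>x. \<phi> x \<partial>\<mu> t) < e" if "n \<ge> n0" "t \<in> {0..T}" for n t
    proof -
      have "(\<lambda>k. \<bar>(\<integral>x. \<phi> x \<partial>N (r n) t) - (\<integral>x. \<phi> x \<partial>N (r k) t)\<bar>) \<longlonglongrightarrow> \<bar>(\<integral>x. \<phi> x \<partial>N (r n) t) - (\<integral>x. \<phi> x \<partial>\<mu> t)\<bar>"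
        using that(2) \<phi> by (intro tendsto_intros \<mu>(2)) auto
      moreover have "\<forall>k\<ge>n0. \<bar>(\<integral>x. \<phi> x \<partial>N (r n) t) - (\<integral>x. \<phi> x \<partial>N (r k) t)\<bar> \<le> e / 2"
        using n0[OF that(1) _ that(2)] by (auto intro: less_imp_le)
      ultimately have "\<bar>(\<integral>x. \<phi> x \<partial>N (r n) t) - (\<integral>x. \<phi> x \<partial>\<mu> t)\<bar> \<le> e / 2" by (blast intro: LIMSEQ_le_const2)
      then show ?thesis using e by (simp add: dist_real_def)
    qed
    then show "\<forall>\<^sub>F n in sequentially. \<forall>t\<in>{0..T}. dist (\<integral>x. \<phi> x \<partial>N (r n) t) (\<integral>x. \<phi> x \<partial>\<mu> t) < e"
      unfolding eventually_sequentially by blast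
  qed
  then show ?thesis using that r \<mu>(1) by blast
qed

text \<open>Continuous functions of compact support on pairs are uniform limits of these on compact sets.\<close>

inductive tensor :: "(phase \<Rightarrow> real) \<Rightarrow> bool" where
  tensor_prod: "a \<in> C_c \<Longrightarrow> b \<in> C_c \<Longrightarrow> tensor (\<lambda>p. a (fst p) * b (snd p))"
| tensor_add: "tensor f \<Longrightarrow> tensor g \<Longrightarrow> tensor (\<lambda>p. f p + g p)"

lemma C_c_mult: "a \<in> C_c \<Longrightarrow> continuous_on UNIV g \<Longrightarrow> (\<lambda>x. g x * a x) \<in> C_c"
  using compact_support_mult[of a g] by (simp add: C_c_def continuous_on_mult mult.commute)

text \<open>A linear form on pairs splits as l(x, y) = l(x, 0) + l(0, y), so its product with a(x)
  b(y) is a sum of two such products. Polynomials follow by induction.\<close>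

lemma tensor_linear:
  assumes "bounded_linear l" shows "tensor f \<Longrightarrow> tensor (\<lambda>p. l p * f p)"
proof (induction rule: tensor.induct)
  case (tensor_prod a b)
  have l: "l p = l (fst p, 0) + l (0, snd p)" for p
    using linear_add[OF bounded_linear.linear[OF assms], of "(fst p, 0)" "(0, snd p)"] by simp
  have c1: "continuous_on UNIV (\<lambda>x. l (x, 0))"
    by (rule continuous_on_compose2[OF linear_continuous_on[OF assms], of UNIV]) (auto intro!: continuous_intros)
  have c2: "continuous_on UNIV (\<lambda>y. l (0, y))"
    by (rule continuous_on_compose2[OF linear_continuous_on[OF assms], of UNIV]) (auto intro!: continuous_intros)
  have "tensor (\<lambda>p. (l (fst p, 0) * a (fst p)) * b (snd p) + a (fst p) * (l (0, snd p) * b (snd p)))"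
    by (rule tensor.intros(2)[OF tensor.intros(1)[OF C_c_mult[OF tensor_prod(1) c1] tensor_prod(2)]
        tensor.intros(1)[OF tensor_prod(1) C_c_mult[OF tensor_prod(2) c2]]])
  moreover have "(\<lambda>p. l p * (a (fst p) * b (snd p))) = (\<lambda>p. (l (fst p, 0) * a (fst p)) * b (snd p) + a (fst p) * (l (0, snd p) * b (snd p)))"
    by (rule ext, subst l) (simp add: algebra_simps)
  ultimately show ?case by simp
next
  case (tensor_add f g) then show ?case by (simp add: distrib_left tensor.intros(2))
qed

lemma tensor_polynomial:
  "real_polynomial_function P \<Longrightarrow> tensor f \<Longrightarrow> tensor (\<lambda>p. P p * f p)"
proof (induction arbitrary: f rule: real_polynomial_function.induct)
  case (linear l) then show ?case by (rule tensor_linear)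
next
  case (const c)
  from const show ?case
  proof (induction rule: tensor.induct)
    case (tensor_prod a b)
    have "tensor (\<lambda>p. (c * a (fst p)) * b (snd p))"
      by (rule tensor.intros(1)[OF C_c_mult[OF tensor_prod(1) continuous_on_const] tensor_prod(2)])
    then show ?case by (simp add: mult.assoc)
  qed (simp add: distrib_left tensor.intros(2))
next
  case (add g h) then show ?case by (simp add: distrib_right tensor.intros(2))
next
  case (mult g h) then show ?case by (simp add: mult.assoc)
qed

section \<open>Convergence of integrals against tensor squares\<close>

lemma Mplus_pair:
  assumes "N \<in> Mplus" shows "finite_measure (N \<Otimes>\<^sub>M N)" "sets (N \<Otimes>\<^sub>M N) = sets borel" "space (N \<Otimes>\<^sub>M N) = UNIV"
    "measure (N \<Otimes>\<^sub>M N) UNIV = (measure N UNIV)\<^sup>2"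
proof -
  interpret finite_measure N by (rule Mplus_simps[OF assms])
  show "finite_measure (N \<Otimes>\<^sub>M N)" by (intro finite_measure_pair_measure finite_measure_axioms)
  show "sets (N \<Otimes>\<^sub>M N) = sets borel"
    using sets_pair_measure_cong[OF Mplus_simps(2)[OF assms] Mplus_simps(2)[OF assms]]
    by (simp only: borel_prod)
  show "space (N \<Otimes>\<^sub>M N) = UNIV" by (simp add: space_pair_measure Mplus_simps[OF assms])
  have "emeasure (N \<Otimes>\<^sub>M N) (UNIV \<times> UNIV) = emeasure N UNIV * emeasure N UNIV"
    by (rule emeasure_pair_measure_Times) (simp_all add: Mplus_simps[OF assms])
  then show "measure (N \<Otimes>\<^sub>M N) UNIV = (measure N UNIV)\<^sup>2"
    by (simp add: measure_def enn2real_mult power2_eq_square)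
qed

lemma Mplus_pair_integrable:
  assumes "N \<in> Mplus" "f \<in> borel_measurable borel" "\<And>p. \<bar>f p\<bar> \<le> B"
  shows "integrable (N \<Otimes>\<^sub>M N) (f :: phase \<Rightarrow> real)"
proof -
  interpret finite_measure "N \<Otimes>\<^sub>M N" by (rule Mplus_pair[OF assms(1)])
  have "f \<in> borel_measurable (N \<Otimes>\<^sub>M N)"
    using assms(2) by (simp add: measurable_cong_sets[OF Mplus_pair(2)[OF assms(1)] refl])
  then show ?thesis using assms(3) by (intro integrable_const_bound[of _ B]) auto
qed

lemma tensor_bounded: "tensor f \<Longrightarrow> continuous_on UNIV f \<and> (\<exists>B. \<forall>p. \<bar>f p\<bar> \<le> B)"
proof (induction rule: tensor.induct)
  case (tensor_prod a b)
  obtain A B where "\<And>x. \<bar>a x\<bar> \<le> A" "\<And>x. \<bar>b x\<bar> \<le> B" using C_c_bounded tensor_prod by metis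
  then have "\<bar>a (fst p) * b (snd p)\<bar> \<le> A * B" for p
    unfolding abs_mult by (intro mult_mono) (auto intro: order_trans[OF abs_ge_zero])
  moreover have "continuous_on UNIV (\<lambda>p. a (fst p) * b (snd p))"
    using tensor_prod by (auto simp: C_c_def intro!: continuous_intros intro: continuous_on_compose2[of UNIV])
  ultimately show ?case by blast
next
  case (tensor_add f g)
  then obtain A B where "\<forall>p. \<bar>f p\<bar> \<le> A" "\<forall>p. \<bar>g p\<bar> \<le> B" by auto
  then have "\<forall>p. \<bar>f p + g p\<bar> \<le> A + B" by (meson abs_triangle_ineq add_mono order_trans)
  then show ?case using tensor_add by (auto intro!: continuous_intros)
qed

lemma tensor_integrable: "N \<in> Mplus \<Longrightarrow> tensor f \<Longrightarrow> integrable (N \<Otimes>\<^sub>M N) f"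
  using tensor_bounded[of f] by (auto intro!: Mplus_pair_integrable borel_measurable_continuous_onI)

lemma tensor_limit:
  assumes N: "\<And>n. N n \<in> Mplus" and \<mu>: "\<mu> \<in> Mplus"
    and lim: "\<And>\<phi>. \<phi> \<in> C_c \<Longrightarrow> (\<lambda>n. \<integral>x. \<phi> x \<partial>N n) \<longlonglongrightarrow> (\<integral>x. \<phi> x \<partial>\<mu>)"
  shows "tensor f \<Longrightarrow> (\<lambda>n. \<integral>p. f p \<partial>(N n \<Otimes>\<^sub>M N n)) \<longlonglongrightarrow> (\<integral>p. f p \<partial>(\<mu> \<Otimes>\<^sub>M \<mu>))"
proof (induction rule: tensor.induct)
  case (tensor_prod a b)
  have "(\<integral>p. a (fst p) * b (snd p) \<partial>(L \<Otimes>\<^sub>M L)) = (\<integral>x. a x \<partial>L) * (\<integral>x. b x \<partial>L)" if L: "L \<in> Mplus" for L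
  proof -
    interpret finite_measure L by (rule Mplus_simps[OF L])
    interpret pair_sigma_finite L L by unfold_locales
    have "(\<integral>x. \<integral>y. a x * b y \<partial>L \<partial>L) = (\<integral>p. a (fst p) * b (snd p) \<partial>(L \<Otimes>\<^sub>M L))"
      using integral_fst'[OF tensor_integrable[OF L tensor.intros(1)[OF tensor_prod]]] by simp
    then show ?thesis by simp
  qed
  then show ?case using N \<mu> tensor_prod lim by (simp add: tendsto_mult)
next
  case (tensor_add f g)
  then show ?case using tensor_integrable N \<mu> by (simp add: Bochner_Integration.integral_add tendsto_add)
qed

text \<open>On the compact support of the cutoff G is uniformly close to a polynomial, and a
  polynomial times the cutoff is a \<open>tensor\<close>, for which the integral is a sum of
  products of convergent integrals.\<close>

lemma pair_limit_continuous:
  assumes N: "\<And>n. N n \<in> Mplus" and \<mu>: "\<mu> \<in> Mplus" and mass: "\<And>n. measure (N n) UNIV \<le> m"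
    and lim: "\<And>\<phi>. \<phi> \<in> C_c \<Longrightarrow> (\<lambda>n. \<integral>x. \<phi> x \<partial>N n) \<longlonglongrightarrow> (\<integral>x. \<phi> x \<partial>\<mu>)"
    and G: "continuous_on UNIV (G :: phase \<Rightarrow> real)" and R: "R > 0"
  shows "(\<lambda>n. \<integral>p. G p * (bump R (fst p) * bump R (snd p)) \<partial>(N n \<Otimes>\<^sub>M N n)) \<longlonglongrightarrow> (\<integral>p. G p * (bump R (fst p) * bump R (snd p)) \<partial>(\<mu> \<Otimes>\<^sub>M \<mu>))"
proof (rule LIMSEQ_I)
  fix e :: real assume e: "e > 0"
  define th where "th p = bump R (fst p) * bump R (snd p)" for p :: phase
  have th: "tensor th" unfolding th_def using bump_props(7)[OF R] by (intro tensor.intros(1))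
  have th01: "0 \<le> th p" "th p \<le> 1" for p
    using bump_props(4,5)[OF R, of "fst p"] bump_props(4,5)[OF R, of "snd p"] by (auto simp: th_def mult_le_one)
  have thz: "th p = 0" if "p \<notin> cball 0 (2*R) \<times> cball 0 (2*R)" for p
    using that bump_props(3)[OF R, of "fst p"] bump_props(3)[OF R, of "snd p"] by (auto simp: th_def mem_Times_iff)
  define S where "S = cball (0::plane) (2*R) \<times> cball (0::plane) (2*R)"
  \<comment> \<open>A common bound for the masses of all tensor squares involved, the limit
    included; the 1 keeps the division by A legitimate.\<close>
  define A where "A = 1 + m\<^sup>2 + (measure \<mu> UNIV)\<^sup>2"
  have A: "A > 0" "m\<^sup>2 \<le> A" "(measure \<mu> UNIV)\<^sup>2 \<le> A" by (auto simp: A_def add_pos_nonneg)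
  have "compact S" unfolding S_def by (intro compact_Times compact_cball)
  then obtain P where P: "real_polynomial_function P" "\<And>p. p \<in> S \<Longrightarrow> \<bar>G p - P p\<bar> < e / (4 * A)"
    using Stone_Weierstrass_real_polynomial_function[of S G "e / (4 * A)"] G e A continuous_on_subset by (metis divide_pos_pos mult_pos_pos subset_UNIV zero_less_numeral)
  have t: "tensor (\<lambda>p. P p * th p)" by (rule tensor_polynomial[OF P(1) th])
  have Gm: "(\<lambda>p. G p * th p) \<in> borel_measurable borel"
    using G tensor_bounded[OF th] by (intro borel_measurable_continuous_onI continuous_intros) auto
  have diff: "\<bar>G p * th p - P p * th p\<bar> \<le> e / (4 * A)" for p
  proof (cases "p \<in> S")
    case True
    have "\<bar>G p * th p - P p * th p\<bar> = \<bar>G p - P p\<bar> * th p" using th01 by (simp add: abs_mult flip: left_diff_distrib)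
    also have "\<dots> \<le> e / (4 * A) * 1" using P(2)[OF True] th01 by (intro mult_mono) auto
    finally show ?thesis by simp
  qed (use thz e A in \<open>auto simp: S_def\<close>)
  have close: "\<bar>(\<integral>p. G p * th p \<partial>(L \<Otimes>\<^sub>M L)) - (\<integral>p. P p * th p \<partial>(L \<Otimes>\<^sub>M L))\<bar> \<le> e / 4" if L: "L \<in> Mplus" "(measure L UNIV)\<^sup>2 \<le> A" for L
  proof -
    interpret LL: finite_measure "L \<Otimes>\<^sub>M L" by (rule Mplus_pair[OF L(1)])
    have Pi: "integrable (L \<Otimes>\<^sub>M L) (\<lambda>p. P p * th p)" by (rule tensor_integrable[OF L(1) t])
    obtain B where B: "\<And>p. \<bar>P p * th p\<bar> \<le> B" using tensor_bounded[OF t] by blast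
    have Gi: "integrable (L \<Otimes>\<^sub>M L) (\<lambda>p. G p * th p)"
    proof (rule Mplus_pair_integrable[OF L(1) Gm])
      fix p show "\<bar>G p * th p\<bar> \<le> e / (4 * A) + B" using diff[of p] B[of p] by linarith
    qed
    have "\<bar>(\<integral>p. G p * th p \<partial>(L \<Otimes>\<^sub>M L)) - (\<integral>p. P p * th p \<partial>(L \<Otimes>\<^sub>M L))\<bar> = \<bar>\<integral>p. G p * th p - P p * th p \<partial>(L \<Otimes>\<^sub>M L)\<bar>"
      using Gi Pi by simp
    also have "\<dots> \<le> (\<integral>p. \<bar>G p * th p - P p * th p\<bar> \<partial>(L \<Otimes>\<^sub>M L))" by (rule integral_abs_bound)
    also have "\<dots> \<le> (\<integral>p. e / (4 * A) \<partial>(L \<Otimes>\<^sub>M L))"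
      using Gi Pi diff by (intro integral_mono) auto
    also have "\<dots> = e / (4 * A) * (measure L UNIV)\<^sup>2" using Mplus_pair[OF L(1)] by simp
    also have "\<dots> \<le> e / (4 * A) * A" using L(2) e A by (intro mult_left_mono) auto
    finally show ?thesis using A by simp
  qed
  have "(\<lambda>n. \<integral>p. P p * th p \<partial>(N n \<Otimes>\<^sub>M N n)) \<longlonglongrightarrow> (\<integral>p. P p * th p \<partial>(\<mu> \<Otimes>\<^sub>M \<mu>))"
    by (rule tensor_limit[OF N \<mu> lim t])
  moreover have "e / 4 > 0" using e by simp
  ultimately obtain n0 where n0: "\<And>n. n \<ge> n0 \<Longrightarrow> norm ((\<integral>p. P p * th p \<partial>(N n \<Otimes>\<^sub>M N n)) - (\<integral>p. P p * th p \<partial>(\<mu> \<Otimes>\<^sub>M \<mu>))) < e / 4"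
    using LIMSEQ_D by blast
  have "norm ((\<integral>p. G p * th p \<partial>(N n \<Otimes>\<^sub>M N n)) - (\<integral>p. G p * th p \<partial>(\<mu> \<Otimes>\<^sub>M \<mu>))) < e" if "n \<ge> n0" for n
  proof -
    have "(measure (N n) UNIV)\<^sup>2 \<le> m\<^sup>2" using mass by (intro power_mono) auto
    then show ?thesis
      using n0[OF that] close[OF N[of n]] close[OF \<mu> A(3)] A(2) e unfolding real_norm_def by linarith
  qed
  then show "\<exists>n0. \<forall>n\<ge>n0. norm ((\<integral>p. G p * (bump R (fst p) * bump R (snd p)) \<partial>(N n \<Otimes>\<^sub>M N n)) - (\<integral>p. G p * (bump R (fst p) * bump R (snd p)) \<partial>(\<mu> \<Otimes>\<^sub>M \<mu>))) < e"
    unfolding th_def by blast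
qed

lemma bump_tendsto_1: "(\<lambda>k. bump (real (Suc k)) (x :: 'a::euclidean_space)) \<longlonglongrightarrow> 1"
proof (rule tendsto_eventually)
  obtain k0 :: nat where "norm x \<le> real k0" using real_arch_simple by blast
  then show "\<forall>\<^sub>F k in sequentially. bump (real (Suc k)) x = 1"
    by (auto simp: eventually_sequentially intro!: exI[of _ k0] bump_props(2))
qed

text \<open>H is multiplied by a continuous weight W that removes a strip around the diagonal and
  the region far out. Then H W is continuous with compact support and its integrals converge, while
  1 - W has a small integral against every tensor square, and H is bounded.\<close>

lemma kernel_limit:
  fixes H :: "phase \<Rightarrow> real"
  assumes N: "\<And>n. N n \<in> Mplus" and \<mu>: "\<mu> \<in> Mplus" and mass: "\<And>n. measure (N n) UNIV \<le> m"
    and moment: "\<And>n. (\<integral>\<^sup>+x. ennreal ((norm x)\<^sup>2) \<partial>N n) \<le> ennreal M" and M: "0 \<le> M"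
    and lim: "\<And>\<phi>. \<phi> \<in> C_c \<Longrightarrow> (\<lambda>n. \<integral>x. \<phi> x \<partial>N n) \<longlonglongrightarrow> (\<integral>x. \<phi> x \<partial>\<mu>)"
    and conc: "\<And>e. e > 0 \<Longrightarrow> \<exists>d>0. \<forall>n. measure (N n \<Otimes>\<^sub>M N n) {p. norm (fst p - snd p) < d} \<le> e"
    and H: "H \<in> borel_measurable borel" "\<And>p. \<bar>H p\<bar> \<le> h" "continuous_on {p. fst p \<noteq> snd p} H"
  shows "(\<lambda>n. \<integral>p. H p \<partial>(N n \<Otimes>\<^sub>M N n)) \<longlonglongrightarrow> (\<integral>p. H p \<partial>(\<mu> \<Otimes>\<^sub>M \<mu>))"
proof (rule LIMSEQ_I)
  fix e' :: real assume e': "e' > 0"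
  have h0: "0 \<le> h" using H(2)[of undefined] by linarith
  \<comment> \<open>The weight 1 - W costs at most 3 e (the diagonal strip and the two regions where
    one variable exceeds R), and h times 3 e is at most e'/4.\<close>
  define e where "e = e' / (12 * (h + 1))"
  have e: "e > 0" using e' h0 by (simp add: e_def)
  have m0: "0 \<le> m" using mass[of 0] measure_nonneg[of "N 0" UNIV] by linarith
  obtain d where d: "d > 0" "\<And>n. measure (N n \<Otimes>\<^sub>M N n) {p. norm (fst p - snd p) < d} \<le> e" using conc[OF e] by blast
  \<comment> \<open>Chosen so that m M / R^2 \<le> e: since R \<ge> 1, R^2 may be replaced by
    R.\<close>
  define R where "R = 1 + m * M / e"
  have R: "R > 0" "R \<ge> 1" using m0 M e by (auto simp: R_def add_pos_nonneg)
  have RM: "m * (M / R\<^sup>2) \<le> e"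
  proof -
    have "m * M \<le> e * R" using e by (simp add: R_def distrib_left)
    also have "\<dots> \<le> e * R\<^sup>2" using R e by (intro mult_left_mono) (auto simp: power2_eq_square)
    finally show ?thesis using R by (simp add: field_simps)
  qed
  define \<kappa> where "\<kappa> p = max 0 (min 1 (2 - 2 * norm (fst p - snd p) / d))" for p :: phase
  have \<kappa>c: "continuous_on UNIV \<kappa>" unfolding \<kappa>_def using d by (intro continuous_intros) auto
  have \<kappa>01: "0 \<le> \<kappa> p" "\<kappa> p \<le> 1" for p by (auto simp: \<kappa>_def)
  have \<kappa>0: "\<kappa> p = 0" if "\<not> norm (fst p - snd p) < d" for p
    using that d by (simp add: \<kappa>_def max_def min_def field_simps)
  have \<kappa>1: "\<kappa> p = 1" if "norm (fst p - snd p) \<le> d / 2" for p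
    using that d by (simp add: \<kappa>_def max_def min_def field_simps)
  define th where "th p = bump R (fst p) * bump R (snd p)" for p :: phase
  have th: "tensor th" unfolding th_def using bump_props(7)[OF R(1)] by (intro tensor.intros(1))
  have thc: "continuous_on UNIV th" using tensor_bounded[OF th] by blast
  have th01: "0 \<le> th p" "th p \<le> 1" for p
    using bump_props(4,5)[OF R(1), of "fst p"] bump_props(4,5)[OF R(1), of "snd p"] by (auto simp: th_def mult_le_one)
  define W where "W p = (1 - \<kappa> p) * th p" for p
  have Wc: "continuous_on UNIV W" unfolding W_def by (intro continuous_intros \<kappa>c thc)
  have W01: "0 \<le> W p" "W p \<le> 1" for p using \<kappa>01[of p] th01[of p] by (auto simp: W_def mult_le_one)
  have Wm: "(\<lambda>p. 1 - W p) \<in> borel_measurable borel" by (intro borel_measurable_continuous_onI continuous_intros Wc)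
  have WN: "(\<integral>p. 1 - W p \<partial>(N n \<Otimes>\<^sub>M N n)) \<le> 3 * e" for n
  proof -
    interpret NN: finite_measure "N n \<Otimes>\<^sub>M N n" by (rule Mplus_pair[OF N])
    interpret Nn: finite_measure "N n" by (rule Mplus_simps[OF N])
    have [measurable_cong, simp]: "sets (N n) = sets borel" by (rule Mplus_simps[OF N])
    define D where "D = {p::phase. norm (fst p - snd p) < d}"
    define A where "A = {x::plane. norm x > R}"
    have As: "A \<in> sets borel" unfolding A_def by measurable
    have Ds: "D \<in> sets (N n \<Otimes>\<^sub>M N n)" unfolding D_def Mplus_pair(2)[OF N]
      by (intro borel_open open_Collect_less continuous_intros)
    have A1: "A \<times> UNIV \<in> sets (N n \<Otimes>\<^sub>M N n)" "UNIV \<times> A \<in> sets (N n \<Otimes>\<^sub>M N n)"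
      using As by (auto intro!: pair_measureI)
    have "measure (N n \<Otimes>\<^sub>M N n) (A \<times> UNIV) = measure (N n) A * measure (N n) UNIV"
      "measure (N n \<Otimes>\<^sub>M N n) (UNIV \<times> A) = measure (N n) UNIV * measure (N n) A"
      using As by (auto simp: measure_def Nn.emeasure_pair_measure_Times enn2real_mult)
    moreover have "measure (N n) A \<le> M / R\<^sup>2" unfolding A_def
      by (rule moment_tail[OF Mplus_simps(1,2)[OF N] moment M R(1)])
    then have "measure (N n) UNIV * measure (N n) A \<le> m * (M / R\<^sup>2)" by (intro mult_mono mass m0) auto
    ultimately have meas: "measure (N n \<Otimes>\<^sub>M N n) (A \<times> UNIV) \<le> e" "measure (N n \<Otimes>\<^sub>M N n) (UNIV \<times> A) \<le> e"
      using RM by (auto simp: mult.commute)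
    have pw: "1 - W p \<le> indicator D p + (indicator (A \<times> UNIV) p + indicator (UNIV \<times> A) p)" for p
    proof (cases "p \<in> D \<or> p \<in> A \<times> UNIV \<or> p \<in> UNIV \<times> A")
      case True then show ?thesis using W01[of p] by (auto simp: indicator_def)
    next
      case False
      then have "\<kappa> p = 0" "norm (fst p) \<le> R" "norm (snd p) \<le> R" using \<kappa>0[of p]
        by (auto simp: D_def A_def mem_Times_iff not_less)
      then have "\<kappa> p = 0" "th p = 1" using bump_props(2)[OF R(1), of "fst p"] bump_props(2)[OF R(1), of "snd p"] by (simp_all add: th_def)
      then show ?thesis by (simp add: W_def)
    qed
    have "(\<integral>p. 1 - W p \<partial>(N n \<Otimes>\<^sub>M N n)) \<le> (\<integral>p. indicator D p + (indicator (A \<times> UNIV) p + indicator (UNIV \<times> A) p) \<partial>(N n \<Otimes>\<^sub>M N n))"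
      using Ds A1 W01 by (intro integral_mono Mplus_pair_integrable[OF N Wm, of 1] pw Bochner_Integration.integrable_add) (auto simp: NN.emeasure_eq_measure)
    also have "\<dots> = measure (N n \<Otimes>\<^sub>M N n) D + (measure (N n \<Otimes>\<^sub>M N n) (A \<times> UNIV) + measure (N n \<Otimes>\<^sub>M N n) (UNIV \<times> A))"
      using Ds A1 by (subst Bochner_Integration.integral_add, simp_all add: NN.emeasure_eq_measure)+
    also have "\<dots> \<le> 3 * e" using d(2)[of n] meas unfolding D_def by linarith
    finally show ?thesis .
  qed
  \<comment> \<open>The bound passes to the limit measure, although 1 - W does not have compact
    support: it holds for (1 - W) times a cutoff by convergence, and the cutoffs then increase to 1.
    No separate argument about atoms of \<mu> is needed.\<close>
  have Wmu: "(\<integral>p. 1 - W p \<partial>(\<mu> \<Otimes>\<^sub>M \<mu>)) \<le> 3 * e"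
  proof -
    interpret mm: finite_measure "\<mu> \<Otimes>\<^sub>M \<mu>" by (rule Mplus_pair[OF \<mu>])
    define b where "b k p = bump (real (Suc k)) (fst p) * bump (real (Suc k)) (snd p)" for k and p :: phase
    have bc: "continuous_on UNIV (b k)" for k
      using tensor_bounded[OF tensor.intros(1)[OF bump_props(7) bump_props(7), of "real (Suc k)" "real (Suc k)"]] unfolding b_def by auto
    have b01: "0 \<le> b k p" "b k p \<le> 1" for k p
      using bump_props(4,5)[of "real (Suc k)" "fst p"] bump_props(4,5)[of "real (Suc k)" "snd p"] by (auto simp: b_def mult_le_one)
    have wb: "(\<lambda>p. (1 - W p) * b k p) \<in> borel_measurable borel" "\<bar>(1 - W p) * b k p\<bar> \<le> 1" for k p
      using W01[of p] b01[of k p] by (auto simp: abs_mult mult_le_one intro!: borel_measurable_continuous_onI continuous_intros Wc bc)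
    have "(\<integral>p. (1 - W p) * b k p \<partial>(\<mu> \<Otimes>\<^sub>M \<mu>)) \<le> 3 * e" for k
    proof (rule LIMSEQ_le_const2)
      show "(\<lambda>n. \<integral>p. (1 - W p) * b k p \<partial>(N n \<Otimes>\<^sub>M N n)) \<longlonglongrightarrow> (\<integral>p. (1 - W p) * b k p \<partial>(\<mu> \<Otimes>\<^sub>M \<mu>))"
        unfolding b_def by (rule pair_limit_continuous[OF N \<mu> mass lim]) (auto intro!: continuous_intros Wc)
      have "(\<integral>p. (1 - W p) * b k p \<partial>(N n \<Otimes>\<^sub>M N n)) \<le> (\<integral>p. 1 - W p \<partial>(N n \<Otimes>\<^sub>M N n))" for n
        using W01 b01 by (intro integral_mono Mplus_pair_integrable[OF N Wm, of 1] Mplus_pair_integrable[OF N wb]) (auto simp: mult_left_le)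
      then show "\<exists>n0. \<forall>n\<ge>n0. (\<integral>p. (1 - W p) * b k p \<partial>(N n \<Otimes>\<^sub>M N n)) \<le> 3 * e" using WN order_trans by blast
    qed
    moreover have "(\<lambda>k. \<integral>p. (1 - W p) * b k p \<partial>(\<mu> \<Otimes>\<^sub>M \<mu>)) \<longlonglongrightarrow> (\<integral>p. 1 - W p \<partial>(\<mu> \<Otimes>\<^sub>M \<mu>))"
    proof (rule integral_dominated_convergence[where w="\<lambda>_. 1"])
      show "(\<lambda>p. 1 - W p) \<in> borel_measurable (\<mu> \<Otimes>\<^sub>M \<mu>)" "\<And>k. (\<lambda>p. (1 - W p) * b k p) \<in> borel_measurable (\<mu> \<Otimes>\<^sub>M \<mu>)"
        using Wm wb by (auto simp: measurable_cong_sets[OF Mplus_pair(2)[OF \<mu>] refl])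
      have "(\<lambda>k. (1 - W p) * b k p) \<longlonglongrightarrow> (1 - W p) * (1 * 1)" for p
        unfolding b_def by (intro tendsto_intros bump_tendsto_1)
      then show "AE p in \<mu> \<Otimes>\<^sub>M \<mu>. (\<lambda>k. (1 - W p) * b k p) \<longlonglongrightarrow> 1 - W p" by simp
      show "\<And>k. AE p in \<mu> \<Otimes>\<^sub>M \<mu>. norm ((1 - W p) * b k p) \<le> 1" using wb(2) by simp
    qed simp
    ultimately show ?thesis by (blast intro: LIMSEQ_le_const2)
  qed
  \<comment> \<open>Continuity is glued from two open sets: the complement of the diagonal, where H
    is continuous, and the strip of width d/2, where 1 - \<kappa> vanishes.\<close>
  have G: "continuous_on UNIV (\<lambda>p. H p * (1 - \<kappa> p))"
  proof -
    define U1 U2 where "U1 = {p::phase. fst p \<noteq> snd p}" and "U2 = {p::phase. norm (fst p - snd p) < d / 2}"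
    have o: "open U1" "open U2" unfolding U1_def U2_def
      by (auto intro!: open_Collect_neq open_Collect_less continuous_intros)
    have "continuous_on U1 (\<lambda>p. H p * (1 - \<kappa> p))"
      using H(3) \<kappa>c unfolding U1_def by (intro continuous_intros) (auto intro: continuous_on_subset)
    moreover have "continuous_on U2 (\<lambda>p. H p * (1 - \<kappa> p))"
    proof -
      have "H p * (1 - \<kappa> p) = 0" if "p \<in> U2" for p using \<kappa>1[of p] that by (simp add: U2_def)
      then show ?thesis using continuous_on_cong[of U2 U2 "\<lambda>p. H p * (1 - \<kappa> p)" "\<lambda>p. 0"] by simp
    qed
    ultimately have "continuous_on (U1 \<union> U2) (\<lambda>p. H p * (1 - \<kappa> p))" using o by (intro continuous_on_open_Un)
    moreover have "U1 \<union> U2 = UNIV" using d by (auto simp: U1_def U2_def)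
    ultimately show ?thesis by simp
  qed
  have HWm: "(\<lambda>p. H p * W p) \<in> borel_measurable borel"
    using H(1) Wc by (intro borel_measurable_times) (auto intro: borel_measurable_continuous_onI)
  have HWb: "\<bar>H p * W p\<bar> \<le> h" for p
    using mult_mono[OF H(2)[of p], of "\<bar>W p\<bar>" 1] W01[of p] h0 by (simp add: abs_mult)
  have close: "\<bar>(\<integral>p. H p \<partial>(L \<Otimes>\<^sub>M L)) - (\<integral>p. H p * W p \<partial>(L \<Otimes>\<^sub>M L))\<bar> \<le> e' / 4"
    if L: "L \<in> Mplus" "(\<integral>p. 1 - W p \<partial>(L \<Otimes>\<^sub>M L)) \<le> 3 * e" for L
  proof -
    note i = Mplus_pair_integrable[OF L(1) H(1,2)] Mplus_pair_integrable[OF L(1) HWm HWb] Mplus_pair_integrable[OF L(1) Wm, of 1]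
    have "\<bar>(\<integral>p. H p \<partial>(L \<Otimes>\<^sub>M L)) - (\<integral>p. H p * W p \<partial>(L \<Otimes>\<^sub>M L))\<bar> = \<bar>\<integral>p. H p - H p * W p \<partial>(L \<Otimes>\<^sub>M L)\<bar>"
      using i by simp
    also have "\<dots> \<le> (\<integral>p. \<bar>H p - H p * W p\<bar> \<partial>(L \<Otimes>\<^sub>M L))" by (rule integral_abs_bound)
    also have "\<dots> \<le> (\<integral>p. h * (1 - W p) \<partial>(L \<Otimes>\<^sub>M L))"
    proof (rule integral_mono)
      show "integrable (L \<Otimes>\<^sub>M L) (\<lambda>p. \<bar>H p - H p * W p\<bar>)" using i by simp
      show "integrable (L \<Otimes>\<^sub>M L) (\<lambda>p. h * (1 - W p))" using i(3) W01 by (intro integrable_mult_right) auto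
      fix p
      have "\<bar>H p - H p * W p\<bar> = \<bar>H p\<bar> * (1 - W p)"
        using W01[of p] by (simp add: abs_mult[symmetric] right_diff_distrib flip: abs_of_nonneg)
          (metis W01(2) abs_mult abs_of_nonneg diff_ge_0_iff_ge mult.right_neutral right_diff_distrib)
      then show "\<bar>H p - H p * W p\<bar> \<le> h * (1 - W p)" using H(2)[of p] W01[of p] by (simp add: mult_right_mono)
    qed
    also have "\<dots> = h * (\<integral>p. 1 - W p \<partial>(L \<Otimes>\<^sub>M L))" by (rule integral_mult_right_zero)
    also have "\<dots> \<le> h * (3 * e)" using L(2) h0 by (intro mult_left_mono)
    also have "\<dots> \<le> e' / 4" using e' h0 by (simp add: e_def field_simps)
    finally show ?thesis .
  qed
  have "(\<lambda>n. \<integral>p. H p * W p \<partial>(N n \<Otimes>\<^sub>M N n)) \<longlonglongrightarrow> (\<integral>p. H p * W p \<partial>(\<mu> \<Otimes>\<^sub>M \<mu>))"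
    using pair_limit_continuous[OF N \<mu> mass lim G R(1)] by (simp add: W_def th_def mult.assoc)
  moreover have "e' / 4 > 0" using e' by simp
  ultimately obtain n0 where n0: "\<And>n. n \<ge> n0 \<Longrightarrow> norm ((\<integral>p. H p * W p \<partial>(N n \<Otimes>\<^sub>M N n)) - (\<integral>p. H p * W p \<partial>(\<mu> \<Otimes>\<^sub>M \<mu>))) < e' / 4"
    using LIMSEQ_D by blast
  have "norm ((\<integral>p. H p \<partial>(N n \<Otimes>\<^sub>M N n)) - (\<integral>p. H p \<partial>(\<mu> \<Otimes>\<^sub>M \<mu>))) < e'" if "n \<ge> n0" for n
    using n0[OF that] close[OF N WN[of n]] close[OF \<mu> Wmu] e' unfolding real_norm_def by linarith
  then show "\<exists>n0. \<forall>n\<ge>n0. norm ((\<integral>p. H p \<partial>(N n \<Otimes>\<^sub>M N n)) - (\<integral>p. H p \<partial>(\<mu> \<Otimes>\<^sub>M \<mu>))) < e'" by blast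
qed

subsection \<open>Estimates for a bounded phase-space density\<close>

lemma borel_measurable_fst_snd [measurable]:
  "(fst :: phase \<Rightarrow> plane) \<in> borel_measurable borel" "(snd :: phase \<Rightarrow> plane) \<in> borel_measurable borel"
  by (auto intro!: borel_measurable_continuous_onI continuous_intros)

lemma perp_components [simp]: "perp v $ 1 = - (v $ 2)" "perp v $ 2 = v $ 1"
  by (simp_all add: perp_def)

lemma plane_inner: "(a :: plane) \<bullet> b = a $ 1 * b $ 1 + a $ 2 * b $ 2"
  by (simp add: inner_vec_def sum_2)

lemma plane_eq_iff: "(a :: plane) = b \<longleftrightarrow> a $ 1 = b $ 1 \<and> a $ 2 = b $ 2"
  by (auto simp: vec_eq_iff forall_2)

lemma perp_linear: "perp (a + b) = perp a + perp b" "perp (c *\<^sub>R a) = c *\<^sub>R perp a" "perp (a - b) = perp a - perp b" "perp (- a) = - perp a"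
  by (auto simp: plane_eq_iff)

lemma perp_inner: "perp a \<bullet> b = - (a \<bullet> perp b)" "perp a \<bullet> a = 0" "a \<bullet> perp a = 0"
  by (simp_all add: plane_inner)

lemma perp_perp [simp]: "perp (perp v) = - v"
  by (simp add: plane_eq_iff)

lemma norm_perp [simp]: "norm (perp v) = norm v"
  by (simp add: norm_eq_sqrt_inner plane_inner)

lemma bounded_linear_perp: "bounded_linear perp"
  by (rule bounded_linear_intro[where K=1]) (simp_all add: perp_linear)

lemma continuous_on_perp [continuous_intros]: "continuous_on S f \<Longrightarrow> continuous_on S (\<lambda>x. perp (f x))"
  by (rule bounded_linear.continuous_on[OF bounded_linear_perp])

lemma perp_measurable [measurable]: "perp \<in> borel_measurable borel"
  by (intro borel_measurable_continuous_onI continuous_on_perp continuous_on_id)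

text \<open>The kernel of the electric field. Its \<open>perp\<close> is the Biot-Savart kernel, up
  to normalisation; at the origin the value is 0.\<close>

definition biot :: "plane \<Rightarrow> plane" where "biot z = (1 / (norm z)\<^sup>2) *\<^sub>R z"

lemma norm_biot: "norm (biot z) = 1 / norm z"
  by (cases "z = 0") (simp_all add: biot_def power2_eq_square)

lemma biot_measurable [measurable]: "biot \<in> borel_measurable borel"
  unfolding biot_def[abs_def] by measurable

lemma biot_minus: "biot (- z) = - biot z"
  by (simp add: biot_def)

definition lnp :: "real \<Rightarrow> real" where "lnp r = max 0 (ln r)"

lemma lnp_measurable [measurable]: "lnp \<in> borel_measurable borel"
  unfolding lnp_def by measurable

lemma lnm_le: "0 \<le> r \<Longrightarrow> lnm r \<le> 1 / r"
proof (cases "r = 0")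
  case False
  assume "0 \<le> r"
  then have "r > 0" using False by simp
  then have "- ln r = ln (1 / r)" by (simp add: ln_div)
  also have "\<dots> \<le> 1 / r" using \<open>r > 0\<close> ln_le_minus_one[of "1 / r"] by simp
  finally show ?thesis using \<open>r > 0\<close> by (simp add: lnm_def)
qed (simp add: lnm_def)

text \<open>From ln r \<le> r - 1 \<le> r^2 / 2 and r^2 \<le> 2 |x|^2 + 2 |y|^2. This is how second
  moments pay for the logarithm at large distance.\<close>

lemma lnp_norm_le: "lnp (norm (x - y)) \<le> (norm x)\<^sup>2 + (norm (y :: plane))\<^sup>2"
proof (cases "x = y")
  case False
  define r where "r = norm (x - y)"
  have r: "r > 0" using False by (simp add: r_def)
  have "0 \<le> (r - 1)\<^sup>2 + 1" by simp
  then have "ln r \<le> r\<^sup>2 / 2" using ln_le_minus_one[OF r] by (simp add: power2_diff)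
  moreover have "r\<^sup>2 \<le> 2 * (norm x)\<^sup>2 + 2 * (norm y)\<^sup>2"
  proof -
    have "r \<le> norm x + norm y" unfolding r_def by (rule norm_triangle_ineq4)
    then have "r\<^sup>2 \<le> (norm x + norm y)\<^sup>2" using r by (intro power_mono) auto
    moreover have "0 \<le> (norm x - norm y)\<^sup>2" by simp
    ultimately show ?thesis by (simp add: power2_sum power2_diff)
  qed
  ultimately show ?thesis by (simp add: lnp_def r_def)
qed (simp add: lnp_def)

lemma ln_eq_lnp_lnm: "ln r = lnp r - lnm r"
  by (simp add: lnp_def lnm_def max_def)

lemma nn_integral_inverse_distance_ball:
  "r > 0 \<Longrightarrow> (\<integral>\<^sup>+y. (if norm (x - y) < r then ennreal (1 / norm (x - y)) else 0) \<partial>lborel) \<le> ennreal (2 * pi * r)" for x :: plane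
proof -
  assume r: "r > 0"
  have [measurable]: "ball (0::plane) r \<in> sets borel" by simp
  have m: "(\<lambda>z. indicator (ball (0::plane) r) z * ennreal (1 / norm z)) \<in> borel_measurable borel" by measurable
  have "(\<integral>\<^sup>+y. (if norm (x - y) < r then ennreal (1 / norm (x - y)) else 0) \<partial>lborel)
     = (\<integral>\<^sup>+y. indicator (ball (0::plane) r) (y - x) * ennreal (1 / norm (y - x)) \<partial>lborel)"
    by (intro nn_integral_cong) (simp add: indicator_def norm_minus_commute)
  also have "\<dots> = (\<integral>\<^sup>+z. indicator (ball (0::plane) r) z * ennreal (1 / norm z) \<partial>lborel)"
    by (rule nn_integral_minus_translation[OF m])
  finally show ?thesis using nn_integral_inverse_norm_ball[OF r] by simp
qed

text \<open>The bounds hold at every point, so sections are integrable without exceptional sets. The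
  radius \<open>R\<close> provides finiteness; the quantitative estimates below are in terms of
  \<Lambda>, the mass, \<open>mom\<close>, \<open>kin\<close> and \<open>Lpot\<close>, which stay
  under control as \<epsilon> tends to 0.\<close>

locale phase_density =
  fixes g :: "phase \<Rightarrow> real" and \<Lambda> R :: real
  assumes g_meas [measurable]: "g \<in> borel_measurable borel"
    and g_nonneg: "0 \<le> g z" and g_le: "g z \<le> \<Lambda>"
    and g_support: "R < norm z \<Longrightarrow> g z = 0" and R_pos: "0 < R"
begin

lemma Lam_nonneg: "0 \<le> \<Lambda>" using g_nonneg[of 0] g_le[of 0] by linarith

lemma g_zero: "R < norm x \<Longrightarrow> g (x, v) = 0" "R < norm v \<Longrightarrow> g (x, v) = 0"
  using norm_fst_le[of x v] norm_snd_le[of v x] by (auto intro!: g_support)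

definition G where "G = density lborel (\<lambda>z. ennreal (g z))"
definition N where "N = density_measure (rho g)"

lemma sets_G [simp, measurable_cong]: "sets G = sets borel" by (simp add: G_def)
lemma space_G [simp]: "space G = UNIV" by (simp add: G_def)
lemma sets_N [simp, measurable_cong]: "sets N = sets borel" by (simp add: N_def density_measure_def)
lemma space_N [simp]: "space N = UNIV" by (simp add: N_def density_measure_def)

lemma finite_G: "finite_measure G"
proof (rule finite_measureI)
  have "emeasure G (space G) = (\<integral>\<^sup>+z. ennreal (g z) \<partial>lborel)" by (simp add: G_def emeasure_density)
  also have "\<dots> \<le> (\<integral>\<^sup>+z. ennreal \<Lambda> * indicator (cball (0::phase) R) z \<partial>lborel)"
    using g_le g_support by (intro nn_integral_mono) (auto simp: indicator_def intro!: ennreal_leI)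
  also have "\<dots> = ennreal \<Lambda> * emeasure lborel (cball (0::phase) R)" by (rule nn_integral_cmult_indicator) simp
  also have "\<dots> < \<infinity>" using emeasure_bounded_finite[of "cball (0::phase) R"] by (simp add: ennreal_mult_less_top)
  finally show "emeasure G (space G) \<noteq> \<infinity>" by simp
qed

sublocale G: finite_measure G by (rule finite_G)

lemma g_meas_prod [measurable]: "g \<in> borel_measurable (borel \<Otimes>\<^sub>M borel)"
  using g_meas by (simp only: borel_prod)

definition rmax where "rmax = \<Lambda> * (pi * R\<^sup>2)"

lemma rmax_nonneg: "0 \<le> rmax" by (simp add: rmax_def Lam_nonneg)

lemma section_bound: "(\<integral>\<^sup>+v. ennreal (g (x, v)) \<partial>lborel) \<le> ennreal rmax"
proof -
  have "(\<integral>\<^sup>+v. ennreal (g (x, v)) \<partial>lborel) \<le> (\<integral>\<^sup>+v. ennreal \<Lambda> * indicator (cball (0::plane) R) v \<partial>lborel)"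
    using g_le g_zero by (intro nn_integral_mono) (auto simp: indicator_def intro!: ennreal_leI)
  also have "\<dots> = ennreal \<Lambda> * emeasure lborel (cball (0::plane) R)" by (rule nn_integral_cmult_indicator) simp
  finally show ?thesis using R_pos Lam_nonneg by (simp add: emeasure_plane_cball rmax_def ennreal_mult)
qed

lemma section_integrable: "integrable lborel (\<lambda>v. g (x, v))"
  using section_bound[of x] g_nonneg by (intro integrableI_bounded) (auto simp: le_less_trans[OF _ ennreal_less_top])

lemma ennreal_rho: "ennreal (rho g x) = (\<integral>\<^sup>+v. ennreal (g (x, v)) \<partial>lborel)"
  unfolding rho_def using section_integrable g_nonneg by (intro nn_integral_eq_integral[symmetric]) auto

lemma rho_nonneg: "0 \<le> rho g x" unfolding rho_def using g_nonneg by simp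

lemma rho_le: "rho g x \<le> rmax"
  using section_bound[of x] rmax_nonneg by (simp add: ennreal_rho[symmetric])

lemma rho_meas [measurable]: "rho g \<in> borel_measurable borel"
proof -
  have "(\<lambda>x. \<integral>v. g (x, v) \<partial>lborel) \<in> borel_measurable borel"
    by (rule lborel.borel_measurable_lebesgue_integral) measurable
  then show ?thesis by (simp add: rho_def[abs_def])
qed

lemma nn_integral_N:
  assumes [measurable]: "F \<in> borel_measurable borel"
  shows "(\<integral>\<^sup>+x. F x \<partial>N) = (\<integral>\<^sup>+z. F (fst z) \<partial>G)"
proof -
  have [measurable]: "F \<in> borel_measurable lborel" by simp
  have "(\<integral>\<^sup>+x. F x \<partial>N) = (\<integral>\<^sup>+x. (\<integral>\<^sup>+v. ennreal (g (x, v)) \<partial>lborel) * F x \<partial>lborel)"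
    by (simp add: N_def density_measure_def nn_integral_density ennreal_rho)
  also have "\<dots> = (\<integral>\<^sup>+x. \<integral>\<^sup>+v. ennreal (g (x, v)) * F (fst (x, v)) \<partial>lborel \<partial>lborel)"
    by (simp add: nn_integral_multc)
  also have "\<dots> = (\<integral>\<^sup>+z. ennreal (g z) * F (fst z) \<partial>(lborel \<Otimes>\<^sub>M lborel))"
    by (rule lborel.nn_integral_fst) measurable
  also have "\<dots> = (\<integral>\<^sup>+z. F (fst z) \<partial>G)"
    unfolding lborel_prod G_def by (rule nn_integral_density[symmetric]) auto
  finally show ?thesis .
qed

lemma N_eq_distr: "N = distr G borel fst"
proof (rule measure_eqI)
  fix A assume "A \<in> sets N"
  then have [measurable]: "A \<in> sets borel" by simp
  have "fst -` A \<in> sets (borel :: phase measure)" using measurable_sets[OF borel_measurable_fst_snd(1) \<open>A \<in> sets borel\<close>] by simp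
  have "emeasure N A = (\<integral>\<^sup>+x. indicator A x \<partial>N)" by simp
  also have "\<dots> = (\<integral>\<^sup>+z. indicator A (fst z) \<partial>G)" by (rule nn_integral_N) measurable
  also have "\<dots> = (\<integral>\<^sup>+z. indicator (fst -` A) z \<partial>G)" by (intro nn_integral_cong) (simp add: indicator_def)
  finally show "emeasure N A = emeasure (distr G borel fst) A"
    using \<open>fst -` A \<in> sets borel\<close> by (simp add: emeasure_distr)
qed simp

lemma finite_N: "finite_measure N"
  unfolding N_eq_distr by (rule G.finite_measure_distr) simp

sublocale N: finite_measure N by (rule finite_N)
sublocale NN: pair_sigma_finite N N ..
sublocale GG: pair_sigma_finite G G ..

lemma N_Mplus: "N \<in> Mplus" by (simp add: Mplus_def finite_N)

definition mass where "mass = measure N UNIV"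

lemma mass_G: "measure G UNIV = mass"
  unfolding mass_def N_eq_distr by (simp add: measure_distr)

lemma mass_nonneg: "0 \<le> mass" by (simp add: mass_def)

lemma N_atom: "emeasure N {x} = 0"
proof -
  have "emeasure N {x} = (\<integral>\<^sup>+y. ennreal (rho g y) * indicator {x} y \<partial>lborel)"
    by (simp add: N_def density_measure_def emeasure_density)
  also have "\<dots> = (\<integral>\<^sup>+y. 0 \<partial>(lborel :: plane measure))"
    using AE_lborel_singleton[of x] by (intro nn_integral_cong_AE) (auto simp: indicator_def)
  finally show ?thesis by simp
qed

lemma AE_G: "AE z in G. norm z \<le> R"
proof -
  have "0 < g z \<Longrightarrow> norm z \<le> R" for z using g_support[of z] by (cases "norm z \<le> R") auto
  then show ?thesis unfolding G_def by (subst AE_density) auto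
qed

lemma AE_N: "AE x in N. norm x \<le> R"
  unfolding N_eq_distr by (subst AE_distr_iff) (use AE_G in \<open>auto elim!: eventually_mono intro: order_trans[OF norm_fst_le]\<close>)

lemma integral_G: "p \<in> borel_measurable borel \<Longrightarrow> (\<integral>z. p z * g z \<partial>lborel) = (\<integral>z. p z \<partial>G)"
  unfolding G_def using g_nonneg by (subst integral_real_density) (auto simp: mult.commute)

lemma integral_N: "\<phi> \<in> borel_measurable borel \<Longrightarrow> (\<integral>x. \<phi> x \<partial>N) = (\<integral>z. (\<phi> (fst z) :: real) \<partial>G)"
  unfolding N_eq_distr by (rule integral_distr) auto

lemma G_integrable:
  fixes p :: "phase \<Rightarrow> real"
  assumes "p \<in> borel_measurable borel" "\<And>z. norm z \<le> R \<Longrightarrow> \<bar>p z\<bar> \<le> B" shows "integrable G p"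
  by (rule G.integrable_const_bound[of _ B]) (use AE_G assms in \<open>auto elim!: eventually_mono\<close>)

lemma N_integrable:
  fixes p :: "plane \<Rightarrow> real"
  assumes "p \<in> borel_measurable borel" "\<And>z. norm z \<le> R \<Longrightarrow> \<bar>p z\<bar> \<le> B" shows "integrable N p"
  by (rule N.integrable_const_bound[of _ B]) (use AE_N assms in \<open>auto elim!: eventually_mono\<close>)

definition mom where "mom = (\<integral>x. (norm x)\<^sup>2 \<partial>N)"
text \<open>Twice the kinetic energy.\<close>

definition kin where "kin = (\<integral>z. (norm (snd z))\<^sup>2 \<partial>G)"

lemma mom_nonneg: "0 \<le> mom" by (simp add: mom_def)
lemma kin_nonneg: "0 \<le> kin" by (simp add: kin_def)

lemma snd_le: "norm (z::phase) \<le> R \<Longrightarrow> norm (snd z) \<le> R" "norm (z::phase) \<le> R \<Longrightarrow> norm (fst z) \<le> R"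
proof -
  show "norm (snd z) \<le> R" if "norm z \<le> R" using that norm_snd_le[of "snd z" "fst z"] by simp
  show "norm (fst z) \<le> R" if "norm z \<le> R" using that norm_fst_le[of "fst z" "snd z"] by simp
qed

lemma integrable_norm_square: "integrable N (\<lambda>x. (norm x)\<^sup>2)" "integrable G (\<lambda>z. (norm (snd z))\<^sup>2)"
  "integrable G (\<lambda>z. (norm (fst z))\<^sup>2)"
  using snd_le by (auto intro!: N_integrable[of _ "R\<^sup>2"] G_integrable[of _ "R\<^sup>2"] power_mono)

lemma nn_integral_mom: "(\<integral>\<^sup>+x. ennreal ((norm x)\<^sup>2) \<partial>N) = ennreal mom"
  unfolding mom_def by (rule nn_integral_eq_integral[OF integrable_norm_square(1)]) auto

lemma nn_integral_kin: "(\<integral>\<^sup>+z. ennreal ((norm (snd z))\<^sup>2) \<partial>G) = ennreal kin"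
  unfolding kin_def by (rule nn_integral_eq_integral[OF integrable_norm_square(2)]) auto

text \<open>A crude bound for the field that depends on the support radius. It serves integrability
  and Fubini only, not the uniform estimates.\<close>

definition Ksup where "Ksup = 2 * pi * rmax + mass"

lemma Ksup_nonneg: "0 \<le> Ksup" by (simp add: Ksup_def rmax_nonneg mass_nonneg)

lemma kernel_bound: "(\<integral>\<^sup>+y. ennreal (1 / norm (x - y)) \<partial>N) \<le> ennreal Ksup"
proof -
  have "(\<integral>\<^sup>+y. ennreal (1 / norm (x - y)) \<partial>N) \<le> (\<integral>\<^sup>+y. (if norm (x - y) < 1 then ennreal (1 / norm (x - y)) else 0) + 1 \<partial>N)"
  proof (intro nn_integral_mono)
    fix y
    show "ennreal (1 / norm (x - y)) \<le> (if norm (x - y) < 1 then ennreal (1 / norm (x - y)) else 0) + 1"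
    proof (cases "norm (x - y) < 1")
      case False
      then have "1 / norm (x - y) \<le> 1" by (simp add: divide_le_eq)
      then show ?thesis using False by (simp add: ennreal_le_1)
    qed (simp add: add_increasing2)
  qed
  also have "\<dots> = (\<integral>\<^sup>+y. (if norm (x - y) < 1 then ennreal (1 / norm (x - y)) else 0) \<partial>N) + (\<integral>\<^sup>+y. 1 \<partial>N)"
    by (rule nn_integral_add) auto
  also have "(\<integral>\<^sup>+y. 1 \<partial>N) = ennreal mass" by (simp add: mass_def N.emeasure_eq_measure)
  also have "(\<integral>\<^sup>+y. (if norm (x - y) < 1 then ennreal (1 / norm (x - y)) else 0) \<partial>N)
     = (\<integral>\<^sup>+y. ennreal (rho g y) * (if norm (x - y) < 1 then ennreal (1 / norm (x - y)) else 0) \<partial>lborel)"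
    unfolding N_def density_measure_def by (rule nn_integral_density) auto
  also have "\<dots> \<le> (\<integral>\<^sup>+y. ennreal rmax * (if norm (x - y) < 1 then ennreal (1 / norm (x - y)) else 0) \<partial>lborel)"
    using rho_le by (intro nn_integral_mono mult_right_mono ennreal_leI) auto
  also have "\<dots> = ennreal rmax * (\<integral>\<^sup>+y. (if norm (x - y) < 1 then ennreal (1 / norm (x - y)) else 0) \<partial>lborel)"
    by (rule nn_integral_cmult) auto
  also have "\<dots> \<le> ennreal rmax * ennreal (2 * pi * 1)"
    by (intro mult_left_mono nn_integral_inverse_distance_ball) auto
  also have "ennreal rmax * ennreal (2 * pi * 1) + ennreal mass = ennreal Ksup"
    using rmax_nonneg mass_nonneg by (simp add: Ksup_def ennreal_mult[symmetric] ennreal_plus[symmetric] mult_ac del: ennreal_plus)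
  finally show ?thesis by (simp add: add_right_mono)
qed

lemma kernel_integrable: "integrable N (\<lambda>y. 1 / norm (x - y))" "integrable N (\<lambda>y. biot (x - y))"
  using kernel_bound[of x] by (auto intro!: integrableI_bounded simp: norm_biot le_less_trans[OF _ ennreal_less_top])

lemma kernel_integral_le: "(\<integral>y. 1 / norm (x - y) \<partial>N) \<le> Ksup"
  using kernel_bound[of x] Ksup_nonneg by (simp add: nn_integral_eq_integral[OF kernel_integrable(1)])

lemma E_field_eq: "E_field (rho g) x = (\<integral>y. biot (x - y) \<partial>N)"
proof -
  have "(\<integral>y. biot (x - y) \<partial>N) = (\<integral>y. rho g y *\<^sub>R biot (x - y) \<partial>lborel)"
    unfolding N_def density_measure_def by (rule integral_density) (auto simp: rho_nonneg)
  then show ?thesis by (simp add: E_field_def biot_def)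
qed

lemma E_field_le: "norm (E_field (rho g) x) \<le> (\<integral>y. 1 / norm (x - y) \<partial>N)"
  unfolding E_field_eq using integral_norm_bound[of N "\<lambda>y. biot (x - y)"] by (simp add: norm_biot)

lemma E_field_bounded: "norm (E_field (rho g) x) \<le> Ksup"
  using E_field_le kernel_integral_le order_trans by blast

lemma E_field_meas [measurable]: "E_field (rho g) \<in> borel_measurable borel"
proof -
  have "(\<lambda>x. \<integral>y. biot (x - y) \<partial>N) \<in> borel_measurable borel"
    by (rule N.borel_measurable_lebesgue_integral) measurable
  then show ?thesis by (simp add: E_field_eq[abs_def])
qed

lemma sets_NN [measurable_cong]: "sets (N \<Otimes>\<^sub>M N) = sets borel" by (rule Mplus_pair(2)[OF N_Mplus])

lemma finite_NN: "finite_measure (N \<Otimes>\<^sub>M N)" by (rule Mplus_pair(1)[OF N_Mplus])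
sublocale NNf: finite_measure "N \<Otimes>\<^sub>M N" by (rule finite_NN)

lemma NN_kernel_integrable: "integrable (N \<Otimes>\<^sub>M N) (\<lambda>p. 1 / norm (fst p - snd p))"
proof (rule integrableI_bounded)
  have "(\<integral>\<^sup>+p. ennreal (norm (1 / norm (fst p - snd p))) \<partial>(N \<Otimes>\<^sub>M N)) = (\<integral>\<^sup>+x. \<integral>\<^sup>+y. ennreal (1 / norm (x - y)) \<partial>N \<partial>N)"
    by (subst N.nn_integral_fst[symmetric]) auto
  also have "\<dots> \<le> (\<integral>\<^sup>+x. ennreal Ksup \<partial>N)" by (intro nn_integral_mono kernel_bound)
  also have "\<dots> < \<infinity>" by (simp add: N.emeasure_eq_measure ennreal_mult_less_top)
  finally show "(\<integral>\<^sup>+p. ennreal (norm (1 / norm (fst p - snd p))) \<partial>(N \<Otimes>\<^sub>M N)) < \<infinity>" .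
qed auto

lemma AE_NN: "AE p in N \<Otimes>\<^sub>M N. norm (fst p) \<le> R \<and> norm (snd p) \<le> R \<and> fst p \<noteq> snd p"
proof (rule NN.AE_pair_measure)
  show "{p \<in> space (N \<Otimes>\<^sub>M N). norm (fst p) \<le> R \<and> norm (snd p) \<le> R \<and> fst p \<noteq> snd p} \<in> sets (N \<Otimes>\<^sub>M N)"
  proof -
    have [measurable]: "{p::phase. fst p \<noteq> snd p} \<in> sets borel"
      by (intro borel_open open_Collect_neq continuous_intros)
    have "{p. norm (fst p) \<le> R \<and> norm (snd p) \<le> R} \<inter> {p::phase. fst p \<noteq> snd p} \<in> sets borel" by measurable
    then show ?thesis unfolding sets_NN Mplus_pair(3)[OF N_Mplus] by (simp add: Int_def conj_assoc)
  qed
  show "AE x in N. AE y in N. norm (fst (x, y)) \<le> R \<and> norm (snd (x, y)) \<le> R \<and> fst (x, y) \<noteq> snd (x, y)"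
    using AE_N
  proof eventually_elim
    fix x :: plane assume x: "norm x \<le> R"
    have "AE y in N. y \<noteq> x" using N_atom[of x] by (intro AE_I[where N="{x}"]) auto
    with AE_N show "AE y in N. norm (fst (x, y)) \<le> R \<and> norm (snd (x, y)) \<le> R \<and> fst (x, y) \<noteq> snd (x, y)"
      by eventually_elim (use x in auto)
  qed
qed

lemma NN_log_integrable:
  "integrable (N \<Otimes>\<^sub>M N) (\<lambda>p. lnm (norm (fst p - snd p)))" "integrable (N \<Otimes>\<^sub>M N) (\<lambda>p. lnp (norm (fst p - snd p)))"
proof -
  show "integrable (N \<Otimes>\<^sub>M N) (\<lambda>p. lnm (norm (fst p - snd p)))"
    by (rule Bochner_Integration.integrable_bound[OF NN_kernel_integrable]) (auto simp: lnm_nonneg lnm_le)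
  have "AE p in N \<Otimes>\<^sub>M N. norm (lnp (norm (fst p - snd p))) \<le> R\<^sup>2 + R\<^sup>2"
    using AE_NN
  proof eventually_elim
    fix p :: phase assume "norm (fst p) \<le> R \<and> norm (snd p) \<le> R \<and> fst p \<noteq> snd p"
    then have "(norm (fst p))\<^sup>2 \<le> R\<^sup>2" "(norm (snd p))\<^sup>2 \<le> R\<^sup>2" by (auto intro: power_mono)
    then show "norm (lnp (norm (fst p - snd p))) \<le> R\<^sup>2 + R\<^sup>2"
      using lnp_norm_le[of "fst p" "snd p"] by (simp add: lnp_def)
  qed
  then show "integrable (N \<Otimes>\<^sub>M N) (\<lambda>p. lnp (norm (fst p - snd p)))" by (rule NNf.integrable_const_bound) auto
qed

text \<open>The quantity J of the overview.\<close>

definition Lpot where "Lpot = (\<integral>p. lnm (norm (fst p - snd p)) \<partial>(N \<Otimes>\<^sub>M N))"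

lemma Lpot_nonneg: "0 \<le> Lpot" by (simp add: Lpot_def lnm_nonneg)

lemma NN_eq_density: "N \<Otimes>\<^sub>M N = density lborel (\<lambda>p. ennreal (rho g (fst p) * rho g (snd p)))"
proof -
  have "N \<Otimes>\<^sub>M N = density (lborel \<Otimes>\<^sub>M lborel) (\<lambda>(x, y). ennreal (rho g x) * ennreal (rho g y))"
    unfolding N_def density_measure_def
    by (rule pair_measure_density)
       (use N.sigma_finite_measure_axioms sigma_finite_lborel in \<open>auto simp: N_def density_measure_def\<close>)
  then show ?thesis by (simp add: lborel_prod ennreal_mult rho_nonneg split_beta')
qed

lemma energy_eq: "energy g = kin / 2 - (\<integral>p. ln (norm (fst p - snd p)) \<partial>(N \<Otimes>\<^sub>M N)) / 2"
proof -
  have "(\<integral>p. ln (norm (fst p - snd p)) \<partial>(N \<Otimes>\<^sub>M N)) = (\<integral>p. (rho g (fst p) * rho g (snd p)) *\<^sub>R ln (norm (fst p - snd p)) \<partial>lborel)"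
    unfolding NN_eq_density by (rule integral_density) (auto simp: rho_nonneg)
  then show ?thesis unfolding energy_def kin_def
    by (subst integral_G) (auto simp: mult_ac)
qed

text \<open>The logarithm enters the energy with a minus sign: its negative part contributes +
  \<open>Lpot\<close> / 2, and only its positive part has the wrong sign, which
  \<open>lnp_norm_le\<close> bounds by moments.\<close>

lemma energy_bound: "kin / 2 + Lpot / 2 \<le> energy g + mass * mom"
proof -
  have "(\<integral>p. ln (norm (fst p - snd p)) \<partial>(N \<Otimes>\<^sub>M N)) = (\<integral>p. lnp (norm (fst p - snd p)) \<partial>(N \<Otimes>\<^sub>M N)) - Lpot"
    unfolding Lpot_def ln_eq_lnp_lnm using NN_log_integrable by simp
  moreover have "(\<integral>p. lnp (norm (fst p - snd p)) \<partial>(N \<Otimes>\<^sub>M N)) \<le> 2 * (mass * mom)"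
  proof -
    have sq: "integrable (N \<Otimes>\<^sub>M N) (\<lambda>p. (norm (fst p))\<^sup>2 + (norm (snd p))\<^sup>2)"
    proof (rule NNf.integrable_const_bound[where B="R\<^sup>2 + R\<^sup>2"])
      show "AE p in N \<Otimes>\<^sub>M N. norm ((norm (fst p))\<^sup>2 + (norm (snd p))\<^sup>2) \<le> R\<^sup>2 + R\<^sup>2"
        using AE_NN
      proof eventually_elim
        fix p :: phase assume "norm (fst p) \<le> R \<and> norm (snd p) \<le> R \<and> fst p \<noteq> snd p"
        then have "(norm (fst p))\<^sup>2 \<le> R\<^sup>2" "(norm (snd p))\<^sup>2 \<le> R\<^sup>2" by (auto intro: power_mono)
        then show "norm ((norm (fst p))\<^sup>2 + (norm (snd p))\<^sup>2) \<le> R\<^sup>2 + R\<^sup>2" by simp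
      qed
    qed auto
    have "(\<integral>p. lnp (norm (fst p - snd p)) \<partial>(N \<Otimes>\<^sub>M N)) \<le> (\<integral>p. (norm (fst p))\<^sup>2 + (norm (snd p))\<^sup>2 \<partial>(N \<Otimes>\<^sub>M N))"
      by (rule integral_mono[OF NN_log_integrable(2) sq lnp_norm_le])
    also have "\<dots> = (\<integral>x. \<integral>y. (norm x)\<^sup>2 + (norm y)\<^sup>2 \<partial>N \<partial>N)"
      using NN.integral_fst'[OF sq] by simp
    also have "\<dots> = (\<integral>x. mass * (norm x)\<^sup>2 + mom \<partial>N)"
      using integrable_norm_square(1) by (simp add: mom_def mass_def mult.commute)
    also have "\<dots> = 2 * (mass * mom)"
      using integrable_norm_square(1) by (simp add: mom_def mass_def)
    finally show ?thesis .
  qed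
  ultimately show ?thesis unfolding energy_eq by linarith
qed

lemma log_double_integral: "(\<integral>\<^sup>+x. \<integral>\<^sup>+y. ennreal (1 + lnm (norm (x - y))) \<partial>N \<partial>N) = ennreal (mass\<^sup>2 + Lpot)"
proof -
  have i: "integrable (N \<Otimes>\<^sub>M N) (\<lambda>p. 1 + lnm (norm (fst p - snd p)))" using NN_log_integrable(1) by simp
  have "(\<integral>\<^sup>+x. \<integral>\<^sup>+y. ennreal (1 + lnm (norm (x - y))) \<partial>N \<partial>N) = (\<integral>\<^sup>+p. ennreal (1 + lnm (norm (fst p - snd p))) \<partial>(N \<Otimes>\<^sub>M N))"
    by (subst N.nn_integral_fst[symmetric]) auto
  also have "\<dots> = ennreal (\<integral>p. 1 + lnm (norm (fst p - snd p)) \<partial>(N \<Otimes>\<^sub>M N))"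
    by (rule nn_integral_eq_integral[OF i]) (simp add: lnm_nonneg)
  also have "(\<integral>p. 1 + lnm (norm (fst p - snd p)) \<partial>(N \<Otimes>\<^sub>M N)) = mass\<^sup>2 + Lpot"
    using NN_log_integrable(1) Mplus_pair(3,4)[OF N_Mplus] by (simp add: Lpot_def mass_def)
  finally show ?thesis .
qed

text \<open>Chebyshev's inequality for the logarithm, which is at least ln (1/d) in the strip. The
  diagonal itself, where \<open>lnm\<close> is 0, has to be discarded as a null set.\<close>

lemma concentration:
  assumes d: "0 < d" "d < 1"
  shows "measure (N \<Otimes>\<^sub>M N) {p. norm (fst p - snd p) < d} \<le> Lpot / ln (1 / d)"
proof -
  have ld: "ln (1 / d) > 0" using d by simp
  define D where "D = {p::phase. norm (fst p - snd p) < d}"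
  have Ds: "D \<in> sets (N \<Otimes>\<^sub>M N)" unfolding D_def sets_NN
    by (intro borel_open open_Collect_less continuous_intros)
  have "ln (1 / d) * measure (N \<Otimes>\<^sub>M N) D = (\<integral>p. ln (1 / d) * indicator D p \<partial>(N \<Otimes>\<^sub>M N))"
    using Ds by simp
  also have "\<dots> \<le> Lpot" unfolding Lpot_def
  proof (rule integral_mono_AE[OF _ NN_log_integrable(1)])
    show "integrable (N \<Otimes>\<^sub>M N) (\<lambda>p. ln (1 / d) * indicator D p)" using Ds by (simp add: NNf.emeasure_eq_measure)
    show "AE p in N \<Otimes>\<^sub>M N. ln (1 / d) * indicator D p \<le> lnm (norm (fst p - snd p))"
      using AE_NN
    proof eventually_elim
      fix p :: phase assume "norm (fst p) \<le> R \<and> norm (snd p) \<le> R \<and> fst p \<noteq> snd p"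
      then have pos: "norm (fst p - snd p) > 0" by simp
      show "ln (1 / d) * indicator D p \<le> lnm (norm (fst p - snd p))"
      proof (cases "p \<in> D")
        case True
        then have "ln (norm (fst p - snd p)) \<le> ln d" using pos d by (simp add: D_def)
        then show ?thesis using True d by (simp add: lnm_def ln_div)
      qed (simp add: lnm_nonneg)
    qed
  qed
  finally show ?thesis using ld by (simp add: D_def field_simps)
qed

text \<open>The velocity u ranges over a disc of area pi |v|^2 on which g \<le> \<Lambda>, and the
  integral of 1/|x - y| over a disc of radius r is at most 2 pi r. With r = 1 / (S (1 + |v|)) one
  has \<Lambda> |v| r \<le> S^2 / S = S, which leaves only |v|^2, that is, kinetic energy.\<close>

lemma near_bound:
  assumes S: "S > 0" "\<Lambda> \<le> S\<^sup>2"
  shows "(\<integral>\<^sup>+w. (if norm (snd w) \<le> norm v \<and> S * norm (x - fst w) * (1 + norm v) < 1 then ennreal (norm v / norm (x - fst w)) else 0) \<partial>G)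
    \<le> ennreal (2 * pi\<^sup>2 * S * (norm v)\<^sup>2)"
proof -
  define r where "r = 1 / (S * (1 + norm v))"
  have v1: "1 + norm v > 0" by (simp add: add_pos_nonneg)
  have r: "r > 0" using S v1 by (simp add: r_def)
  have eq: "S * norm (x - y) * (1 + norm v) < 1 \<longleftrightarrow> norm (x - y) < r" for y
    unfolding r_def by (subst pos_less_divide_eq) (use S v1 in \<open>auto simp: mult_ac\<close>)
  have "(\<integral>\<^sup>+w. (if norm (snd w :: plane) \<le> norm v \<and> norm (x - fst w) < r then ennreal (norm v / norm (x - fst w)) else 0) \<partial>G)
    = (\<integral>\<^sup>+w. ennreal (g w) * (if norm (snd w :: plane) \<le> norm v \<and> norm (x - fst w) < r then ennreal (norm v / norm (x - fst w)) else 0) \<partial>lborel)"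
    unfolding G_def by (rule nn_integral_density) measurable
  also have "\<dots> \<le> (\<integral>\<^sup>+w. ennreal \<Lambda> * (if norm (snd w :: plane) \<le> norm v \<and> norm (x - fst w) < r then ennreal (norm v / norm (x - fst w)) else 0) \<partial>lborel)"
    using g_le by (intro nn_integral_mono mult_right_mono ennreal_leI) auto
  also have "\<dots> = (\<integral>\<^sup>+w. ennreal \<Lambda> * (if norm (snd w :: plane) \<le> norm v \<and> norm (x - fst w) < r then ennreal (norm v / norm (x - fst w)) else 0) \<partial>(lborel \<Otimes>\<^sub>M lborel))"
    by (simp add: lborel_prod)
  also have "\<dots> = (\<integral>\<^sup>+y. \<integral>\<^sup>+u. ennreal \<Lambda> * (if norm (u :: plane) \<le> norm v \<and> norm (x - y) < r then ennreal (norm v / norm (x - y)) else 0) \<partial>lborel \<partial>lborel)"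
    by (subst lborel.nn_integral_fst[symmetric]) (measurable, simp only: fst_conv snd_conv)
  also have "\<dots> = (\<integral>\<^sup>+y. ennreal (\<Lambda> * norm v * (pi * (norm v)\<^sup>2)) * (if norm (x - y) < r then ennreal (1 / norm (x - y)) else 0) \<partial>lborel)"
  proof (rule nn_integral_cong)
    fix y
    have "(\<integral>\<^sup>+u. ennreal \<Lambda> * (if norm (u :: plane) \<le> norm v \<and> norm (x - y) < r then ennreal (norm v / norm (x - y)) else 0) \<partial>lborel)
      = (\<integral>\<^sup>+u. (ennreal (\<Lambda> * norm v) * (if norm (x - y) < r then ennreal (1 / norm (x - y)) else 0)) * indicator (cball (0::plane) (norm v)) u \<partial>lborel)"
      using Lam_nonneg by (intro nn_integral_cong) (auto simp: indicator_def ennreal_mult[symmetric])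
    also have "\<dots> = (ennreal (\<Lambda> * norm v) * (if norm (x - y) < r then ennreal (1 / norm (x - y)) else 0)) * ennreal (pi * (norm v)\<^sup>2)"
      by (subst nn_integral_cmult_indicator) (auto simp: emeasure_plane_cball)
    finally show "(\<integral>\<^sup>+u. ennreal \<Lambda> * (if norm (u :: plane) \<le> norm v \<and> norm (x - y) < r then ennreal (norm v / norm (x - y)) else 0) \<partial>lborel)
      = ennreal (\<Lambda> * norm v * (pi * (norm v)\<^sup>2)) * (if norm (x - y) < r then ennreal (1 / norm (x - y)) else 0)"
      using Lam_nonneg by (simp add: ennreal_mult mult_ac)
  qed
  also have "\<dots> = ennreal (\<Lambda> * norm v * (pi * (norm v)\<^sup>2)) * (\<integral>\<^sup>+y. (if norm (x - y) < r then ennreal (1 / norm (x - y)) else 0) \<partial>lborel)"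
    by (rule nn_integral_cmult) measurable
  also have "\<dots> \<le> ennreal (\<Lambda> * norm v * (pi * (norm v)\<^sup>2)) * ennreal (2 * pi * r)"
    by (intro mult_left_mono nn_integral_inverse_distance_ball r) auto
  also have "\<dots> = ennreal (\<Lambda> * norm v * (pi * (norm v)\<^sup>2) * (2 * pi * r))"
    using Lam_nonneg r by (simp add: ennreal_mult)
  also have "\<dots> \<le> ennreal (2 * pi\<^sup>2 * S * (norm v)\<^sup>2)"
  proof (rule ennreal_leI)
    have "norm v / (1 + norm v) \<le> 1" using v1 by (subst pos_divide_le_eq) auto
    then have "norm v / (1 + norm v) * (1 / S) \<le> 1 * (1 / S)" using S by (intro mult_right_mono) auto
    moreover have "norm v * r = norm v / (1 + norm v) * (1 / S)" by (simp add: r_def mult.commute)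
    ultimately have "norm v * r \<le> 1 / S" by simp
    then have "\<Lambda> * (norm v * r) \<le> S\<^sup>2 * (1 / S)" using S Lam_nonneg r by (intro mult_mono) auto
    then have "\<Lambda> * (norm v * r) \<le> S" using S by (simp add: power2_eq_square)
    then have "(\<Lambda> * (norm v * r)) * (2 * pi\<^sup>2 * (norm v)\<^sup>2) \<le> S * (2 * pi\<^sup>2 * (norm v)\<^sup>2)" by (intro mult_right_mono) auto
    then show "\<Lambda> * norm v * (pi * (norm v)\<^sup>2) * (2 * pi * r) \<le> 2 * pi\<^sup>2 * S * (norm v)\<^sup>2"
      by (simp add: mult_ac power2_eq_square)
  qed
  finally show ?thesis by (simp only: eq)
qed

text \<open>The first two terms come from integrating 1 + 3 |v|^2 + |w|^2 over pairs, the last from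
  two copies of the near part, 2 pi^2 \<open>kin\<close> each.\<close>

definition drift where "drift = mass\<^sup>2 + 4 * mass * kin + 4 * pi\<^sup>2 * kin"

text \<open>Here a and b are the speeds of two particles at distance d. Far pairs, with S d (1 + max
  a b) \<ge> 1, satisfy 1/d \<le> S (1 + max a b), which costs only squares of speeds. Near pairs
  are charged to the faster particle, a/d \<le> b/d if b > a, so that the slower velocity is the one
  integrated over, as \<open>near_bound\<close> requires.\<close>

lemma kernel_splitting:
  fixes a b d S :: real
  assumes "0 \<le> a" "0 \<le> b" "0 \<le> d" "S > 0"
  shows "a / d \<le> S * (1 + 3 * a\<^sup>2 + b\<^sup>2) + ((if b \<le> a \<and> S * d * (1 + a) < 1 then a / d else 0) + (if a \<le> b \<and> S * d * (1 + b) < 1 then b / d else 0))"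
proof (cases "S * d * (1 + max a b) < 1")
  case True
  show ?thesis
  proof (cases "b \<le> a")
    case True
    then have "S * d * (1 + a) < 1" using \<open>S * d * (1 + max a b) < 1\<close> by (simp add: max_def split: if_splits)
    then show ?thesis using True assms by simp
  next
    case False
    then have "S * d * (1 + b) < 1" using \<open>S * d * (1 + max a b) < 1\<close> by (simp add: max_def split: if_splits)
    moreover have "a / d \<le> b / d" using False assms by (intro divide_right_mono) auto
    moreover have "0 \<le> S * (1 + 3 * a\<^sup>2 + b\<^sup>2)" using assms by simp
    ultimately show ?thesis using False by simp
  qed
next
  case False
  have "a / d \<le> S * (1 + 3 * a\<^sup>2 + b\<^sup>2)"
  proof (cases "d = 0")
    case False
    then have "d > 0" using assms by simp
    have "1 \<le> S * d * (1 + max a b)" using \<open>\<not> S * d * (1 + max a b) < 1\<close> by simp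
    then have "a * 1 \<le> a * (S * d * (1 + max a b))" using assms by (intro mult_left_mono) auto
    then have "a / d \<le> S * (a * (1 + max a b))" using \<open>d > 0\<close> by (simp add: field_simps)
    \<comment> \<open>Young's inequality: a \<le> 1 + a^2 and a max(a, b) \<le> 2 a^2 + b^2.\<close>
    also have "a * (1 + max a b) \<le> 1 + 3 * a\<^sup>2 + b\<^sup>2"
    proof -
      have "a \<le> 1 + a\<^sup>2" using zero_le_power2[of "a - 1/2"] by (simp add: power2_diff power_divide)
      moreover have "a * max a b \<le> a\<^sup>2 + (a\<^sup>2 + b\<^sup>2)"
      proof (cases "a \<le> b")
        case True
        have "0 \<le> a * b" using assms by simp
        then have "a * b \<le> a\<^sup>2 + b\<^sup>2" using sum_squares_bound[of a b] by linarith
        moreover have "0 \<le> a\<^sup>2" by simp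
        ultimately have "a * b \<le> a\<^sup>2 + (a\<^sup>2 + b\<^sup>2)" by linarith
        then show ?thesis using True by (simp only: max_def if_True)
      qed (simp add: max_def power2_eq_square)
      ultimately show ?thesis by (simp add: distrib_left)
    qed
    finally show ?thesis using assms by (simp add: mult_left_mono)
  qed (use assms in simp)
  moreover have "0 \<le> (if b \<le> a \<and> S * d * (1 + a) < 1 then a / d else 0) + (if a \<le> b \<and> S * d * (1 + b) < 1 then b / d else 0)"
    using assms by simp
  ultimately show ?thesis by linarith
qed

lemma drift_bound:
  assumes S: "S > 0" "\<Lambda> \<le> S\<^sup>2"
  shows "(\<integral>\<^sup>+z. \<integral>\<^sup>+w. ennreal (norm (snd z) / norm (fst z - fst w)) \<partial>G \<partial>G) \<le> ennreal (S * drift)"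
proof -
  define P where "P z w = (if norm (snd w) \<le> norm (snd z) \<and> S * norm (fst z - fst w) * (1 + norm (snd z)) < 1
     then ennreal (norm (snd z) / norm (fst z - fst w)) else 0)" for z w :: phase
  have [measurable]: "(\<lambda>(z, w). P z w) \<in> borel_measurable (borel \<Otimes>\<^sub>M borel)" unfolding P_def by measurable
  define F where "F z w = ennreal (S * (1 + 3 * (norm (snd z))\<^sup>2 + (norm (snd w))\<^sup>2))" for z w :: phase
  have [measurable]: "(\<lambda>(z, w). F z w) \<in> borel_measurable (borel \<Otimes>\<^sub>M borel)" unfolding F_def by measurable
  have "(\<integral>\<^sup>+z. \<integral>\<^sup>+w. ennreal (norm (snd z) / norm (fst z - fst w)) \<partial>G \<partial>G) \<le> (\<integral>\<^sup>+z. \<integral>\<^sup>+w. F z w + (P z w + P w z) \<partial>G \<partial>G)"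
  proof (intro nn_integral_mono)
    fix z w :: phase
    show "ennreal (norm (snd z) / norm (fst z - fst w)) \<le> F z w + (P z w + P w z)"
      using ennreal_leI[OF kernel_splitting[of "norm (snd z)" "norm (snd w)" "norm (fst z - fst w)" S]] S
      by (auto simp: F_def P_def norm_minus_commute[of "fst w" "fst z"] ennreal_plus[symmetric] simp del: ennreal_plus split: if_splits)
  qed
  also have "\<dots> = (\<integral>\<^sup>+z. (\<integral>\<^sup>+w. F z w \<partial>G) + ((\<integral>\<^sup>+w. P z w \<partial>G) + (\<integral>\<^sup>+w. P w z \<partial>G)) \<partial>G)"
    by (intro nn_integral_cong) (simp add: nn_integral_add)
  also have "\<dots> = (\<integral>\<^sup>+z. \<integral>\<^sup>+w. F z w \<partial>G \<partial>G) + ((\<integral>\<^sup>+z. \<integral>\<^sup>+w. P z w \<partial>G \<partial>G) + (\<integral>\<^sup>+z. \<integral>\<^sup>+w. P w z \<partial>G \<partial>G))"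
    by (simp add: nn_integral_add)
  \<comment> \<open>The near terms for the two particles are exchanged by Tonelli, so one estimate
    serves both.\<close>
  also have "(\<integral>\<^sup>+z. \<integral>\<^sup>+w. P w z \<partial>G \<partial>G) = (\<integral>\<^sup>+z. \<integral>\<^sup>+w. P z w \<partial>G \<partial>G)"
    by (rule nn_integral_swap[OF G.sigma_finite_measure_axioms G.sigma_finite_measure_axioms]) measurable
  also have Pb: "(\<integral>\<^sup>+z. \<integral>\<^sup>+w. P z w \<partial>G \<partial>G) \<le> ennreal (2 * pi\<^sup>2 * S * kin)"
  proof -
    have "(\<integral>\<^sup>+z. \<integral>\<^sup>+w. P z w \<partial>G \<partial>G) \<le> (\<integral>\<^sup>+z. ennreal (2 * pi\<^sup>2 * S) * ennreal ((norm (snd z))\<^sup>2) \<partial>G)"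
    proof (rule nn_integral_mono)
      fix z :: phase
      show "(\<integral>\<^sup>+w. P z w \<partial>G) \<le> ennreal (2 * pi\<^sup>2 * S) * ennreal ((norm (snd z))\<^sup>2)"
        unfolding P_def using near_bound[OF S, of "snd z" "fst z"] S by (simp add: ennreal_mult)
    qed
    also have "\<dots> = ennreal (2 * pi\<^sup>2 * S) * ennreal kin"
      by (subst nn_integral_cmult) (auto simp: nn_integral_kin)
    finally show ?thesis using S kin_nonneg by (simp add: ennreal_mult)
  qed
  also have "(\<integral>\<^sup>+z. \<integral>\<^sup>+w. F z w \<partial>G \<partial>G) = ennreal (S * (mass\<^sup>2 + 4 * mass * kin))"
  proof -
    have "(\<integral>\<^sup>+w. F z w \<partial>G) = ennreal (S * (mass * (1 + 3 * (norm (snd z))\<^sup>2) + kin))" for z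
    proof -
      have "(\<integral>\<^sup>+w. F z w \<partial>G) = ennreal (\<integral>w. S * ((1 + 3 * (norm (snd z))\<^sup>2) + (norm (snd w))\<^sup>2) \<partial>G)"
        unfolding F_def using integrable_norm_square(2) S by (subst nn_integral_eq_integral) (auto simp: add.assoc)
      also have "(\<integral>w. S * ((1 + 3 * (norm (snd z))\<^sup>2) + (norm (snd w))\<^sup>2) \<partial>G) = S * (mass * (1 + 3 * (norm (snd z))\<^sup>2) + kin)"
        using integrable_norm_square(2) by (simp add: kin_def mass_G)
      finally show ?thesis .
    qed
    then have "(\<integral>\<^sup>+z. \<integral>\<^sup>+w. F z w \<partial>G \<partial>G) = (\<integral>\<^sup>+z. ennreal (S * (mass * (1 + 3 * (norm (snd z))\<^sup>2) + kin)) \<partial>G)" by simp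
    also have "\<dots> = ennreal (\<integral>z. S * (mass * (1 + 3 * (norm (snd z))\<^sup>2) + kin) \<partial>G)"
      using integrable_norm_square(2) S mass_nonneg kin_nonneg by (subst nn_integral_eq_integral) auto
    also have "(\<integral>z. S * (mass * (1 + 3 * (norm (snd z))\<^sup>2) + kin) \<partial>G) = S * (mass\<^sup>2 + 4 * mass * kin)"
    proof -
      have k: "(\<integral>z. (norm (snd z))\<^sup>2 \<partial>G) = kin" by (simp add: kin_def)
      have "(\<integral>z. S * (mass * (1 + 3 * (norm (snd z))\<^sup>2) + kin) \<partial>G) = S * (mass * (mass + 3 * kin) + mass * kin)"
        using integrable_norm_square(2) by (simp add: mass_G k)
      then show ?thesis by (simp add: power2_eq_square algebra_simps)
    qed
    finally show ?thesis .
  qed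
  finally have "(\<integral>\<^sup>+z. \<integral>\<^sup>+w. ennreal (norm (snd z) / norm (fst z - fst w)) \<partial>G \<partial>G)
    \<le> ennreal (S * (mass\<^sup>2 + 4 * mass * kin)) + (ennreal (2 * pi\<^sup>2 * S * kin) + ennreal (2 * pi\<^sup>2 * S * kin))"
    using Pb by (auto intro: order_trans add_left_mono add_mono)
  also have "\<dots> = ennreal (S * drift)"
    using S mass_nonneg kin_nonneg by (simp add: drift_def ennreal_plus[symmetric] algebra_simps del: ennreal_plus)
  finally show ?thesis .
qed

text \<open>|E(x)| is at most the integral of 1/|x - y| against the spatial marginal; lifting this
  integral to phase space gives the double integral of \<open>drift_bound\<close>.\<close>

lemma integral_v_E:
  assumes S: "S > 0" "\<Lambda> \<le> S\<^sup>2"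
  shows "integrable G (\<lambda>z. norm (snd z) * norm (E_field (rho g) (fst z)))"
    "(\<integral>z. norm (snd z) * norm (E_field (rho g) (fst z)) \<partial>G) \<le> S * drift"
proof -
  show i: "integrable G (\<lambda>z. norm (snd z) * norm (E_field (rho g) (fst z)))"
    using snd_le E_field_bounded R_pos by (intro G_integrable[of _ "R * Ksup"]) (auto simp: abs_mult intro!: mult_mono)
  have "ennreal (\<integral>z. norm (snd z) * norm (E_field (rho g) (fst z)) \<partial>G) = (\<integral>\<^sup>+z. ennreal (norm (snd z) * norm (E_field (rho g) (fst z))) \<partial>G)"
    by (rule nn_integral_eq_integral[OF i, symmetric]) auto
  also have "\<dots> \<le> (\<integral>\<^sup>+z. \<integral>\<^sup>+w. ennreal (norm (snd z) / norm (fst z - fst w)) \<partial>G \<partial>G)"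
  proof (rule nn_integral_mono)
    fix z :: phase
    have "ennreal (norm (E_field (rho g) (fst z))) \<le> ennreal (\<integral>y. 1 / norm (fst z - y) \<partial>N)"
      by (intro ennreal_leI E_field_le)
    also have "\<dots> = (\<integral>\<^sup>+y. ennreal (1 / norm (fst z - y)) \<partial>N)"
      by (rule nn_integral_eq_integral[OF kernel_integrable(1), symmetric]) auto
    also have "\<dots> = (\<integral>\<^sup>+w. ennreal (1 / norm (fst z - fst w)) \<partial>G)" by (rule nn_integral_N) measurable
    finally have "ennreal (norm (snd z)) * ennreal (norm (E_field (rho g) (fst z))) \<le> ennreal (norm (snd z)) * (\<integral>\<^sup>+w. ennreal (1 / norm (fst z - fst w)) \<partial>G)"
      by (rule mult_left_mono) auto
    also have "\<dots> = (\<integral>\<^sup>+w. ennreal (norm (snd z)) * ennreal (1 / norm (fst z - fst w)) \<partial>G)"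
      by (rule nn_integral_cmult[symmetric]) measurable
    also have "\<dots> = (\<integral>\<^sup>+w. ennreal (norm (snd z) / norm (fst z - fst w)) \<partial>G)"
      by (intro nn_integral_cong) (simp add: ennreal_mult[symmetric])
    finally show "ennreal (norm (snd z) * norm (E_field (rho g) (fst z))) \<le> (\<integral>\<^sup>+w. ennreal (norm (snd z) / norm (fst z - fst w)) \<partial>G)"
      by (simp only: ennreal_mult[OF norm_ge_zero norm_ge_zero])
  qed
  also have "\<dots> \<le> ennreal (S * drift)" by (rule drift_bound[OF S])
  finally show "(\<integral>z. norm (snd z) * norm (E_field (rho g) (fst z)) \<partial>G) \<le> S * drift"
    using S mass_nonneg kin_nonneg by (simp add: drift_def)
qed

text \<open>Exchanging the two variables and using that the kernel is odd; Fubini is available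
  because the density is bounded. V needs a bound only on the support, so that V x = x is allowed in
  \<open>moment_conservation\<close>.\<close>

lemma symmetrization:
  assumes V [measurable]: "V \<in> borel_measurable borel" and B: "\<And>x. norm x \<le> R \<Longrightarrow> norm (V x) \<le> B"
  shows "(\<integral>x. perp (E_field (rho g) x) \<bullet> V x \<partial>N) = (\<integral>p. 1/2 * (perp (biot (fst p - snd p)) \<bullet> (V (fst p) - V (snd p))) \<partial>(N \<Otimes>\<^sub>M N))"
proof -
  have B0: "0 \<le> B" using B[of 0] R_pos norm_ge_zero[of "V 0"] by (simp) (meson norm_ge_zero order_trans)
  define F where "F = (\<lambda>p. perp (biot (fst p - snd p)) \<bullet> V (fst p))"
  have [measurable]: "F \<in> borel_measurable borel" unfolding F_def by measurable
  have Fi: "integrable (N \<Otimes>\<^sub>M N) F"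
  proof (rule Bochner_Integration.integrable_bound[OF integrable_mult_right[OF NN_kernel_integrable, of B]])
    show "AE p in N \<Otimes>\<^sub>M N. norm (F p) \<le> norm (B * (1 / norm (fst p - snd p)))"
      using AE_NN
    proof eventually_elim
      fix p :: phase assume p: "norm (fst p) \<le> R \<and> norm (snd p) \<le> R \<and> fst p \<noteq> snd p"
      have "norm (F p) \<le> norm (perp (biot (fst p - snd p))) * norm (V (fst p))"
        unfolding F_def real_norm_def by (rule Cauchy_Schwarz_ineq2)
      also have "\<dots> \<le> 1 / norm (fst p - snd p) * B" using p B by (auto simp: norm_biot intro!: divide_right_mono)
      finally show "norm (F p) \<le> norm (B * (1 / norm (fst p - snd p)))" using B0 by simp
    qed
  qed measurable
  have "(\<integral>x. perp (E_field (rho g) x) \<bullet> V x \<partial>N) = (\<integral>x. \<integral>y. F (x, y) \<partial>N \<partial>N)"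
  proof (rule Bochner_Integration.integral_cong[OF refl])
    fix x
    have "perp (E_field (rho g) x) \<bullet> V x = - ((\<integral>y. biot (x - y) \<partial>N) \<bullet> perp (V x))"
      by (simp add: perp_inner(1) E_field_eq)
    also have "\<dots> = - (\<integral>y. biot (x - y) \<bullet> perp (V x) \<partial>N)" using kernel_integrable(2) by simp
    also have "\<dots> = (\<integral>y. F (x, y) \<partial>N)" by (simp add: F_def perp_inner(1))
    finally show "perp (E_field (rho g) x) \<bullet> V x = (\<integral>y. F (x, y) \<partial>N)" .
  qed
  also have "\<dots> = (\<integral>p. F p \<partial>(N \<Otimes>\<^sub>M N))" by (rule NN.integral_fst'[OF Fi])
  finally have 1: "(\<integral>x. perp (E_field (rho g) x) \<bullet> V x \<partial>N) = (\<integral>p. F p \<partial>(N \<Otimes>\<^sub>M N))" .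
  have sw: "(\<integral>p. F (snd p, fst p) \<partial>(N \<Otimes>\<^sub>M N)) = (\<integral>p. F p \<partial>(N \<Otimes>\<^sub>M N))"
    using NN.integral_product_swap[of F] by (simp add: split_beta')
  have swi: "integrable (N \<Otimes>\<^sub>M N) (\<lambda>p. F (snd p, fst p))"
    using NN.integrable_product_swap[OF Fi] by (simp add: split_beta')
  have "(\<integral>p. 1/2 * (perp (biot (fst p - snd p)) \<bullet> (V (fst p) - V (snd p))) \<partial>(N \<Otimes>\<^sub>M N)) = (\<integral>p. 1/2 * (F p + F (snd p, fst p)) \<partial>(N \<Otimes>\<^sub>M N))"
  proof (rule Bochner_Integration.integral_cong[OF refl])
    fix p :: phase
    have "biot (snd p - fst p) = - biot (fst p - snd p)" using biot_minus[of "fst p - snd p"] by simp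
    then show "1/2 * (perp (biot (fst p - snd p)) \<bullet> (V (fst p) - V (snd p))) = 1/2 * (F p + F (snd p, fst p))"
      by (simp add: F_def perp_linear inner_diff_right)
  qed
  also have "\<dots> = 1/2 * ((\<integral>p. F p \<partial>(N \<Otimes>\<^sub>M N)) + (\<integral>p. F (snd p, fst p) \<partial>(N \<Otimes>\<^sub>M N)))"
    using Fi swi by simp
  finally show ?thesis using 1 sw by simp
qed

text \<open>Symmetrisation requires V at the position x, whereas the weak form supplies it at the
  gyrocentre. By the Lipschitz bound the exchange costs B \<epsilon> |v| |E|, which
  \<open>integral_v_E\<close> integrates.\<close>

lemma gyro_drift:
  assumes V: "continuous_on UNIV V" and B: "\<And>x. norm (V x) \<le> B" and L: "\<And>x y. norm (V x - V y) \<le> B * norm (x - y)"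
    and S: "S > 0" "\<Lambda> \<le> S\<^sup>2" and \<epsilon>: "\<epsilon> \<ge> 0"
  shows "\<bar>(\<integral>z. perp (E_field (rho g) (fst z)) \<bullet> V (fst z + \<epsilon> *\<^sub>R perp (snd z)) \<partial>G)
     - (\<integral>p. 1/2 * (perp (biot (fst p - snd p)) \<bullet> (V (fst p) - V (snd p))) \<partial>(N \<Otimes>\<^sub>M N))\<bar> \<le> B * \<epsilon> * (S * drift)"
proof -
  have [measurable]: "V \<in> borel_measurable borel" by (rule borel_measurable_continuous_onI[OF V])
  have B0: "0 \<le> B" using B[of 0] norm_ge_zero order_trans by blast
  define P where "P = (\<lambda>z. perp (E_field (rho g) (fst z)) \<bullet> V (fst z + \<epsilon> *\<^sub>R perp (snd z)))"
  define Q where "Q = (\<lambda>z::phase. perp (E_field (rho g) (fst z)) \<bullet> V (fst z))"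
  have bd: "\<bar>perp (E_field (rho g) x) \<bullet> V y\<bar> \<le> Ksup * B" for x y
    by (rule order_trans[OF Cauchy_Schwarz_ineq2]) (use E_field_bounded B Ksup_nonneg in \<open>auto intro!: mult_mono\<close>)
  have i: "integrable G P" "integrable G Q"
    unfolding P_def Q_def using bd by (auto intro!: G_integrable[of _ "Ksup * B"])
  have Q: "(\<integral>z. Q z \<partial>G) = (\<integral>p. 1/2 * (perp (biot (fst p - snd p)) \<bullet> (V (fst p) - V (snd p))) \<partial>(N \<Otimes>\<^sub>M N))"
    unfolding Q_def using B
    by (subst symmetrization[symmetric]) (auto intro!: integral_N[symmetric])
  have "\<bar>(\<integral>z. P z \<partial>G) - (\<integral>z. Q z \<partial>G)\<bar> = \<bar>\<integral>z. P z - Q z \<partial>G\<bar>" using i by simp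
  also have "\<dots> \<le> (\<integral>z. \<bar>P z - Q z\<bar> \<partial>G)" by (rule integral_abs_bound)
  also have "\<dots> \<le> (\<integral>z. B * \<epsilon> * (norm (snd z) * norm (E_field (rho g) (fst z))) \<partial>G)"
  proof (rule integral_mono)
    show "integrable G (\<lambda>z. \<bar>P z - Q z\<bar>)" using i by simp
    show "integrable G (\<lambda>z. B * \<epsilon> * (norm (snd z) * norm (E_field (rho g) (fst z))))"
      by (intro integrable_mult_right integral_v_E(1)[OF S])
    fix z :: phase
    have "\<bar>P z - Q z\<bar> = \<bar>perp (E_field (rho g) (fst z)) \<bullet> (V (fst z + \<epsilon> *\<^sub>R perp (snd z)) - V (fst z))\<bar>"
      by (simp add: P_def Q_def inner_diff_right)
    also have "\<dots> \<le> norm (E_field (rho g) (fst z)) * norm (V (fst z + \<epsilon> *\<^sub>R perp (snd z)) - V (fst z))"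
      by (rule order_trans[OF Cauchy_Schwarz_ineq2]) simp
    also have "\<dots> \<le> norm (E_field (rho g) (fst z)) * (B * (\<epsilon> * norm (snd z)))"
      using L[of "fst z + \<epsilon> *\<^sub>R perp (snd z)" "fst z"] \<epsilon> by (intro mult_left_mono) auto
    finally show "\<bar>P z - Q z\<bar> \<le> B * \<epsilon> * (norm (snd z) * norm (E_field (rho g) (fst z)))" by (simp add: mult_ac)
  qed
  also have "\<dots> = B * \<epsilon> * (\<integral>z. norm (snd z) * norm (E_field (rho g) (fst z)) \<partial>G)" by (rule integral_mult_right_zero)
  also have "\<dots> \<le> B * \<epsilon> * (S * drift)" using B0 \<epsilon> by (intro mult_left_mono integral_v_E(2)[OF S]) auto
  finally show ?thesis unfolding Q by (simp add: P_def)
qed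

text \<open>The shift has length \<epsilon> |v|; the bound |v| \<le> 1 + |v|^2 expresses its average
  through mass and kinetic energy.\<close>

lemma gyro_shift:
  assumes \<phi>: "continuous_on UNIV \<phi>" "\<And>x. \<bar>\<phi> x\<bar> \<le> B" and L: "\<And>x y. \<bar>\<phi> x - \<phi> y\<bar> \<le> B * norm (x - y)" and \<epsilon>: "\<epsilon> \<ge> 0"
  shows "\<bar>(\<integral>z. \<phi> (fst z + \<epsilon> *\<^sub>R perp (snd z)) \<partial>G) - (\<integral>x. \<phi> x \<partial>N)\<bar> \<le> B * \<epsilon> * (mass + kin)"
proof -
  have [measurable]: "\<phi> \<in> borel_measurable borel" by (rule borel_measurable_continuous_onI[OF \<phi>(1)])
  have B0: "0 \<le> B" using \<phi>(2)[of 0] abs_ge_zero order_trans by blast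
  have i: "integrable G (\<lambda>z. \<phi> (fst z + \<epsilon> *\<^sub>R perp (snd z)))" "integrable G (\<lambda>z. \<phi> (fst z))"
    using \<phi>(2) by (auto intro!: G_integrable[of _ B])
  have "\<bar>(\<integral>z. \<phi> (fst z + \<epsilon> *\<^sub>R perp (snd z)) \<partial>G) - (\<integral>x. \<phi> x \<partial>N)\<bar> = \<bar>\<integral>z. \<phi> (fst z + \<epsilon> *\<^sub>R perp (snd z)) - \<phi> (fst z) \<partial>G\<bar>"
    using i by (simp add: integral_N)
  also have "\<dots> \<le> (\<integral>z. \<bar>\<phi> (fst z + \<epsilon> *\<^sub>R perp (snd z)) - \<phi> (fst z)\<bar> \<partial>G)" by (rule integral_abs_bound)
  also have "\<dots> \<le> (\<integral>z. B * \<epsilon> * (1 + (norm (snd z))\<^sup>2) \<partial>G)"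
  proof (rule integral_mono)
    show "integrable G (\<lambda>z. \<bar>\<phi> (fst z + \<epsilon> *\<^sub>R perp (snd z)) - \<phi> (fst z)\<bar>)" using i by simp
    show "integrable G (\<lambda>z. B * \<epsilon> * (1 + (norm (snd z))\<^sup>2))" using integrable_norm_square(2) by simp
    fix z :: phase
    have "\<bar>\<phi> (fst z + \<epsilon> *\<^sub>R perp (snd z)) - \<phi> (fst z)\<bar> \<le> B * (\<epsilon> * norm (snd z))"
      using L[of "fst z + \<epsilon> *\<^sub>R perp (snd z)" "fst z"] \<epsilon> by simp
    also have "\<dots> \<le> B * (\<epsilon> * (1 + (norm (snd z))\<^sup>2))"
    proof (intro mult_left_mono B0 \<epsilon>)
      show "norm (snd z) \<le> 1 + (norm (snd z))\<^sup>2" using zero_le_power2[of "norm (snd z) - 1"] by (simp add: power2_diff)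
          (smt (verit) norm_ge_zero)
    qed
    finally show "\<bar>\<phi> (fst z + \<epsilon> *\<^sub>R perp (snd z)) - \<phi> (fst z)\<bar> \<le> B * \<epsilon> * (1 + (norm (snd z))\<^sup>2)" by (simp add: mult_ac)
  qed
  also have "\<dots> = B * \<epsilon> * (mass + kin)" using integrable_norm_square(2) by (simp add: mass_G kin_def)
  finally show ?thesis .
qed

end

subsection \<open>Gyrocentre dynamics on a time interval\<close>

lemma space_section_derivative:
  fixes \<Phi> :: "real \<times> 'a::euclidean_space \<Rightarrow> real"
  assumes "smooth \<Phi>"
  shows "((\<lambda>x. \<Phi> (s, x)) has_derivative (\<lambda>h. dirderiv \<Phi> (s, x) (0, h))) (at x)"
    "((\<lambda>\<tau>. \<Phi> (\<tau>, x)) has_real_derivative dirderiv \<Phi> (s, x) (1, 0)) (at s)"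
proof -
  show "((\<lambda>x. \<Phi> (s, x)) has_derivative (\<lambda>h. dirderiv \<Phi> (s, x) (0, h))) (at x)"
    by (rule has_derivative_compose[OF _ smooth_has_derivative[OF assms]]) (auto intro!: derivative_eq_intros)
  have "((\<lambda>\<tau>. \<Phi> (\<tau>, x)) has_derivative (\<lambda>h. dirderiv \<Phi> (s, x) (h, 0))) (at s)"
    by (rule has_derivative_compose[OF _ smooth_has_derivative[OF assms]]) (auto intro!: derivative_eq_intros)
  moreover have "(\<lambda>h. dirderiv \<Phi> (s, x) (h, 0)) = (*) (dirderiv \<Phi> (s, x) (1, 0))"
  proof (rule ext)
    fix h
    have "dirderiv \<Phi> (s, x) (h, 0) = dirderiv \<Phi> (s, x) (h *\<^sub>R (1, 0))" by simp
    also have "\<dots> = h *\<^sub>R dirderiv \<Phi> (s, x) (1, 0)" by (rule linear_cmul[OF dirderiv_linear[OF assms]])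
    also have "\<dots> = dirderiv \<Phi> (s, x) (1, 0) * h" by (simp only: real_scaleR_def mult.commute)
    finally show "dirderiv \<Phi> (s, x) (h, 0) = dirderiv \<Phi> (s, x) (1, 0) * h" .
  qed
  ultimately show "((\<lambda>\<tau>. \<Phi> (\<tau>, x)) has_real_derivative dirderiv \<Phi> (s, x) (1, 0)) (at s)"
    by (simp only: has_field_derivative_def)
qed

lemma deriv_section: "smooth \<Phi> \<Longrightarrow> deriv (\<lambda>\<tau>. \<Phi> (\<tau>, x)) s = dirderiv \<Phi> (s, x) (1, 0)"
  for \<Phi> :: "real \<times> 'a::euclidean_space \<Rightarrow> real"
  by (rule DERIV_imp_deriv[OF space_section_derivative(2)])

lemma inner_grad_section: "smooth \<Phi> \<Longrightarrow> u \<bullet> grad (\<lambda>x. \<Phi> (s, x)) x = dirderiv \<Phi> (s, x) (0, u)"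
  for \<Phi> :: "real \<times> plane \<Rightarrow> real"
  using space_section_derivative(1)[of \<Phi> s x]
  by (subst inner_grad) (auto simp: differentiable_def dirderiv_eq)

text \<open>Written as a single derivative along the vector field of the system, the operator
  follows linear changes of variables by the chain rule.\<close>

lemma VP_operator_eq:
  fixes \<Psi> :: "real \<times> phase \<Rightarrow> real"
  assumes s: "smooth \<Psi>"
  shows "VP_operator \<epsilon> r \<Psi> s x v = dirderiv \<Psi> (s, x, v) (1, (1 / \<epsilon>) *\<^sub>R v, (1 / \<epsilon>) *\<^sub>R E_field r x + (1 / \<epsilon>\<^sup>2) *\<^sub>R perp v)"
proof -
  have l: "linear (dirderiv \<Psi> (s, x, v))" by (rule dirderiv_linear[OF s])
  have "((\<lambda>y. \<Psi> (s, y, v)) has_derivative (\<lambda>h. dirderiv \<Psi> (s, x, v) (0, h, 0))) (at x)"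
    by (rule has_derivative_compose[OF _ smooth_has_derivative[OF s]]) (auto intro!: derivative_eq_intros)
  then have 1: "u \<bullet> grad (\<lambda>y. \<Psi> (s, y, v)) x = dirderiv \<Psi> (s, x, v) (0, u, 0)" for u
    by (subst inner_grad) (auto simp: differentiable_def dirderiv_eq)
  have "((\<lambda>w. \<Psi> (s, x, w)) has_derivative (\<lambda>h. dirderiv \<Psi> (s, x, v) (0, 0, h))) (at v)"
    by (rule has_derivative_compose[OF _ smooth_has_derivative[OF s]]) (auto intro!: derivative_eq_intros)
  then have 2: "u \<bullet> grad (\<lambda>w. \<Psi> (s, x, w)) v = dirderiv \<Psi> (s, x, v) (0, 0, u)" for u
    by (subst inner_grad) (auto simp: differentiable_def dirderiv_eq)
  have "dirderiv \<Psi> (s, x, v) (1, a, b) = dirderiv \<Psi> (s, x, v) (1, 0) + dirderiv \<Psi> (s, x, v) (0, a, 0) + dirderiv \<Psi> (s, x, v) (0, 0, b)" for a b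
    using linear_add[OF l, of "(1, 0)" "(0, a, 0)"] linear_add[OF l, of "(1, a, 0)" "(0, 0, b)"] by (simp add: zero_prod_def)
  then show ?thesis
    unfolding VP_operator_def 1 2 deriv_section[OF s] by simp
qed

lemma measurable_dirderiv:
  fixes \<Psi> :: "'a::euclidean_space \<Rightarrow> real"
  assumes "smooth \<Psi>" "p \<in> borel_measurable M" "h \<in> borel_measurable M"
  shows "(\<lambda>\<omega>. dirderiv \<Psi> (p \<omega>) (h \<omega>)) \<in> borel_measurable M"
proof -
  have "(\<lambda>\<omega>. dirderiv \<Psi> (p \<omega>) b) \<in> borel_measurable M" for b
    by (rule measurable_compose[OF assms(2) borel_measurable_continuous_onI[OF smooth_continuous_on[OF smooth_dirderiv[OF assms(1)]]]])
  then show ?thesis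
    unfolding dirderiv_basis[OF assms(1), of _ "h _"] using assms(3)
    by (intro borel_measurable_sum borel_measurable_times borel_measurable_inner) auto
qed

lemma set_integrable_bounded:
  fixes W :: "real \<Rightarrow> real"
  assumes "W \<in> borel_measurable borel" "\<And>s. s \<in> {a..b} \<Longrightarrow> \<bar>W s\<bar> \<le> C"
  shows "set_integrable lborel {a..b} W"
  unfolding set_integrable_def
proof (rule Bochner_Integration.integrable_bound)
  show "integrable lborel (\<lambda>s. C * indicator {a..b} s)" by (cases "a \<le> b") auto
  show "AE s in lborel. norm (indicator {a..b} s *\<^sub>R W s) \<le> norm (C * indicator {a..b} s)"
    using assms(2) by (intro AE_I2) (auto simp: indicator_def intro: order_trans[OF _ abs_ge_self])
qed (use assms(1) in measurable)

lemma set_integral_abs_le: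
  fixes W :: "real \<Rightarrow> real"
  assumes "W \<in> borel_measurable borel" "\<And>s. s \<in> {a..b} \<Longrightarrow> \<bar>W s\<bar> \<le> C" "a \<le> b" "0 \<le> C"
  shows "\<bar>LINT s:{a..b}|lborel. W s\<bar> \<le> C * (b - a)"
proof -
  have i: "integrable lborel (\<lambda>s. indicator {a..b} s *\<^sub>R W s)"
    using set_integrable_bounded[OF assms(1,2)] by (simp add: set_integrable_def)
  have "\<bar>LINT s:{a..b}|lborel. W s\<bar> \<le> (\<integral>s. \<bar>indicator {a..b} s *\<^sub>R W s\<bar> \<partial>lborel)"
    unfolding set_lebesgue_integral_def by (rule integral_abs_bound)
  also have "\<dots> \<le> (\<integral>s. C * indicator {a..b} s \<partial>lborel)"
  proof (rule integral_mono)
    show "integrable lborel (\<lambda>s. \<bar>indicator {a..b} s *\<^sub>R W s\<bar>)" by (rule integrable_abs[OF i])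
    show "integrable lborel (\<lambda>s. C * indicator {a..b} s)" by (cases "a \<le> b") auto
    show "\<bar>indicator {a..b} s *\<^sub>R W s\<bar> \<le> C * indicator {a..b} s" for s
      using assms by (auto simp: indicator_def)
  qed
  also have "\<dots> = C * (b - a)" using assms by simp
  finally show ?thesis .
qed

lemma set_integral_split:
  fixes W :: "real \<Rightarrow> real"
  assumes "W \<in> borel_measurable borel" "\<And>s. s \<in> {0..t} \<Longrightarrow> \<bar>W s\<bar> \<le> C" "0 \<le> r" "r \<le> t" "0 \<le> C"
  shows "\<bar>(LINT s:{0..t}|lborel. W s) - (LINT s:{0..r}|lborel. W s)\<bar> \<le> C * (t - r)"
proof -
  have i: "set_integrable lborel {0..t} W" by (rule set_integrable_bounded[OF assms(1,2)])
  have "(LINT s:{0..t}|lborel. W s) = (LINT s:{0..r}|lborel. W s) + (LINT s:{r<..t}|lborel. W s)"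
  proof -
    have u: "{0..t} = {0..r} \<union> {r<..t}" and dj: "{0..r} \<inter> {r<..t} = {}" using assms by auto
    show ?thesis unfolding u
      by (rule set_integral_Un[OF dj]) (use assms in \<open>auto intro!: set_integrable_subset[OF i]\<close>)
  qed
  moreover have "(LINT s:{r<..t}|lborel. W s) = (LINT s:{r..t}|lborel. W s)"
    by (rule set_integral_discrete_difference[where X="{r}"]) (use assms in auto)
  moreover have "\<bar>LINT s:{r..t}|lborel. W s\<bar> \<le> C * (t - r)"
    using assms by (intro set_integral_abs_le) auto
  ultimately show ?thesis by simp
qed

text \<open>The norm of a gradient, or of a difference of two, is recovered from bounds on
  directional derivatives by taking the vector itself as direction.\<close>

lemma Lipschitz_gradient_section:
  fixes \<Phi> :: "real \<times> plane \<Rightarrow> real"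
  assumes s: "smooth \<Phi>"
    and B: "\<And>p h. \<bar>dirderiv \<Phi> p h\<bar> \<le> B * norm h"
    and L: "\<And>p q h. \<bar>dirderiv \<Phi> p h - dirderiv \<Phi> q h\<bar> \<le> B * norm (p - q) * norm h"
  shows "norm (grad (\<lambda>x. \<Phi> (s, x)) x) \<le> B"
    "norm (grad (\<lambda>x. \<Phi> (s, x)) x - grad (\<lambda>x. \<Phi> (s, x)) y) \<le> B * norm (x - y)"
    "continuous_on UNIV (grad (\<lambda>x. \<Phi> (s, x)))"
proof -
  have B0: "0 \<le> B"
  proof -
    have "0 \<le> B * norm ((1, 0) :: real \<times> plane)" using B[of 0 "(1, 0)"] by (meson abs_ge_zero order_trans)
    then show ?thesis by (simp add: norm_Pair)
  qed
  define V where "V x = grad (\<lambda>x. \<Phi> (s, x)) x" for x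
  have inn: "u \<bullet> V x = dirderiv \<Phi> (s, x) (0, u)" for u x unfolding V_def by (rule inner_grad_section[OF s])
  have le: "norm u \<le> c" if "u \<bullet> u \<le> c * norm u" "0 \<le> c" for u :: plane and c
  proof (cases "u = 0")
    case False
    then show ?thesis using that by (simp add: dot_square_norm power2_eq_square)
  qed (use that in simp)
  have "V x \<bullet> V x \<le> B * norm (V x)" for x
    using inn[of "V x" x] B[of "(s, x)" "(0, V x)"] by (simp add: norm_Pair)
  then show "norm (grad (\<lambda>x. \<Phi> (s, x)) x) \<le> B" using le B0 unfolding V_def by blast
  have "norm (V x - V y) \<le> B * norm (x - y)" for x y
  proof (rule le)
    have "(V x - V y) \<bullet> (V x - V y) = dirderiv \<Phi> (s, x) (0, V x - V y) - dirderiv \<Phi> (s, y) (0, V x - V y)"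
      unfolding inn[symmetric] by (simp add: inner_diff_right)
    also have "\<dots> \<le> B * norm ((s, x) - (s, y)) * norm (0 :: real, V x - V y)"
      using L[of "(s, x)" "(0, V x - V y)" "(s, y)"] by linarith
    finally show "(V x - V y) \<bullet> (V x - V y) \<le> B * norm (x - y) * norm (V x - V y)" by (simp add: norm_Pair)
  qed (use B0 in simp)
  then show "norm (grad (\<lambda>x. \<Phi> (s, x)) x - grad (\<lambda>x. \<Phi> (s, x)) y) \<le> B * norm (x - y)" unfolding V_def .
  have "continuous_on UNIV (\<lambda>x. dirderiv \<Phi> (s, x) (0, axis i 1))" for i
    by (rule continuous_on_compose2[OF smooth_continuous_on[OF smooth_dirderiv[OF s], of UNIV]]) (auto intro!: continuous_intros)
  moreover have "grad (\<lambda>x. \<Phi> (s, x)) = (\<lambda>x. \<chi> i. dirderiv \<Phi> (s, x) (0, axis i 1))"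
    unfolding grad_def by (simp add: dirderiv_eq[OF space_section_derivative(1)[OF s]])
  ultimately show "continuous_on UNIV (grad (\<lambda>x. \<Phi> (s, x)))" by (simp add: continuous_on_vec_lambda)
qed

lemma H_kernel_eq: "H_kernel \<phi> x y = 1/2 * (perp (biot (x - y)) \<bullet> (grad \<phi> x - grad \<phi> y))"
  by (simp add: H_kernel_def biot_def perp_linear)

lemma H_kernel_bound:
  assumes "\<And>x y. norm (grad \<phi> x - grad \<phi> y) \<le> B * norm (x - y)" "0 \<le> B"
  shows "\<bar>H_kernel \<phi> x y\<bar> \<le> B / 2"
proof -
  have "\<bar>perp (biot (x - y)) \<bullet> (grad \<phi> x - grad \<phi> y)\<bar> \<le> 1 / norm (x - y) * (B * norm (x - y))"
    by (rule order_trans[OF Cauchy_Schwarz_ineq2], unfold norm_perp norm_biot, rule mult_left_mono[OF assms(1)]) simp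
  also have "\<dots> \<le> B" using assms(2) by simp
  finally show ?thesis by (simp add: H_kernel_eq)
qed

definition gyro :: "real \<Rightarrow> real \<times> phase \<Rightarrow> real \<times> plane" where
  "gyro \<epsilon> p = (fst p, fst (snd p) + \<epsilon> *\<^sub>R perp (snd (snd p)))"

lemma bounded_linear_gyro: "bounded_linear (gyro \<epsilon>)"
  unfolding gyro_def
  by (intro bounded_linear_Pair bounded_linear_add bounded_linear_fst bounded_linear_fst_comp bounded_linear_snd
    bounded_linear_compose[OF bounded_linear_scaleR_right] bounded_linear_compose[OF bounded_linear_perp] bounded_linear_compose[OF bounded_linear_fst] bounded_linear_compose[OF bounded_linear_snd])

text \<open>
  A solution on \<open>[0, T]\<close> after modification on null sets, so that bounds and support hold everywhere.
  The common support radius allows all smooth test functions, not only compactly supported ones.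
\<close>

locale vp_run =
  fixes \<epsilon> T \<Lambda> R :: real and gt :: "real \<Rightarrow> phase \<Rightarrow> real"
  assumes eps: "\<epsilon> > 0" and T0: "T \<ge> 0"
    and gt_meas: "(\<lambda>p. gt (fst p) (snd p)) \<in> borel_measurable borel"
    and gt_density: "\<And>s. phase_density (gt s) \<Lambda> R"
    and weak: "\<And>\<Psi> t. smooth \<Psi> \<Longrightarrow> t \<in> {0..T} \<Longrightarrow>
      (\<integral>z. \<Psi> (t, z) * gt t z \<partial>lborel) = (\<integral>z. \<Psi> (0, z) * gt 0 z \<partial>lborel)
        + (LINT s:{0..t}|lborel. (\<integral>z. VP_operator \<epsilon> (rho (gt s)) \<Psi> s (fst z) (snd z) * gt s z \<partial>lborel))"
    and energy_le: "\<And>t. t \<in> {0..T} \<Longrightarrow> energy (gt t) \<le> energy (gt 0)"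
begin

sublocale P: phase_density "gt s" \<Lambda> R for s by (rule gt_density)

abbreviation N where "N s \<equiv> phase_density.N (gt s)"
abbreviation G where "G s \<equiv> phase_density.G (gt s)"

lemma gt_joint_measurable [measurable]: "(\<lambda>(s, z). gt s z) \<in> borel_measurable (borel \<Otimes>\<^sub>M borel)"
  using gt_meas by (simp add: borel_prod split_beta')

lemma rho_joint_measurable [measurable]: "(\<lambda>(s, x). rho (gt s) x) \<in> borel_measurable (borel \<Otimes>\<^sub>M borel)"
proof -
  have "(\<lambda>p. \<integral>v. gt (fst p) (snd p, v) \<partial>lborel) \<in> borel_measurable (borel \<Otimes>\<^sub>M borel)"
    by (rule lborel.borel_measurable_lebesgue_integral) measurable
  then show ?thesis by (simp add: rho_def split_beta')
qed

lemma E_joint_measurable [measurable]: "(\<lambda>(s, x). E_field (rho (gt s)) x) \<in> borel_measurable (borel \<Otimes>\<^sub>M borel)"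
proof -
  have "(\<lambda>p. \<integral>y. (rho (gt (fst p)) y / (norm (snd p - y))\<^sup>2) *\<^sub>R (snd p - y) \<partial>lborel) \<in> borel_measurable (borel \<Otimes>\<^sub>M borel)"
    by (rule lborel.borel_measurable_lebesgue_integral) measurable
  then show ?thesis by (simp add: E_field_def split_beta')
qed

text \<open>\<open>G s\<close> varies with s, but measurability in a parameter is known for a fixed
  measure; the integral is therefore rewritten against Lebesgue measure with the jointly measurable
  density \<open>gt\<close>.\<close>

lemma integral_G_meas:
  assumes [measurable]: "(\<lambda>(s, z). p s z) \<in> borel_measurable (borel \<Otimes>\<^sub>M (borel :: phase measure))"
  shows "(\<lambda>s. \<integral>z. (p s z :: real) \<partial>G s) \<in> borel_measurable borel"
proof -
  have "(\<lambda>s. \<integral>z. p s z * gt s z \<partial>lborel) \<in> borel_measurable borel"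
    by (rule lborel.borel_measurable_lebesgue_integral) measurable
  moreover have "p s \<in> borel_measurable borel" for s
    by measurable
  ultimately show ?thesis by (simp add: P.integral_G)
qed

lemma weak_G:
  assumes s: "smooth \<Psi>" and t: "t \<in> {0..T}"
  shows "(\<integral>z. \<Psi> (t, z) \<partial>G t) = (\<integral>z. \<Psi> (0, z) \<partial>G 0) + (LINT s:{0..t}|lborel.
     (\<integral>z. dirderiv \<Psi> (s, z) (1, (1 / \<epsilon>) *\<^sub>R snd z, (1 / \<epsilon>) *\<^sub>R E_field (rho (gt s)) (fst z) + (1 / \<epsilon>\<^sup>2) *\<^sub>R perp (snd z)) \<partial>G s))"
proof -
  have m1: "(\<lambda>z. \<Psi> (s, z)) \<in> borel_measurable borel" for s
    by (rule borel_measurable_continuous_onI, rule continuous_on_compose2[OF smooth_continuous_on[OF s, of UNIV]]) (auto intro!: continuous_intros)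
  have m2: "(\<lambda>z. dirderiv \<Psi> (s, z) (1, (1 / \<epsilon>) *\<^sub>R snd z, (1 / \<epsilon>) *\<^sub>R E_field (rho (gt s)) (fst z) + (1 / \<epsilon>\<^sup>2) *\<^sub>R perp (snd z))) \<in> borel_measurable borel" for s
    by (rule measurable_dirderiv[OF s]) measurable
  show ?thesis using weak[OF s t] unfolding VP_operator_eq[OF s] P.integral_G[OF m1]
    by (simp add: P.integral_G[OF m2])
qed

lemma mass_const: "t \<in> {0..T} \<Longrightarrow> P.mass t = P.mass 0"
  using weak_G[OF smooth_const[of 1], of t]
  by (simp add: frechet_derivative_const P.mass_G)

lemma gyro_weak:
  assumes s: "smooth \<Phi>" and t: "t \<in> {0..T}"
  shows "(\<integral>z. \<Phi> (t, fst z + \<epsilon> *\<^sub>R perp (snd z)) \<partial>G t) = (\<integral>z. \<Phi> (0, fst z + \<epsilon> *\<^sub>R perp (snd z)) \<partial>G 0) + (LINT s:{0..t}|lborel.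
     (\<integral>z. dirderiv \<Phi> (s, fst z + \<epsilon> *\<^sub>R perp (snd z)) (1, perp (E_field (rho (gt s)) (fst z))) \<partial>G s))"
proof -
  have sm: "smooth (\<lambda>p. \<Phi> (gyro \<epsilon> p))" by (rule smooth_compose_linear[OF s bounded_linear_gyro])
  have d: "dirderiv (\<lambda>p. \<Phi> (gyro \<epsilon> p)) p h = dirderiv \<Phi> (gyro \<epsilon> p) (gyro \<epsilon> h)" for p h
    by (rule dirderiv_eq[OF has_derivative_compose[OF bounded_linear_imp_has_derivative[OF bounded_linear_gyro] smooth_has_derivative[OF s]]])
  \<comment> \<open>The cancellation of the singular terms: v/\<epsilon> is compensated by
    \<epsilon> perp (perp v) / \<epsilon>^2 = - v/\<epsilon>, and only perp E remains.\<close>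
  have g: "gyro \<epsilon> (1, (1 / \<epsilon>) *\<^sub>R v, (1 / \<epsilon>) *\<^sub>R E + (1 / \<epsilon>\<^sup>2) *\<^sub>R perp v) = (1, perp E)" for v E
    using eps by (simp add: gyro_def perp_linear scaleR_add_right scaleR_diff_right power2_eq_square)
  show ?thesis using weak_G[OF sm t] unfolding d g by (simp add: gyro_def)
qed

text \<open>The integrand is the squared norm of the gyrocentre without \<epsilon>^2 |v|^2; leaving
  that term out removes the contribution 2 \<epsilon> v . E to the time derivative. What remains is
  2 x . perp E, whose integral vanishes by symmetrisation because perp (x - y) is orthogonal to x -
  y.\<close>

lemma moment_conservation:
  assumes t: "t \<in> {0..T}"
  shows "(\<integral>z. (norm (fst z))\<^sup>2 + 2 * \<epsilon> * (fst z \<bullet> perp (snd z)) \<partial>G t) = (\<integral>z. (norm (fst z))\<^sup>2 + 2 * \<epsilon> * (fst z \<bullet> perp (snd z)) \<partial>G 0)"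
proof -
  define \<Psi> where "\<Psi> = (\<lambda>p::real \<times> phase. fst (snd p) \<bullet> fst (snd p) + 2 * \<epsilon> * (fst (snd p) \<bullet> perp (snd (snd p))))"
  have lin: "bounded_linear (\<lambda>p::real \<times> phase. fst (snd p) $ i)" "bounded_linear (\<lambda>p::real \<times> phase. snd (snd p) $ i)" for i
    by (rule bounded_linear_compose[OF bounded_linear_vec_nth], rule bounded_linear_compose[OF bounded_linear_fst bounded_linear_snd],
      rule bounded_linear_compose[OF bounded_linear_vec_nth], rule bounded_linear_compose[OF bounded_linear_snd bounded_linear_snd])
  have s: "smooth \<Psi>"
    unfolding \<Psi>_def plane_inner perp_components diff_conv_add_uminus mult_minus_right
    by (rule smooth_real_polynomial_function)
       (intro real_polynomial_function.intros(2-4) real_polynomial_function.intros(1)[OF lin(1)] real_polynomial_function.intros(1)[OF lin(2)] real_polynomial_function_minus)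
  have d: "dirderiv \<Psi> p h = 2 * (fst (snd p) \<bullet> fst (snd h)) + 2 * \<epsilon> * (fst (snd p) \<bullet> perp (snd (snd h)) + fst (snd h) \<bullet> perp (snd (snd p)))" for p h
  proof (rule dirderiv_eq)
    have f: "((\<lambda>p::real \<times> phase. fst (snd p)) has_derivative (\<lambda>h. fst (snd h))) (at p)"
      by (rule bounded_linear_imp_has_derivative[OF bounded_linear_compose[OF bounded_linear_fst bounded_linear_snd]])
    have g: "((\<lambda>p::real \<times> phase. perp (snd (snd p))) has_derivative (\<lambda>h. perp (snd (snd h)))) (at p)"
      by (rule bounded_linear_imp_has_derivative[OF bounded_linear_compose[OF bounded_linear_perp bounded_linear_compose[OF bounded_linear_snd bounded_linear_snd]]])
    have "(\<Psi> has_derivative (\<lambda>h. (fst (snd p) \<bullet> fst (snd h) + fst (snd h) \<bullet> fst (snd p)) + 2 * \<epsilon> * (fst (snd p) \<bullet> perp (snd (snd h)) + fst (snd h) \<bullet> perp (snd (snd p))))) (at p)"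
      unfolding \<Psi>_def by (intro has_derivative_add has_derivative_inner has_derivative_mult_right f g)
    then show "(\<Psi> has_derivative (\<lambda>h. 2 * (fst (snd p) \<bullet> fst (snd h)) + 2 * \<epsilon> * (fst (snd p) \<bullet> perp (snd (snd h)) + fst (snd h) \<bullet> perp (snd (snd p))))) (at p)"
      by (simp add: inner_commute)
  qed
  have val: "dirderiv \<Psi> (s, z) (1, (1 / \<epsilon>) *\<^sub>R snd z, (1 / \<epsilon>) *\<^sub>R E + (1 / \<epsilon>\<^sup>2) *\<^sub>R perp (snd z)) = 2 * (perp E \<bullet> fst z)" for s z E
    unfolding d using eps
    by (simp add: perp_linear perp_inner inner_add_right inner_diff_right power2_eq_square inner_commute algebra_simps)
  have "(\<integral>z. 2 * (perp (E_field (rho (gt s)) (fst z)) \<bullet> fst z) \<partial>G s) = 0" for s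
  proof -
    have "(\<integral>z. perp (E_field (rho (gt s)) (fst z)) \<bullet> fst z \<partial>G s) = (\<integral>x. perp (E_field (rho (gt s)) x) \<bullet> x \<partial>N s)"
      by (rule P.integral_N[symmetric]) measurable
    also have "\<dots> = (\<integral>p. 1/2 * (perp (biot (fst p - snd p)) \<bullet> (fst p - snd p)) \<partial>(N s \<Otimes>\<^sub>M N s))"
      by (rule P.symmetrization[of "\<lambda>x. x" R]) auto
    also have "\<dots> = 0" by (simp add: biot_def perp_linear(2) perp_inner)
    finally show ?thesis by simp
  qed
  then show ?thesis using weak_G[OF s t] unfolding val by (simp add: \<Psi>_def power2_norm_eq_inner)
qed

lemma cross_integrable: "integrable (G s) (\<lambda>z. fst z \<bullet> perp (snd z))"
proof (rule P.G_integrable)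
  fix z :: phase assume "norm z \<le> R"
  then show "\<bar>fst z \<bullet> perp (snd z)\<bar> \<le> R * R"
    using P.snd_le[of z] P.R_pos by (intro order_trans[OF Cauchy_Schwarz_ineq2] mult_mono) auto
qed measurable

lemma mom_G: "P.mom s = (\<integral>z. (norm (fst z))\<^sup>2 \<partial>G s)"
  unfolding P.mom_def by (rule P.integral_N) measurable

lemma cross_bound: "\<bar>2 * (\<integral>z. fst z \<bullet> perp (snd z) \<partial>G s)\<bar> \<le> P.mom s + P.kin s"
proof -
  have "\<bar>2 * (\<integral>z. fst z \<bullet> perp (snd z) \<partial>G s)\<bar> = \<bar>\<integral>z. 2 * (fst z \<bullet> perp (snd z)) \<partial>G s\<bar>" by simp
  also have "\<dots> \<le> (\<integral>z. \<bar>2 * (fst z \<bullet> perp (snd z))\<bar> \<partial>G s)" by (rule integral_abs_bound)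
  also have "\<dots> \<le> (\<integral>z. (norm (fst z))\<^sup>2 + (norm (snd z))\<^sup>2 \<partial>G s)"
  proof (rule integral_mono)
    show "integrable (G s) (\<lambda>z. \<bar>2 * (fst z \<bullet> perp (snd z))\<bar>)" using cross_integrable by (intro integrable_abs integrable_mult_right) 
    show "integrable (G s) (\<lambda>z. (norm (fst z))\<^sup>2 + (norm (snd z))\<^sup>2)" using P.integrable_norm_square(2,3) by simp
    fix z :: phase
    have "\<bar>fst z \<bullet> perp (snd z)\<bar> \<le> norm (fst z) * norm (snd z)" using Cauchy_Schwarz_ineq2[of "fst z" "perp (snd z)"] by simp
    then show "\<bar>2 * (fst z \<bullet> perp (snd z))\<bar> \<le> (norm (fst z))\<^sup>2 + (norm (snd z))\<^sup>2"
      using sum_squares_bound[of "norm (fst z)" "norm (snd z)"] by (simp add: abs_mult)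
  qed
  also have "\<dots> = P.mom s + P.kin s"
    using P.integrable_norm_square(2,3) by (simp add: mom_G P.kin_def)
  finally show ?thesis .
qed

lemma moment_inequality:
  assumes t: "t \<in> {0..T}"
  shows "P.mom t \<le> P.mom 0 + \<epsilon> * (P.mom 0 + P.kin 0) + \<epsilon> * (P.mom t + P.kin t)"
proof -
  define C where "C s = 2 * (\<integral>z. fst z \<bullet> perp (snd z) \<partial>G s)" for s
  have "(\<integral>z. (norm (fst z))\<^sup>2 + 2 * \<epsilon> * (fst z \<bullet> perp (snd z)) \<partial>G s) = P.mom s + \<epsilon> * C s" for s
    using P.integrable_norm_square(3) cross_integrable by (simp add: mom_G C_def)
  then have "P.mom t + \<epsilon> * C t = P.mom 0 + \<epsilon> * C 0" using moment_conservation[OF t] by simp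
  moreover have "\<bar>\<epsilon> * C s\<bar> \<le> \<epsilon> * (P.mom s + P.kin s)" for s
    using cross_bound[of s] eps by (simp add: C_def abs_mult)
  from this[of 0] this[of t] calculation show ?thesis by linarith
qed

text \<open>The energy gives \<open>kin\<close> \<le> 2 H + 2 A \<open>mom\<close>, and
  \<open>moment_inequality\<close> bounds \<open>mom\<close> through \<epsilon> (\<open>mom\<close>
  + \<open>kin\<close>). Inserting one into the other, half of \<open>mom t\<close> is absorbed:
  \<open>mom t\<close> / 2 \<le> A + (A/2 + H) + H, which is the bound 3 A + 4 H. The other two
  quantities follow from the energy.\<close>

lemma uniform_bounds:
  assumes A: "P.mass 0 \<le> A" "P.mom 0 \<le> A" and H: "energy (gt 0) \<le> H" "0 \<le> H"
    and small: "\<epsilon> * (1 + 2 * A) \<le> 1/2" and t: "t \<in> {0..T}"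
  shows "P.mom t \<le> 3 * A + 4 * H" "P.kin t \<le> 2 * H + 2 * A * (3 * A + 4 * H)" "P.Lpot t \<le> 2 * H + 2 * A * (3 * A + 4 * H)"
proof -
  have A0: "0 \<le> A" using A P.mass_nonneg[of 0] by linarith
  have e: "P.kin s / 2 + P.Lpot s / 2 \<le> H + A * P.mom s" if "s \<in> {0..T}" for s
  proof -
    have "P.mass s * P.mom s \<le> A * P.mom s" using mass_const[OF that] A P.mom_nonneg by (intro mult_right_mono) auto
    then show ?thesis using P.energy_bound[of s] energy_le[OF that] H by linarith
  qed
  have k: "P.kin s \<le> 2 * H + 2 * A * P.mom s" if "s \<in> {0..T}" for s
    using e[OF that] P.Lpot_nonneg[of s] by linarith
  have l: "P.Lpot s \<le> 2 * H + 2 * A * P.mom s" if "s \<in> {0..T}" for s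
    using e[OF that] P.kin_nonneg[of s] by linarith
  have z: "0 \<in> {0..T}" using T0 by simp
  have e2: "\<epsilon> \<le> 1/2" using small A0 eps by (smt (verit) mult_nonneg_nonneg mult_le_cancel_left1 distrib_left mult.right_neutral)
  \<comment> \<open>The coefficient of \<open>mom\<close> is \<epsilon> (1 + 2 A), at most 1/2 by
    smallness, and 2 \<epsilon> H \<le> H because \<epsilon> \<le> 1/2.\<close>
  have sA: "\<epsilon> * (P.mom s + P.kin s) \<le> 1/2 * P.mom s + H" if "s \<in> {0..T}" for s
  proof -
    have "\<epsilon> * (P.mom s + P.kin s) \<le> \<epsilon> * ((1 + 2 * A) * P.mom s + 2 * H)"
      using k[OF that] eps by (intro mult_left_mono) (auto simp: algebra_simps)
    also have "\<dots> = (\<epsilon> * (1 + 2 * A)) * P.mom s + (2 * \<epsilon>) * H" by (simp add: algebra_simps)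
    also have "\<dots> \<le> 1/2 * P.mom s + 1 * H"
      using small e2 H P.mom_nonneg by (intro add_mono mult_right_mono) auto
    finally show ?thesis by simp
  qed
  show m: "P.mom t \<le> 3 * A + 4 * H"
    using moment_inequality[OF t] sA[OF t] sA[OF z] A(2) by linarith
  have "2 * A * P.mom t \<le> 2 * A * (3 * A + 4 * H)" using m A0 by (intro mult_left_mono) auto
  then show "P.kin t \<le> 2 * H + 2 * A * (3 * A + 4 * H)" "P.Lpot t \<le> 2 * H + 2 * A * (3 * A + 4 * H)"
    using k[OF t] l[OF t] by linarith+
qed

lemma smooth_test_meas:
  assumes "smooth \<Phi>" shows "(\<lambda>(s, x). dirderiv \<Phi> (s, x) h) \<in> borel_measurable (borel \<Otimes>\<^sub>M borel)"
  using borel_measurable_continuous_onI[OF smooth_continuous_on[OF smooth_dirderiv[OF assms, of h], of UNIV]]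
  by (simp add: borel_prod split_beta')

text \<open>The gyrocentre form of the equation is exact. Comparing it with the Euler equation for
  the density costs one shift at time t, one at time 0, and under the time integral the shift of the
  time derivative together with the commutator.\<close>

lemma Euler_defect:
  fixes \<Phi> :: "real \<times> plane \<Rightarrow> real"
  assumes s: "smooth \<Phi>" and t: "t \<in> {0..T}"
    and B: "\<And>p. \<bar>\<Phi> p\<bar> \<le> B" "\<And>p h. \<bar>dirderiv \<Phi> p h\<bar> \<le> B * norm h"
      "\<And>p q. \<bar>\<Phi> p - \<Phi> q\<bar> \<le> B * norm (p - q)"
      "\<And>p q h. \<bar>dirderiv \<Phi> p h - dirderiv \<Phi> q h\<bar> \<le> B * norm (p - q) * norm h"
    and mass: "P.mass 0 \<le> A" and kin: "\<And>s. s \<in> {0..T} \<Longrightarrow> P.kin s \<le> K"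
    and S: "S > 0" "\<Lambda> \<le> S\<^sup>2"
  defines "a \<equiv> (\<lambda>s. \<integral>x. dirderiv \<Phi> (s, x) (1, 0) \<partial>N s)"
    and "h \<equiv> (\<lambda>s. \<integral>p. H_kernel (\<lambda>x. \<Phi> (s, x)) (fst p) (snd p) \<partial>(N s \<Otimes>\<^sub>M N s))"
  shows "a \<in> borel_measurable borel" "h \<in> borel_measurable borel"
    "\<And>s. s \<in> {0..T} \<Longrightarrow> \<bar>a s\<bar> \<le> B * A" "\<And>s. s \<in> {0..T} \<Longrightarrow> \<bar>h s\<bar> \<le> B * A\<^sup>2"
    "\<bar>(\<integral>x. \<Phi> (t, x) \<partial>N t) - (\<integral>x. \<Phi> (0, x) \<partial>N 0) - (LINT s:{0..t}|lborel. a s) - (LINT s:{0..t}|lborel. h s)\<bar>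
      \<le> B * (2 + t) * (\<epsilon> * (A + K + S * (A\<^sup>2 + 4 * A * K + 4 * pi\<^sup>2 * K)))"
proof -
  have B0: "0 \<le> B" using B(1)[of 0] abs_ge_zero order_trans by blast
  have A0: "0 \<le> A" using mass P.mass_nonneg[of 0] by linarith
  have z: "0 \<in> {0..T}" using T0 by simp
  have K0: "0 \<le> K" using kin[OF z] P.kin_nonneg[of 0] by linarith
  have ms: "P.mass s \<le> A" if "s \<in> {0..T}" for s using mass_const[OF that] mass by simp
  define V where "V s = grad (\<lambda>x. \<Phi> (s, x))" for s
  note VB = Lipschitz_gradient_section[OF s B(2,4), folded V_def]
  have Vm: "(\<lambda>(s, x). V s x) \<in> borel_measurable (borel \<Otimes>\<^sub>M borel)"
  proof -
    have "V s x = (\<chi> i. dirderiv \<Phi> (s, x) (0, axis i 1))" for s x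
      unfolding V_def grad_def by (simp add: dirderiv_eq[OF space_section_derivative(1)[OF s]])
    moreover have "continuous_on UNIV (\<lambda>p. \<chi> i. dirderiv \<Phi> p (0, axis i 1))"
      by (intro continuous_on_vec_lambda smooth_continuous_on smooth_dirderiv s)
    then have "(\<lambda>p. \<chi> i. dirderiv \<Phi> p (0, axis i 1)) \<in> borel_measurable (borel :: (real \<times> plane) measure)"
      by (rule borel_measurable_continuous_onI)
    ultimately show ?thesis by (simp add: borel_prod split_beta')
  qed
  note [measurable] = Vm smooth_test_meas[OF s]
  have Vm1[measurable]: "V s \<in> borel_measurable borel" for s by (rule borel_measurable_continuous_onI[OF VB(3)])
  have am1[measurable]: "(\<lambda>x. dirderiv \<Phi> (s, x) h) \<in> borel_measurable borel" for s h
    by measurable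
  have a_eq: "a s = (\<integral>z. dirderiv \<Phi> (s, fst z) (1, 0) \<partial>G s)" for s
    unfolding a_def by (rule P.integral_N) measurable
  \<comment> \<open>Undoing the symmetrisation turns the double integral over a varying tensor
    square into a single integral against \<open>G s\<close>, whose measurability in s is
    available.\<close>
  have h_eq: "h s = (\<integral>z. perp (E_field (rho (gt s)) (fst z)) \<bullet> V s (fst z) \<partial>G s)" for s
  proof -
    have "h s = (\<integral>x. perp (E_field (rho (gt s)) x) \<bullet> V s x \<partial>N s)"
      unfolding h_def H_kernel_eq V_def[symmetric] using VB(1) by (subst P.symmetrization[symmetric]) auto
    then show ?thesis by (simp add: P.integral_N)
  qed
  show am: "a \<in> borel_measurable borel"
    unfolding a_eq[abs_def] by (rule integral_G_meas) measurable
  show hm: "h \<in> borel_measurable borel"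
    unfolding h_eq[abs_def] by (rule integral_G_meas) measurable
  show ab: "\<bar>a s\<bar> \<le> B * A" if "s \<in> {0..T}" for s
  proof -
    have d1: "\<bar>dirderiv \<Phi> (s, x) (1, 0)\<bar> \<le> B" for x using B(2)[of "(s, x)" "(1, 0)"] by (simp add: norm_Pair)
    have "\<bar>a s\<bar> \<le> (\<integral>x. \<bar>dirderiv \<Phi> (s, x) (1, 0)\<bar> \<partial>N s)" unfolding a_def by (rule integral_abs_bound)
    also have "\<dots> \<le> (\<integral>x. B \<partial>N s)" using d1 by (intro integral_mono integrable_abs P.N_integrable) auto
    also have "\<dots> = B * P.mass s" by (simp add: P.mass_def)
    also have "\<dots> \<le> B * A" using ms[OF that] B0 by (intro mult_left_mono)
    finally show ?thesis .
  qed
  show hb: "\<bar>h s\<bar> \<le> B * A\<^sup>2" if "s \<in> {0..T}" for s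
  proof -
    have k: "\<bar>H_kernel (\<lambda>x. \<Phi> (s, x)) x y\<bar> \<le> B / 2" for x y
      using VB(2)[of s] B0 unfolding V_def by (rule H_kernel_bound)
    have km: "(\<lambda>p. H_kernel (\<lambda>x. \<Phi> (s, x)) (fst p) (snd p)) \<in> borel_measurable (N s \<Otimes>\<^sub>M N s)"
      unfolding H_kernel_eq V_def[symmetric] by measurable
    have "\<bar>h s\<bar> \<le> (\<integral>p. \<bar>H_kernel (\<lambda>x. \<Phi> (s, x)) (fst p) (snd p)\<bar> \<partial>(N s \<Otimes>\<^sub>M N s))" unfolding h_def by (rule integral_abs_bound)
    also have "\<dots> \<le> (\<integral>p. B \<partial>(N s \<Otimes>\<^sub>M N s))"
    proof (rule integral_mono)
      show "integrable (N s \<Otimes>\<^sub>M N s) (\<lambda>p. \<bar>H_kernel (\<lambda>x. \<Phi> (s, x)) (fst p) (snd p)\<bar>)"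
        using k km by (intro integrable_abs P.NNf.integrable_const_bound[where B="B/2"]) auto
      show "\<bar>H_kernel (\<lambda>x. \<Phi> (s, x)) (fst p) (snd p)\<bar> \<le> B" for p using k[of "fst p" "snd p"] B0 by linarith
    qed simp
    also have "\<dots> = B * (P.mass s)\<^sup>2" using Mplus_pair(3,4)[OF P.N_Mplus] by (simp add: P.mass_def)
    also have "\<dots> \<le> B * A\<^sup>2" using ms[OF that] B0 P.mass_nonneg by (intro mult_left_mono power_mono)
    finally show ?thesis .
  qed
  define D where "D = \<epsilon> * (A + K + S * (A\<^sup>2 + 4 * A * K + 4 * pi\<^sup>2 * K))"
  have drift: "P.drift s \<le> A\<^sup>2 + 4 * A * K + 4 * pi\<^sup>2 * K" if "s \<in> {0..T}" for s
    unfolding P.drift_def using ms[OF that] kin[OF that] P.mass_nonneg P.kin_nonneg A0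
    by (intro add_mono power_mono mult_mono) auto
  define W where "W s = (\<integral>z. dirderiv \<Phi> (s, fst z + \<epsilon> *\<^sub>R perp (snd z)) (1, perp (E_field (rho (gt s)) (fst z))) \<partial>G s)" for s
  have Wm: "W \<in> borel_measurable borel"
  proof -
    have "(\<lambda>p. dirderiv \<Phi> (fst p, fst (snd p) + \<epsilon> *\<^sub>R perp (snd (snd p))) (1, perp (E_field (rho (gt (fst p))) (fst (snd p))))) \<in> borel_measurable (borel \<Otimes>\<^sub>M (borel :: phase measure))"
      by (rule measurable_dirderiv[OF s]) measurable
    then have "(\<lambda>s. \<integral>z. dirderiv \<Phi> (s, fst z + \<epsilon> *\<^sub>R perp (snd z)) (1, perp (E_field (rho (gt s)) (fst z))) \<partial>G s) \<in> borel_measurable borel"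
      by (intro integral_G_meas) (simp add: split_beta')
    then show ?thesis by (simp add: W_def[abs_def])
  qed
  have W_close: "\<bar>W s - (a s + h s)\<bar> \<le> B * D" if "s \<in> {0..T}" for s
  proof -
    define y where "y z = fst z + \<epsilon> *\<^sub>R perp (snd z)" for z :: phase
    have [measurable]: "y \<in> borel_measurable borel" unfolding y_def by measurable
    have i1: "integrable (G s) (\<lambda>z. dirderiv \<Phi> (s, y z) (1, 0))"
      using B(2)[of "(s, _)" "(1, 0)"] by (intro P.G_integrable[of _ B]) (auto simp: norm_Pair)
    have i2: "integrable (G s) (\<lambda>z. perp (E_field (rho (gt s)) (fst z)) \<bullet> V s (y z))"
    proof (rule P.G_integrable)
      show "\<bar>perp (E_field (rho (gt s)) (fst z)) \<bullet> V s (y z)\<bar> \<le> P.Ksup s * B" for z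
        by (rule order_trans[OF Cauchy_Schwarz_ineq2]) (use P.E_field_bounded VB(1) P.Ksup_nonneg in \<open>auto intro!: mult_mono\<close>)
    qed measurable
    have "W s = (\<integral>z. dirderiv \<Phi> (s, y z) (1, 0) + perp (E_field (rho (gt s)) (fst z)) \<bullet> V s (y z) \<partial>G s)"
      unfolding W_def y_def[symmetric]
    proof (rule Bochner_Integration.integral_cong[OF refl])
      fix z
      show "dirderiv \<Phi> (s, y z) (1, perp (E_field (rho (gt s)) (fst z))) = dirderiv \<Phi> (s, y z) (1, 0) + perp (E_field (rho (gt s)) (fst z)) \<bullet> V s (y z)"
        unfolding V_def inner_grad_section[OF s]
        using linear_add[OF dirderiv_linear[OF s], of "(s, y z)" "(1, 0)" "(0, perp (E_field (rho (gt s)) (fst z)))"] by simp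
    qed
    also have "\<dots> = (\<integral>z. dirderiv \<Phi> (s, y z) (1, 0) \<partial>G s) + (\<integral>z. perp (E_field (rho (gt s)) (fst z)) \<bullet> V s (y z) \<partial>G s)"
      by (rule Bochner_Integration.integral_add[OF i1 i2])
    finally have W: "W s = \<dots>" .
    have "\<bar>(\<integral>z. dirderiv \<Phi> (s, y z) (1, 0) \<partial>G s) - a s\<bar> \<le> B * \<epsilon> * (P.mass s + P.kin s)"
      unfolding a_def y_def
    proof (rule P.gyro_shift[of "\<lambda>x. dirderiv \<Phi> (s, x) (1, 0)"])
      show "continuous_on UNIV (\<lambda>x. dirderiv \<Phi> (s, x) (1, 0))"
        by (rule continuous_on_compose2[OF smooth_continuous_on[OF smooth_dirderiv[OF s], of UNIV]]) (auto intro!: continuous_intros)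
      show "\<bar>dirderiv \<Phi> (s, x) (1, 0)\<bar> \<le> B" for x using B(2)[of "(s, x)" "(1, 0)"] by (simp add: norm_Pair)
      show "\<bar>dirderiv \<Phi> (s, x) (1, 0) - dirderiv \<Phi> (s, y) (1, 0)\<bar> \<le> B * norm (x - y)" for x y
        using B(4)[of "(s, x)" "(1, 0)" "(s, y)"] by (simp add: norm_Pair)
    qed (use eps in simp)
    also have "\<dots> \<le> B * \<epsilon> * (A + K)"
      using B0 eps ms[OF that] kin[OF that] by (intro mult_left_mono add_mono) auto
    finally have c1: "\<bar>(\<integral>z. dirderiv \<Phi> (s, y z) (1, 0) \<partial>G s) - a s\<bar> \<le> B * \<epsilon> * (A + K)" .
    have "\<bar>(\<integral>z. perp (E_field (rho (gt s)) (fst z)) \<bullet> V s (y z) \<partial>G s) - h s\<bar> \<le> B * \<epsilon> * (S * P.drift s)"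
      unfolding h_def y_def H_kernel_eq V_def[symmetric]
      by (rule P.gyro_drift[OF VB(3) VB(1) VB(2) S]) (use eps in simp)
    also have "\<dots> \<le> B * \<epsilon> * (S * (A\<^sup>2 + 4 * A * K + 4 * pi\<^sup>2 * K))"
      using B0 eps S drift[OF that] by (intro mult_left_mono) auto
    finally have c2: "\<bar>(\<integral>z. perp (E_field (rho (gt s)) (fst z)) \<bullet> V s (y z) \<partial>G s) - h s\<bar> \<le> B * \<epsilon> * (S * (A\<^sup>2 + 4 * A * K + 4 * pi\<^sup>2 * K))" .
    have "B * D = B * \<epsilon> * (A + K) + B * \<epsilon> * (S * (A\<^sup>2 + 4 * A * K + 4 * pi\<^sup>2 * K))" by (simp add: D_def algebra_simps)
    then show ?thesis using c1 c2 W by linarith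
  qed
  have D0: "0 \<le> D" using eps A0 K0 S by (simp add: D_def)
  have tT: "s \<in> {0..T}" if "s \<in> {0..t}" for s using that t by auto
  have si: "set_integrable lborel {0..t} a" "set_integrable lborel {0..t} h" "set_integrable lborel {0..t} W"
  proof -
    show "set_integrable lborel {0..t} a" using ab tT by (intro set_integrable_bounded[OF am, of _ _ "B * A"]) auto
    show "set_integrable lborel {0..t} h" using hb tT by (intro set_integrable_bounded[OF hm, of _ _ "B * A\<^sup>2"]) auto
    have "\<bar>W s\<bar> \<le> B * D + B * A + B * A\<^sup>2" if "s \<in> {0..t}" for s
      using W_close[OF tT[OF that]] ab[OF tT[OF that]] hb[OF tT[OF that]] by linarith
    then show "set_integrable lborel {0..t} W" by (intro set_integrable_bounded[OF Wm]) auto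
  qed
  have "(LINT s:{0..t}|lborel. W s) - (LINT s:{0..t}|lborel. a s) - (LINT s:{0..t}|lborel. h s) = (LINT s:{0..t}|lborel. W s - (a s + h s))"
    using set_integral_diff(2)[OF si(3) set_integral_add(1)[OF si(1,2)]] set_integral_add(2)[OF si(1,2)] by simp
  moreover have "\<bar>LINT s:{0..t}|lborel. W s - (a s + h s)\<bar> \<le> B * D * (t - 0)"
    using Wm am hm W_close tT t B0 D0 by (intro set_integral_abs_le) auto
  ultimately have I: "\<bar>(LINT s:{0..t}|lborel. W s) - (LINT s:{0..t}|lborel. a s) - (LINT s:{0..t}|lborel. h s)\<bar> \<le> B * D * t" by simp
  have shift: "\<bar>(\<integral>z. \<Phi> (s, fst z + \<epsilon> *\<^sub>R perp (snd z)) \<partial>G s) - (\<integral>x. \<Phi> (s, x) \<partial>N s)\<bar> \<le> B * D" if "s \<in> {0..T}" for s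
  proof -
    have "\<bar>(\<integral>z. \<Phi> (s, fst z + \<epsilon> *\<^sub>R perp (snd z)) \<partial>G s) - (\<integral>x. \<Phi> (s, x) \<partial>N s)\<bar> \<le> B * \<epsilon> * (P.mass s + P.kin s)"
    proof (rule P.gyro_shift[of "\<lambda>x. \<Phi> (s, x)"])
      show "continuous_on UNIV (\<lambda>x. \<Phi> (s, x))"
        by (rule continuous_on_compose2[OF smooth_continuous_on[OF s, of UNIV]]) (auto intro!: continuous_intros)
      show "\<bar>\<Phi> (s, x)\<bar> \<le> B" for x by (rule B(1))
      show "\<bar>\<Phi> (s, x) - \<Phi> (s, y)\<bar> \<le> B * norm (x - y)" for x y using B(3)[of "(s, x)" "(s, y)"] by (simp add: norm_Pair)
    qed (use eps in simp)
    also have "\<dots> \<le> B * \<epsilon> * (A + K)"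
      using B0 eps ms[OF that] kin[OF that] by (intro mult_left_mono add_mono) auto
    also have "\<dots> \<le> B * D"
    proof -
      have "0 \<le> S * (A\<^sup>2 + 4 * A * K + 4 * pi\<^sup>2 * K)" using S A0 K0 by simp
      then have "\<epsilon> * (A + K) \<le> D" unfolding D_def using eps by (intro mult_left_mono) auto
      then show ?thesis using B0 by (simp add: mult.assoc mult_left_mono)
    qed
    finally show ?thesis .
  qed
  have "(\<integral>z. \<Phi> (t, fst z + \<epsilon> *\<^sub>R perp (snd z)) \<partial>G t) = (\<integral>z. \<Phi> (0, fst z + \<epsilon> *\<^sub>R perp (snd z)) \<partial>G 0) + (LINT s:{0..t}|lborel. W s)"
    unfolding W_def by (rule gyro_weak[OF s t])
  \<comment> \<open>The two shifts at the endpoints contribute B D each and the time integral B D t,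
    hence the factor 2 + t.\<close>
  then have "\<bar>(\<integral>x. \<Phi> (t, x) \<partial>N t) - (\<integral>x. \<Phi> (0, x) \<partial>N 0) - (LINT s:{0..t}|lborel. a s) - (LINT s:{0..t}|lborel. h s)\<bar> \<le> B * D + B * D + B * D * t"
    using I shift[OF t] shift[OF z] by linarith
  also have "\<dots> = B * (2 + t) * D" by (simp add: algebra_simps)
  finally show "\<bar>(\<integral>x. \<Phi> (t, x) \<partial>N t) - (\<integral>x. \<Phi> (0, x) \<partial>N 0) - (LINT s:{0..t}|lborel. a s) - (LINT s:{0..t}|lborel. h s)\<bar>
      \<le> B * (2 + t) * (\<epsilon> * (A + K + S * (A\<^sup>2 + 4 * A * K + 4 * pi\<^sup>2 * K)))" unfolding D_def .
qed

text \<open>Testing with a function of x alone leaves the velocity v/\<epsilon>, bounded on the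
  support. The constant blows up as \<epsilon> tends to 0; it gives continuity in time for each
  fixed \<epsilon>, whereas compactness rests on \<open>equicontinuity\<close>.\<close>

lemma density_Lipschitz_in_time:
  assumes \<phi>: "\<phi> \<in> C_c_inf"
  shows "\<exists>C\<ge>0. \<forall>r\<in>{0..T}. \<forall>t\<in>{0..T}. r \<le> t \<longrightarrow> \<bar>(\<integral>x. \<phi> x \<partial>N t) - (\<integral>x. \<phi> x \<partial>N r)\<bar> \<le> C * (t - r)"
proof -
  have s: "smooth \<phi>" using \<phi> by (simp add: C_c_inf_smooth)
  define L where "L p = fst (snd p)" for p :: "real \<times> phase"
  have L: "bounded_linear L" unfolding L_def by (rule bounded_linear_compose[OF bounded_linear_fst bounded_linear_snd])
  have sm: "smooth (\<lambda>p. \<phi> (L p))" by (rule smooth_compose_linear[OF s L])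
  have d: "dirderiv (\<lambda>p. \<phi> (L p)) p h = dirderiv \<phi> (L p) (L h)" for p h
    by (rule dirderiv_eq[OF has_derivative_compose[OF bounded_linear_imp_has_derivative[OF L] smooth_has_derivative[OF s]]])
  obtain B where B: "B > 0" "\<And>x h. \<bar>dirderiv \<phi> x h\<bar> \<le> B * norm h" using C_c_inf_dirderiv_bounded[OF \<phi>] by blast
  define W where "W s = (\<integral>z. dirderiv \<phi> (fst z) ((1 / \<epsilon>) *\<^sub>R snd z) \<partial>G s)" for s
  have Wm: "W \<in> borel_measurable borel"
  proof -
    have "(\<lambda>p. dirderiv \<phi> (fst (snd p)) ((1 / \<epsilon>) *\<^sub>R snd (snd p))) \<in> borel_measurable ((borel :: real measure) \<Otimes>\<^sub>M (borel :: phase measure))"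
      by (rule measurable_dirderiv[OF s]) measurable
    then have "(\<lambda>s. \<integral>z. dirderiv \<phi> (fst z) ((1 / \<epsilon>) *\<^sub>R snd z) \<partial>G s) \<in> borel_measurable borel"
      by (intro integral_G_meas) (simp add: split_beta')
    then show ?thesis by (simp add: W_def[abs_def])
  qed
  define C where "C = B * (1 / \<epsilon> * R) * P.mass 0"
  have C0: "0 \<le> C" using B eps P.R_pos P.mass_nonneg by (simp add: C_def)
  have Wb: "\<bar>W s\<bar> \<le> C" if "s \<in> {0..T}" for s
  proof -
    have m: "(\<lambda>z. dirderiv \<phi> (fst z) ((1 / \<epsilon>) *\<^sub>R snd z)) \<in> borel_measurable (borel :: phase measure)"
      by (rule measurable_dirderiv[OF s]) measurable
    have b: "\<bar>dirderiv \<phi> (fst z) ((1 / \<epsilon>) *\<^sub>R snd z)\<bar> \<le> B * (1 / \<epsilon> * R)" if "norm z \<le> R" for z :: phase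
    proof -
      have "\<bar>dirderiv \<phi> (fst z) ((1 / \<epsilon>) *\<^sub>R snd z)\<bar> \<le> B * (1 / \<epsilon> * norm (snd z))"
        using B(2)[of "fst z" "(1 / \<epsilon>) *\<^sub>R snd z"] eps by simp
      also have "\<dots> \<le> B * (1 / \<epsilon> * R)" using B(1) eps P.snd_le(1)[OF that] by (intro mult_left_mono) auto
      finally show ?thesis .
    qed
    have "\<bar>W s\<bar> \<le> (\<integral>z. \<bar>dirderiv \<phi> (fst z) ((1 / \<epsilon>) *\<^sub>R snd z)\<bar> \<partial>G s)" unfolding W_def by (rule integral_abs_bound)
    also have "\<dots> \<le> (\<integral>z. B * (1 / \<epsilon> * R) \<partial>G s)"
    proof (rule integral_mono_AE)
      show "integrable (G s) (\<lambda>z. \<bar>dirderiv \<phi> (fst z) ((1 / \<epsilon>) *\<^sub>R snd z)\<bar>)"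
        using b by (intro integrable_abs P.G_integrable[OF m]) auto
      show "AE z in G s. \<bar>dirderiv \<phi> (fst z) ((1 / \<epsilon>) *\<^sub>R snd z)\<bar> \<le> B * (1 / \<epsilon> * R)"
        using P.AE_G by eventually_elim (rule b)
    qed simp
    also have "\<dots> = C" using mass_const[OF that] by (simp add: C_def P.mass_G)
    finally show ?thesis .
  qed
  have eq: "(\<integral>x. \<phi> x \<partial>N t) = (\<integral>x. \<phi> x \<partial>N 0) + (LINT s:{0..t}|lborel. W s)" if "t \<in> {0..T}" for t
    using weak_G[OF sm that] unfolding d W_def
    by (simp add: L_def P.integral_N[OF borel_measurable_continuous_onI[OF smooth_continuous_on[OF s]]])
  have "\<bar>(\<integral>x. \<phi> x \<partial>N t) - (\<integral>x. \<phi> x \<partial>N r)\<bar> \<le> C * (t - r)" if "r \<in> {0..T}" "t \<in> {0..T}" "r \<le> t" for r t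
    unfolding eq[OF that(1)] eq[OF that(2)] using set_integral_split[OF Wm, of t C r] Wb that C0 by auto
  then show ?thesis using C0 by blast
qed

end

subsection \<open>From weak solutions to regular representatives\<close>

lemma L1_Linf_measurable: "g \<in> L1_Linf \<Longrightarrow> g \<in> borel_measurable borel"
  by (auto simp: L1_Linf_def dest: borel_measurable_integrable)

lemma AE_le_Linf_norm:
  assumes "g \<in> L1_Linf" shows "AE z in lborel. \<bar>g z\<bar> \<le> Linf_norm g"
proof -
  note [measurable] = L1_Linf_measurable[OF assms]
  have "esssup lborel (\<lambda>z. ereal \<bar>g z\<bar>) < \<infinity>" using assms by (simp add: L1_Linf_def ess_bounded_def)
  moreover have "AE z in lborel. ereal \<bar>g z\<bar> \<le> esssup lborel (\<lambda>z. ereal \<bar>g z\<bar>)" by (rule esssup_AE)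
  ultimately show ?thesis unfolding Linf_norm_def
    by (cases "esssup lborel (\<lambda>z. ereal \<bar>g z\<bar>)") auto
qed

lemma Linf_norm_nonneg:
  fixes g :: "'a::euclidean_space \<Rightarrow> real"
  assumes "g \<in> L1_Linf" shows "0 \<le> Linf_norm g"
proof (rule ccontr)
  assume "\<not> 0 \<le> Linf_norm g"
  then have "AE z in (lborel :: 'a measure). False" using AE_le_Linf_norm[OF assms] by (auto elim!: eventually_mono)
  then show False by (simp add: eventually_False ae_filter_eq_bot_iff)
qed

lemma Lp_norm_1: "Lp_norm 1 g = (\<integral>z. \<bar>g z\<bar> \<partial>lborel)"
  by (simp add: Lp_norm_def)

lemma Linf_norm_cong:
  assumes [measurable]: "g \<in> borel_measurable borel" "h \<in> borel_measurable borel" and "AE z in lborel. g z = h z"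
  shows "Linf_norm g = Linf_norm h"
  unfolding Linf_norm_def using assms(3) by (subst esssup_AE_cong[of _ _ "\<lambda>z. ereal \<bar>h z\<bar>"]) auto

lemma section_measurable:
  fixes g :: "phase \<Rightarrow> real"
  assumes "g \<in> borel_measurable borel" shows "(\<lambda>v. g (x, v)) \<in> borel_measurable borel"
proof -
  have "(\<lambda>v. (x, v)) \<in> borel \<rightarrow>\<^sub>M (borel :: phase measure)"
    by (intro borel_measurable_continuous_onI continuous_intros)
  from measurable_compose[OF this assms] show ?thesis .
qed

lemma rho_measurable:
  assumes "g \<in> borel_measurable borel" shows "rho g \<in> borel_measurable borel"
proof -
  have [measurable]: "g \<in> borel_measurable (borel \<Otimes>\<^sub>M borel)" using assms by (simp only: borel_prod)
  have "(\<lambda>x. \<integral>v. g (x, v) \<partial>lborel) \<in> borel_measurable borel"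
    by (rule lborel.borel_measurable_lebesgue_integral) measurable
  then show ?thesis by (simp add: rho_def[abs_def])
qed

lemma rho_cong:
  assumes "g \<in> borel_measurable borel" "h \<in> borel_measurable borel" "AE z in lborel. g z = h z"
  shows "AE x in lborel. rho g x = rho h x"
proof -
  have "AE z in lborel \<Otimes>\<^sub>M lborel. g z = h z" using assms(3) by (subst lborel_prod)
  from lborel_pair.AE_pair[OF this] show ?thesis
  proof eventually_elim
    fix x assume "AE v in lborel. g (x, v) = h (x, v)"
    then show "rho g x = rho h x" unfolding rho_def
      using section_measurable[OF assms(1)] section_measurable[OF assms(2)] by (intro integral_cong_AE) auto
  qed
qed

lemma E_field_cong:
  assumes [measurable]: "r \<in> borel_measurable borel" "r' \<in> borel_measurable borel" and "AE x in lborel. r x = r' x"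
  shows "E_field r x = E_field r' x"
  unfolding E_field_def using assms(3) by (intro integral_cong_AE) (auto elim!: eventually_mono)

lemma energy_cong:
  assumes [measurable]: "g \<in> borel_measurable borel" "h \<in> borel_measurable borel" and eq: "AE z in lborel. g z = h z"
  shows "energy g = energy h"
proof -
  note [measurable] = rho_measurable[OF assms(1)] rho_measurable[OF assms(2)]
  have "AE p in lborel \<Otimes>\<^sub>M lborel. rho g (fst p) = rho h (fst p) \<and> rho g (snd p) = rho h (snd p)"
  proof (rule lborel_pair.AE_pair_measure)
    show "AE x in lborel. AE y in lborel. rho g (fst (x, y)) = rho h (fst (x, y)) \<and> rho g (snd (x, y)) = rho h (snd (x, y))"
      using rho_cong[OF assms]
    proof eventually_elim
      fix x assume "rho g x = rho h x"
      with rho_cong[OF assms] show "AE y in lborel. rho g (fst (x, y)) = rho h (fst (x, y)) \<and> rho g (snd (x, y)) = rho h (snd (x, y))"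
        by (auto elim!: eventually_mono)
    qed
  qed measurable
  then have AEp: "AE p in (lborel :: phase measure). rho g (fst p) = rho h (fst p) \<and> rho g (snd p) = rho h (snd p)"
    by (simp only: lborel_prod)
  have "(\<integral>p. ln (norm (fst p - snd p)) * rho g (fst p) * rho g (snd p) \<partial>(lborel :: phase measure))
    = (\<integral>p. ln (norm (fst p - snd p)) * rho h (fst p) * rho h (snd p) \<partial>lborel)"
  proof (rule integral_cong_AE)
    show "AE p in (lborel :: phase measure). ln (norm (fst p - snd p)) * rho g (fst p) * rho g (snd p) = ln (norm (fst p - snd p)) * rho h (fst p) * rho h (snd p)"
      using AEp by eventually_elim simp
  qed measurable
  moreover have "(\<integral>z. (norm (snd z))\<^sup>2 * g z \<partial>lborel) = (\<integral>z. (norm (snd z))\<^sup>2 * h z \<partial>lborel)"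
    using eq by (intro integral_cong_AE) (auto elim!: eventually_mono)
  ultimately show ?thesis by (simp add: energy_def)
qed

lemma density_measure_cong:
  assumes [measurable]: "r \<in> borel_measurable borel" "r' \<in> borel_measurable borel" and "AE x in lborel. r x = r' x"
  shows "density_measure r = density_measure r'"
  unfolding density_measure_def using assms(3) by (intro density_cong) (auto elim!: eventually_mono)

lemma VP_operator_cutoff:
  assumes s: "smooth \<Psi>" and R: "R > 0" and p: "norm (s, x, v) < R"
  shows "VP_operator \<epsilon> r (\<lambda>p. bump R p * \<Psi> p) s x v = VP_operator \<epsilon> r \<Psi> s x v"
proof -
  have b: "smooth (bump R :: real \<times> phase \<Rightarrow> real)" by (rule bump_props(1)[OF R])
  have "(bump R has_derivative (\<lambda>h. 0)) (at (s, x, v))"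
  proof (rule has_derivative_transform_within_open[OF has_derivative_const])
    show "open (ball (0 :: real \<times> phase) R)" by simp
    show "(s, x, v) \<in> ball 0 R" using p by simp
    show "1 = bump R q" if "q \<in> ball 0 R" for q :: "real \<times> phase" using that bump_props(2)[OF R, of q] by simp
  qed
  then have d0: "dirderiv (bump R) (s, x, v) h = 0" for h by (rule dirderiv_eq)
  have "dirderiv (\<lambda>p. bump R p * \<Psi> p) (s, x, v) h = bump R (s, x, v) * dirderiv \<Psi> (s, x, v) h + dirderiv (bump R) (s, x, v) h * \<Psi> (s, x, v)" for h
    by (rule dirderiv_eq[OF has_derivative_mult[OF smooth_has_derivative[OF b] smooth_has_derivative[OF s]]])
  then have "dirderiv (\<lambda>p. bump R p * \<Psi> p) (s, x, v) h = dirderiv \<Psi> (s, x, v) h" for h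
    using bump_props(2)[OF R, of "(s, x, v)"] p by (simp add: d0)
  then show ?thesis by (simp add: VP_operator_eq[OF s] VP_operator_eq[OF smooth_mult[OF b s]])
qed

text \<open>A cutoff that is 1 around [0, T] times the common support does not change the equation,
  so test functions need no compact support. Off the ball f vanishes only almost everywhere; the
  conditional makes the integrand independent of the cutoff there.\<close>

lemma weak_smooth:
  fixes f :: "real \<Rightarrow> phase \<Rightarrow> real"
  assumes sol: "VP_weak_solution \<epsilon> f0 f" and supp: "\<And>t. t \<in> {0..T} \<Longrightarrow> ess_supported_in R (f t)"
    and s: "smooth \<Psi>" and t: "t \<in> {0..T}" and f0m: "f0 \<in> borel_measurable borel"
  shows "(\<integral>z. \<Psi> (t, z) * f t z \<partial>lborel) = (\<integral>z. \<Psi> (0, z) * f0 z \<partial>lborel)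
        + (LINT s:{0..t}|lborel. (\<integral>z. (if norm z \<le> R then VP_operator \<epsilon> (rho (f s)) \<Psi> s (fst z) (snd z) * f s z else 0) \<partial>lborel))"
proof -
  \<comment> \<open>Larger than the norm of any (s, z) with s in [0, T] and |z| \<le> R; the + 1
    keeps the inequality strict, so that the cutoff is constant near such points.\<close>
  define Q where "Q = \<bar>R\<bar> + T + 1"
  have "0 \<le> T" using t by simp
  then have Q: "Q > 0" unfolding Q_def by linarith
  have small: "norm (s, z) < Q" if "s \<in> {0..T}" "norm z \<le> R" for s and z :: phase
    using norm_Pair_le[of s z] that abs_ge_self[of R] by (simp add: Q_def)
  define \<Phi> where "\<Phi> = (\<lambda>p. bump Q p * \<Psi> p)"
  have Phi: "\<Phi> \<in> C_c_inf" unfolding \<Phi>_def by (rule C_c_inf_mult[OF bump_props(6)[OF Q] s])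
  have Phi1: "\<Phi> (s, z) = \<Psi> (s, z)" if "s \<in> {0..T}" "norm z \<le> R" for s z
    using bump_props(2)[OF Q, of "(s, z)"] small[OF that] by (simp add: \<Phi>_def)
  have fm: "f s \<in> borel_measurable borel" if "s \<ge> 0" for s
    using sol that by (intro L1_Linf_measurable) (simp add: VP_weak_solution_def)
  have cm: "(\<lambda>z. \<theta> (s, z)) \<in> borel_measurable borel" if "smooth \<theta>" for s and \<theta> :: "real \<times> phase \<Rightarrow> real"
    by (rule borel_measurable_continuous_onI, rule continuous_on_compose2[OF smooth_continuous_on[OF that, of UNIV]]) (auto intro!: continuous_intros)
  have Phis: "smooth \<Phi>" using Phi by (simp add: C_c_inf_smooth)
  have e1: "(\<integral>z. \<Phi> (s, z) * f s z \<partial>lborel) = (\<integral>z. \<Psi> (s, z) * f s z \<partial>lborel)" if "s \<in> {0..T}" for s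
  proof (rule integral_cong_AE)
    show "AE z in lborel. \<Phi> (s, z) * f s z = \<Psi> (s, z) * f s z"
      using supp[OF that] unfolding ess_supported_in_def
      by eventually_elim (use Phi1[OF that] in \<open>force simp: not_le[symmetric]\<close>)
  qed (use fm that cm Phis s in auto)
  have T0: "0 \<in> {0..T}" using t by auto
  have f0eq: "AE z in lborel. f 0 z = f0 z" using sol by (simp add: VP_weak_solution_def)
  have e2: "(\<integral>z. \<theta> (0, z) * f0 z \<partial>lborel) = (\<integral>z. \<theta> (0, z) * f 0 z \<partial>lborel)" if "smooth \<theta>" for \<theta> :: "real \<times> phase \<Rightarrow> real"
    using f0eq fm[of 0] f0m cm[OF that] by (intro integral_cong_AE) (auto elim!: eventually_mono)
  have "(\<integral>z. \<Phi> (t, z) * f t z \<partial>lborel) = (\<integral>z. \<Phi> (0, z) * f0 z \<partial>lborel)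
      + (LINT s:{0..t}|lborel. (\<integral>z. VP_operator \<epsilon> (rho (f s)) \<Phi> s (fst z) (snd z) * f s z \<partial>lborel))"
    using sol Phi t unfolding VP_weak_solution_def by auto
  moreover have "(LINT s:{0..t}|lborel. (\<integral>z. VP_operator \<epsilon> (rho (f s)) \<Phi> s (fst z) (snd z) * f s z \<partial>lborel))
    = (LINT s:{0..t}|lborel. (\<integral>z. (if norm z \<le> R then VP_operator \<epsilon> (rho (f s)) \<Psi> s (fst z) (snd z) * f s z else 0) \<partial>lborel))"
  proof (rule set_lebesgue_integral_cong)
    show "\<forall>s. s \<in> {0..t} \<longrightarrow> (\<integral>z. VP_operator \<epsilon> (rho (f s)) \<Phi> s (fst z) (snd z) * f s z \<partial>lborel)
      = (\<integral>z. (if norm z \<le> R then VP_operator \<epsilon> (rho (f s)) \<Psi> s (fst z) (snd z) * f s z else 0) \<partial>lborel)"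
    proof (intro allI impI)
      fix s assume "s \<in> {0..t}"
      then have sT: "s \<in> {0..T}" using t by auto
      have opm: "(\<lambda>z. VP_operator \<epsilon> (rho (f s)) \<theta> s (fst z) (snd z)) \<in> borel_measurable borel" if "smooth \<theta>" for \<theta> :: "real \<times> phase \<Rightarrow> real"
      proof -
        have [measurable]: "E_field (rho (f s)) \<in> borel_measurable borel"
        proof -
          note [measurable] = rho_measurable[OF fm[of s]]
          have "rho (f s) \<in> borel_measurable borel" using rho_measurable[OF fm[of s]] sT by simp
          note [measurable] = this
          have "(\<lambda>x. \<integral>y. (rho (f s) y / (norm (x - y))\<^sup>2) *\<^sub>R (x - y) \<partial>lborel) \<in> borel_measurable borel"
            by (rule lborel.borel_measurable_lebesgue_integral) measurable
          then show ?thesis by (simp add: E_field_def[abs_def])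
        qed
        show ?thesis unfolding VP_operator_eq[OF that] by (rule measurable_dirderiv[OF that]) measurable
      qed
      note [measurable] = opm[OF Phis] opm[OF s] fm[of s]
      have fsm[measurable]: "f s \<in> borel_measurable borel" using fm sT by simp
      show "(\<integral>z. VP_operator \<epsilon> (rho (f s)) \<Phi> s (fst z) (snd z) * f s z \<partial>lborel)
      = (\<integral>z. (if norm z \<le> R then VP_operator \<epsilon> (rho (f s)) \<Psi> s (fst z) (snd z) * f s z else 0) \<partial>lborel)"
      proof (rule integral_cong_AE)
        show "AE z in lborel. VP_operator \<epsilon> (rho (f s)) \<Phi> s (fst z) (snd z) * f s z
            = (if norm z \<le> R then VP_operator \<epsilon> (rho (f s)) \<Psi> s (fst z) (snd z) * f s z else 0)"
          using supp[OF sT] unfolding ess_supported_in_def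
        proof eventually_elim
          fix z assume z: "R < norm z \<longrightarrow> f s z = 0"
          show "VP_operator \<epsilon> (rho (f s)) \<Phi> s (fst z) (snd z) * f s z
            = (if norm z \<le> R then VP_operator \<epsilon> (rho (f s)) \<Psi> s (fst z) (snd z) * f s z else 0)"
            using z VP_operator_cutoff[OF s Q, of s "fst z" "snd z"] small[OF sT, of z] by (auto simp: \<Phi>_def)
        qed
      qed measurable
    qed
  qed simp
  ultimately show ?thesis using e1[OF t] e1[OF T0] e2[OF Phis] e2[OF s] by simp
qed

text \<open>Mass is conserved and the \<open>L\<^sup>1\<close> norm does not increase: this gives positivity at later times.\<close>

lemma nonneg_from_mass:
  assumes i: "integrable M f" and le: "(\<integral>z. \<bar>f z\<bar> \<partial>M) \<le> (\<integral>z. f z \<partial>M)"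
  shows "AE z in M. 0 \<le> (f z :: real)"
proof -
  have "(\<integral>z. \<bar>f z\<bar> - f z \<partial>M) = 0"
  proof (rule antisym)
    show "(\<integral>z. \<bar>f z\<bar> - f z \<partial>M) \<le> 0" using i le by simp
    show "0 \<le> (\<integral>z. \<bar>f z\<bar> - f z \<partial>M)" by (rule Bochner_Integration.integral_nonneg) simp
  qed
  then have "AE z in M. \<bar>f z\<bar> - f z = 0"
    using i by (subst (asm) integral_nonneg_eq_0_iff_AE) auto
  then show ?thesis by (auto elim!: eventually_mono)
qed

text \<open>At each time the bounds fail only on a null set, and neither the density, the field nor
  the energy sees such sets. Positivity at later times is not part of the notion of solution and is
  derived from conservation of mass.\<close>

lemma vp_run_exists:
  fixes f :: "real \<Rightarrow> phase \<Rightarrow> real"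
  assumes eps: "\<epsilon> > 0" and f0: "f0 \<in> L1_Linf" "AE z in lborel. 0 \<le> f0 z"
    and sol: "VP_global_solution \<epsilon> f0 f" and T: "T \<ge> 0"
  shows "\<exists>R gt. vp_run \<epsilon> T (Linf_norm f0) R gt \<and> (\<forall>s\<in>{0..T}. AE z in lborel. f s z = gt s z) \<and> (AE z in lborel. f0 z = gt 0 z)"
proof -
  have weak: "VP_weak_solution \<epsilon> f0 f" using sol by (simp add: VP_global_solution_def)
  have fL: "f s \<in> L1_Linf" if "s \<ge> 0" for s using weak that by (simp add: VP_weak_solution_def)
  have fm: "f s \<in> borel_measurable borel" if "s \<ge> 0" for s using fL[OF that] by (rule L1_Linf_measurable)
  have f0m: "f0 \<in> borel_measurable borel" by (rule L1_Linf_measurable[OF f0(1)])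
  have f0eq: "AE z in lborel. f 0 z = f0 z" using weak by (simp add: VP_weak_solution_def)
  obtain R0 where R0: "\<And>t. t \<in> {0..T} \<Longrightarrow> ess_supported_in R0 (f t)"
    using weak T unfolding VP_weak_solution_def by blast
  define R where "R = max R0 1"
  have R: "ess_supported_in R (f t)" if "t \<in> {0..T}" for t
    using R0[OF that] unfolding ess_supported_in_def R_def by (auto elim!: eventually_mono)
  \<comment> \<open>Testing with the constant 1, which \<open>weak_smooth\<close> permits, gives
    conservation of the integral of f.\<close>
  have int0: "(\<integral>z. f t z \<partial>lborel) = (\<integral>z. f0 z \<partial>lborel)" if "t \<in> {0..T}" for t
    using weak_smooth[OF weak R smooth_const[of 1] that f0m]
    by (simp add: VP_operator_eq[OF smooth_const] frechet_derivative_const cong: if_cong)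
  have nonneg: "AE z in lborel. 0 \<le> f t z" if t: "t \<in> {0..T}" for t
  proof (rule nonneg_from_mass)
    show "integrable lborel (f t)" using fL t by (simp add: L1_Linf_def)
    have "Lp_norm 1 (f t) \<le> Lp_norm 1 (f 0)" using sol t unfolding VP_global_solution_def by auto
    moreover have "(\<integral>z. \<bar>f 0 z\<bar> \<partial>lborel) = (\<integral>z. f0 z \<partial>lborel)"
      using f0eq f0(2) fm[of 0] f0m by (intro integral_cong_AE) auto
    ultimately show "(\<integral>z. \<bar>f t z\<bar> \<partial>lborel) \<le> (\<integral>z. f t z \<partial>lborel)" using int0[OF t] by (simp add: Lp_norm_1)
  qed
  define \<Lambda> where "\<Lambda> = Linf_norm f0"
  have L0: "0 \<le> \<Lambda>" unfolding \<Lambda>_def by (rule Linf_norm_nonneg[OF f0(1)])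
  have upper: "AE z in lborel. f t z \<le> \<Lambda>" if t: "t \<in> {0..T}" for t
  proof -
    have "Linf_norm (f t) \<le> Linf_norm (f 0)" using sol t unfolding VP_global_solution_def by auto
    moreover have "Linf_norm (f 0) = \<Lambda>" unfolding \<Lambda>_def using f0eq fm[of 0] f0m by (intro Linf_norm_cong) auto
    moreover have "AE z in lborel. \<bar>f t z\<bar> \<le> Linf_norm (f t)" using fL t by (intro AE_le_Linf_norm) auto
    ultimately show ?thesis by (auto elim!: eventually_mono)
  qed
  \<comment> \<open>The modification is decided pointwise from the value of f itself, so joint
    measurability in (s, z) survives. A separate choice of a representative for each time could
    destroy it.\<close>
  define gt where "gt s z = (if 0 \<le> s \<and> s \<le> T \<and> norm z \<le> R \<and> 0 \<le> f s z \<and> f s z \<le> \<Lambda> then f s z else 0)" for s z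
  have eq: "AE z in lborel. f s z = gt s z" if s: "s \<in> {0..T}" for s
    using nonneg[OF s] upper[OF s] R[OF s, unfolded ess_supported_in_def]
    by eventually_elim (use s in \<open>auto simp: gt_def not_le\<close>)
  have gt_meas: "(\<lambda>p. gt (fst p) (snd p)) \<in> borel_measurable borel"
  proof -
    define F where "F p = indicator ({0..} \<times> UNIV) p *\<^sub>R f (fst p) (snd p)" for p :: "real \<times> phase"
    have "closed ({0..} \<times> (UNIV :: phase set) :: (real \<times> phase) set)" by (intro closed_Times) auto
    then have [measurable]: "F \<in> borel_measurable borel"
      using weak unfolding VP_weak_solution_def F_def[abs_def]
      by (subst borel_measurable_restrict_space_iff[symmetric]) auto
    have [measurable]: "(fst :: real \<times> phase \<Rightarrow> real) \<in> borel_measurable borel" "(snd :: real \<times> phase \<Rightarrow> phase) \<in> borel_measurable borel"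
      by (auto intro!: borel_measurable_continuous_onI continuous_intros)
    have "(\<lambda>p. if 0 \<le> fst p \<and> fst p \<le> T \<and> norm (snd p) \<le> R \<and> 0 \<le> F p \<and> F p \<le> \<Lambda> then F p else 0) \<in> borel_measurable borel"
      by measurable
    also have "(\<lambda>p. if 0 \<le> fst p \<and> fst p \<le> T \<and> norm (snd p) \<le> R \<and> 0 \<le> F p \<and> F p \<le> \<Lambda> then F p else 0) = (\<lambda>p. gt (fst p) (snd p))"
      by (auto simp: fun_eq_iff gt_def F_def indicator_def)
    finally show ?thesis .
  qed
  have gsm: "gt s \<in> borel_measurable borel" for s
  proof -
    have "(\<lambda>z::phase. (s, z)) \<in> borel \<rightarrow>\<^sub>M (borel :: (real \<times> phase) measure)"
      by (intro borel_measurable_continuous_onI continuous_intros)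
    from measurable_compose[OF this gt_meas] show ?thesis by simp
  qed
  have pd: "phase_density (gt s) \<Lambda> R" for s
    by unfold_locales (use gsm L0 in \<open>auto simp: gt_def R_def\<close>)
  have "vp_run \<epsilon> T \<Lambda> R gt"
  proof (rule vp_run.intro)
    show "\<epsilon> > 0" "T \<ge> 0" by fact+
    show "(\<lambda>p. gt (fst p) (snd p)) \<in> borel_measurable borel" by fact
    show "phase_density (gt s) \<Lambda> R" for s by (rule pd)
    fix t assume t: "t \<in> {0..T}"
    have "energy (f t) \<le> energy (f 0)" using sol t unfolding VP_global_solution_def by auto
    then show "energy (gt t) \<le> energy (gt 0)"
      using energy_cong[OF fm gsm eq[OF t]] energy_cong[OF fm gsm eq, of 0] t T by simp
  next
    fix \<Psi> :: "real \<times> phase \<Rightarrow> real" and t assume s: "smooth \<Psi>" and t: "t \<in> {0..T}"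
    have cm: "(\<lambda>z. \<Psi> (s, z)) \<in> borel_measurable borel" for s
      by (rule borel_measurable_continuous_onI, rule continuous_on_compose2[OF smooth_continuous_on[OF s, of UNIV]]) (auto intro!: continuous_intros)
    have a: "(\<integral>z. \<Psi> (s, z) * f s z \<partial>lborel) = (\<integral>z. \<Psi> (s, z) * gt s z \<partial>lborel)" if "s \<in> {0..T}" for s
      using eq[OF that] fm[of s] gsm cm that by (intro integral_cong_AE) (auto elim!: eventually_mono)
    have T0: "0 \<in> {0..T}" using T by simp
    have b: "(\<integral>z. \<Psi> (0, z) * f0 z \<partial>lborel) = (\<integral>z. \<Psi> (0, z) * f 0 z \<partial>lborel)"
      using f0eq fm[of 0] f0m cm by (intro integral_cong_AE) (auto elim!: eventually_mono)
    have "(LINT s:{0..t}|lborel. (\<integral>z. (if norm z \<le> R then VP_operator \<epsilon> (rho (f s)) \<Psi> s (fst z) (snd z) * f s z else 0) \<partial>lborel))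
      = (LINT s:{0..t}|lborel. (\<integral>z. VP_operator \<epsilon> (rho (gt s)) \<Psi> s (fst z) (snd z) * gt s z \<partial>lborel))"
    proof (rule set_lebesgue_integral_cong)
      show "\<forall>s. s \<in> {0..t} \<longrightarrow> (\<integral>z. (if norm z \<le> R then VP_operator \<epsilon> (rho (f s)) \<Psi> s (fst z) (snd z) * f s z else 0) \<partial>lborel)
        = (\<integral>z. VP_operator \<epsilon> (rho (gt s)) \<Psi> s (fst z) (snd z) * gt s z \<partial>lborel)"
      proof (intro allI impI)
        fix r assume "r \<in> {0..t}"
        then have rT: "r \<in> {0..T}" using t by auto
        interpret P: phase_density "gt r" \<Lambda> R by (rule pd)
        have fr[measurable]: "f r \<in> borel_measurable borel" using fm rT by simp
        have "E_field (rho (f r)) x = E_field (rho (gt r)) x" for x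
          by (rule E_field_cong[OF rho_measurable[OF fr] rho_measurable[OF gsm] rho_cong[OF fr gsm eq[OF rT]]])
        then have op: "VP_operator \<epsilon> (rho (f r)) \<Psi> r x v = VP_operator \<epsilon> (rho (gt r)) \<Psi> r x v" for x v
          by (simp add: VP_operator_def)
        have opm[measurable]: "(\<lambda>z. VP_operator \<epsilon> (rho (gt r)) \<Psi> r (fst z) (snd z)) \<in> borel_measurable borel"
          unfolding VP_operator_eq[OF s] by (rule measurable_dirderiv[OF s]) measurable
        show "(\<integral>z. (if norm z \<le> R then VP_operator \<epsilon> (rho (f r)) \<Psi> r (fst z) (snd z) * f r z else 0) \<partial>lborel)
          = (\<integral>z. VP_operator \<epsilon> (rho (gt r)) \<Psi> r (fst z) (snd z) * gt r z \<partial>lborel)"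
          unfolding op
        proof (rule integral_cong_AE)
          show "AE z in lborel. (if norm z \<le> R then VP_operator \<epsilon> (rho (gt r)) \<Psi> r (fst z) (snd z) * f r z else 0)
            = VP_operator \<epsilon> (rho (gt r)) \<Psi> r (fst z) (snd z) * gt r z"
            using eq[OF rT] by eventually_elim (auto simp: P.g_support)
        qed measurable
      qed
    qed simp
    then show "(\<integral>z. \<Psi> (t, z) * gt t z \<partial>lborel) = (\<integral>z. \<Psi> (0, z) * gt 0 z \<partial>lborel)
        + (LINT s:{0..t}|lborel. (\<integral>z. VP_operator \<epsilon> (rho (gt s)) \<Psi> s (fst z) (snd z) * gt s z \<partial>lborel))"
      using weak_smooth[OF weak R s t f0m] a[OF t] a[OF T0] b by simp
  qed
  moreover have "AE z in lborel. f0 z = gt 0 z" using f0eq eq[of 0] T by (auto elim!: eventually_elim2)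
  ultimately show ?thesis using eq unfolding \<Lambda>_def by blast
qed

lemma C_c_inf_all_bounds:
  fixes \<phi> :: "'a::euclidean_space \<Rightarrow> real"
  assumes "\<phi> \<in> C_c_inf"
  obtains B where "B > 0" "\<And>x. \<bar>\<phi> x\<bar> \<le> B" "\<And>x h. \<bar>dirderiv \<phi> x h\<bar> \<le> B * norm h"
    "\<And>x y. \<bar>\<phi> x - \<phi> y\<bar> \<le> B * norm (x - y)"
    "\<And>x y h. \<bar>dirderiv \<phi> x h - dirderiv \<phi> y h\<bar> \<le> B * norm (x - y) * norm h"
proof -
  obtain B where B: "B > 0" "\<And>x. \<bar>\<phi> x\<bar> \<le> B" "\<And>x h. \<bar>dirderiv \<phi> x h\<bar> \<le> B * norm h"
    "\<And>x y h. \<bar>dirderiv \<phi> x h - dirderiv \<phi> y h\<bar> \<le> B * norm (x - y) * norm h"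
    using C_c_inf_derivative_bounds[OF assms] by blast
  obtain L where L: "L > 0" "\<And>x y. \<bar>\<phi> x - \<phi> y\<bar> \<le> L * norm (x - y)"
    using C_c_inf_Lipschitz[OF assms] by blast
  have "B \<le> max B L" "L \<le> max B L" by auto
  then have m: "B * c \<le> max B L * c" "L * c \<le> max B L * c" if "0 \<le> c" for c
    using that by (auto intro: mult_right_mono)
  show ?thesis
  proof (rule that[of "max B L"])
    show "max B L > 0" using B(1) by simp
    show "\<bar>\<phi> x\<bar> \<le> max B L" for x using B(2)[of x] by simp
    show "\<bar>dirderiv \<phi> x h\<bar> \<le> max B L * norm h" for x h using B(3)[of x h] m(1)[of "norm h"] by simp
    show "\<bar>\<phi> x - \<phi> y\<bar> \<le> max B L * norm (x - y)" for x y using L(2)[of x y] m(2)[of "norm (x - y)"] by simp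
    show "\<bar>dirderiv \<phi> x h - dirderiv \<phi> y h\<bar> \<le> max B L * norm (x - y) * norm h" for x y h
      using B(4)[of x h y] m(1)[of "norm (x - y) * norm h"] by (simp add: mult.assoc)
  qed
qed

lemma section_C_c:
  fixes \<Phi> :: "real \<times> plane \<Rightarrow> real"
  assumes "\<Phi> \<in> C_c" shows "(\<lambda>x. \<Phi> (s, x)) \<in> C_c"
proof -
  obtain R where R: "R > 0" "\<And>p. norm p > R \<Longrightarrow> \<Phi> p = 0"
    using assms compact_supportD[of \<Phi>] by (auto simp: C_c_def)
  have "compact_support (\<lambda>x. \<Phi> (s, x))"
    by (rule compact_supportI[of R]) (use R(2) norm_snd_le in \<open>force intro: less_le_trans\<close>)
  moreover have "continuous_on UNIV (\<lambda>x. \<Phi> (s, x))"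
    using assms by (auto simp: C_c_def intro!: continuous_on_compose2[of UNIV \<Phi>] continuous_intros)
  ultimately show ?thesis by (simp add: C_c_def)
qed

lemma continuous_on_halfline:
  assumes "\<And>T. T \<ge> 0 \<Longrightarrow> continuous_on {0..T} F" shows "continuous_on {0..} (F :: real \<Rightarrow> real)"
  unfolding continuous_on_eq_continuous_within
proof
  fix t :: real assume t: "t \<in> {0..}"
  have "continuous (at t within {0..t+1}) F" using assms[of "t+1"] t by (simp add: continuous_on_eq_continuous_within)
  moreover have "at t within {0..t+1} = at t within {0..}"
    by (rule at_within_nhd[of _ "{..<t+1}"]) (use t in auto)
  ultimately show "continuous (at t within {0..}) F" by simp
qed

text \<open>With bounded masses, uniform approximation of \<phi> by smooth test functions gives
  approximation of the integrals uniformly in time, and uniform limits keep continuity.\<close>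

lemma continuous_on_by_density:
  assumes N: "\<And>t. t \<in> {0..T} \<Longrightarrow> N t \<in> Mplus" "\<And>t. t \<in> {0..T} \<Longrightarrow> measure (N t) UNIV \<le> A" and A: "0 \<le> A"
    and c: "\<And>\<psi>. \<psi> \<in> C_c_inf \<Longrightarrow> continuous_on {0..T} (\<lambda>t. \<integral>x. \<psi> x \<partial>N t)" and \<phi>: "\<phi> \<in> C_c"
  shows "continuous_on {0..T} (\<lambda>t. \<integral>x. \<phi> x \<partial>N t)"
proof -
  have "\<exists>\<psi>. \<psi> \<in> C_c_inf \<and> (\<forall>x. \<bar>\<phi> x - \<psi> x\<bar> \<le> 1 / real (Suc k))" for k
    using C_c_inf_dense[OF \<phi>, of "1 / real (Suc k)"] by (metis of_nat_0_less_iff zero_less_Suc zero_less_divide_1_iff)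
  then obtain \<psi> where \<psi>: "\<And>k. \<psi> k \<in> C_c_inf" "\<And>k x. \<bar>\<phi> x - \<psi> k x\<bar> \<le> 1 / real (Suc k)" by metis
  have "uniform_limit {0..T} (\<lambda>k t. \<integral>x. \<psi> k x \<partial>N t) (\<lambda>t. \<integral>x. \<phi> x \<partial>N t) sequentially"
  proof (rule uniform_limitI)
    fix e :: real assume e: "e > 0"
    have "(\<lambda>k. A * inverse (real (Suc k))) \<longlonglongrightarrow> A * 0" by (intro tendsto_intros LIMSEQ_inverse_real_of_nat)
    then have "\<forall>\<^sub>F k in sequentially. A * inverse (real (Suc k)) < e" using e by (intro order_tendstoD) auto
    then show "\<forall>\<^sub>F k in sequentially. \<forall>t\<in>{0..T}. dist (\<integral>x. \<psi> k x \<partial>N t) (\<integral>x. \<phi> x \<partial>N t) < e"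
    proof eventually_elim
      fix k assume k: "A * inverse (real (Suc k)) < e"
      show "\<forall>t\<in>{0..T}. dist (\<integral>x. \<psi> k x \<partial>N t) (\<integral>x. \<phi> x \<partial>N t) < e"
      proof
        fix t assume t: "t \<in> {0..T}"
        have "\<bar>(\<integral>x. \<phi> x \<partial>N t) - (\<integral>x. \<psi> k x \<partial>N t)\<bar> \<le> 1 / real (Suc k) * A"
          by (rule integral_diff_le[OF N(1)[OF t] N(2)[OF t] \<phi> C_c_inf_subset_C_c[OF \<psi>(1)] \<psi>(2)])
        then show "dist (\<integral>x. \<psi> k x \<partial>N t) (\<integral>x. \<phi> x \<partial>N t) < e"
          using k by (simp add: dist_real_def abs_minus_commute divide_inverse mult.commute)
      qed
    qed
  qed
  then show ?thesis
    by (rule uniform_limit_theorem[rotated]) (use c \<psi>(1) in auto)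
qed

subsection \<open>The limit\<close>

locale vp_family =
  fixes f0 :: "real \<Rightarrow> phase \<Rightarrow> real" and f :: "real \<Rightarrow> real \<Rightarrow> phase \<Rightarrow> real" and A H :: real
  assumes f0_class: "\<And>\<epsilon>. \<epsilon> > 0 \<Longrightarrow> f0 \<epsilon> \<in> L1_Linf"
    and f0_nonneg: "\<And>\<epsilon>. \<epsilon> > 0 \<Longrightarrow> AE z in lborel. 0 \<le> f0 \<epsilon> z"
    and solution: "\<And>\<epsilon>. \<epsilon> > 0 \<Longrightarrow> VP_global_solution \<epsilon> (f0 \<epsilon>) (f \<epsilon>)"
    and mass_moment: "\<And>\<epsilon>. \<epsilon> > 0 \<Longrightarrow> Lp_norm 1 (f0 \<epsilon>) + (\<integral>x. (norm x)\<^sup>2 * rho (f0 \<epsilon>) x \<partial>lborel) \<le> A"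
    and energy_bound: "\<And>\<epsilon>. \<epsilon> > 0 \<Longrightarrow> energy (f0 \<epsilon>) \<le> H" and H_nonneg: "0 \<le> H"
    and Linf_growth: "((\<lambda>\<epsilon>. \<epsilon>\<^sup>2 * Theta (Linf_norm (f0 \<epsilon>))) \<longlongrightarrow> 0) (at_right 0)"
begin

definition \<nu> where "\<nu> \<epsilon> t = density_measure (rho (f \<epsilon> t))"
definition M where "M = 3 * A + 4 * H"
text \<open>By \<open>uniform_bounds\<close> this bounds both \<open>kin\<close> and
  \<open>Lpot\<close>; \<open>M\<close> bounds the second moment.\<close>

definition K where "K = 2 * H + 2 * A * M"
definition S where "S \<epsilon> = sqrt (1 + Linf_norm (f0 \<epsilon>))"
text \<open>The bound of \<open>Euler_defect\<close> without the factor B (2 + t), which depends on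
  the test function and on time.\<close>

definition err where "err \<epsilon> = \<epsilon> * (A + K + S \<epsilon> * (A\<^sup>2 + 4 * A * K + 4 * pi\<^sup>2 * K))"

text \<open>The support radius, and hence the representative, depends on T, but the measure
  \<open>\<nu> \<epsilon> s\<close> does not: every statement about it may use the interval that
  suits it.\<close>

lemma run:
  assumes eps: "\<epsilon> > 0" and T: "T \<ge> 0"
  obtains R gt where "vp_run \<epsilon> T (Linf_norm (f0 \<epsilon>)) R gt"
    "\<And>s. s \<in> {0..T} \<Longrightarrow> \<nu> \<epsilon> s = phase_density.N (gt s)"
    "\<And>s. s \<in> {0..T} \<Longrightarrow> AE x in lborel. 0 \<le> rho (f \<epsilon> s) x"
    "phase_density.mass (gt 0) \<le> A" "phase_density.mom (gt 0) \<le> A" "energy (gt 0) \<le> H"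
proof -
  obtain R gt where run: "vp_run \<epsilon> T (Linf_norm (f0 \<epsilon>)) R gt"
    and eq: "\<And>s. s \<in> {0..T} \<Longrightarrow> AE z in lborel. f \<epsilon> s z = gt s z" and eq0: "AE z in lborel. f0 \<epsilon> z = gt 0 z"
    using vp_run_exists[OF eps f0_class[OF eps] f0_nonneg[OF eps] solution[OF eps] T] by blast
  interpret vp_run \<epsilon> T "Linf_norm (f0 \<epsilon>)" R gt by (rule run)
  have fm: "f \<epsilon> s \<in> borel_measurable borel" if "s \<ge> 0" for s
    using solution[OF eps] that by (intro L1_Linf_measurable) (simp add: VP_global_solution_def VP_weak_solution_def)
  have f0m: "f0 \<epsilon> \<in> borel_measurable borel" by (rule L1_Linf_measurable[OF f0_class[OF eps]])
  have rc: "AE x in lborel. rho (f \<epsilon> s) x = rho (gt s) x" if "s \<in> {0..T}" for s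
    using that by (intro rho_cong fm P.g_meas eq) auto
  have r0: "AE x in lborel. rho (f0 \<epsilon>) x = rho (gt 0) x" by (rule rho_cong[OF f0m P.g_meas eq0])
  have mom: "P.mom 0 = (\<integral>x. (norm x)\<^sup>2 * rho (f0 \<epsilon>) x \<partial>lborel)"
  proof -
    note [measurable] = rho_measurable[OF f0m] P.rho_meas[of 0]
    have "P.mom 0 = (\<integral>x. rho (gt 0) x * (norm x)\<^sup>2 \<partial>lborel)"
      unfolding P.mom_def P.N_def density_measure_def by (rule integral_real_density) (auto simp: P.rho_nonneg)
    also have "\<dots> = (\<integral>x. (norm x)\<^sup>2 * rho (f0 \<epsilon>) x \<partial>lborel)"
      using r0 by (intro integral_cong_AE) (auto elim!: eventually_mono)
    finally show ?thesis .
  qed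
  have mass: "P.mass 0 = Lp_norm 1 (f0 \<epsilon>)"
  proof -
    have "P.mass 0 = (\<integral>z. 1 \<partial>G 0)" by (simp add: P.mass_G)
    also have "\<dots> = (\<integral>z. 1 * gt 0 z \<partial>lborel)" by (rule P.integral_G[symmetric]) simp
    also have "\<dots> = (\<integral>z. \<bar>f0 \<epsilon> z\<bar> \<partial>lborel)"
      using eq0 f0m P.g_meas P.g_nonneg by (intro integral_cong_AE) (auto elim!: eventually_mono)
    finally show ?thesis by (simp add: Lp_norm_1)
  qed
  show ?thesis
  proof (rule that[OF run])
    show "\<nu> \<epsilon> s = phase_density.N (gt s)" if "s \<in> {0..T}" for s
      unfolding \<nu>_def P.N_def using that by (intro density_measure_cong rho_measurable fm P.rho_meas rc) auto
    show "AE x in lborel. 0 \<le> rho (f \<epsilon> s) x" if "s \<in> {0..T}" for s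
      using rc[OF that] by eventually_elim (simp add: P.rho_nonneg)
    show "P.mass 0 \<le> A" "P.mom 0 \<le> A" using mass_moment[OF eps] mass mom P.mass_nonneg[of 0] P.mom_nonneg[of 0] by linarith+
    show "energy (gt 0) \<le> H" using energy_bound[OF eps] energy_cong[OF f0m P.g_meas eq0] by simp
  qed
qed

lemma A_nonneg: "0 \<le> A"
proof -
  obtain R gt where "vp_run 1 0 (Linf_norm (f0 1)) R gt" and A: "phase_density.mass (gt 0) \<le> A" using run[of 1 0] by (metis zero_less_one order_refl)
  then interpret vp_run 1 0 "Linf_norm (f0 1)" R gt by simp
  show ?thesis using A P.mass_nonneg[of 0] by linarith
qed

lemma M_nonneg: "0 \<le> M" by (simp add: M_def A_nonneg H_nonneg)
lemma K_nonneg: "0 \<le> K" by (simp add: K_def M_nonneg A_nonneg H_nonneg)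

lemma S_props: "\<epsilon> > 0 \<Longrightarrow> S \<epsilon> > 0" "\<epsilon> > 0 \<Longrightarrow> Linf_norm (f0 \<epsilon>) \<le> (S \<epsilon>)\<^sup>2"
  using Linf_norm_nonneg[OF f0_class, of \<epsilon>] by (auto simp: S_def)

text \<open>The smallness under which the moment and energy bounds close in
  \<open>uniform_bounds\<close>.\<close>

definition small where "small \<epsilon> \<longleftrightarrow> 0 < \<epsilon> \<and> \<epsilon> * (1 + 2 * A) \<le> 1/2"

lemma bounds:
  assumes eps: "small \<epsilon>" and t: "t \<ge> 0"
  shows "AE x in lborel. 0 \<le> rho (f \<epsilon> t) x" "\<nu> \<epsilon> t \<in> Mplus" "measure (\<nu> \<epsilon> t) UNIV \<le> A"
    "(\<integral>\<^sup>+x. ennreal ((norm x)\<^sup>2) \<partial>\<nu> \<epsilon> t) \<le> ennreal M"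
    "\<And>d. 0 < d \<Longrightarrow> d < 1 \<Longrightarrow> measure (\<nu> \<epsilon> t \<Otimes>\<^sub>M \<nu> \<epsilon> t) {p. norm (fst p - snd p) < d} \<le> K / ln (1 / d)"
    "\<And>\<phi>. \<phi> \<in> C_c_inf \<Longrightarrow> \<bar>\<integral>x. \<phi> x \<partial>\<nu> \<epsilon> t\<bar> \<le> 4 * sqrt (A\<^sup>2 + K) * H1_norm \<phi>"
proof -
  have e: "\<epsilon> > 0" "\<epsilon> * (1 + 2 * A) \<le> 1/2" using eps by (auto simp: small_def)
  obtain R gt where run: "vp_run \<epsilon> t (Linf_norm (f0 \<epsilon>)) R gt"
    and N: "\<And>s. s \<in> {0..t} \<Longrightarrow> \<nu> \<epsilon> s = phase_density.N (gt s)"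
    and pos: "\<And>s. s \<in> {0..t} \<Longrightarrow> AE x in lborel. 0 \<le> rho (f \<epsilon> s) x"
    and AA: "phase_density.mass (gt 0) \<le> A" "phase_density.mom (gt 0) \<le> A" and HH: "energy (gt 0) \<le> H"
    using run[OF e(1) t] by metis
  interpret vp_run \<epsilon> t "Linf_norm (f0 \<epsilon>)" R gt by (rule run)
  have tt: "t \<in> {0..t}" using t by simp
  note N_t = N[OF tt]
  note ub = uniform_bounds[OF AA HH H_nonneg e(2) tt, folded M_def, folded K_def]
  show "AE x in lborel. 0 \<le> rho (f \<epsilon> t) x" by (rule pos[OF tt])
  show "\<nu> \<epsilon> t \<in> Mplus" unfolding N_t by (rule P.N_Mplus)
  have mA: "P.mass t \<le> A" using mass_const[OF tt] AA by simp
  then show "measure (\<nu> \<epsilon> t) UNIV \<le> A" unfolding N_t by (simp add: P.mass_def)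
  show "(\<integral>\<^sup>+x. ennreal ((norm x)\<^sup>2) \<partial>\<nu> \<epsilon> t) \<le> ennreal M"
    unfolding N_t P.nn_integral_mom by (rule ennreal_leI[OF ub(1)])
  show "measure (\<nu> \<epsilon> t \<Otimes>\<^sub>M \<nu> \<epsilon> t) {p. norm (fst p - snd p) < d} \<le> K / ln (1 / d)" if d: "0 < d" "d < 1" for d
    unfolding N_t by (rule order_trans[OF P.concentration[OF d]], rule divide_right_mono[OF ub(3)]) (use d in auto)
  show "\<bar>\<integral>x. \<phi> x \<partial>\<nu> \<epsilon> t\<bar> \<le> 4 * sqrt (A\<^sup>2 + K) * H1_norm \<phi>" if \<phi>: "\<phi> \<in> C_c_inf" for \<phi>
    unfolding N_t
  proof (rule H1_duality[OF P.finite_N P.sets_N P.N_atom _ _ \<phi>])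
    show "(\<integral>\<^sup>+x. \<integral>\<^sup>+y. ennreal (1 + lnm (norm (x - y))) \<partial>phase_density.N (gt t) \<partial>phase_density.N (gt t)) \<le> ennreal (A\<^sup>2 + K)"
      unfolding P.log_double_integral
      by (intro ennreal_leI add_mono power_mono mA ub(3) P.mass_nonneg)
    show "0 \<le> A\<^sup>2 + K" using K_nonneg by simp
  qed
qed

text \<open>The integrands are carried along as measurable functions a and h that agree with the
  integrals on [0, T] only, because measurability in time is obtained from a representative
  belonging to that interval.\<close>

definition approx_weak_form :: "(real \<times> plane \<Rightarrow> real) \<Rightarrow> real \<Rightarrow> real \<Rightarrow> real \<Rightarrow> (real \<Rightarrow> real) \<Rightarrow> (real \<Rightarrow> real) \<Rightarrow> bool" where
  "approx_weak_form \<Phi> B T \<epsilon> a h \<longleftrightarrow> a \<in> borel_measurable borel \<and> h \<in> borel_measurable borel \<and>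
    (\<forall>s\<in>{0..T}. a s = (\<integral>x. dirderiv \<Phi> (s, x) (1, 0) \<partial>\<nu> \<epsilon> s)
      \<and> h s = (\<integral>p. H_kernel (\<lambda>x. \<Phi> (s, x)) (fst p) (snd p) \<partial>(\<nu> \<epsilon> s \<Otimes>\<^sub>M \<nu> \<epsilon> s))
      \<and> \<bar>a s\<bar> \<le> B * A \<and> \<bar>h s\<bar> \<le> B * A\<^sup>2) \<and>
    (\<forall>t\<in>{0..T}. \<bar>(\<integral>x. \<Phi> (t, x) \<partial>\<nu> \<epsilon> t) - (\<integral>x. \<Phi> (0, x) \<partial>\<nu> \<epsilon> 0) - (LINT s:{0..t}|lborel. a s) - (LINT s:{0..t}|lborel. h s)\<bar>
      \<le> B * (2 + t) * err \<epsilon>)"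

lemma approx_weak_form_exists:
  fixes \<Phi> :: "real \<times> plane \<Rightarrow> real"
  assumes eps: "small \<epsilon>" and T: "T \<ge> 0" and s: "smooth \<Phi>"
    and B: "\<And>p. \<bar>\<Phi> p\<bar> \<le> B" "\<And>p h. \<bar>dirderiv \<Phi> p h\<bar> \<le> B * norm h"
      "\<And>p q. \<bar>\<Phi> p - \<Phi> q\<bar> \<le> B * norm (p - q)"
      "\<And>p q h. \<bar>dirderiv \<Phi> p h - dirderiv \<Phi> q h\<bar> \<le> B * norm (p - q) * norm h"
  shows "\<exists>a h. approx_weak_form \<Phi> B T \<epsilon> a h"
proof -
  have e: "\<epsilon> > 0" "\<epsilon> * (1 + 2 * A) \<le> 1/2" using eps by (auto simp: small_def)
  obtain R gt where run: "vp_run \<epsilon> T (Linf_norm (f0 \<epsilon>)) R gt"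
    and N: "\<And>s. s \<in> {0..T} \<Longrightarrow> \<nu> \<epsilon> s = phase_density.N (gt s)"
    and AA: "phase_density.mass (gt 0) \<le> A" "phase_density.mom (gt 0) \<le> A" and HH: "energy (gt 0) \<le> H"
    using run[OF e(1) T] by metis
  interpret vp_run \<epsilon> T "Linf_norm (f0 \<epsilon>)" R gt by (rule run)
  have kin: "P.kin s \<le> K" if "s \<in> {0..T}" for s
    using uniform_bounds(2)[OF AA HH H_nonneg e(2) that] by (simp add: K_def M_def)
  have z: "0 \<in> {0..T}" using T by simp
  define a where "a = (\<lambda>s. \<integral>x. dirderiv \<Phi> (s, x) (1, 0) \<partial>phase_density.N (gt s))"
  define h where "h = (\<lambda>s. \<integral>p. H_kernel (\<lambda>x. \<Phi> (s, x)) (fst p) (snd p) \<partial>(phase_density.N (gt s) \<Otimes>\<^sub>M phase_density.N (gt s)))"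
  note D = Euler_defect[OF s _ B AA(1) _ S_props[OF e(1)], where K = K, folded a_def h_def, folded err_def]
  show ?thesis
  proof (unfold approx_weak_form_def, rule exI[of _ a], rule exI[of _ h], intro conjI ballI)
    show "a \<in> borel_measurable borel" by (rule D(1)[OF z]) (erule kin)
    show "h \<in> borel_measurable borel" by (rule D(2)[OF z]) (erule kin)
    fix s assume st: "s \<in> {0..T}"
    show "a s = (\<integral>x. dirderiv \<Phi> (s, x) (1, 0) \<partial>\<nu> \<epsilon> s)" by (simp add: a_def N[OF st])
    show "h s = (\<integral>p. H_kernel (\<lambda>x. \<Phi> (s, x)) (fst p) (snd p) \<partial>(\<nu> \<epsilon> s \<Otimes>\<^sub>M \<nu> \<epsilon> s))" by (simp add: h_def N[OF st])
    show "\<bar>a s\<bar> \<le> B * A" unfolding a_def by (rule D(3)[OF z _ st]) (erule kin)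
    show "\<bar>h s\<bar> \<le> B * A\<^sup>2" unfolding h_def by (rule D(4)[OF z _ st]) (erule kin)
  next
    fix t assume t: "t \<in> {0..T}"
    show "\<bar>(\<integral>x. \<Phi> (t, x) \<partial>\<nu> \<epsilon> t) - (\<integral>x. \<Phi> (0, x) \<partial>\<nu> \<epsilon> 0) - (LINT s:{0..t}|lborel. a s) - (LINT s:{0..t}|lborel. h s)\<bar>
      \<le> B * (2 + t) * err \<epsilon>"
      unfolding N[OF t] N[OF z] by (rule D(5)[OF t]) (erule kin)
  qed
qed

lemma Lipschitz_in_time:
  assumes eps: "small \<epsilon>" and T: "T \<ge> 0" and \<phi>: "\<phi> \<in> C_c_inf"
  shows "\<exists>C\<ge>0. \<forall>r\<in>{0..T}. \<forall>t\<in>{0..T}. \<bar>(\<integral>x. \<phi> x \<partial>\<nu> \<epsilon> t) - (\<integral>x. \<phi> x \<partial>\<nu> \<epsilon> r)\<bar> \<le> C * \<bar>t - r\<bar>"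
proof -
  have e: "\<epsilon> > 0" using eps by (auto simp: small_def)
  obtain R gt where run: "vp_run \<epsilon> T (Linf_norm (f0 \<epsilon>)) R gt"
    and N: "\<And>s. s \<in> {0..T} \<Longrightarrow> \<nu> \<epsilon> s = phase_density.N (gt s)"
    using run[OF e T] by metis
  interpret vp_run \<epsilon> T "Linf_norm (f0 \<epsilon>)" R gt by (rule run)
  obtain C where C: "C \<ge> 0" "\<And>r t. r \<in> {0..T} \<Longrightarrow> t \<in> {0..T} \<Longrightarrow> r \<le> t \<Longrightarrow>
      \<bar>(\<integral>x. \<phi> x \<partial>phase_density.N (gt t)) - (\<integral>x. \<phi> x \<partial>phase_density.N (gt r))\<bar> \<le> C * (t - r)"
    using density_Lipschitz_in_time[OF \<phi>] by blast
  have "\<bar>(\<integral>x. \<phi> x \<partial>\<nu> \<epsilon> t) - (\<integral>x. \<phi> x \<partial>\<nu> \<epsilon> r)\<bar> \<le> C * \<bar>t - r\<bar>" if "r \<in> {0..T}" "t \<in> {0..T}" for r t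
  proof (cases "r \<le> t")
    case True then show ?thesis using C(2)[OF that] N that by simp
  next
    case False then show ?thesis using C(2)[OF that(2,1)] N that by (simp add: abs_minus_commute)
  qed
  then show ?thesis using C(1) by blast
qed

lemma N_continuous:
  assumes eps: "small \<epsilon>" and \<phi>: "\<phi> \<in> C_c"
  shows "continuous_on {0..} (\<lambda>t. \<integral>x. \<phi> x \<partial>\<nu> \<epsilon> t)"
proof (rule continuous_on_halfline, rule continuous_on_by_density[OF _ _ A_nonneg _ \<phi>])
  fix T :: real assume T: "T \<ge> 0"
  show "\<nu> \<epsilon> t \<in> Mplus" "measure (\<nu> \<epsilon> t) UNIV \<le> A" if "t \<in> {0..T}" for t using bounds(2,3)[OF eps] that by auto
  fix \<psi> :: "plane \<Rightarrow> real" assume "\<psi> \<in> C_c_inf"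
  then obtain C where "C \<ge> 0" "\<And>r t. r \<in> {0..T} \<Longrightarrow> t \<in> {0..T} \<Longrightarrow> \<bar>(\<integral>x. \<psi> x \<partial>\<nu> \<epsilon> t) - (\<integral>x. \<psi> x \<partial>\<nu> \<epsilon> r)\<bar> \<le> C * \<bar>t - r\<bar>"
    using Lipschitz_in_time[OF eps T] by metis
  then have "C-lipschitz_on {0..T} (\<lambda>t. \<integral>x. \<psi> x \<partial>\<nu> \<epsilon> t)"
    by (intro lipschitz_onI) (auto simp: dist_real_def)
  then show "continuous_on {0..T} (\<lambda>t. \<integral>x. \<psi> x \<partial>\<nu> \<epsilon> t)" by (rule lipschitz_on_continuous_on)
qed

lemma err_nonneg: "\<epsilon> > 0 \<Longrightarrow> 0 \<le> err \<epsilon>"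
  using S_props(1)[of \<epsilon>] A_nonneg K_nonneg by (simp add: err_def)

text \<open>As ln (\<tau> + 2) \<ge> ln 2, the hypothesis on \<open>Theta\<close> gives \<epsilon>^2
  times the supremum norm tending to 0, and \<epsilon> \<open>S \<epsilon>\<close> is the square
  root of \<epsilon>^2 plus this quantity.\<close>

lemma err_tendsto_0: "(err \<longlongrightarrow> 0) (at_right 0)"
proof -
  have pos: "\<forall>\<^sub>F \<epsilon> in at_right (0::real). \<epsilon> > 0" by (simp add: eventually_at_right_less)
  have L: "((\<lambda>\<epsilon>. \<epsilon>\<^sup>2 * Linf_norm (f0 \<epsilon>)) \<longlongrightarrow> 0) (at_right 0)"
  proof (rule Lim_null_comparison)
    have ln2: "ln 2 > (0::real)" by simp
    show "((\<lambda>\<epsilon>. \<epsilon>\<^sup>2 * Theta (Linf_norm (f0 \<epsilon>)) / ln 2) \<longlongrightarrow> 0) (at_right 0)"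
      using tendsto_divide[OF Linf_growth tendsto_const[of "ln 2"]] by simp
    show "\<forall>\<^sub>F \<epsilon> in at_right 0. norm (\<epsilon>\<^sup>2 * Linf_norm (f0 \<epsilon>)) \<le> \<epsilon>\<^sup>2 * Theta (Linf_norm (f0 \<epsilon>)) / ln 2"
      using pos
    proof eventually_elim
      fix \<epsilon> :: real assume e: "\<epsilon> > 0"
      define \<Lambda> where "\<Lambda> = Linf_norm (f0 \<epsilon>)"
      have L0: "0 \<le> \<Lambda>" unfolding \<Lambda>_def by (rule Linf_norm_nonneg[OF f0_class[OF e]])
      have "\<Lambda> * ln 2 \<le> Theta \<Lambda>" unfolding Theta_def using L0 by (intro mult_left_mono) auto
      then have "\<Lambda> \<le> Theta \<Lambda> / ln 2" using ln2 by (simp add: pos_le_divide_eq)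
      then have "\<epsilon>\<^sup>2 * \<Lambda> \<le> \<epsilon>\<^sup>2 * (Theta \<Lambda> / ln 2)" by (intro mult_left_mono) auto
      then show "norm (\<epsilon>\<^sup>2 * Linf_norm (f0 \<epsilon>)) \<le> \<epsilon>\<^sup>2 * Theta (Linf_norm (f0 \<epsilon>)) / ln 2"
        using L0 by (simp add: \<Lambda>_def)
    qed
  qed
  have "((\<lambda>\<epsilon>. sqrt (\<epsilon>\<^sup>2 + \<epsilon>\<^sup>2 * Linf_norm (f0 \<epsilon>))) \<longlongrightarrow> sqrt (0\<^sup>2 + 0)) (at_right 0)"
    by (intro tendsto_intros L)
  moreover have "\<forall>\<^sub>F \<epsilon> in at_right 0. sqrt (\<epsilon>\<^sup>2 + \<epsilon>\<^sup>2 * Linf_norm (f0 \<epsilon>)) = \<epsilon> * S \<epsilon>"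
    using pos
  proof eventually_elim
    fix \<epsilon> :: real assume "\<epsilon> > 0"
    have "\<epsilon>\<^sup>2 + \<epsilon>\<^sup>2 * Linf_norm (f0 \<epsilon>) = \<epsilon>\<^sup>2 * (1 + Linf_norm (f0 \<epsilon>))" by (simp add: distrib_left)
    then show "sqrt (\<epsilon>\<^sup>2 + \<epsilon>\<^sup>2 * Linf_norm (f0 \<epsilon>)) = \<epsilon> * S \<epsilon>"
      using \<open>\<epsilon> > 0\<close> by (simp add: real_sqrt_mult S_def)
  qed
  ultimately have eS: "((\<lambda>\<epsilon>. \<epsilon> * S \<epsilon>) \<longlongrightarrow> 0) (at_right 0)"
    by (auto intro: Lim_transform_eventually)
  have "((\<lambda>\<epsilon>. \<epsilon> * (A + K) + (\<epsilon> * S \<epsilon>) * (A\<^sup>2 + 4 * A * K + 4 * pi\<^sup>2 * K)) \<longlongrightarrow> 0 * (A + K) + 0 * (A\<^sup>2 + 4 * A * K + 4 * pi\<^sup>2 * K)) (at_right 0)"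
    by (intro tendsto_intros eS)
  moreover have "err = (\<lambda>\<epsilon>. \<epsilon> * (A + K) + (\<epsilon> * S \<epsilon>) * (A\<^sup>2 + 4 * A * K + 4 * pi\<^sup>2 * K))"
    by (auto simp: err_def fun_eq_iff distrib_left mult.assoc)
  ultimately show ?thesis by simp
qed

text \<open>For a test function that does not depend on time only the nonlinear term remains, and
  its integrand is bounded by B A^2 because the symmetrised kernel is bounded. This gives a constant
  independent of \<epsilon>, at the price of the additive error
  \<open>err \<epsilon>\<close>.\<close>

lemma equicontinuity:
  assumes \<phi>: "\<phi> \<in> C_c_inf" and T: "T \<ge> 0"
  shows "\<exists>C\<ge>0. \<forall>\<epsilon>. small \<epsilon> \<longrightarrow> (\<forall>s\<in>{0..T}. \<forall>t\<in>{0..T}.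
        \<bar>(\<integral>x. \<phi> x \<partial>\<nu> \<epsilon> t) - (\<integral>x. \<phi> x \<partial>\<nu> \<epsilon> s)\<bar> \<le> C * (\<bar>t - s\<bar> + err \<epsilon>))"
proof -
  obtain B where B: "B > 0" "\<And>x. \<bar>\<phi> x\<bar> \<le> B" "\<And>x h. \<bar>dirderiv \<phi> x h\<bar> \<le> B * norm h"
    "\<And>x y. \<bar>\<phi> x - \<phi> y\<bar> \<le> B * norm (x - y)"
    "\<And>x y h. \<bar>dirderiv \<phi> x h - dirderiv \<phi> y h\<bar> \<le> B * norm (x - y) * norm h"
    using C_c_inf_all_bounds[OF \<phi>] by blast
  have s: "smooth \<phi>" using \<phi> by (simp add: C_c_inf_smooth)
  define \<Phi> where "\<Phi> = (\<lambda>p::real \<times> plane. \<phi> (snd p))"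
  have sm: "smooth \<Phi>" unfolding \<Phi>_def by (rule smooth_compose_linear[OF s bounded_linear_snd])
  have d: "dirderiv \<Phi> p h = dirderiv \<phi> (snd p) (snd h)" for p h unfolding \<Phi>_def
    by (rule dirderiv_eq[OF has_derivative_compose[OF bounded_linear_imp_has_derivative[OF bounded_linear_snd] smooth_has_derivative[OF s]]])
  have sn: "norm (snd p) \<le> norm p" for p :: "real \<times> plane" using norm_snd_le[of "snd p" "fst p"] by simp
  have b: "\<And>p. \<bar>\<Phi> p\<bar> \<le> B" "\<And>p h. \<bar>dirderiv \<Phi> p h\<bar> \<le> B * norm h"
      "\<And>p q. \<bar>\<Phi> p - \<Phi> q\<bar> \<le> B * norm (p - q)"
      "\<And>p q h. \<bar>dirderiv \<Phi> p h - dirderiv \<Phi> q h\<bar> \<le> B * norm (p - q) * norm h"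
  proof -
    show "\<bar>\<Phi> p\<bar> \<le> B" for p unfolding \<Phi>_def by (rule B(2))
    show "\<bar>dirderiv \<Phi> p h\<bar> \<le> B * norm h" for p h unfolding d
      using B(3)[of "snd p" "snd h"] mult_left_mono[OF sn[of h], of B] B(1) by linarith
    show "\<bar>\<Phi> p - \<Phi> q\<bar> \<le> B * norm (p - q)" for p q unfolding \<Phi>_def
    proof -
      have "norm (snd p - snd q) \<le> norm (p - q)" using sn[of "p - q"] by simp
      then have "B * norm (snd p - snd q) \<le> B * norm (p - q)" using B(1) by (intro mult_left_mono) auto
      then show "\<bar>\<phi> (snd p) - \<phi> (snd q)\<bar> \<le> B * norm (p - q)" using B(4)[of "snd p" "snd q"] by linarith
    qed
    show "\<bar>dirderiv \<Phi> p h - dirderiv \<Phi> q h\<bar> \<le> B * norm (p - q) * norm h" for p q h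
    proof -
      have "B * norm (snd p - snd q) * norm (snd h) \<le> B * norm (p - q) * norm h"
        using sn[of "p - q"] sn[of h] B(1) by (intro mult_mono mult_left_mono) auto
      then show ?thesis unfolding d using B(5)[of "snd p" "snd h" "snd q"] by linarith
    qed
  qed
  \<comment> \<open>The rate of the nonlinear term, plus the defect B (2 + T) once for each of the
    two times.\<close>
  define C where "C = B * A\<^sup>2 + 2 * (B * (2 + T))"
  have C0: "0 \<le> C" using B(1) T by (simp add: C_def)
  have "\<bar>(\<integral>x. \<phi> x \<partial>\<nu> \<epsilon> t) - (\<integral>x. \<phi> x \<partial>\<nu> \<epsilon> r)\<bar> \<le> C * (\<bar>t - r\<bar> + err \<epsilon>)"
    if eps: "small \<epsilon>" and rt: "r \<in> {0..T}" "t \<in> {0..T}" for \<epsilon> r t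
  proof -
    have e0: "0 \<le> err \<epsilon>" using eps err_nonneg by (simp add: small_def)
    obtain a h where P: "approx_weak_form \<Phi> B T \<epsilon> a h" using approx_weak_form_exists[OF eps T sm b] by blast
    have ah: "h \<in> borel_measurable borel"
      "\<And>s. s \<in> {0..T} \<Longrightarrow> a s = (\<integral>x. dirderiv \<Phi> (s, x) (1, 0) \<partial>\<nu> \<epsilon> s)"
      "\<And>s. s \<in> {0..T} \<Longrightarrow> \<bar>h s\<bar> \<le> B * A\<^sup>2"
      "\<And>t. t \<in> {0..T} \<Longrightarrow> \<bar>(\<integral>x. \<Phi> (t, x) \<partial>\<nu> \<epsilon> t) - (\<integral>x. \<Phi> (0, x) \<partial>\<nu> \<epsilon> 0) - (LINT s:{0..t}|lborel. a s) - (LINT s:{0..t}|lborel. h s)\<bar>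
      \<le> B * (2 + t) * err \<epsilon>"
      using P unfolding approx_weak_form_def by blast+
    have a0: "a s = 0" if "s \<in> {0..T}" for s
      using ah(2)[OF that] linear_0[OF dirderiv_linear[OF s]] by (simp add: d)
    have La: "(LINT s:{0..u}|lborel. a s) = 0" if "u \<in> {0..T}" for u
    proof -
      have "(LINT s:{0..u}|lborel. a s) = (LINT s:{0..u}|lborel. 0)"
        using a0 that by (intro set_lebesgue_integral_cong) auto
      then show ?thesis by simp
    qed
    have x: "\<bar>(\<integral>x. \<phi> x \<partial>\<nu> \<epsilon> u) - (\<integral>x. \<phi> x \<partial>\<nu> \<epsilon> 0) - (LINT s:{0..u}|lborel. h s)\<bar> \<le> B * (2 + T) * err \<epsilon>" if "u \<in> {0..T}" for u
    proof -
      have "B * (2 + u) * err \<epsilon> \<le> B * (2 + T) * err \<epsilon>"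
        using that B(1) e0 by (intro mult_right_mono mult_left_mono) auto
      then show ?thesis using ah(4)[OF that] La[OF that] by (simp add: \<Phi>_def)
    qed
    have BA: "0 \<le> B * A\<^sup>2" using B(1) by simp
    have "\<bar>(LINT s:{0..t}|lborel. h s) - (LINT s:{0..r}|lborel. h s)\<bar> \<le> B * A\<^sup>2 * \<bar>t - r\<bar>"
    proof (cases "r \<le> t")
      case True
      have "\<bar>(LINT s:{0..t}|lborel. h s) - (LINT s:{0..r}|lborel. h s)\<bar> \<le> B * A\<^sup>2 * (t - r)"
        by (rule set_integral_split[OF ah(1)]) (use ah(3) rt True BA in auto)
      then show ?thesis using True by simp
    next
      case False
      have "\<bar>(LINT s:{0..r}|lborel. h s) - (LINT s:{0..t}|lborel. h s)\<bar> \<le> B * A\<^sup>2 * (r - t)"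
        by (rule set_integral_split[OF ah(1)]) (use ah(3) rt False BA in auto)
      then show ?thesis using False by (simp add: abs_minus_commute)
    qed
    then have "\<bar>(\<integral>x. \<phi> x \<partial>\<nu> \<epsilon> t) - (\<integral>x. \<phi> x \<partial>\<nu> \<epsilon> r)\<bar> \<le> B * A\<^sup>2 * \<bar>t - r\<bar> + 2 * (B * (2 + T)) * err \<epsilon>"
      using x[OF rt(1)] x[OF rt(2)] by linarith
    also have "\<dots> \<le> C * \<bar>t - r\<bar> + C * err \<epsilon>"
      using B(1) T e0 BA by (intro add_mono mult_right_mono) (auto simp: C_def)
    finally show ?thesis by (simp add: distrib_left)
  qed
  then show ?thesis using C0 by blast
qed

lemma uniform_concentration:
  assumes "e > 0"
  shows "\<exists>d>0. \<forall>\<epsilon> t. small \<epsilon> \<longrightarrow> t \<ge> 0 \<longrightarrow> measure (\<nu> \<epsilon> t \<Otimes>\<^sub>M \<nu> \<epsilon> t) {p. norm (fst p - snd p) < d} \<le> e"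
proof -
  \<comment> \<open>Solves ln (1/d) = K/e + 1, which makes K / ln (1/d) at most e; the + 1 ensures d
    < 1 even if K = 0.\<close>
  define d where "d = exp (- (K / e + 1))"
  have Ke: "0 \<le> K / e" using assms K_nonneg by simp
  then have d: "0 < d" "d < 1" by (auto simp: d_def)
  have "ln (1 / d) = K / e + 1" by (simp add: d_def ln_div)
  moreover have "K / (K / e + 1) \<le> e"
    using assms Ke by (simp add: pos_divide_le_eq distrib_left)
  ultimately have "K / ln (1 / d) \<le> e" by simp
  then show ?thesis using order_trans[OF bounds(5)[OF _ _ d]] d(1) by blast
qed

text \<open>At each time the linear term converges by weak convergence and the quadratic one by
  \<open>kernel_limit\<close>; dominated convergence in time, with the uniform bounds on a and h,
  yields the integrated equation, while the defect vanishes with \<open>err\<close>.\<close>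

lemma limit_equation:
  fixes e :: "nat \<Rightarrow> real" and \<mu> :: "real \<Rightarrow> plane measure"
  assumes e: "\<And>n. small (e n)" and err: "(\<lambda>n. err (e n)) \<longlonglongrightarrow> 0"
    and \<mu>: "\<And>t. t \<ge> 0 \<Longrightarrow> \<mu> t \<in> Mplus"
    and lim: "\<And>\<phi> t. \<phi> \<in> C_c \<Longrightarrow> t \<ge> 0 \<Longrightarrow> (\<lambda>n. \<integral>x. \<phi> x \<partial>\<nu> (e n) t) \<longlonglongrightarrow> (\<integral>x. \<phi> x \<partial>\<mu> t)"
    and Phi: "\<Phi> \<in> C_c_inf" and t: "t \<ge> 0"
  shows "(\<integral>x. \<Phi> (t, x) \<partial>\<mu> t) = (\<integral>x. \<Phi> (0, x) \<partial>\<mu> 0)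
      + (LINT s:{0..t}|lborel. (\<integral>x. deriv (\<lambda>\<tau>. \<Phi> (\<tau>, x)) s \<partial>\<mu> s))
      + (LINT s:{0..t}|lborel. (\<integral>p. H_kernel (\<lambda>x. \<Phi> (s, x)) (fst p) (snd p) \<partial>(\<mu> s \<Otimes>\<^sub>M \<mu> s)))"
proof -
  obtain B where B: "B > 0" "\<And>p. \<bar>\<Phi> p\<bar> \<le> B" "\<And>p h. \<bar>dirderiv \<Phi> p h\<bar> \<le> B * norm h"
    "\<And>p q. \<bar>\<Phi> p - \<Phi> q\<bar> \<le> B * norm (p - q)"
    "\<And>p q h. \<bar>dirderiv \<Phi> p h - dirderiv \<Phi> q h\<bar> \<le> B * norm (p - q) * norm h"
    using C_c_inf_all_bounds[OF Phi] by blast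
  have s: "smooth \<Phi>" using Phi by (simp add: C_c_inf_smooth)
  have "\<exists>a h. approx_weak_form \<Phi> B t (e n) a h" for n by (rule approx_weak_form_exists[OF e t s B(2,3,4,5)])
  then obtain a h where P: "\<And>n. approx_weak_form \<Phi> B t (e n) (a n) (h n)" by metis
  have am: "\<And>n. a n \<in> borel_measurable borel" and hm: "\<And>n. h n \<in> borel_measurable borel"
    and ae: "\<And>n s. s \<in> {0..t} \<Longrightarrow> a n s = (\<integral>x. dirderiv \<Phi> (s, x) (1, 0) \<partial>\<nu> (e n) s)"
    and he: "\<And>n s. s \<in> {0..t} \<Longrightarrow> h n s = (\<integral>p. H_kernel (\<lambda>x. \<Phi> (s, x)) (fst p) (snd p) \<partial>(\<nu> (e n) s \<Otimes>\<^sub>M \<nu> (e n) s))"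
    and ab: "\<And>n s. s \<in> {0..t} \<Longrightarrow> \<bar>a n s\<bar> \<le> B * A" and hb: "\<And>n s. s \<in> {0..t} \<Longrightarrow> \<bar>h n s\<bar> \<le> B * A\<^sup>2"
    and def: "\<And>n u. u \<in> {0..t} \<Longrightarrow> \<bar>(\<integral>x. \<Phi> (u, x) \<partial>\<nu> (e n) u) - (\<integral>x. \<Phi> (0, x) \<partial>\<nu> (e n) 0) - (LINT s:{0..u}|lborel. a n s) - (LINT s:{0..u}|lborel. h n s)\<bar>
      \<le> B * (2 + u) * err (e n)"
    using P unfolding approx_weak_form_def by blast+
  define a' where "a' s = (\<integral>x. deriv (\<lambda>\<tau>. \<Phi> (\<tau>, x)) s \<partial>\<mu> s)" for s
  define h' where "h' s = (\<integral>p. H_kernel (\<lambda>x. \<Phi> (s, x)) (fst p) (snd p) \<partial>(\<mu> s \<Otimes>\<^sub>M \<mu> s))" for s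
  have alim: "(\<lambda>n. a n s) \<longlonglongrightarrow> a' s" if st: "s \<in> {0..t}" for s
  proof -
    have "(\<lambda>x. dirderiv \<Phi> (s, x) (1, 0)) \<in> C_c"
      by (rule section_C_c[OF C_c_inf_subset_C_c[OF dirderiv_C_c_inf[OF Phi]]])
    then show ?thesis using lim[of "\<lambda>x. dirderiv \<Phi> (s, x) (1, 0)" s] st
      by (simp add: ae a'_def deriv_section[OF s])
  qed
  have hlim: "(\<lambda>n. h n s) \<longlonglongrightarrow> h' s" if st: "s \<in> {0..t}" for s
  proof -
    note VB = Lipschitz_gradient_section[OF s B(3,5)]
    have s0: "s \<ge> 0" using st by simp
    have "(\<lambda>n. \<integral>p. H_kernel (\<lambda>x. \<Phi> (s, x)) (fst p) (snd p) \<partial>(\<nu> (e n) s \<Otimes>\<^sub>M \<nu> (e n) s))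
      \<longlonglongrightarrow> (\<integral>p. H_kernel (\<lambda>x. \<Phi> (s, x)) (fst p) (snd p) \<partial>(\<mu> s \<Otimes>\<^sub>M \<mu> s))"
    proof (rule kernel_limit[OF bounds(2)[OF e s0] \<mu>[OF s0] bounds(3)[OF e s0] bounds(4)[OF e s0] M_nonneg lim[OF _ s0]])
      show "\<exists>d>0. \<forall>n. measure (\<nu> (e n) s \<Otimes>\<^sub>M \<nu> (e n) s) {p. norm (fst p - snd p) < d} \<le> \<eta>" if "\<eta> > 0" for \<eta>
        using uniform_concentration[OF that] e s0 by blast
      have [measurable]: "grad (\<lambda>x. \<Phi> (s, x)) \<in> borel_measurable borel"
        by (rule borel_measurable_continuous_onI[OF VB(3)])
      show "(\<lambda>p. H_kernel (\<lambda>x. \<Phi> (s, x)) (fst p) (snd p)) \<in> borel_measurable borel"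
        unfolding H_kernel_eq by measurable
      show "\<bar>H_kernel (\<lambda>x. \<Phi> (s, x)) (fst p) (snd p)\<bar> \<le> B / 2" for p :: phase
        using VB(2) B(1) by (intro H_kernel_bound) auto
      have g: "continuous_on X (\<lambda>p. grad (\<lambda>x. \<Phi> (s, x)) (fst p))" "continuous_on X (\<lambda>p. grad (\<lambda>x. \<Phi> (s, x)) (snd p))" for X :: "phase set"
        by (intro continuous_on_compose2[OF VB(3) continuous_on_fst[OF continuous_on_id]] continuous_on_compose2[OF VB(3) continuous_on_snd[OF continuous_on_id]] subset_UNIV)+
      show "continuous_on {p. fst p \<noteq> snd p} (\<lambda>p. H_kernel (\<lambda>x. \<Phi> (s, x)) (fst p) (snd p))"
        unfolding H_kernel_eq biot_def by (intro continuous_intros g) auto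
    qed
    then show ?thesis using st by (simp add: he h'_def)
  qed
  have conv: "(\<lambda>n. LINT s:{0..t}|lborel. u n s) \<longlonglongrightarrow> (LINT s:{0..t}|lborel. u' s)"
    if um: "\<And>n. u n \<in> borel_measurable borel" and ub: "\<And>n s. s \<in> {0..t} \<Longrightarrow> \<bar>u n s\<bar> \<le> C"
      and ul: "\<And>s. s \<in> {0..t} \<Longrightarrow> (\<lambda>n. u n s) \<longlonglongrightarrow> u' s" for u :: "nat \<Rightarrow> real \<Rightarrow> real" and u' C
  proof -
    have l: "(\<lambda>n. indicator {0..t} s *\<^sub>R u n s) \<longlonglongrightarrow> indicator {0..t} s *\<^sub>R u' s" for s
      using ul[of s] by (cases "s \<in> {0..t}") auto
    have m: "(\<lambda>s. indicator {0..t} s *\<^sub>R u n s) \<in> borel_measurable lborel" for n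
      using um[of n] by measurable
    show ?thesis unfolding set_lebesgue_integral_def
    proof (rule integral_dominated_convergence[where w="\<lambda>s. C * indicator {0..t} s"])
      \<comment> \<open>The limit integrand inherits measurability as a pointwise limit; nothing is
        known about it beforehand.\<close>
      show "(\<lambda>s. indicator {0..t} s *\<^sub>R u' s) \<in> borel_measurable lborel"
        by (rule borel_measurable_LIMSEQ_metric[OF m]) (rule l)
      show "(\<lambda>s. indicator {0..t} s *\<^sub>R u n s) \<in> borel_measurable lborel" for n by (rule m)
      show "integrable lborel (\<lambda>s. C * indicator {0..t} s)" by (cases "0 \<le> t") auto
      show "AE s in lborel. (\<lambda>n. indicator {0..t} s *\<^sub>R u n s) \<longlonglongrightarrow> indicator {0..t} s *\<^sub>R u' s" using l by simp
      show "AE s in lborel. norm (indicator {0..t} s *\<^sub>R u n s) \<le> C * indicator {0..t} s" for n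
        using ub by (intro AE_I2) (auto simp: indicator_def)
    qed
  qed
  have "(\<lambda>n. (\<integral>x. \<Phi> (t, x) \<partial>\<nu> (e n) t) - (\<integral>x. \<Phi> (0, x) \<partial>\<nu> (e n) 0) - (LINT s:{0..t}|lborel. a n s) - (LINT s:{0..t}|lborel. h n s))
    \<longlonglongrightarrow> (\<integral>x. \<Phi> (t, x) \<partial>\<mu> t) - (\<integral>x. \<Phi> (0, x) \<partial>\<mu> 0) - (LINT s:{0..t}|lborel. a' s) - (LINT s:{0..t}|lborel. h' s)"
    using t by (intro tendsto_diff lim section_C_c C_c_inf_subset_C_c Phi conv[OF am ab alim] conv[OF hm hb hlim]) auto
  moreover have "(\<lambda>n. (\<integral>x. \<Phi> (t, x) \<partial>\<nu> (e n) t) - (\<integral>x. \<Phi> (0, x) \<partial>\<nu> (e n) 0) - (LINT s:{0..t}|lborel. a n s) - (LINT s:{0..t}|lborel. h n s)) \<longlonglongrightarrow> 0"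
  proof (rule Lim_null_comparison)
    show "(\<lambda>n. B * (2 + t) * err (e n)) \<longlonglongrightarrow> 0" using tendsto_mult_right_zero[OF err] by simp
    show "\<forall>\<^sub>F n in sequentially. norm ((\<integral>x. \<Phi> (t, x) \<partial>\<nu> (e n) t) - (\<integral>x. \<Phi> (0, x) \<partial>\<nu> (e n) 0) - (LINT s:{0..t}|lborel. a n s) - (LINT s:{0..t}|lborel. h n s))
      \<le> B * (2 + t) * err (e n)"
      using def t by (intro always_eventually allI) simp
  qed
  ultimately have "(\<integral>x. \<Phi> (t, x) \<partial>\<mu> t) - (\<integral>x. \<Phi> (0, x) \<partial>\<mu> 0) - (LINT s:{0..t}|lborel. a' s) - (LINT s:{0..t}|lborel. h' s) = 0"
    by (rule LIMSEQ_unique)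
  then show ?thesis unfolding a'_def h'_def by linarith
qed

lemma gyrokinetic_limit:
  "\<exists>(e :: nat \<Rightarrow> real) (\<mu> :: real \<Rightarrow> plane measure).
      (\<forall>n. 0 < e n) \<and> e \<longlonglongrightarrow> 0 \<and>
      (\<forall>n. \<forall>t\<ge>0. AE x in lborel. 0 \<le> rho (f (e n) t) x) \<and>
      converges_in_C_Mplus (\<lambda>n t. density_measure (rho (f (e n) t))) \<mu> \<and>
      \<mu> \<in> Linf_Hm1 \<and>
      Euler_weak_solution (\<mu> 0) \<mu>"
proof -
  \<comment> \<open>The largest \<epsilon> satisfying \<open>small\<close>, so that the whole
    sequence below it is admissible.\<close>
  define e0 where "e0 = 1 / (2 * (1 + 2 * A))"
  have e0: "e0 > 0" "e0 * (1 + 2 * A) = 1 / 2" using A_nonneg by (auto simp: e0_def)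
  define d where "d n = e0 / real (Suc n)" for n
  have d: "small (d n)" for n
  proof -
    have "d n \<le> e0" using e0(1) by (simp add: d_def divide_le_eq)
    then have "d n * (1 + 2 * A) \<le> e0 * (1 + 2 * A)" using A_nonneg by (intro mult_right_mono) auto
    then show ?thesis using e0 by (simp add: small_def d_def)
  qed
  have dpos: "0 < d n" for n using d by (simp add: small_def)
  have d0: "d \<longlonglongrightarrow> 0"
    using tendsto_mult_right_zero[OF LIMSEQ_inverse_real_of_nat, of e0] by (simp add: d_def[abs_def] divide_inverse)
  have "filterlim d (at_right 0) sequentially"
    by (simp add: filterlim_at d0 dpos less_imp_neq[OF dpos, symmetric])
  then have derr: "(\<lambda>n. err (d n)) \<longlonglongrightarrow> 0" by (rule filterlim_compose[OF err_tendsto_0])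
  obtain r \<mu> where r: "strict_mono r" and \<mu>: "\<And>t. t \<ge> 0 \<Longrightarrow> \<mu> t \<in> Mplus"
    and ul: "\<And>\<phi> T. \<phi> \<in> C_c \<Longrightarrow> T \<ge> 0 \<Longrightarrow> uniform_limit {0..T} (\<lambda>n t. \<integral>x. \<phi> x \<partial>\<nu> (d (r n)) t) (\<lambda>t. \<integral>x. \<phi> x \<partial>\<mu> t) sequentially"
  proof (rule extraction[of "\<lambda>n. \<nu> (d n)" A M "\<lambda>n. err (d n)"])
    show "\<nu> (d n) t \<in> Mplus" "measure (\<nu> (d n) t) UNIV \<le> A" "(\<integral>\<^sup>+x. ennreal ((norm x)\<^sup>2) \<partial>\<nu> (d n) t) \<le> ennreal M" if "t \<ge> 0" for n t
      using bounds(2-4)[OF d that] by auto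
    show "\<exists>C\<ge>0. \<forall>n. \<forall>s\<in>{0..T}. \<forall>t\<in>{0..T}. \<bar>(\<integral>x. \<phi> x \<partial>\<nu> (d n) t) - (\<integral>x. \<phi> x \<partial>\<nu> (d n) s)\<bar> \<le> C * (\<bar>t - s\<bar> + err (d n))"
      if "\<phi> \<in> C_c_inf" "T \<ge> 0" for \<phi> T using equicontinuity[OF that] d by blast
  qed (use M_nonneg derr in auto)
  define e where "e n = d (r n)" for n
  have e: "small (e n)" for n by (simp add: e_def d)
  have elim: "e \<longlonglongrightarrow> 0" "(\<lambda>n. err (e n)) \<longlonglongrightarrow> 0"
    using LIMSEQ_subseq_LIMSEQ[OF d0 r] LIMSEQ_subseq_LIMSEQ[OF derr r] by (auto simp: e_def[abs_def] o_def)
  note ul = ul[folded e_def]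
  have lim: "(\<lambda>n. \<integral>x. \<phi> x \<partial>\<nu> (e n) t) \<longlonglongrightarrow> (\<integral>x. \<phi> x \<partial>\<mu> t)" if "\<phi> \<in> C_c" "t \<ge> 0" for \<phi> t
    using tendsto_uniform_limitI[OF ul[OF that]] that(2) by simp
  have NC: "\<nu> (e n) \<in> C_Mplus" for n
    using bounds(2)[OF e] N_continuous[OF e] by (simp add: C_Mplus_def)
  have \<mu>C: "\<mu> \<in> C_Mplus" unfolding C_Mplus_def
  proof (intro CollectI conjI allI impI ballI \<mu>)
    fix \<phi> :: "plane \<Rightarrow> real" assume \<phi>: "\<phi> \<in> C_c"
    show "continuous_on {0..} (\<lambda>t. \<integral>x. \<phi> x \<partial>\<mu> t)"
    proof (rule continuous_on_halfline)
      fix T :: real assume T: "T \<ge> 0"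
      have "continuous_on {0..T} (\<lambda>t. \<integral>x. \<phi> x \<partial>\<nu> (e n) t)" for n
        using N_continuous[OF e \<phi>] by (rule continuous_on_subset) auto
      then show "continuous_on {0..T} (\<lambda>t. \<integral>x. \<phi> x \<partial>\<mu> t)"
        by (intro uniform_limit_theorem[OF _ ul[OF \<phi> T]]) auto
    qed
  qed
  define C where "C = 4 * sqrt (A\<^sup>2 + K)"
  \<comment> \<open>The dual norm is a supremum of quantities continuous under the convergence,
    hence lower semicontinuous. The bound holds at every time and in particular at time 0, as the
    initial measure requires.\<close>
  have Hm: "Hm1_norm (\<mu> t) \<le> ereal C" if t: "t \<ge> 0" for t
    unfolding Hm1_norm_def
  proof (rule SUP_least)
    fix \<phi> :: "plane \<Rightarrow> real" assume "\<phi> \<in> {\<phi> \<in> C_c_inf. H1_norm \<phi> \<le> 1}"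
    then have \<phi>: "\<phi> \<in> C_c_inf" "H1_norm \<phi> \<le> 1" by auto
    have C0: "0 \<le> C" using K_nonneg by (simp add: C_def)
    have b: "\<bar>\<integral>x. \<phi> x \<partial>\<nu> (e n) t\<bar> \<le> C" for n
      using bounds(6)[OF e t \<phi>(1), of n] mult_left_mono[OF \<phi>(2) C0] unfolding C_def by linarith
    have "(\<lambda>n. \<bar>\<integral>x. \<phi> x \<partial>\<nu> (e n) t\<bar>) \<longlonglongrightarrow> \<bar>\<integral>x. \<phi> x \<partial>\<mu> t\<bar>"
      by (intro tendsto_rabs lim C_c_inf_subset_C_c \<phi> t)
    then have "\<bar>\<integral>x. \<phi> x \<partial>\<mu> t\<bar> \<le> C" by (rule LIMSEQ_le_const2) (use b in blast)
    then show "ereal \<bar>\<integral>x. \<phi> x \<partial>\<mu> t\<bar> \<le> ereal C" by simp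
  qed
  have L: "\<mu> \<in> Linf_Hm1" unfolding Linf_Hm1_def using Hm by (auto intro!: exI[of _ C])
  have "\<mu> 0 \<in> Mplus \<inter> Hm1"
    using \<mu>[of 0] Hm[of 0] le_less_trans[of "Hm1_norm (\<mu> 0)" "ereal C" \<infinity>] by (auto simp: Hm1_def)
  then have E: "Euler_weak_solution (\<mu> 0) \<mu>"
    unfolding Euler_weak_solution_def using \<mu>C L limit_equation[OF e elim(2) \<mu> lim] by blast
  have cv: "converges_in_C_Mplus (\<lambda>n. \<nu> (e n)) \<mu>"
    unfolding converges_in_C_Mplus_def using NC \<mu>C ul by blast
  show ?thesis
  proof (intro exI conjI allI impI)
    show "0 < e n" for n using e by (simp add: small_def)
    show "AE x in lborel. 0 \<le> rho (f (e n) t) x" if "t \<ge> 0" for n t by (rule bounds(1)[OF e that])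
    show "converges_in_C_Mplus (\<lambda>n t. density_measure (rho (f (e n) t))) \<mu>"
      using cv by (simp add: \<nu>_def[abs_def])
  qed (fact elim L E)+
qed

end

theorem theorem1p1:
  fixes f0 :: "real \<Rightarrow> phase \<Rightarrow> real"
    and f :: "real \<Rightarrow> real \<Rightarrow> phase \<Rightarrow> real"
  assumes f0_class: "\<And>\<epsilon>. \<epsilon> > 0 \<Longrightarrow> f0 \<epsilon> \<in> L1_Linf"
    and f0_nonneg: "\<And>\<epsilon>. \<epsilon> > 0 \<Longrightarrow> AE z in lborel. 0 \<le> f0 \<epsilon> z"
    and f0_support: "\<And>\<epsilon>. \<epsilon> > 0 \<Longrightarrow> \<exists>R. ess_supported_in R (f0 \<epsilon>)"
    and mass_moment:
      "bdd_above ((\<lambda>\<epsilon>. Lp_norm 1 (f0 \<epsilon>) + (\<integral>x. (norm x)\<^sup>2 * rho (f0 \<epsilon>) x \<partial>lborel)) ` {0<..})"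
    and energy_bound: "bdd_above ((\<lambda>\<epsilon>. energy (f0 \<epsilon>)) ` {0<..})"
    and Linf_growth: "((\<lambda>\<epsilon>. \<epsilon>\<^sup>2 * Theta (Linf_norm (f0 \<epsilon>))) \<longlongrightarrow> 0) (at_right 0)"
    and solution: "\<And>\<epsilon>. \<epsilon> > 0 \<Longrightarrow> VP_global_solution \<epsilon> (f0 \<epsilon>) (f \<epsilon>)"
  shows "\<exists>(e :: nat \<Rightarrow> real) (\<mu> :: real \<Rightarrow> plane measure).
      (\<forall>n. 0 < e n) \<and> e \<longlonglongrightarrow> 0 \<and>
      (\<forall>n. \<forall>t\<ge>0. AE x in lborel. 0 \<le> rho (f (e n) t) x) \<and>
      converges_in_C_Mplus (\<lambda>n t. density_measure (rho (f (e n) t))) \<mu> \<and>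
      \<mu> \<in> Linf_Hm1 \<and>
      Euler_weak_solution (\<mu> 0) \<mu>"
proof -
  obtain A where A: "\<And>\<epsilon>. \<epsilon> > 0 \<Longrightarrow> Lp_norm 1 (f0 \<epsilon>) + (\<integral>x. (norm x)\<^sup>2 * rho (f0 \<epsilon>) x \<partial>lborel) \<le> A"
    using mass_moment by (auto simp: bdd_above_def)
  obtain H where H: "\<And>\<epsilon>. \<epsilon> > 0 \<Longrightarrow> energy (f0 \<epsilon>) \<le> H" using energy_bound by (auto simp: bdd_above_def)
  \<comment> \<open>The supremum of the energies may be negative; the estimates take a nonnegative
    bound.\<close>
  interpret vp_family f0 f A "max H 0"
    by (rule vp_family.intro[OF f0_class f0_nonneg solution A _ _ Linf_growth]) (use H in \<open>auto intro: max.coboundedI1\<close>)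
  show ?thesis by (rule gyrokinetic_limit)
qed

end
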